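(* Let $0<\alpha<2\pi$. Then $$\mathcal N(\alpha)=\frac{1}{\min\left\{\sqrt{\alpha/(2\pi)},\ \sqrt{1-\alpha/(2\pi)}\right\}},$$ where $$\mathcal N(\alpha):=\inf\left\{\|E\|_{W^{1,2}(A_\alpha)\to W^{1,2}(\mathbb R^2)}:\ E \text{ is an extension operator}\right\}.$$ Moreover, this infimum is attained by the extension operator $E_0$ defined, for $u\in W^{1,2}(A_\alpha)$, by $E_0u:=u$ in $A_\alpha$ and $E_0u:=T_0u$ in $B_\alpha:=\mathbb R^2\setminus\overline{A_\alpha}$, where $T_0u$ is the unique minimizer of $\|v\|_{W^{1,2}(B_\alpha)}^2$ among all $v\in W^{1,2}(B_\alpha)$ whose trace on $\partial B_\alpha=\partial A_\alpha$ coincides with the trace of $u$ on $\partial A_\alpha$.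
   Context: Identify $\mathbb R^2$ with $\mathbb C$. For $0<\alpha<2\pi$ let $A_\alpha:=\{z\in\mathbb C:\ 0<\arg z<\alpha\}$, an open planar sector of opening angle $\alpha$ (so $\arg$ takes values in $[0,2\pi)$). Functions are complex-valued. For an open set $\Omega\subset\mathbb R^2$, the Sobolev space $W^{1,2}(\Omega)$ is equipped with the norm given by $$\|u\|_{W^{1,2}(\Omega)}^2=\int_\Omega\left(|\nabla u|^2+|u|^2\right)dx.$$ A linear operator $E:W^{1,2}(A_\alpha)\to W^{1,2}(\mathbb R^2)$ is called an extension operator if $Eu=u$ in $A_\alpha$ for all $u\in W^{1,2}(A_\alpha)$. $\|E\|_{W^{1,2}(A_\alpha)\to W^{1,2}(\mathbb R^2)}$ is its operator norm with respect to the norms $\|\cdot\|_{W^{1,2}(A_\alpha)}$ and $\|\cdot\|_{W^{1,2}(\mathbb R^2)}$. Traces are Sobolev traces, i.e. elements of $L^2_{\rm loc}$ of the boundary, agreeing with pointwise restriction for functions continuous up to the boundary. *)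

theory Defs
  imports "HOL-Analysis.Analysis"
begin

text \<open>
  The plane is the type \<^typ>\<open>complex\<close>, a Euclidean space with basis \<open>1, \<i>\<close>.
  Elements of \<open>L\<^sup>2\<close> and \<open>W\<^sup>1\<^sup>,\<^sup>2\<close> over \<open>\<Omega>\<close> are represented by functions on all of \<^typ>\<open>complex\<close>
  whose values outside \<open>\<Omega>\<close> are irrelevant; equality of elements is equality
  almost everywhere in \<open>\<Omega>\<close>.
\<close>

definition eq_ae :: "complex set \<Rightarrow> (complex \<Rightarrow> complex) \<Rightarrow> (complex \<Rightarrow> complex) \<Rightarrow> bool" where
  "eq_ae \<Omega> u v \<longleftrightarrow> (AE x in lebesgue_on \<Omega>. u x = v x)"


section \<open>Sobolev spaces\<close>

primrec Ck :: "nat \<Rightarrow> (complex \<Rightarrow> complex) \<Rightarrow> bool" where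
  "Ck 0 f \<longleftrightarrow> continuous_on UNIV f"
| "Ck (Suc k) f \<longleftrightarrow>
     (\<forall>x. f differentiable (at x)) \<and> (\<forall>b\<in>Basis. Ck k (\<lambda>x. frechet_derivative f (at x) b))"

definition test_function :: "complex set \<Rightarrow> (complex \<Rightarrow> complex) \<Rightarrow> bool" where
  "test_function \<Omega> \<phi> \<longleftrightarrow>
     (\<forall>k. Ck k \<phi>) \<and> compact (closure {x. \<phi> x \<noteq> 0}) \<and> closure {x. \<phi> x \<noteq> 0} \<subseteq> \<Omega>"

definition locally_integrable :: "complex set \<Rightarrow> (complex \<Rightarrow> complex) \<Rightarrow> bool" where
  "locally_integrable \<Omega> u \<longleftrightarrow> (\<forall>K. compact K \<and> K \<subseteq> \<Omega> \<longrightarrow> u absolutely_integrable_on K)"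

definition has_weak_partial ::
    "complex set \<Rightarrow> complex \<Rightarrow> (complex \<Rightarrow> complex) \<Rightarrow> (complex \<Rightarrow> complex) \<Rightarrow> bool" where
  "has_weak_partial \<Omega> b u g \<longleftrightarrow>
     locally_integrable \<Omega> u \<and> locally_integrable \<Omega> g \<and>
     (\<forall>\<phi>. test_function \<Omega> \<phi> \<longrightarrow>
        (LINT x|lebesgue_on \<Omega>. u x * frechet_derivative \<phi> (at x) b)
          = - (LINT x|lebesgue_on \<Omega>. g x * \<phi> x))"

definition weak_partial ::
    "complex set \<Rightarrow> complex \<Rightarrow> (complex \<Rightarrow> complex) \<Rightarrow> complex \<Rightarrow> complex" where
  "weak_partial \<Omega> b u = (SOME g. has_weak_partial \<Omega> b u g)"

definition L2 :: "complex set \<Rightarrow> (complex \<Rightarrow> complex) set" where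
  "L2 \<Omega> = {u \<in> borel_measurable (lebesgue_on \<Omega>).
            integrable (lebesgue_on \<Omega>) (\<lambda>x. (cmod (u x))\<^sup>2)}"

definition W12 :: "complex set \<Rightarrow> (complex \<Rightarrow> complex) set" where
  "W12 \<Omega> = {u \<in> L2 \<Omega>. \<forall>b\<in>Basis. \<exists>g\<in>L2 \<Omega>. has_weak_partial \<Omega> b u g}"

definition W12_norm :: "complex set \<Rightarrow> (complex \<Rightarrow> complex) \<Rightarrow> real" where
  "W12_norm \<Omega> u =
     sqrt (LINT x|lebesgue_on \<Omega>. (\<Sum>b\<in>Basis. (cmod (weak_partial \<Omega> b u x))\<^sup>2) + (cmod (u x))\<^sup>2)"


section \<open>Sectors\<close>

definition sector :: "real \<Rightarrow> complex set" where
  "sector \<alpha> = {z. 0 < Arg2pi z \<and> Arg2pi z < \<alpha>}"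

definition cosector :: "real \<Rightarrow> complex set" where
  "cosector \<alpha> = - closure (sector \<alpha>)"


section \<open>Traces\<close>

text \<open>
  For \<open>0 < \<alpha> < 2\<pi>\<close> the common boundary of \<open>sector \<alpha>\<close> and \<open>cosector \<alpha>\<close> consists of the
  closed rays at the angles \<open>0\<close> and \<open>\<alpha>\<close>, which are parametrized by arc length.
\<close>

definition ray :: "real \<Rightarrow> real \<Rightarrow> complex" where
  "ray \<theta> t = of_real t * cis \<theta>"

definition L2loc_rays :: "real \<Rightarrow> (complex \<Rightarrow> complex) set" where
  "L2loc_rays \<alpha> = {g. \<forall>\<theta>\<in>{0, \<alpha>}.
     (\<lambda>t. g (ray \<theta> t)) \<in> borel_measurable (lebesgue_on {0..}) \<and>
     (\<forall>R. integrable (lebesgue_on {0..R}) (\<lambda>t. (cmod (g (ray \<theta> t)))\<^sup>2))}"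

text \<open>
  Here \<open>\<Omega>\<close> is \<open>sector \<alpha>\<close> or \<open>cosector \<alpha>\<close>. The trace is the extension by continuity, from
  \<open>W\<^sup>1\<^sup>,\<^sup>2(\<Omega>)\<close> to \<open>L\<^sup>2\<^sub>l\<^sub>o\<^sub>c\<close> of the boundary, of pointwise restriction on those elements of
  \<open>W\<^sup>1\<^sup>,\<^sup>2(\<Omega>)\<close> that are continuous up to the boundary. Thus \<open>g\<close> is a trace of \<open>u\<close> if it is
  an \<open>L\<^sup>2\<^sub>l\<^sub>o\<^sub>c\<close>-limit of the restrictions of such functions converging to \<open>u\<close>; it is
  determined up to a null set of the boundary.
\<close>

definition has_trace ::
    "real \<Rightarrow> complex set \<Rightarrow> (complex \<Rightarrow> complex) \<Rightarrow> (complex \<Rightarrow> complex) \<Rightarrow> bool" where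
  "has_trace \<alpha> \<Omega> u g \<longleftrightarrow> g \<in> L2loc_rays \<alpha> \<and>
     (\<exists>w :: nat \<Rightarrow> complex \<Rightarrow> complex.
        (\<forall>n. w n \<in> W12 \<Omega> \<and> continuous_on (closure \<Omega>) (w n)) \<and>
        (\<lambda>n. W12_norm \<Omega> (\<lambda>x. w n x - u x)) \<longlonglongrightarrow> 0 \<and>
        (\<forall>\<theta>\<in>{0, \<alpha>}. \<forall>R.
           (\<lambda>n. LINT t|lebesgue_on {0..R}. (cmod (w n (ray \<theta> t) - g (ray \<theta> t)))\<^sup>2) \<longlonglongrightarrow> 0))"

definition same_trace :: "real \<Rightarrow> (complex \<Rightarrow> complex) \<Rightarrow> (complex \<Rightarrow> complex) \<Rightarrow> bool" where
  "same_trace \<alpha> u v \<longleftrightarrow> (\<exists>g. has_trace \<alpha> (sector \<alpha>) u g \<and> has_trace \<alpha> (cosector \<alpha>) v g)"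


section \<open>Extension operators\<close>

text \<open>
  An operator acts on representatives; the second clause says that it is well defined on
  classes modulo equality almost everywhere. It need not be bounded, so its norm
  lies in \<^typ>\<open>ennreal\<close>.
\<close>

definition extension_operator ::
    "real \<Rightarrow> ((complex \<Rightarrow> complex) \<Rightarrow> complex \<Rightarrow> complex) \<Rightarrow> bool" where
  "extension_operator \<alpha> E \<longleftrightarrow>
     (\<forall>u \<in> W12 (sector \<alpha>). E u \<in> W12 UNIV) \<and>
     (\<forall>u \<in> W12 (sector \<alpha>). \<forall>v \<in> W12 (sector \<alpha>).
        eq_ae (sector \<alpha>) u v \<longrightarrow> eq_ae UNIV (E u) (E v)) \<and>
     (\<forall>u \<in> W12 (sector \<alpha>). \<forall>v \<in> W12 (sector \<alpha>). \<forall>a b :: complex.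
        eq_ae UNIV (E (\<lambda>x. a * u x + b * v x)) (\<lambda>x. a * E u x + b * E v x)) \<and>
     (\<forall>u \<in> W12 (sector \<alpha>). eq_ae (sector \<alpha>) (E u) u)"

definition op_norm :: "real \<Rightarrow> ((complex \<Rightarrow> complex) \<Rightarrow> complex \<Rightarrow> complex) \<Rightarrow> ennreal" where
  "op_norm \<alpha> E =
     (SUP u \<in> {u \<in> W12 (sector \<alpha>). W12_norm (sector \<alpha>) u \<le> 1}. ennreal (W12_norm UNIV (E u)))"

definition min_ext_norm :: "real \<Rightarrow> ennreal" where
  "min_ext_norm \<alpha> = (INF E \<in> {E. extension_operator \<alpha> E}. op_norm \<alpha> E)"

definition is_T0 :: "real \<Rightarrow> (complex \<Rightarrow> complex) \<Rightarrow> (complex \<Rightarrow> complex) \<Rightarrow> bool" where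
  "is_T0 \<alpha> u v \<longleftrightarrow>
     v \<in> W12 (cosector \<alpha>) \<and> same_trace \<alpha> u v \<and>
     (\<forall>v' \<in> W12 (cosector \<alpha>). same_trace \<alpha> u v' \<longrightarrow>
        (W12_norm (cosector \<alpha>) v)\<^sup>2 \<le> (W12_norm (cosector \<alpha>) v')\<^sup>2)"

definition T0 :: "real \<Rightarrow> (complex \<Rightarrow> complex) \<Rightarrow> complex \<Rightarrow> complex" where
  "T0 \<alpha> u = (SOME v. is_T0 \<alpha> u v)"

text \<open>The value on the boundary is immaterial, the boundary being a null set.\<close>

definition E0 :: "real \<Rightarrow> (complex \<Rightarrow> complex) \<Rightarrow> complex \<Rightarrow> complex" where
  "E0 \<alpha> u z = (if z \<in> sector \<alpha> then u z else T0 \<alpha> u z)"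

end

(*
  Put A = sector alpha and B = cosector alpha. In the coordinates z = exp (s + i t) the Dirichlet
  integral is conformally invariant, so mapping the angles of B linearly onto those of A turns u
  into a function on B with the same trace and with energy at most max (k, 1/k) times that of u,
  k being the ratio of the openings. The minimizer T0 u can only do better, and gluing along the
  boundary gives |E0 u|^2 <= (1 + max (k, 1/k)) |u|^2. T0 is linear because minimizers are the
  functions orthogonal to everything with vanishing trace.

  For the lower bound, the integral of dw /\ d psi over the plane vanishes for every compactly
  supported psi. If w extends u and phi is a fixed smooth extension of u, then w - phi vanishes on
  A, so dw /\ d psi and d phi /\ d psi have the same integral over B, and Cauchy-Schwarz bounds
  the energy of w on B from below. The pair R(s), R'(s) t, spread over a long interval of s far
  out at minus infinity where zeroth order terms carry no weight, makes this asymptotically sharp.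

  Traces are accessible because averaging translates that point into a sector approximates any
  W12 function by functions that are smooth on the whole plane.
*)
theory Submission
 imports Defs "HOL-Analysis.Analysis" "HOL-Computational_Algebra.Polynomial" "HOL-Real_Asymp.Real_Asymp"
begin

type_synonym cfun = "complex \<Rightarrow> complex"

abbreviation der :: "cfun \<Rightarrow> complex \<Rightarrow> cfun" where "der f x \<equiv> frechet_derivative f (at x)"

abbreviation mu :: "'a::euclidean_space set \<Rightarrow> 'a measure" where "mu \<equiv> lebesgue_on"

abbreviation bm :: "('a::topological_space \<Rightarrow> 'b::topological_space) set" where "bm \<equiv> borel_measurable borel"

abbreviation nn_lborel :: "('a::euclidean_space \<Rightarrow> ennreal) \<Rightarrow> ennreal" (binder \<open>NN \<close> 10) where
  "nn_lborel \<equiv> nn_integral lborel"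

lemmas continuous_bm = borel_measurable_continuous_onI

section \<open>Square integrable functions\<close>

definition l2 :: "'a measure \<Rightarrow> ('a \<Rightarrow> 'b::euclidean_space) \<Rightarrow> bool" where
 "l2 M f \<longleftrightarrow> f \<in> borel_measurable M \<and> integrable M (\<lambda>x. (norm (f x))^2)"

definition n2 :: "'a measure \<Rightarrow> ('a \<Rightarrow> 'b::euclidean_space) \<Rightarrow> real" where
 "n2 M f = sqrt (LINT x|M. (norm (f x))^2)"

lemma l2_measurable: "l2 M f \<Longrightarrow> f \<in> borel_measurable M"
 and l2_integrable: "l2 M f \<Longrightarrow> integrable M (\<lambda>x. (norm (f x))^2)"
 by (auto simp: l2_def)

lemma n2_nonneg [simp]: "0 \<le> n2 M f"
 by (simp add: n2_def)

lemma n2_power2: "(n2 M f)^2 = (LINT x|M. (norm (f x))^2)"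
 by (simp add: n2_def)

lemma l2_bound:
 assumes "f \<in> borel_measurable M" "integrable M g" "AE x in M. (norm (f x))^2 \<le> g x"
 shows "l2 M f"
 unfolding l2_def
proof
 have [measurable]: "f \<in> borel_measurable M" by fact
 show "integrable M (\<lambda>x. (norm (f x))^2)"
  by (rule Bochner_Integration.integrable_bound[OF assms(2)]) (use assms(3) in auto)
qed fact

lemma n2_mono:
 assumes "l2 M g" "AE x in M. norm (f x) \<le> norm (g x)"
 shows "n2 M f \<le> n2 M g"
proof (cases "integrable M (\<lambda>x. (norm (f x))^2)")
 case True
 show ?thesis
  unfolding n2_def
  by (intro real_sqrt_le_mono integral_mono_AE True l2_integrable assms(1))
    (use assms(2) in \<open>auto intro: power_mono\<close>)
next
 case False
 then show ?thesis by (simp add: n2_def not_integrable_integral_eq)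
qed

lemma l2_cong_AE:
 assumes "l2 M f" "g \<in> borel_measurable M" "AE x in M. f x = g x"
 shows "l2 M g"
 by (rule l2_bound[OF assms(2) l2_integrable[OF assms(1)]]) (use assms(3) in auto)

lemma n2_cong_AE:
 assumes "f \<in> borel_measurable M" "g \<in> borel_measurable M" "AE x in M. f x = g x"
 shows "n2 M f = n2 M g"
proof -
 have [measurable]: "f \<in> borel_measurable M" "g \<in> borel_measurable M" by fact+
 have "(LINT x|M. (norm (f x))^2) = (LINT x|M. (norm (g x))^2)"
  by (intro integral_cong_AE) (use assms(3) in auto)
 then show ?thesis by (simp add: n2_def)
qed

lemma norm_add_power2_le: "(norm (a + b :: 'a::real_normed_vector))^2 \<le> 2 * (norm a)^2 + 2 * (norm b)^2"
proof -
 have "(norm (a + b))^2 \<le> (norm a + norm b)^2"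
  by (intro power_mono norm_triangle_ineq) auto
 also have "... \<le> 2 * (norm a)^2 + 2 * (norm b)^2"
  using sum_squares_bound[of "norm a" "norm b"] by (simp add: power2_sum)
 finally show ?thesis .
qed

lemma l2_add:
 assumes "l2 M f" "l2 M g" shows "l2 M (\<lambda>x. f x + g x)"
 using assms
 by (intro l2_bound[where g="\<lambda>x. 2 * (norm (f x))^2 + 2 * (norm (g x))^2"])
   (auto simp: norm_add_power2_le l2_def)

lemma l2_scaleR: "l2 M f \<Longrightarrow> l2 M (\<lambda>x. c *\<^sub>R f x)"
 by (auto simp: l2_def power_mult_distrib)

lemma l2_cmult: fixes f :: "_ \<Rightarrow> complex" shows "l2 M f \<Longrightarrow> l2 M (\<lambda>x. c * f x)"
 by (auto simp: l2_def power_mult_distrib norm_mult)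

lemma l2_uminus: "l2 M f \<Longrightarrow> l2 M (\<lambda>x. - f x)"
 by (auto simp: l2_def)

lemma l2_diff: "l2 M f \<Longrightarrow> l2 M g \<Longrightarrow> l2 M (\<lambda>x. f x - g x)"
 using l2_add[OF _ l2_uminus, of M f g] by simp

lemma n2_scaleR: "n2 M (\<lambda>x. c *\<^sub>R f x) = \<bar>c\<bar> * n2 M f"
 by (simp add: n2_def power_mult_distrib real_sqrt_mult)

lemma n2_minus_commute: "n2 M (\<lambda>x. f x - g x) = n2 M (\<lambda>x. g x - f x)"
 by (simp add: n2_def norm_minus_commute)

lemma n2_zero [simp]: "n2 M (\<lambda>x. 0) = 0"
 by (simp add: n2_def)

lemma integrable_l2_mult:
 fixes f g :: "_ \<Rightarrow> real"
 assumes "l2 M f" "l2 M g" shows "integrable M (\<lambda>x. f x * g x)"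
proof (rule Bochner_Integration.integrable_bound)
 show "integrable M (\<lambda>x. (norm (f x))^2 + (norm (g x))^2)"
  using assms by (auto simp: l2_def)
 show "(\<lambda>x. f x * g x) \<in> borel_measurable M"
  using assms by (auto simp: l2_def)
 have "\<bar>a * b\<bar> \<le> a^2 + b^2" for a b :: real
  using sum_squares_bound[of "\<bar>a\<bar>" "\<bar>b\<bar>"] mult_nonneg_nonneg[OF abs_ge_zero[of a] abs_ge_zero[of b]]
  by (simp add: abs_mult) (metis abs_ge_zero add_increasing le_add_same_cancel1 mult_2 mult.assoc mult_nonneg_nonneg order_trans)
 then show "AE x in M. norm (f x * g x) \<le> norm ((norm (f x))^2 + (norm (g x))^2)"
  by (intro AE_I2) (simp add: abs_of_nonneg)
qed

lemma l2_norm: "l2 M f \<Longrightarrow> l2 M (\<lambda>x. norm (f x))"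
 by (auto simp: l2_def)

lemma n2_norm [simp]: "n2 M (\<lambda>x. norm (f x)) = n2 M f"
 by (simp add: n2_def)

lemma quadratic_nonneg_imp:
 fixes a b c :: real
 assumes "\<And>t. 0 \<le> a + 2 * b * t + c * t^2" "c \<ge> 0"
 shows "b^2 \<le> a * c"
proof (cases "c = 0")
 case True
 have "b = 0"
 proof (rule ccontr)
  assume "b \<noteq> 0"
  then show False using assms(1)[of "(- a - 1) / (2 * b)"] True by (simp add: field_simps)
 qed
 then show ?thesis using True by simp
next
 case False
 then have "c > 0" using assms by simp
 then show ?thesis using assms(1)[of "- b / c"] by (simp add: field_simps power2_eq_square)
qed

lemma integrable_l2_inner:
 assumes "l2 M f" "l2 M g" shows "integrable M (\<lambda>x. f x \<bullet> g x)"
proof (rule Bochner_Integration.integrable_bound)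
 show "integrable M (\<lambda>x. norm (f x) * norm (g x))"
  by (intro integrable_l2_mult l2_norm assms)
 show "(\<lambda>x. f x \<bullet> g x) \<in> borel_measurable M"
  using assms by (auto simp: l2_def)
qed (simp add: Cauchy_Schwarz_ineq2)

lemma n2_add_power2:
 assumes "l2 M f" "l2 M g"
 shows "(n2 M (\<lambda>x. f x + g x))^2 = (n2 M f)^2 + 2 * (LINT x|M. f x \<bullet> g x) + (n2 M g)^2"
proof -
 have "(n2 M (\<lambda>x. f x + g x))^2 = (LINT x|M. (norm (f x))^2 + 2 * (f x \<bullet> g x) + (norm (g x))^2)"
  unfolding n2_power2 by (simp add: power2_norm_eq_inner inner_add_left inner_add_right inner_commute algebra_simps)
 also have "... = (n2 M f)^2 + 2 * (LINT x|M. f x \<bullet> g x) + (n2 M g)^2"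
  unfolding n2_power2 using integrable_l2_inner[OF assms] l2_integrable[OF assms(1)] l2_integrable[OF assms(2)]
  by simp
 finally show ?thesis .
qed

lemma n2_Cauchy_Schwarz:
 assumes "l2 M f" "l2 M g"
 shows "\<bar>LINT x|M. f x \<bullet> g x\<bar> \<le> n2 M f * n2 M g"
proof -
 have "(LINT x|M. f x \<bullet> g x)^2 \<le> (n2 M f)^2 * (n2 M g)^2"
 proof (rule quadratic_nonneg_imp)
  fix t :: real
  have "0 \<le> (n2 M (\<lambda>x. f x + t *\<^sub>R g x))^2" by simp
  also have "... = (n2 M f)^2 + 2 * (LINT x|M. f x \<bullet> (t *\<^sub>R g x)) + (n2 M (\<lambda>x. t *\<^sub>R g x))^2"
   by (intro n2_add_power2 assms l2_scaleR)
  finally show "0 \<le> (n2 M f)^2 + 2 * (LINT x|M. f x \<bullet> g x) * t + (n2 M g)^2 * t^2"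
   by (simp add: n2_scaleR power_mult_distrib mult_ac)
 qed simp
 then have "(LINT x|M. f x \<bullet> g x)^2 \<le> (n2 M f * n2 M g)^2"
  by (simp add: power_mult_distrib)
 then show ?thesis
  unfolding abs_le_square_iff[symmetric] by simp
qed

lemma n2_triangle:
 assumes "l2 M f" "l2 M g" shows "n2 M (\<lambda>x. f x + g x) \<le> n2 M f + n2 M g"
proof (rule power2_le_imp_le)
 show "(n2 M (\<lambda>x. f x + g x))^2 \<le> (n2 M f + n2 M g)^2"
  using n2_Cauchy_Schwarz[OF assms] by (simp add: n2_add_power2[OF assms] power2_sum)
qed simp

lemma n2_triangle_diff:
 assumes "l2 M f" "l2 M g" "l2 M h"
 shows "n2 M (\<lambda>x. f x - h x) \<le> n2 M (\<lambda>x. f x - g x) + n2 M (\<lambda>x. g x - h x)"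
 using n2_triangle[OF l2_diff[OF assms(1,2)] l2_diff[OF assms(2,3)]] by simp

lemma n2_mult_bound:
 fixes f g :: "_ \<Rightarrow> complex"
 assumes "l2 M f" "l2 M g"
 shows "integrable M (\<lambda>x. f x * g x)" "(LINT x|M. norm (f x) * norm (g x)) \<le> n2 M f * n2 M g"
  "norm (LINT x|M. f x * g x) \<le> n2 M f * n2 M g"
proof -
 have *: "integrable M (\<lambda>x. norm (f x) * norm (g x))"
  by (intro integrable_l2_mult l2_norm assms)
 show **: "integrable M (\<lambda>x. f x * g x)"
  using assms by (intro Bochner_Integration.integrable_bound[OF *]) (auto simp: l2_def norm_mult)
 show ***: "(LINT x|M. norm (f x) * norm (g x)) \<le> n2 M f * n2 M g"
  using n2_Cauchy_Schwarz[OF l2_norm l2_norm, OF assms] by simp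
 have "norm (LINT x|M. f x * g x) \<le> (LINT x|M. norm (f x * g x))"
  by (rule integral_norm_bound)
 with *** show "norm (LINT x|M. f x * g x) \<le> n2 M f * n2 M g"
  by (simp add: norm_mult)
qed

lemma n2_parallelogram:
 assumes "l2 M f" "l2 M g"
 shows "(n2 M (\<lambda>x. f x - g x))^2 + (n2 M (\<lambda>x. f x + g x))^2 = 2 * (n2 M f)^2 + 2 * (n2 M g)^2"
proof -
 have "(n2 M (\<lambda>x. f x + - g x))^2 = (n2 M f)^2 + 2 * (LINT x|M. f x \<bullet> - g x) + (n2 M (\<lambda>x. - g x))^2"
  by (intro n2_add_power2 assms l2_uminus)
 moreover have "n2 M (\<lambda>x. - g x) = n2 M g" by (simp add: n2_def)
 ultimately show ?thesis
  using n2_add_power2[OF assms] by simp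
qed

text \<open>The sum of \<open>2\<^sup>n \<parallel>f\<^sub>n\<^sub>+\<^sub>1 - f\<^sub>n\<parallel>^2\<close> is integrable, hence almost everywhere finite.\<close>

lemma l2_complete:
 fixes f :: "nat \<Rightarrow> 'a \<Rightarrow> 'b::euclidean_space"
 assumes f: "\<And>n. l2 M (f n)"
  and c: "\<And>m n. n \<le> m \<Longrightarrow> n2 M (\<lambda>x. f m x - f n x) \<le> (1/2)^n"
 defines "F \<equiv> \<lambda>x. lim (\<lambda>n. f n x)"
 shows "AE x in M. (\<lambda>n. f n x) \<longlonglongrightarrow> F x" "l2 M F" "\<And>n. n2 M (\<lambda>x. f n x - F x) \<le> (1/2)^n"
proof -
 have [measurable]: "f n \<in> borel_measurable M" for n using f by (auto simp: l2_def)
 have [measurable]: "F \<in> borel_measurable M"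
  unfolding F_def by (rule borel_measurable_lim_metric) simp
 have nn: "(\<integral>\<^sup>+x. ennreal ((norm (f m x - f n x))^2) \<partial>M) = ennreal ((n2 M (\<lambda>x. f m x - f n x))^2)" for m n
  unfolding n2_power2 by (rule nn_integral_eq_integral) (auto intro!: l2_integrable l2_diff f)
 have nb: "(\<integral>\<^sup>+x. ennreal ((norm (f m x - f n x))^2) \<partial>M) \<le> ennreal (((1/2)^n)^2)" if "n \<le> m" for m n
  unfolding nn using c[OF that] by (intro ennreal_leI power_mono) auto
 define D where "D n x = (norm (f (Suc n) x - f n x))^2" for n x
 have [measurable]: "D n \<in> borel_measurable M" for n unfolding D_def by measurable
 have "(\<integral>\<^sup>+x. (\<Sum>n. ennreal (2^n * D n x)) \<partial>M) = (\<Sum>n. \<integral>\<^sup>+x. ennreal (2^n * D n x) \<partial>M)"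
  by (rule nn_integral_suminf) simp
 also have "... \<le> (\<Sum>n. ennreal ((1/2)^n))"
 proof (rule suminf_le)
  fix n
  have "(\<integral>\<^sup>+x. ennreal (2^n * D n x) \<partial>M) = ennreal (2^n) * (\<integral>\<^sup>+x. ennreal (D n x) \<partial>M)"
   by (simp add: ennreal_mult' nn_integral_cmult D_def)
  also have "... \<le> ennreal (2^n) * ennreal (((1/2)^n)^2)"
   unfolding D_def by (intro mult_left_mono nb) auto
  also have "... = ennreal ((1/2)^n)"
   by (subst ennreal_mult[symmetric]) (auto simp: power2_eq_square power_one_over)
  finally show "(\<integral>\<^sup>+x. ennreal (2^n * D n x) \<partial>M) \<le> ennreal ((1/2)^n)" .
 qed auto
 also have "... = ennreal (\<Sum>n. (1/2)^n)"
  by (rule suminf_ennreal2) (auto intro: summable_geometric)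
 also have "... < \<infinity>" by simp
 finally have "AE x in M. (\<Sum>n. ennreal (2^n * D n x)) \<noteq> \<infinity>"
  by (intro nn_integral_PInf_AE) auto
 then show conv: "AE x in M. (\<lambda>n. f n x) \<longlonglongrightarrow> F x"
 proof eventually_elim
  case (elim x)
  have "summable (\<lambda>n. 2^n * D n x)"
   by (rule summable_suminf_not_top) (use elim in \<open>auto simp: D_def\<close>)
  then have s: "summable (\<lambda>n. 2^n * D n x + (1/2)^n)"
   by (intro summable_add summable_geometric) auto
  have "summable (\<lambda>n. norm (f (Suc n) x - f n x))"
  proof (rule summable_comparison_test'[OF s])
   fix n :: nat
   let ?a = "norm (f (Suc n) x - f n x)"
   have "0 \<le> (2^n * ?a - 1)^2 + 2 ^ n * ?a * 0" by simp
   then have "2 * (2^n * ?a) \<le> (2^n * ?a)^2 + 1" by (simp add: power2_diff)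
   moreover have "0 \<le> 2^n * ?a" by simp
   ultimately have "2^n * ?a \<le> (2^n * ?a)^2 + 1" by linarith
   then have "?a \<le> 2^n * ?a^2 + (1/2)^n"
    by (simp add: field_simps power2_eq_square)
   then show "norm ?a \<le> 2^n * D n x + (1/2)^n" by (simp add: D_def)
  qed
  then have "summable (\<lambda>n. f (Suc n) x - f n x)" by (rule summable_norm_cancel)
  then have "convergent (\<lambda>n. f n x - f 0 x)"
   unfolding summable_iff_convergent sum_lessThan_telescope[of "\<lambda>n. f n x"] .
  then have "convergent (\<lambda>n. (f n x - f 0 x) + f 0 x)"
   by (intro convergent_add convergent_const)
  then have "convergent (\<lambda>n. f n x)" by simp
  then show ?case unfolding F_def by (simp add: convergent_LIMSEQ_iff)
 qed
 have Fb: "(\<integral>\<^sup>+x. ennreal ((norm (f n x - F x))^2) \<partial>M) \<le> ennreal (((1/2)^n)^2)" for n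
 proof -
  have "(\<integral>\<^sup>+x. ennreal ((norm (f n x - F x))^2) \<partial>M) = (\<integral>\<^sup>+x. liminf (\<lambda>m. ennreal ((norm (f m x - f n x))^2)) \<partial>M)"
   using conv
  proof (intro nn_integral_cong_AE, eventually_elim)
   case (elim x)
   have "(\<lambda>m. ennreal ((norm (f m x - f n x))^2)) \<longlonglongrightarrow> ennreal ((norm (F x - f n x))^2)"
    by (intro tendsto_intros elim)
   from lim_imp_Liminf[OF _ this] show ?case by (simp add: norm_minus_commute)
  qed
  also have "... \<le> liminf (\<lambda>m. \<integral>\<^sup>+x. ennreal ((norm (f m x - f n x))^2) \<partial>M)"
   by (rule nn_integral_liminf) simp
  also have "... \<le> liminf (\<lambda>m. ennreal (((1/2)^n)^2))"
   by (rule Liminf_mono) (use nb in \<open>auto simp: eventually_sequentially\<close>)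
  finally show ?thesis by (simp add: Liminf_const)
 qed
 have d: "l2 M (\<lambda>x. f n x - F x)" for n
  unfolding l2_def
 proof
  show "integrable M (\<lambda>x. (norm (f n x - F x))^2)"
   by (rule integrableI_bounded) (use Fb[of n] in \<open>auto simp: less_top[symmetric] top_unique\<close>)
 qed simp
 show "l2 M F" using l2_diff[OF f[of 0] d[of 0]] by simp
 show "n2 M (\<lambda>x. f n x - F x) \<le> (1/2)^n" for n
 proof -
  have "ennreal ((n2 M (\<lambda>x. f n x - F x))^2) = (\<integral>\<^sup>+x. ennreal ((norm (f n x - F x))^2) \<partial>M)"
   unfolding n2_power2 by (rule nn_integral_eq_integral[symmetric]) (auto intro: l2_integrable d)
  then have "(n2 M (\<lambda>x. f n x - F x))^2 \<le> ((1/2)^n)^2"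
   using Fb[of n] by (metis ennreal_le_iff zero_le_power2)
  then show ?thesis by (rule power2_le_imp_le) simp
 qed
qed

lemma fast_subsequence:
 fixes D :: "nat \<Rightarrow> nat \<Rightarrow> real"
 assumes "\<And>e. e > 0 \<Longrightarrow> \<exists>N. \<forall>m\<ge>N. \<forall>n\<ge>N. D m n < e"
 obtains r where "strict_mono r" "\<And>m n. n \<le> m \<Longrightarrow> D (r m) (r n) \<le> (1/2)^n"
proof -
 obtain N where N: "\<And>k m n. m \<ge> N k \<Longrightarrow> n \<ge> N k \<Longrightarrow> D m n < (1/2)^k"
  using assms[of "(1/2)^k" for k] by (metis zero_less_power half_gt_zero_iff zero_less_one)
 define r where "r = rec_nat (N 0) (\<lambda>k p. Suc (p + N (Suc k)))"
 have r: "r 0 = N 0" "r (Suc k) = Suc (r k + N (Suc k))" for k by (auto simp: r_def)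
 have mono: "strict_mono r" by (rule strict_monoI_Suc) (simp add: r)
 have ge: "r k \<ge> N k" for k by (cases k) (auto simp: r)
 have "D (r m) (r n) \<le> (1/2)^n" if "n \<le> m" for m n
  using N[of n "r m" "r n"] ge[of n] strict_mono_mono[OF mono, THEN monoD, OF that] by force
 then show ?thesis using that mono by blast
qed

section \<open>Smooth functions and mollification\<close>

lemma Ck_SucI:
 assumes "\<And>x. (f has_derivative f' x) (at x)" "\<And>b. b \<in> Basis \<Longrightarrow> Ck k (\<lambda>x. f' x b)"
 shows "Ck (Suc k) f"
proof -
 have "der f x = f' x" for x
  using frechet_derivative_at[OF assms(1)] by simp
 with assms show ?thesis by (auto intro: differentiableI)
qed

lemma Ck_SucD:
 assumes "Ck (Suc k) f"
 shows "(f has_derivative der f x) (at x)"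
  "b \<in> Basis \<Longrightarrow> Ck k (\<lambda>x. der f x b)"
 using assms by (auto simp: frechet_derivative_works[symmetric])

lemma Ck_1D:
 assumes "Ck 1 f"
 shows "(f has_derivative der f x) (at x)"
  "continuous_on UNIV (\<lambda>x. der f x 1)"
  "continuous_on UNIV (\<lambda>x. der f x \<i>)"
proof -
 have *: "Ck (Suc 0) f" using assms by simp
 show "(f has_derivative der f x) (at x)"
  by (rule Ck_SucD(1)[OF *])
 show "continuous_on UNIV (\<lambda>x. der f x 1)"
  "continuous_on UNIV (\<lambda>x. der f x \<i>)"
  using Ck_SucD(2)[OF *, of 1] Ck_SucD(2)[OF *, of \<i>] by (simp_all add: Basis_complex_def)
qed

lemma Ck_continuous: "Ck k f \<Longrightarrow> continuous_on UNIV f"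
 by (cases k) (auto intro!: differentiable_imp_continuous_on simp: differentiable_on_def
   intro: differentiable_at_withinI)

lemma Ck_Suc_imp: "Ck (Suc k) f \<Longrightarrow> Ck k f"
proof (induction k arbitrary: f)
 case 0
 then show ?case using Ck_continuous[of 1 f] by simp
next
 case (Suc k)
 show ?case
  by (rule Ck_SucI[OF Ck_SucD(1)[OF Suc.prems]]) (rule Suc.IH[OF Ck_SucD(2)[OF Suc.prems]])
qed

lemma Ck_mono: "Ck k f \<Longrightarrow> j \<le> k \<Longrightarrow> Ck j f"
proof (induction k)
 case (Suc k)
 then show ?case using Ck_Suc_imp by (cases "j = Suc k") (auto simp del: Ck.simps)
qed simp

lemma Ck_const: "Ck k (\<lambda>x. c)"
 by (induction k arbitrary: c) (auto intro!: continuous_intros simp: frechet_derivative_const)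

lemma Ck_add: "Ck k f \<Longrightarrow> Ck k g \<Longrightarrow> Ck k (\<lambda>x. f x + g x)"
proof (induction k arbitrary: f g)
 case (Suc k)
 show ?case
  by (rule Ck_SucI[OF has_derivative_add[OF Ck_SucD(1)[OF Suc.prems(1)] Ck_SucD(1)[OF Suc.prems(2)]]])
    (intro Suc.IH Ck_SucD(2)[OF Suc.prems(1)] Ck_SucD(2)[OF Suc.prems(2)])
qed (auto intro!: continuous_intros)

lemma Ck_mult: "Ck k f \<Longrightarrow> Ck k g \<Longrightarrow> Ck k (\<lambda>x. f x * g x)"
proof (induction k arbitrary: f g)
 case (Suc k)
 show ?case
  by (rule Ck_SucI[OF has_derivative_mult[OF Ck_SucD(1)[OF Suc.prems(1)] Ck_SucD(1)[OF Suc.prems(2)]]])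
    (intro Ck_add Suc.IH Ck_SucD(2)[OF Suc.prems(1)] Ck_SucD(2)[OF Suc.prems(2)]
     Ck_Suc_imp[OF Suc.prems(1)] Ck_Suc_imp[OF Suc.prems(2)])
qed (auto intro!: continuous_intros)

lemma Ck_uminus: "Ck k f \<Longrightarrow> Ck k (\<lambda>x. - f x)"
 using Ck_mult[OF Ck_const[of k "-1"], of f] by simp

lemma Ck_diff: "Ck k f \<Longrightarrow> Ck k g \<Longrightarrow> Ck k (\<lambda>x. f x - g x)"
 using Ck_add[OF _ Ck_uminus, of k f g] by simp

lemma Ck_affine: "Ck k f \<Longrightarrow> Ck k (\<lambda>x. f (r *\<^sub>R x + c))"
proof (induction k arbitrary: f)
 case 0
 then show ?case
  by (auto intro!: continuous_on_compose2[of UNIV f] continuous_intros)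
next
 case (Suc k)
 have d: "((\<lambda>x. f (r *\<^sub>R x + c)) has_derivative
   (\<lambda>h. der f (r *\<^sub>R x + c) (r *\<^sub>R h))) (at x)" for x
  by (rule has_derivative_compose[of "\<lambda>x. r *\<^sub>R x + c" "\<lambda>h. r *\<^sub>R h" x UNIV f, simplified])
    (auto intro!: derivative_eq_intros Ck_SucD(1)[OF Suc.prems])
 have lin: "der f y (r *\<^sub>R h) = of_real r * der f y h" for y h
  using linear_scale[OF has_derivative_linear[OF Ck_SucD(1)[OF Suc.prems]]] by (simp add: scaleR_conv_of_real)
 show ?case
  by (rule Ck_SucI[OF d]) (use lin in \<open>auto intro!: Ck_mult Ck_const Suc.IH Ck_SucD(2)[OF Suc.prems]\<close>)
qed

definition flat :: "real poly \<Rightarrow> real \<Rightarrow> real" where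
 "flat p t = (if t > 0 then poly p (1 / t) * exp (- (1 / t)) else 0)"

lemma flat_derivative:
 "(flat p has_real_derivative flat (monom 1 2 * (p - pderiv p)) t) (at t)"
proof -
 consider "t > 0" | "t < 0" | "t = 0" by linarith
 then show ?thesis
 proof cases
  case 1
  have "((\<lambda>t. poly p (1 / t) * exp (- (1 / t))) has_real_derivative flat (monom 1 2 * (p - pderiv p)) t) (at t)"
   using 1 by (auto intro!: derivative_eq_intros DERIV_chain'[OF _ poly_DERIV]
     simp: flat_def poly_monom field_simps power2_eq_square)
  then show ?thesis
   by (rule has_field_derivative_transform_within_open[where S="{0<..}"]) (use 1 in \<open>auto simp: flat_def\<close>)
 next
  case 2
  have "((\<lambda>t. 0) has_real_derivative flat (monom 1 2 * (p - pderiv p)) t) (at t)"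
   using 2 by (simp add: flat_def)
  then show ?thesis
   by (rule has_field_derivative_transform_within_open[where S="{..<0}"]) (use 2 in \<open>auto simp: flat_def\<close>)
 next
  case 3
  have "((\<lambda>x::real. (\<Sum>i\<le>degree p. coeff p i * (x ^ Suc i / exp x))) \<longlongrightarrow> (\<Sum>i\<le>degree p. coeff p i * 0)) at_top"
   by (intro tendsto_intros tendsto_power_div_exp_0)
  then have l: "((\<lambda>x. x * poly p x * exp (- x)) \<longlongrightarrow> 0) at_top"
   by (simp add: poly_altdef sum_distrib_left sum_distrib_right exp_minus field_simps)
  have r: "((\<lambda>t. flat p t / t) \<longlongrightarrow> 0) (at_right 0)"
  proof (rule Lim_transform_eventually)
   show "((\<lambda>t. inverse t * poly p (inverse t) * exp (- inverse t)) \<longlongrightarrow> 0) (at_right 0)"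
    by (rule filterlim_compose[OF l filterlim_inverse_at_top_right])
   show "\<forall>\<^sub>F t in at_right 0. inverse t * poly p (inverse t) * exp (- inverse t) = flat p t / t"
    by (rule eventually_at_rightI[of 0 1]) (auto simp: flat_def field_simps)
  qed
  have "((\<lambda>t. flat p t / t) \<longlongrightarrow> 0) (at_left 0)"
  proof (rule Lim_transform_eventually[OF tendsto_const])
   show "\<forall>\<^sub>F t in at_left 0. 0 = flat p t / t"
    by (rule eventually_at_leftI[of "-1" 0]) (auto simp: flat_def)
  qed
  with r have "((\<lambda>t. flat p t / t) \<longlongrightarrow> 0) (at 0)"
   by (simp add: filterlim_split_at)
  then show ?thesis using 3 by (simp add: has_field_derivative_iff flat_def)
 qed
qed

lemma continuous_flat: "continuous_on UNIV (flat p)"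
 by (meson DERIV_isCont continuous_at_imp_continuous_on flat_derivative)

lemma Ck_flat:
 assumes "bounded_linear L"
 shows "Ck k (\<lambda>z. of_real (flat p (L z + a)))"
proof (induction k arbitrary: p)
 case 0
 show ?case
  by (auto intro!: continuous_intros continuous_on_compose2[OF continuous_flat] bounded_linear.continuous_on[OF assms])
next
 case (Suc k)
 have d: "((\<lambda>z. complex_of_real (flat p (L z + a))) has_derivative
   (\<lambda>h. of_real (flat (monom 1 2 * (p - pderiv p)) (L x + a) * L h))) (at x)" for x
 proof -
  have "((\<lambda>z. L z + a) has_derivative L) (at x)"
   by (auto intro!: derivative_eq_intros bounded_linear.has_derivative[OF assms])
  then have "((\<lambda>z. flat p (L z + a)) has_derivative (\<lambda>h. flat (monom 1 2 * (p - pderiv p)) (L x + a) * L h)) (at x)"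
   by (rule has_derivative_compose) (use flat_derivative in \<open>simp add: has_field_derivative_def\<close>)
  then show ?thesis
   by (rule bounded_linear.has_derivative[OF bounded_linear_of_real])
 qed
 show ?case
  by (rule Ck_SucI[OF d]) (auto intro!: Ck_mult Ck_const Suc.IH)
qed

definition bump0 :: "complex \<Rightarrow> real" where
 "bump0 z = flat 1 (Re z + 1/2) * flat 1 (1/2 - Re z) * (flat 1 (Im z + 1/2) * flat 1 (1/2 - Im z))"

lemma Ck_bump0: "Ck k (\<lambda>z. of_real (bump0 z))"
proof -
 have "Ck k (\<lambda>z. of_real (flat 1 (Re z + 1/2)))" "Ck k (\<lambda>z. of_real (flat 1 (- Re z + 1/2)))"
   "Ck k (\<lambda>z. of_real (flat 1 (Im z + 1/2)))" "Ck k (\<lambda>z. of_real (flat 1 (- Im z + 1/2)))"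
  by (intro Ck_flat bounded_linear_Re bounded_linear_Im bounded_linear_minus)+
 then show ?thesis unfolding bump0_def of_real_mult
  by (intro Ck_mult) (simp_all add: algebra_simps)
qed

lemma flat_1_nonneg: "0 \<le> flat 1 t" and flat_1_pos: "t > 0 \<Longrightarrow> 0 < flat 1 t" and flat_neg: "t \<le> 0 \<Longrightarrow> flat p t = 0"
 by (auto simp: flat_def)

lemma bump0_nonneg: "0 \<le> bump0 z"
 by (simp add: bump0_def flat_1_nonneg)

lemma bump0_eq_0: "norm z > 1 \<Longrightarrow> bump0 z = 0"
proof -
 assume "norm z > 1"
 then have "\<bar>Re z\<bar> > 1/2 \<or> \<bar>Im z\<bar> > 1/2"
  using cmod_le[of z] by linarith
 then have "Re z + 1/2 \<le> 0 \<or> 1/2 - Re z \<le> 0 \<or> Im z + 1/2 \<le> 0 \<or> 1/2 - Im z \<le> 0" by linarith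
 then show ?thesis by (auto simp: bump0_def flat_neg)
qed

lemma integrable_compact_support:
 fixes f :: "complex \<Rightarrow> 'b::euclidean_space"
 assumes "continuous_on UNIV f" "\<And>y. norm y > B \<Longrightarrow> f y = 0"
 shows "integrable lborel f"
proof -
 have "set_integrable lborel (cball 0 B) f"
  unfolding set_integrable_def
  by (rule borel_integrable_compact) (auto intro: continuous_on_subset[OF assms(1)])
 moreover have "indicator (cball 0 B) x *\<^sub>R f x = f x" for x
  using assms(2)[of x] by (auto simp: indicator_def)
 ultimately show ?thesis by (simp add: set_integrable_def)
qed

lemma continuous_bump0: "continuous_on UNIV bump0"
proof -
 have "continuous_on UNIV (\<lambda>z. Re (complex_of_real (bump0 z)))"
  by (intro continuous_on_Re Ck_continuous[OF Ck_bump0])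
 then show ?thesis by simp
qed

lemma integral_bump0_pos: "0 < (LINT z|lborel. bump0 z)"
proof -
 have i: "integrable lborel bump0"
  by (rule integrable_compact_support[OF continuous_bump0 bump0_eq_0])
 have "0 \<le> (LINT z|lborel. bump0 z)" by (simp add: bump0_nonneg)
 moreover have "(LINT z|lborel. bump0 z) \<noteq> 0"
 proof
  assume "(LINT z|lborel. bump0 z) = 0"
  then have "AE z in lborel. bump0 z = 0"
   by (simp add: integral_nonneg_eq_0_iff_AE[OF i] bump0_nonneg)
  moreover have "bump0 z > 0" if "z \<in> ball 0 (1/2)" for z
   using that abs_Re_le_cmod[of z] abs_Im_le_cmod[of z] by (auto simp: bump0_def intro!: mult_pos_pos flat_1_pos)
  ultimately have "AE z in lborel. z \<notin> ball (0::complex) (1/2)" by fastforce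
  then have "emeasure lborel (ball (0::complex) (1/2)) = 0"
   by (subst (asm) AE_iff_measurable[of "ball (0::complex) (1/2)"]) auto
  then show False using content_ball_pos[of "1/2" "0::complex"] by (simp add: measure_def)
 qed
 ultimately show ?thesis by linarith
qed

definition bump :: "complex \<Rightarrow> real" where
 "bump z = bump0 z / (LINT z|lborel. bump0 z)"

lemma bump_nonneg: "0 \<le> bump z"
 using integral_bump0_pos by (simp add: bump_def bump0_nonneg)

lemma bump_eq_0: "norm z > 1 \<Longrightarrow> bump z = 0"
 by (simp add: bump_def bump0_eq_0)

lemma integral_bump: "(LINT z|lborel. bump z) = 1"
 using integral_bump0_pos by (simp add: bump_def)

lemma Ck_bump: "Ck k (\<lambda>z. of_real (bump z))"
 unfolding bump_def divide_inverse of_real_mult by (intro Ck_mult Ck_const Ck_bump0)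

lemma continuous_bump: "continuous_on UNIV bump"
 unfolding bump_def using integral_bump0_pos by (intro continuous_intros continuous_bump0) auto

lemma integrable_bump: "integrable lborel bump"
 by (rule integrable_compact_support[OF continuous_bump bump_eq_0])

lemma uniformly_continuous_compact_support:
 fixes f :: "cfun"
 assumes "continuous_on UNIV f" "\<And>y. norm y > B \<Longrightarrow> f y = 0" "e > 0"
 obtains d where "d > 0" "\<And>x y. norm (x - y) \<le> d \<Longrightarrow> norm (f x - f y) \<le> e"
proof -
 have "uniformly_continuous_on (cball 0 (B + 1)) f"
  by (intro compact_uniformly_continuous continuous_on_subset[OF assms(1)]) auto
 then obtain d where d: "d > 0" "\<And>x y. x \<in> cball 0 (B + 1) \<Longrightarrow> y \<in> cball 0 (B + 1) \<Longrightarrow> dist y x < d \<Longrightarrow> dist (f y) (f x) < e"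
  using \<open>e > 0\<close> unfolding uniformly_continuous_on_def by metis
 show ?thesis
 proof (rule that[of "min (d/2) 1"])
  show "norm (f x - f y) \<le> e" if "norm (x - y) \<le> min (d/2) 1" for x y
  proof (cases "norm x > B \<and> norm y > B")
   case True
   then show ?thesis using assms by simp
  next
   case False
   then have "norm x \<le> B + 1" "norm y \<le> B + 1"
    using that norm_triangle_ineq2[of x y] norm_triangle_ineq2[of y x] by (auto simp: norm_minus_commute)
   then show ?thesis using d(2)[of y x] that d(1) by (auto simp: dist_norm)
  qed
 qed (use d in auto)
qed

lemma frechet_complex:
 fixes f :: "cfun"
 assumes "(f has_derivative f') (at x)"
 shows "f' h = Re h *\<^sub>R f' 1 + Im h *\<^sub>R f' \<i>"
proof -
 have "linear f'" by (rule has_derivative_linear[OF assms])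
 then have "f' (Re h *\<^sub>R 1 + Im h *\<^sub>R \<i>) = Re h *\<^sub>R f' 1 + Im h *\<^sub>R f' \<i>"
  by (simp add: linear_add linear_scale)
 moreover have "Re h *\<^sub>R 1 + Im h *\<^sub>R \<i> = h" by (simp add: complex_eq_iff)
 ultimately show ?thesis by simp
qed

lemma frechet_derivative_support:
 fixes f :: "cfun"
 assumes "\<And>y. norm y > B \<Longrightarrow> f y = 0" "norm x > B"
 shows "der f x h = 0"
proof -
 have "((\<lambda>_. 0) has_derivative (\<lambda>_. 0)) (at x)" by simp
 then have "(f has_derivative (\<lambda>_. 0)) (at x)"
  by (rule has_derivative_transform_within_open[where s="- cball 0 B"]) (use assms in auto)
 then show ?thesis using frechet_derivative_at by metis
qed

lemma conv_integrable:
 fixes f \<eta> :: "cfun"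
 assumes f: "f \<in> bm" "\<And>R. set_integrable lborel (cball 0 R) f"
  and \<eta>: "continuous_on UNIV \<eta>" "\<And>y. norm y > B \<Longrightarrow> \<eta> y = 0"
 shows "integrable lborel (\<lambda>y. f y * \<eta> (z - y))"
proof -
 have [measurable]: "\<eta> \<in> bm"
  by (rule continuous_bm[OF \<eta>(1)])
 have [measurable]: "f \<in> bm" by fact
 have "bounded (\<eta> ` cball 0 B)"
  by (intro compact_imp_bounded compact_continuous_image continuous_on_subset[OF \<eta>(1)]) auto
 then obtain C0 where C0: "\<And>y. y \<in> cball 0 B \<Longrightarrow> norm (\<eta> y) \<le> C0" unfolding bounded_iff by blast
 define C where "C = max C0 0"
 have C: "norm (\<eta> y) \<le> C" for y
  using C0[of y] \<eta>(2)[of y] by (cases "norm y > B") (auto simp: C_def)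
 have "integrable lborel (\<lambda>y. C * norm (indicator (cball 0 (norm z + B)) y *\<^sub>R f y))"
  using f(2)[of "norm z + B"] unfolding set_integrable_def
  by (intro integrable_mult_right integrable_norm)
 then show ?thesis
 proof (rule Bochner_Integration.integrable_bound)
  show "AE y in lborel. norm (f y * \<eta> (z - y)) \<le> norm (C * norm (indicator (cball 0 (norm z + B)) y *\<^sub>R f y))"
  proof (rule AE_I2)
   fix y
   show "norm (f y * \<eta> (z - y)) \<le> norm (C * norm (indicator (cball 0 (norm z + B)) y *\<^sub>R f y))"
   proof (cases "norm (z - y) > B")
    case True
    then show ?thesis using \<eta>(2) by simp
   next
    case False
    then have "norm y \<le> norm z + B"
     using norm_triangle_ineq2[of y z] by (simp add: norm_minus_commute)
    then show ?thesis using mult_right_mono[OF C[of "z - y"], of "norm (f y)"]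
     by (simp add: C_def norm_mult mult.commute)
   qed
  qed
 qed simp
qed

lemma conv_bound:
 fixes f \<xi> :: "cfun"
 assumes "integrable lborel (\<lambda>y. f y * \<xi> y)" "set_integrable lborel (cball 0 R) f"
  and "\<And>y. norm y > R \<Longrightarrow> \<xi> y = 0" "\<And>y. norm (\<xi> y) \<le> e"
 shows "norm (LINT y|lborel. f y * \<xi> y) \<le> e * (LINT y|lborel. norm (indicator (cball 0 R) y *\<^sub>R f y))"
proof -
 have "norm (LINT y|lborel. f y * \<xi> y) \<le> (LINT y|lborel. norm (f y * \<xi> y))"
  by (rule integral_norm_bound)
 also have "... \<le> (LINT y|lborel. e * norm (indicator (cball 0 R) y *\<^sub>R f y))"
 proof (rule integral_mono)
  show "norm (f y * \<xi> y) \<le> e * norm (indicator (cball 0 R) y *\<^sub>R f y)" for y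
   using assms(3)[of y] mult_right_mono[OF assms(4)[of y], of "norm (f y)"]
   by (auto simp: indicator_def norm_mult mult.commute)
  show "integrable lborel (\<lambda>y. e * norm (indicator (cball 0 R) y *\<^sub>R f y))"
   using assms(2) unfolding set_integrable_def by (intro integrable_mult_right integrable_norm)
  show "integrable lborel (\<lambda>y. norm (f y * \<xi> y))"
   using assms(1) by (rule integrable_norm)
 qed
 finally show ?thesis by simp
qed

lemma conv_has_derivative:
 fixes f \<eta> :: "cfun"
 assumes f: "f \<in> bm" "\<And>R. set_integrable lborel (cball 0 R) f"
  and \<eta>: "Ck 1 \<eta>" "\<And>y. norm y > B \<Longrightarrow> \<eta> y = 0"
 shows "((\<lambda>z. LINT y|lborel. f y * \<eta> (z - y)) has_derivative
  (\<lambda>h. LINT y|lborel. f y * der \<eta> (z - y) h)) (at z)"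
proof -
 let ?D = "\<lambda>x. der \<eta> x"
 let ?I = "\<lambda>h. LINT y|lborel. f y * ?D (z - y) h"
 have D: "(\<eta> has_derivative ?D x) (at x)" for x by (rule Ck_1D[OF \<eta>(1)])
 have Dc: "continuous_on UNIV (\<lambda>x. ?D x 1)" "continuous_on UNIV (\<lambda>x. ?D x \<i>)"
  by (rule Ck_1D[OF \<eta>(1)])+
 have Ds: "norm y > B \<Longrightarrow> ?D y h = 0" for y h by (rule frechet_derivative_support[OF \<eta>(2)])
 have Dh: "?D x h = of_real (Re h) * ?D x 1 + of_real (Im h) * ?D x \<i>" for x h
  unfolding scaleR_conv_of_real[symmetric] by (rule frechet_complex[OF D])
 have Dc': "continuous_on UNIV (\<lambda>x. ?D x h)" for h
  unfolding Dh[of _ h] by (intro continuous_intros Dc)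
 have int: "integrable lborel (\<lambda>y. f y * ?D (z - y) h)" for h
  by (rule conv_integrable[OF f Dc' Ds])
 have int0: "integrable lborel (\<lambda>y. f y * \<eta> (z - y))" for z
  by (rule conv_integrable[OF f Ck_continuous[OF \<eta>(1)] \<eta>(2)])
 have I: "?I h = Re h *\<^sub>R ?I 1 + Im h *\<^sub>R ?I \<i>" for h
 proof -
  have "?I h = (LINT y|lborel. Re h *\<^sub>R (f y * ?D (z - y) 1) + Im h *\<^sub>R (f y * ?D (z - y) \<i>))"
   unfolding Dh[of _ h] by (simp add: scaleR_conv_of_real algebra_simps)
  then show ?thesis using int by simp
 qed
 have bl: "bounded_linear ?I"
  by (subst ext[OF I]) (intro bounded_linear_add bounded_linear_scaleR_left[THEN bounded_linear_compose, OF bounded_linear_Re]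
    bounded_linear_scaleR_left[THEN bounded_linear_compose, OF bounded_linear_Im])
 define R where "R = norm z + B + 1"
 define A where "A = (LINT y|lborel. norm (indicator (cball 0 R) y *\<^sub>R f y))"
 have "A \<ge> 0" by (simp add: A_def)
 show ?thesis
  unfolding has_derivative_at_alt
 proof (intro conjI allI impI bl)
  fix e :: real assume "e > 0"
  define e' where "e' = e / (2 * (A + 1))"
  have "e' > 0" using \<open>e > 0\<close> \<open>A \<ge> 0\<close> by (simp add: e'_def)
  obtain d1 where d1: "d1 > 0" "\<And>x y. norm (x - y) \<le> d1 \<Longrightarrow> norm (?D x 1 - ?D y 1) \<le> e'"
   using uniformly_continuous_compact_support[OF Dc(1) Ds \<open>e' > 0\<close>] by blast
  obtain d2 where d2: "d2 > 0" "\<And>x y. norm (x - y) \<le> d2 \<Longrightarrow> norm (?D x \<i> - ?D y \<i>) \<le> e'"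
   using uniformly_continuous_compact_support[OF Dc(2) Ds \<open>e' > 0\<close>] by blast
  define d where "d = min 1 (min d1 d2)"
  have lin: "norm (\<eta> (x + h) - \<eta> x - ?D x h) \<le> norm h * (2 * e')" if "norm h \<le> d" for x h
  proof -
   have "norm (\<eta> (x + h) - \<eta> x - ?D x ((x + h) - x)) \<le> norm ((x + h) - x) * (2 * e')"
   proof (rule differentiable_bound_linearization[where S="cball x d" and f'="?D" and ?x0.0=x])
    fix y assume y: "y \<in> cball x d"
    show "(\<eta> has_derivative ?D y) (at y within cball x d)" by (rule has_derivative_at_withinI[OF D])
    show "onorm (?D y - ?D x) \<le> 2 * e'"
    proof (rule onorm_bound)
     fix k
     have "norm (y - x) \<le> d1" "norm (y - x) \<le> d2" using y by (auto simp: d_def dist_norm norm_minus_commute)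
     note b = d1(2)[OF this(1)] d2(2)[OF this(2)]
     have "(?D y - ?D x) k = of_real (Re k) * (?D y 1 - ?D x 1) + of_real (Im k) * (?D y \<i> - ?D x \<i>)"
      by (simp add: Dh[of y k] Dh[of x k] algebra_simps)
     then have "norm ((?D y - ?D x) k) \<le> \<bar>Re k\<bar> * norm (?D y 1 - ?D x 1) + \<bar>Im k\<bar> * norm (?D y \<i> - ?D x \<i>)"
      by (simp add: norm_mult order_trans[OF norm_triangle_ineq])
     also have "... \<le> norm k * e' + norm k * e'"
      by (intro add_mono mult_mono b abs_Re_le_cmod abs_Im_le_cmod) auto
     finally show "norm ((?D y - ?D x) k) \<le> 2 * e' * norm k" by simp
    qed (use \<open>e' > 0\<close> in auto)
   next
    fix t :: real assume "t \<in> {0..1}"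
    then have "norm (t *\<^sub>R h) \<le> 1 * d" unfolding norm_scaleR by (intro mult_mono that) auto
    then show "x + t *\<^sub>R (x + h - x) \<in> cball x d" by (simp add: dist_norm)
   qed (use d1 d2 in \<open>auto simp: d_def\<close>)
   then show ?thesis by simp
  qed
  show "\<exists>d>0. \<forall>y. norm (y - z) < d \<longrightarrow>
    norm ((LINT x|lborel. f x * \<eta> (y - x)) - (LINT y|lborel. f y * \<eta> (z - y)) - ?I (y - z)) \<le> e * norm (y - z)"
  proof (intro exI[of _ d] conjI allI impI)
   fix w assume w: "norm (w - z) < d"
   define \<xi> where "\<xi> y = \<eta> (w - y) - \<eta> (z - y) - ?D (z - y) (w - z)" for y
   have xi: "norm (\<xi> y) \<le> norm (w - z) * (2 * e')" for y
    using lin[of "w - z" "z - y"] w by (simp add: \<xi>_def algebra_simps)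
   have xi0: "\<xi> y = 0" if "norm y > R" for y
   proof -
    have "norm (z - y) > B" "norm (w - y) > B"
     using that w norm_triangle_ineq2[of y z] norm_triangle_ineq2[of y w] norm_triangle_ineq2[of w z]
     by (auto simp: R_def d_def norm_minus_commute)
    then show ?thesis using \<eta>(2) Ds by (simp add: \<xi>_def)
   qed
   have "(LINT x|lborel. f x * \<eta> (w - x)) - (LINT y|lborel. f y * \<eta> (z - y)) - ?I (w - z) = (LINT y|lborel. f y * \<xi> y)"
    using int int0 by (simp add: \<xi>_def right_diff_distrib)
   also have "norm ... \<le> (norm (w - z) * (2 * e')) * A"
    unfolding A_def
   proof (rule conv_bound[OF _ f(2) xi0 xi])
    show "integrable lborel (\<lambda>y. f y * \<xi> y)"
     using int int0 by (auto simp: \<xi>_def right_diff_distrib)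
   qed
   also have "... \<le> e * norm (w - z)"
   proof -
    have "2 * e' * A \<le> 2 * e' * (A + 1)" using \<open>e' > 0\<close> by simp
    also have "... = e" using \<open>A \<ge> 0\<close> by (simp add: e'_def field_simps)
    finally show ?thesis by (metis mult.commute mult.left_commute mult_left_mono norm_ge_zero)
   qed
   finally show "norm ((LINT x|lborel. f x * \<eta> (w - x)) - (LINT y|lborel. f y * \<eta> (z - y)) - ?I (w - z)) \<le> e * norm (w - z)" .
  qed (use d1 d2 in \<open>auto simp: d_def\<close>)
 qed
qed

lemma conv_continuous:
 fixes f \<eta> :: "cfun"
 assumes f: "f \<in> bm" "\<And>R. set_integrable lborel (cball 0 R) f"
  and \<eta>: "continuous_on UNIV \<eta>" "\<And>y. norm y > B \<Longrightarrow> \<eta> y = 0"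
 shows "continuous_on UNIV (\<lambda>z. LINT y|lborel. f y * \<eta> (z - y))"
proof (rule continuous_at_imp_continuous_on, rule ballI)
 fix z :: complex
 define R where "R = norm z + B + 1"
 define A where "A = (LINT y|lborel. norm (indicator (cball 0 R) y *\<^sub>R f y))"
 have "A \<ge> 0" by (simp add: A_def)
 have int0: "integrable lborel (\<lambda>y. f y * \<eta> (z - y))" for z
  by (rule conv_integrable[OF f \<eta>])
 show "isCont (\<lambda>z. LINT y|lborel. f y * \<eta> (z - y)) z"
  unfolding continuous_at_eps_delta
 proof (intro allI impI)
  fix e :: real assume "e > 0"
  define e' where "e' = e / (2 * (A + 1))"
  have "e' > 0" using \<open>e > 0\<close> \<open>A \<ge> 0\<close> by (simp add: e'_def)
  obtain d1 where d1: "d1 > 0" "\<And>x y. norm (x - y) \<le> d1 \<Longrightarrow> norm (\<eta> x - \<eta> y) \<le> e'"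
   using uniformly_continuous_compact_support[OF \<eta> \<open>e' > 0\<close>] by blast
  show "\<exists>d>0. \<forall>x'. dist x' z < d \<longrightarrow> dist (LINT y|lborel. f y * \<eta> (x' - y)) (LINT y|lborel. f y * \<eta> (z - y)) < e"
  proof (intro exI[of _ "min 1 d1"] conjI allI impI)
   fix w assume w: "dist w z < min 1 d1"
   have "dist (LINT y|lborel. f y * \<eta> (w - y)) (LINT y|lborel. f y * \<eta> (z - y))
     = norm (LINT y|lborel. f y * (\<eta> (w - y) - \<eta> (z - y)))"
    using int0 by (simp add: dist_norm right_diff_distrib)
   also have "... \<le> e' * A"
    unfolding A_def
   proof (rule conv_bound[OF _ f(2)])
    show "integrable lborel (\<lambda>y. f y * (\<eta> (w - y) - \<eta> (z - y)))"
     using int0 by (auto simp: right_diff_distrib)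
    show "norm (\<eta> (w - y) - \<eta> (z - y)) \<le> e'" for y
     using w by (intro d1(2)) (auto simp: dist_norm)
    show "\<eta> (w - y) - \<eta> (z - y) = 0" if "norm y > R" for y
    proof -
     have "norm (z - y) > B" "norm (w - y) > B"
      using that w norm_triangle_ineq2[of y z] norm_triangle_ineq2[of y w] norm_triangle_ineq2[of w z]
      by (auto simp: R_def dist_norm norm_minus_commute)
     then show ?thesis using \<eta>(2) by simp
    qed
   qed
   also have "... < e"
    using \<open>e > 0\<close> \<open>A \<ge> 0\<close> by (simp add: e'_def field_simps) (smt (verit) mult_nonneg_nonneg)
   finally show "dist (LINT y|lborel. f y * \<eta> (w - y)) (LINT y|lborel. f y * \<eta> (z - y)) < e" .
  qed (use d1 in auto)
 qed
qed

lemma conv_Ck: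
 fixes f \<eta> :: "cfun"
 assumes f: "f \<in> bm" "\<And>R. set_integrable lborel (cball 0 R) f"
 shows "Ck k \<eta> \<Longrightarrow> (\<And>y. norm y > B \<Longrightarrow> \<eta> y = 0) \<Longrightarrow> Ck k (\<lambda>z. LINT y|lborel. f y * \<eta> (z - y))"
proof (induction k arbitrary: \<eta>)
 case 0
 then show ?case using conv_continuous[OF f, of \<eta> B] by simp
next
 case (Suc k)
 have 1: "Ck 1 \<eta>" by (rule Ck_mono[OF Suc.prems(1)]) simp
 show ?case
  by (rule Ck_SucI[OF conv_has_derivative[OF f 1 Suc.prems(2)]])
    (auto intro!: Suc.IH Ck_SucD(2)[OF Suc.prems(1)] frechet_derivative_support[OF Suc.prems(2)])
qed

section \<open>Weak derivatives\<close>

lemma lborel_integral_affine: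
 fixes f :: "complex \<Rightarrow> 'b::{banach, second_countable_topology}"
 assumes "c \<noteq> 0" "f \<in> bm"
 shows "(LINT x|lborel. f x) = c^2 *\<^sub>R (LINT x|lborel. f (t + c *\<^sub>R x))"
  "integrable lborel f \<longleftrightarrow> integrable lborel (\<lambda>x. f (t + c *\<^sub>R x))"
proof -
 have [measurable]: "f \<in> bm" by fact
 have *: "lborel = density (distr lborel borel (\<lambda>x::complex. t + c *\<^sub>R x)) (\<lambda>_. ennreal (c^2))"
  using lborel_affine[OF assms(1), of t] by simp
 have "(LINT x|lborel. f x) = (LINT x|density (distr lborel borel (\<lambda>x::complex. t + c *\<^sub>R x)) (\<lambda>_. ennreal (c^2)). f x)"
  using * by simp
 also have "... = c^2 *\<^sub>R (LINT x|lborel. f (t + c *\<^sub>R x))"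
  by (subst integral_density) (auto simp: integral_distr)
 finally show "(LINT x|lborel. f x) = c^2 *\<^sub>R (LINT x|lborel. f (t + c *\<^sub>R x))" .
 have e: "integrable lborel (\<lambda>x. c^2 *\<^sub>R h x) \<Longrightarrow> integrable lborel h" for h :: "complex \<Rightarrow> 'b"
  using integrable_scaleR_right[of "inverse (c^2)" lborel "\<lambda>x. c^2 *\<^sub>R h x"] assms(1) by simp
 have "integrable lborel f \<longleftrightarrow> integrable (density (distr lborel borel (\<lambda>x::complex. t + c *\<^sub>R x)) (\<lambda>_. ennreal (c^2))) f"
  using * by simp
 also have "... \<longleftrightarrow> integrable lborel (\<lambda>x. f (t + c *\<^sub>R x))"
  using assms(1) by (subst integrable_density) (auto simp: integrable_distr_eq dest!: e)
 finally show "integrable lborel f \<longleftrightarrow> integrable lborel (\<lambda>x. f (t + c *\<^sub>R x))" .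
qed

definition bump_at :: "real \<Rightarrow> complex \<Rightarrow> real" where
 "bump_at e y = bump (y /\<^sub>R e) / e^2"

definition moll :: "real \<Rightarrow> cfun \<Rightarrow> cfun" where
 "moll e \<phi> z = (LINT y|lborel. of_real (bump_at e y) * \<phi> (z - y))"

context
 fixes \<phi> :: "cfun" and B e :: real
 assumes cont: "continuous_on UNIV \<phi>" and supp: "\<And>y. norm y > B \<Longrightarrow> \<phi> y = 0" and e: "e > 0"
begin

lemma bump_e_cont_real: "continuous_on UNIV (bump_at e)"
 unfolding bump_at_def using e by (auto intro!: continuous_intros continuous_on_compose2[OF continuous_bump])

lemma bump_e_cont: "continuous_on UNIV (\<lambda>y. complex_of_real (bump_at e y))"
 by (intro continuous_intros bump_e_cont_real)

lemma bump_e_supp: "norm y > e \<Longrightarrow> bump_at e y = 0"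
 using e bump_eq_0[of "y /\<^sub>R e"] by (simp add: field_simps bump_at_def)

lemma bump_e_integrable: "integrable lborel (bump_at e)"
 by (rule integrable_compact_support[OF bump_e_cont_real bump_e_supp])

lemma bump_e_integral: "(LINT y|lborel. bump_at e y) = 1"
proof -
 have [measurable]: "bump \<in> bm"
  by (rule continuous_bm[OF continuous_bump])
 have "(LINT x|lborel. bump x) = (inverse e)^2 *\<^sub>R (LINT x|lborel. bump (0 + inverse e *\<^sub>R x))"
  by (rule lborel_integral_affine) (use e in auto)
 then show ?thesis using e by (simp add: integral_bump power_inverse divide_inverse bump_at_def mult.commute)
qed

lemma cont_meas: "\<phi> \<in> bm"
 by (rule continuous_bm[OF cont])

lemma cont_set_integrable: "set_integrable lborel (cball 0 R) \<phi>"
 unfolding set_integrable_def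
 by (rule borel_integrable_compact) (auto intro: continuous_on_subset[OF cont])

lemma bump_e_set_integrable: "set_integrable lborel (cball 0 R) (\<lambda>y. complex_of_real (bump_at e y))"
 unfolding set_integrable_def
 by (rule borel_integrable_compact[OF compact_cball continuous_on_subset[OF bump_e_cont subset_UNIV]])

lemma bump_e_meas: "(\<lambda>y. complex_of_real (bump_at e y)) \<in> bm"
 by (rule continuous_bm[OF bump_e_cont])

lemma moll_integrable: "integrable lborel (\<lambda>y. of_real (bump_at e y) * \<phi> (z - y))"
 by (rule conv_integrable[OF bump_e_meas bump_e_set_integrable cont supp])

lemma moll_commute: "moll e \<phi> = (\<lambda>z. LINT y|lborel. \<phi> y * of_real (bump_at e (z - y)))"
proof
 fix z
 have [measurable]: "bump_at e \<in> bm" "\<phi> \<in> bm"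
  by (rule continuous_bm[OF bump_e_cont_real], rule cont_meas)
 have "(LINT y|lborel. \<phi> y * of_real (bump_at e (z - y)))
   = (-1)^2 *\<^sub>R (LINT y|lborel. \<phi> (z + (-1) *\<^sub>R y) * of_real (bump_at e (z - (z + (-1) *\<^sub>R y))))"
  by (rule lborel_integral_affine) auto
 then show "moll e \<phi> z = (LINT y|lborel. \<phi> y * of_real (bump_at e (z - y)))"
  by (simp add: moll_def mult.commute[of "\<phi> _"])
qed

lemma Ck_moll: "Ck k (moll e \<phi>)"
 unfolding moll_commute
proof (rule conv_Ck[OF cont_meas cont_set_integrable])
 show "Ck k (\<lambda>y. complex_of_real (bump_at e y))"
  using Ck_mult[OF Ck_affine[OF Ck_bump, of k "inverse e" 0] Ck_const[of k "of_real (inverse (e^2))"]]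
  by (simp add: divide_inverse bump_at_def)
 show "complex_of_real (bump_at e y) = 0" if "e < cmod y" for y
  using bump_e_supp[OF that] by simp
qed

lemma moll_approx:
 assumes "\<And>x y. norm (x - y) \<le> e \<Longrightarrow> norm (\<phi> x - \<phi> y) \<le> \<delta>"
 shows "norm (moll e \<phi> z - \<phi> z) \<le> \<delta>"
proof -
 let ?b = "bump_at e"
 have i: "integrable lborel (\<lambda>y. of_real (?b y) * \<phi> z)"
  using bump_e_integrable by (intro integrable_mult_left integrable_of_real) auto
 have "\<phi> z = (LINT y|lborel. of_real (?b y) * \<phi> z)"
  using bump_e_integral by simp
 then have "moll e \<phi> z - \<phi> z = (LINT y|lborel. of_real (?b y) * (\<phi> (z - y) - \<phi> z))"
  unfolding moll_def right_diff_distrib using moll_integrable[of z] i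
  by (subst Bochner_Integration.integral_diff) auto
 also have "norm ... \<le> (LINT y|lborel. norm (of_real (?b y) * (\<phi> (z - y) - \<phi> z)))"
  by (rule integral_norm_bound)
 also have "... \<le> (LINT y|lborel. ?b y * \<delta>)"
 proof (rule integral_mono)
  show "integrable lborel (\<lambda>y. norm (of_real (?b y) * (\<phi> (z - y) - \<phi> z)))"
   unfolding right_diff_distrib using moll_integrable i by (intro integrable_norm Bochner_Integration.integrable_diff)
  show "integrable lborel (\<lambda>y. ?b y * \<delta>)" using bump_e_integrable by simp
  show "norm (of_real (?b y) * (\<phi> (z - y) - \<phi> z)) \<le> ?b y * \<delta>" for y
  proof (cases "norm y > e")
   case True then show ?thesis by (simp add: bump_e_supp)
  next
   case False
   then have "norm (\<phi> (z - y) - \<phi> z) \<le> \<delta>" by (intro assms) simp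
   then show ?thesis using bump_nonneg[of "y /\<^sub>R e"]
    unfolding norm_mult norm_of_real bump_at_def
    by (simp add: mult_left_mono divide_right_mono)
  qed
 qed
 also have "... = \<delta>" using bump_e_integral by simp
 finally show ?thesis .
qed

lemma moll_supp:
 assumes "\<And>x. \<phi> x \<noteq> 0 \<Longrightarrow> norm (z - x) > e"
 shows "moll e \<phi> z = 0"
proof -
 have *: "of_real (bump_at e y) * \<phi> (z - y) = 0" for y
  using assms[of "z - y"] bump_e_supp[of y] by auto
 show ?thesis unfolding moll_def * by simp
qed

end

lemma moll_derivative:
 assumes "Ck 1 \<phi>" "\<And>y. norm y > B \<Longrightarrow> \<phi> y = 0" "e > 0"
 shows "der (moll e \<phi>) z h = moll e (\<lambda>x. der \<phi> x h) z"
proof -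
 note c = Ck_continuous[OF assms(1)]
 have "(moll e \<phi> has_derivative (\<lambda>h. moll e (\<lambda>x. der \<phi> x h) z)) (at z)"
  unfolding moll_def
  by (rule conv_has_derivative[OF bump_e_meas[OF c assms(2,3)] bump_e_set_integrable[OF c assms(2,3)] assms(1,2)])
 then show ?thesis using frechet_derivative_at by metis
qed

lemma integral_derivative_zero:
 assumes "Ck 1 \<phi>" "\<And>y. norm y > B \<Longrightarrow> \<phi> y = 0"
 shows "(LINT x|lborel. der \<phi> x h) = 0"
proof -
 have m [measurable]: "\<phi> \<in> bm"
  by (rule continuous_bm[OF Ck_continuous[OF assms(1)]])
 have "(\<lambda>x. der \<phi> x h) = (\<lambda>x. Re h *\<^sub>R der \<phi> x 1 + Im h *\<^sub>R der \<phi> x \<i>)"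
  using frechet_complex[OF Ck_1D(1)[OF assms(1)]] by blast
 moreover have "continuous_on UNIV (\<lambda>x. Re h *\<^sub>R der \<phi> x 1 + Im h *\<^sub>R der \<phi> x \<i>)"
  by (intro continuous_intros Ck_1D[OF assms(1)])
 ultimately have m' [measurable]: "(\<lambda>x. der \<phi> x h) \<in> bm"
  by (simp add: continuous_bm)
 have sub: "(LINT y|lborel. f (z - y)) = (LINT y|lborel. f y)" if "f \<in> bm" for f :: "cfun" and z
  using lborel_integral_affine(1)[of "-1" f z] that by simp
 have si: "set_integrable lborel (cball 0 R) (\<lambda>_. 1 :: complex)" for R
  unfolding set_integrable_def by (rule borel_integrable_compact) auto
 have "((\<lambda>z. LINT y|lborel. 1 * \<phi> (z - y)) has_derivative
  (\<lambda>h. LINT y|lborel. 1 * der \<phi> (0 - y) h)) (at 0)"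
  by (rule conv_has_derivative[OF _ si assms]) auto
 then have "((\<lambda>z::complex. LINT y|lborel. \<phi> y) has_derivative
  (\<lambda>h. LINT y|lborel. der \<phi> (0 - y) h)) (at 0)"
  by (simp only: sub[OF m] mult_1)
 moreover have "((\<lambda>z::complex. LINT y|lborel. \<phi> y) has_derivative (\<lambda>h. 0)) (at 0)" by simp
 ultimately have "(LINT y|lborel. der \<phi> (0 - y) h) = 0"
  using has_derivative_unique by metis
 then show ?thesis using sub[OF m', of 0] by simp
qed

definition C1c :: "complex set \<Rightarrow> cfun \<Rightarrow> bool" where
 "C1c Z \<phi> \<longleftrightarrow> Ck 1 \<phi> \<and> (\<exists>K. compact K \<and> K \<subseteq> Z \<and> (\<forall>x. x \<notin> K \<longrightarrow> \<phi> x = 0))"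

lemma test_functionI:
 assumes "\<And>k. Ck k \<phi>" "compact K" "K \<subseteq> Z" "\<And>x. x \<notin> K \<Longrightarrow> \<phi> x = 0"
 shows "test_function Z \<phi>"
proof -
 have "closure {x. \<phi> x \<noteq> 0} \<subseteq> K"
  by (rule closure_minimal) (use assms compact_imp_closed in auto)
 moreover from this have "compact (closure {x. \<phi> x \<noteq> 0})"
  using assms(2) by (meson bounded_subset closed_closure compact_eq_bounded_closed)
 ultimately show ?thesis using assms unfolding test_function_def by auto
qed

lemma test_function_C1c: "test_function Z \<phi> \<Longrightarrow> C1c Z \<phi>"
 unfolding test_function_def C1c_def using closure_subset[of "{x. \<phi> x \<noteq> 0}"] by blast

lemma test_function_mono: "test_function Z \<phi> \<Longrightarrow> Z \<subseteq> Z' \<Longrightarrow> test_function Z' \<phi>"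
 unfolding test_function_def by blast

lemma compact_bound:
 assumes "compact K" "\<And>x::complex. x \<notin> K \<Longrightarrow> \<phi> x = 0"
 shows "\<exists>B. \<forall>y. norm y > B \<longrightarrow> \<phi> y = 0"
proof -
 obtain B where "\<forall>x\<in>K. norm x \<le> B" using compact_imp_bounded[OF assms(1)] unfolding bounded_iff by blast
 then have "\<forall>y. norm y > B \<longrightarrow> \<phi> y = 0"
  using assms(2) by (meson linorder_not_less)
 then show ?thesis by blast
qed

lemma lint_support:
 fixes u \<psi> :: "cfun"
 assumes "Z \<in> sets lebesgue" "K \<subseteq> Z" "\<And>x. x \<notin> K \<Longrightarrow> \<psi> x = 0"
 shows "(LINT x|mu Z. u x * \<psi> x) = (LINT x|lebesgue. indicator K x *\<^sub>R u x * \<psi> x)"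
  "integrable (mu Z) (\<lambda>x. u x * \<psi> x) \<longleftrightarrow> integrable lebesgue (\<lambda>x. indicator K x *\<^sub>R u x * \<psi> x)"
proof -
 have *: "indicator Z x *\<^sub>R (u x * \<psi> x) = indicator K x *\<^sub>R u x * \<psi> x" for x
  using assms by (auto simp: indicator_def)
 show "(LINT x|mu Z. u x * \<psi> x) = (LINT x|lebesgue. indicator K x *\<^sub>R u x * \<psi> x)"
  using assms(1) by (subst integral_restrict_space) (auto simp: *)
 show "integrable (mu Z) (\<lambda>x. u x * \<psi> x) \<longleftrightarrow> integrable lebesgue (\<lambda>x. indicator K x *\<^sub>R u x * \<psi> x)"
  using assms(1) by (subst integrable_restrict_space) (auto simp: *)
qed

lemma lint_bound:
 fixes u \<psi> :: "cfun"
 assumes "Z \<in> sets lebesgue" "K \<subseteq> Z" "\<And>x. x \<notin> K \<Longrightarrow> \<psi> x = 0"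
  and u: "u absolutely_integrable_on K" and \<psi>: "\<psi> \<in> bm" "\<And>x. norm (\<psi> x) \<le> C"
 shows "integrable (mu Z) (\<lambda>x. u x * \<psi> x)"
  "norm (LINT x|mu Z. u x * \<psi> x) \<le> C * (LINT x|lebesgue. norm (indicator K x *\<^sub>R u x))"
proof -
 have ui: "integrable lebesgue (\<lambda>x. indicator K x *\<^sub>R u x)" using u by (simp add: set_integrable_def)
 have [measurable]: "\<psi> \<in> borel_measurable lebesgue"
  using \<psi>(1) by (simp add: measurable_completion)
 have "C \<ge> 0" using \<psi>(2)[of 0] norm_ge_zero[of "\<psi> 0"] by linarith
 have b: "norm (indicator K x *\<^sub>R u x * \<psi> x) \<le> C * norm (indicator K x *\<^sub>R u x)" for x
  using mult_right_mono[OF \<psi>(2)[of x], of "norm (indicator K x *\<^sub>R u x)"] by (simp add: norm_mult mult_ac)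
 have ib: "integrable lebesgue (\<lambda>x. C * norm (indicator K x *\<^sub>R u x))"
  by (intro integrable_mult_right integrable_norm ui)
 have i: "integrable lebesgue (\<lambda>x. indicator K x *\<^sub>R u x * \<psi> x)"
  by (rule Bochner_Integration.integrable_bound[OF ib])
    (use b \<open>C \<ge> 0\<close> in \<open>auto simp: abs_mult intro!: borel_measurable_times borel_measurable_integrable[OF ui] simp del: scaleR_conv_of_real mult_scaleR_left\<close>)
 then show "integrable (mu Z) (\<lambda>x. u x * \<psi> x)"
  by (subst lint_support(2)[OF assms(1,2)]) (use assms(3) in auto)
 have "norm (LINT x|lebesgue. indicator K x *\<^sub>R u x * \<psi> x) \<le> (LINT x|lebesgue. norm (indicator K x *\<^sub>R u x * \<psi> x))"
  by (rule integral_norm_bound)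
 also have "... \<le> (LINT x|lebesgue. C * norm (indicator K x *\<^sub>R u x))"
  by (rule integral_mono[OF integrable_norm[OF i] ib b])
 finally show "norm (LINT x|mu Z. u x * \<psi> x) \<le> C * (LINT x|lebesgue. norm (indicator K x *\<^sub>R u x))"
  by (subst lint_support(1)[OF assms(1,2)]) (use assms(3) in auto)
qed

lemma lint_uniform_limit:
 fixes u \<psi> :: "cfun"
 assumes "Z \<in> sets lebesgue" "K \<subseteq> Z" "\<And>x. x \<notin> K \<Longrightarrow> \<psi> x = 0" "\<And>n x. x \<notin> K \<Longrightarrow> \<psi>n n x = 0"
  and u: "u absolutely_integrable_on K" and \<psi>: "continuous_on UNIV \<psi>" "\<And>n. continuous_on UNIV (\<psi>n n)"
  and K: "compact K"
  and lim: "\<And>e. e > 0 \<Longrightarrow> \<exists>N. \<forall>n\<ge>N. \<forall>x. norm (\<psi>n n x - \<psi> x) \<le> e"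
 shows "(\<lambda>n. LINT x|mu Z. u x * \<psi>n n x) \<longlonglongrightarrow> (LINT x|mu Z. u x * \<psi> x)"
proof -
 define A where "A = (LINT x|lebesgue. norm (indicator K x *\<^sub>R u x))"
 have "A \<ge> 0" by (simp add: A_def)
 have int: "integrable (mu Z) (\<lambda>x. u x * f x)" if f: "continuous_on UNIV f" "\<And>x. x \<notin> K \<Longrightarrow> f x = 0" for f
 proof -
  have "bounded (f ` K)"
   by (intro compact_imp_bounded compact_continuous_image K continuous_on_subset[OF f(1)]) auto
  then obtain C where C: "\<And>x. x \<in> K \<Longrightarrow> norm (f x) \<le> C" unfolding bounded_iff by blast
  have "norm (f x) \<le> max C 0" for x using C[of x] f(2)[of x] by (cases "x \<in> K") auto
  then show ?thesis
   using lint_bound(1)[of Z K f, OF assms(1,2) f(2) u continuous_bm[OF f(1)]] by blast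
 qed
 show ?thesis
 proof (rule metric_LIMSEQ_I)
  fix e :: real assume "e > 0"
  define e' where "e' = e / (A + 1)"
  have "e' > 0" using \<open>e > 0\<close> \<open>A \<ge> 0\<close> by (simp add: e'_def)
  obtain N where N: "\<And>n x. n \<ge> N \<Longrightarrow> norm (\<psi>n n x - \<psi> x) \<le> e'" using lim[OF \<open>e' > 0\<close>] by blast
  show "\<exists>N. \<forall>n\<ge>N. dist (LINT x|mu Z. u x * \<psi>n n x) (LINT x|mu Z. u x * \<psi> x) < e"
  proof (intro exI allI impI)
   fix n assume "n \<ge> N"
   have "dist (LINT x|mu Z. u x * \<psi>n n x) (LINT x|mu Z. u x * \<psi> x)
    = norm (LINT x|mu Z. u x * (\<psi>n n x - \<psi> x))"
    unfolding dist_norm right_diff_distrib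
    by (subst Bochner_Integration.integral_diff[symmetric]) (auto intro!: int assms)
   also have "... \<le> e' * A"
    unfolding A_def
    by (rule lint_bound(2)[OF assms(1,2) _ u])
      (use assms N[OF \<open>n \<ge> N\<close>] in \<open>auto intro!: continuous_bm continuous_intros\<close>)
   also have "... < e' * (A + 1)" using \<open>e' > 0\<close> by simp
   also have "... = e" using \<open>A \<ge> 0\<close> by (simp add: e'_def)
   finally show "dist (LINT x|mu Z. u x * \<psi>n n x) (LINT x|mu Z. u x * \<psi> x) < e" .
  qed
 qed
qed

lemma compact_neighbourhood:
 fixes K Z :: "complex set"
 assumes "compact K" "K \<subseteq> Z" "open Z"
 obtains d K' where "d > 0" "compact K'" "K' \<subseteq> Z" "K \<subseteq> K'" "\<And>x y. x \<in> K \<Longrightarrow> norm (y - x) \<le> d \<Longrightarrow> y \<in> K'"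
proof -
 obtain d where d: "d > 0" "(\<Union>x\<in>K. cball x d) \<subseteq> Z"
  using compact_subset_open_imp_cball_epsilon_subset[OF assms(1,3,2)] by blast
 have eq: "(\<Union>x\<in>K. cball x d) = {x + y |x y. x \<in> K \<and> y \<in> cball 0 d}"
 proof (intro set_eqI iffI)
  fix z assume "z \<in> (\<Union>x\<in>K. cball x d)"
  then obtain x where "x \<in> K" "dist x z \<le> d" by auto
  then show "z \<in> {x + y |x y. x \<in> K \<and> y \<in> cball 0 d}"
   by (intro CollectI exI[of _ x] exI[of _ "z - x"]) (auto simp: dist_norm norm_minus_commute)
 next
  fix z assume "z \<in> {x + y |x y. x \<in> K \<and> y \<in> cball 0 d}"
  then obtain x y where "x \<in> K" "y \<in> cball 0 d" "z = x + y" by blast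
  then show "z \<in> (\<Union>x\<in>K. cball x d)" by (auto simp: dist_norm intro!: bexI[of _ x])
 qed
 have "compact (\<Union>x\<in>K. cball x d)" unfolding eq by (intro compact_sums assms compact_cball)
 moreover have "K \<subseteq> (\<Union>x\<in>K. cball x d)" using d(1) by (force simp: less_imp_le)
 moreover have "y \<in> (\<Union>x\<in>K. cball x d)" if "x \<in> K" "norm (y - x) \<le> d" for x y
  using that by (auto simp: dist_norm norm_minus_commute)
 ultimately show thesis using that[OF d(1) _ d(2)] by blast
qed

lemma moll_sequence:
 fixes K Z :: "complex set"
 assumes "compact K" "K \<subseteq> Z" "open Z"
 shows "\<exists>s K'. compact K' \<and> K' \<subseteq> Z \<and> K \<subseteq> K' \<and> (\<forall>n::nat. s n > (0::real)) \<and>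
  (\<forall>\<phi>. continuous_on UNIV \<phi> \<longrightarrow> (\<forall>x. x \<notin> K \<longrightarrow> \<phi> x = 0) \<longrightarrow>
   (\<forall>n x. x \<notin> K' \<longrightarrow> moll (s n) \<phi> x = 0) \<and>
   (\<forall>e>0. \<exists>N. \<forall>n\<ge>N. \<forall>x. norm (moll (s n) \<phi> x - \<phi> x) \<le> e))"
proof -
 obtain d K' where dK: "d > 0" "compact K'" "K' \<subseteq> Z" "K \<subseteq> K'"
   "\<And>x y. x \<in> K \<Longrightarrow> norm (y - x) \<le> d \<Longrightarrow> y \<in> K'"
  using compact_neighbourhood[OF assms] by blast
 define s where "s n = d / (real n + 1)" for n
 have s: "s n > 0" "s n \<le> d" for n using dK(1) by (auto simp: s_def field_simps)
 have supp: "moll (s n) \<phi> x = 0" if \<phi>: "continuous_on UNIV \<phi>" "\<And>x. x \<notin> K \<Longrightarrow> \<phi> x = 0" "x \<notin> K'" for \<phi> n x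
 proof -
  have "\<exists>B. \<forall>y. norm y > B \<longrightarrow> \<phi> y = 0"
  by (rule compact_bound[OF assms(1)]) (rule \<phi>(2))
 then obtain B where B: "\<And>y. norm y > B \<Longrightarrow> \<phi> y = 0" by blast
  show ?thesis
  proof (rule moll_supp[OF \<phi>(1) B s(1)])
   fix y assume "\<phi> y \<noteq> 0"
   then have "y \<in> K" using \<phi>(2) by blast
   then show "s n < norm (x - y)" using dK(5)[of y x] s(2)[of n] \<phi>(3) by force
  qed
 qed
 have lim: "\<exists>N. \<forall>n\<ge>N. \<forall>x. norm (moll (s n) \<phi> x - \<phi> x) \<le> e"
  if \<phi>: "continuous_on UNIV \<phi>" "\<And>x. x \<notin> K \<Longrightarrow> \<phi> x = 0" "e > 0" for \<phi> e
 proof -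
  have "\<exists>B. \<forall>y. norm y > B \<longrightarrow> \<phi> y = 0"
  by (rule compact_bound[OF assms(1)]) (rule \<phi>(2))
 then obtain B where B: "\<And>y. norm y > B \<Longrightarrow> \<phi> y = 0" by blast
  obtain r where r: "r > 0" "\<And>x y. norm (x - y) \<le> r \<Longrightarrow> norm (\<phi> x - \<phi> y) \<le> e"
   using uniformly_continuous_compact_support[OF \<phi>(1) B \<phi>(3)] by blast
  obtain N :: nat where N: "d / r < N" using reals_Archimedean2 by blast
  have "norm (moll (s n) \<phi> x - \<phi> x) \<le> e" if "n \<ge> N" for n x
  proof (rule moll_approx[OF \<phi>(1) B s(1)])
   fix x y :: complex assume "norm (x - y) \<le> s n"
   also have "s n \<le> r"
   proof -
    have "d / r < real n + 1" using N that by linarith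
    then have "d < (real n + 1) * r" using r(1) by (simp add: field_simps)
    then show ?thesis by (simp add: s_def field_simps)
   qed
   finally show "norm (\<phi> x - \<phi> y) \<le> e" by (rule r(2))
  qed
  then show ?thesis by blast
 qed
 show ?thesis using dK(2,3,4) s(1) supp lim by (intro exI[of _ s] exI[of _ K'] conjI allI impI) auto
qed

lemma locally_integrableD: "locally_integrable Z u \<Longrightarrow> compact K \<Longrightarrow> K \<subseteq> Z \<Longrightarrow> u absolutely_integrable_on K"
 by (simp add: locally_integrable_def)

lemma sets_lebesgue_open: "open Z \<Longrightarrow> (Z :: complex set) \<in> sets lebesgue"
 by auto

lemma weak_partial_C1c:
 assumes "open Z" and w: "has_weak_partial Z b u g" and "C1c Z \<phi>"
 shows "(LINT x|mu Z. u x * der \<phi> x b) = - (LINT x|mu Z. g x * \<phi> x)"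
proof -
 obtain K where K: "compact K" "K \<subseteq> Z" "\<And>x. x \<notin> K \<Longrightarrow> \<phi> x = 0" and C1: "Ck 1 \<phi>"
  using assms(3) unfolding C1c_def by blast
 have "\<exists>B. \<forall>y. norm y > B \<longrightarrow> \<phi> y = 0"
  by (rule compact_bound[OF K(1)]) (rule K(3))
 then obtain B where B: "\<And>y. norm y > B \<Longrightarrow> \<phi> y = 0" by blast
 obtain s K' where s: "compact K'" "K' \<subseteq> Z" "K \<subseteq> K'" "\<And>n::nat. s n > (0::real)"
  and s': "\<forall>\<phi>. continuous_on UNIV \<phi> \<longrightarrow> (\<forall>x. x \<notin> K \<longrightarrow> \<phi> x = 0) \<longrightarrow>
   (\<forall>n x. x \<notin> K' \<longrightarrow> moll (s n) \<phi> x = 0) \<and>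
   (\<forall>e>0. \<exists>N. \<forall>n\<ge>N. \<forall>x. norm (moll (s n) \<phi> x - \<phi> x) \<le> e)"
  using moll_sequence[OF K(1,2) assms(1)] by (elim exE conjE) blast
 have s5: "moll (s n) \<phi> x = 0" if "continuous_on UNIV \<phi>" "\<And>x. x \<notin> K \<Longrightarrow> \<phi> x = 0" "x \<notin> K'" for \<phi> n x
  using s'[rule_format, OF that(1)] that(2,3) by simp
 have s6: "\<exists>N. \<forall>n\<ge>N. \<forall>x. norm (moll (s n) \<phi> x - \<phi> x) \<le> e"
  if "continuous_on UNIV \<phi>" "\<And>x. x \<notin> K \<Longrightarrow> \<phi> x = 0" "e > 0" for \<phi> e
  using s'[rule_format, OF that(1)] that(2,3) by simp
 let ?D = "\<lambda>x. der \<phi> x b"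
 note c = Ck_continuous[OF C1]
 have "?D x = Re b *\<^sub>R der \<phi> x 1 + Im b *\<^sub>R der \<phi> x \<i>" for x
  by (rule frechet_complex[OF Ck_1D(1)[OF C1]])
 moreover have "continuous_on UNIV (\<lambda>x. Re b *\<^sub>R der \<phi> x 1 + Im b *\<^sub>R der \<phi> x \<i>)"
  by (intro continuous_intros Ck_1D[OF C1])
 ultimately have Dc: "continuous_on UNIV ?D" by presburger
 have Ds: "?D x = 0" if "x \<notin> K" for x
 proof -
  have "((\<lambda>_. 0) has_derivative (\<lambda>_. 0)) (at x)" by simp
  then have "(\<phi> has_derivative (\<lambda>_. 0)) (at x)"
   by (rule has_derivative_transform_within_open[where s="- K"])
     (use K that compact_imp_closed in auto)
  then show ?thesis using frechet_derivative_at by metis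
 qed
 have DB: "?D y = 0" if "norm y > B" for y by (rule frechet_derivative_support[OF B that])
 have tf: "test_function Z (moll (s n) \<phi>)" for n
  by (rule test_functionI[OF Ck_moll[OF c B s(4)] s(1,2) s5[OF c K(3)]])
 have li: "u absolutely_integrable_on K'" "g absolutely_integrable_on K'"
  using w s(1,2) unfolding has_weak_partial_def by (auto intro: locally_integrableD)
 have eq: "(LINT x|mu Z. u x * moll (s n) ?D x) = - (LINT x|mu Z. g x * moll (s n) \<phi> x)" for n
 proof -
  have "(LINT x|mu Z. u x * der (moll (s n) \<phi>) x b) = - (LINT x|mu Z. g x * moll (s n) \<phi> x)"
   using w tf[of n] unfolding has_weak_partial_def by simp
  then show ?thesis by (simp only: moll_derivative[OF C1 B s(4)])
 qed
 have "(\<lambda>n. LINT x|mu Z. u x * moll (s n) ?D x) \<longlonglongrightarrow> (LINT x|mu Z. u x * ?D x)"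
  by (rule lint_uniform_limit[OF _ s(2) _ s5[OF Dc Ds] li(1) Dc Ck_continuous[OF Ck_moll[OF Dc DB s(4)]] s(1) s6[OF Dc Ds]])
    (use assms(1) s(3) Ds in auto)
 moreover have "(\<lambda>n. LINT x|mu Z. g x * moll (s n) \<phi> x) \<longlonglongrightarrow> (LINT x|mu Z. g x * \<phi> x)"
  by (rule lint_uniform_limit[OF _ s(2) _ s5[OF c K(3)] li(2) c Ck_continuous[OF Ck_moll[OF c B s(4)]] s(1) s6[OF c K(3)]])
    (use assms(1) s(3) K in auto)
 ultimately show ?thesis
  unfolding eq using LIMSEQ_unique tendsto_minus by blast
qed

lemma fundamental_continuous:
 assumes "open Z" and li: "locally_integrable Z g"
  and t: "\<And>\<phi>. test_function Z \<phi> \<Longrightarrow> (LINT x|mu Z. g x * \<phi> x) = 0"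
  and K: "compact K" "K \<subseteq> Z" "\<And>x. x \<notin> K \<Longrightarrow> \<phi> x = 0" and c: "continuous_on UNIV \<phi>"
 shows "(LINT x|mu Z. g x * \<phi> x) = 0"
proof -
 have "\<exists>B. \<forall>y. norm y > B \<longrightarrow> \<phi> y = 0"
  by (rule compact_bound[OF K(1)]) (rule K(3))
 then obtain B where B: "\<And>y. norm y > B \<Longrightarrow> \<phi> y = 0" by blast
 obtain s K' where s: "compact K'" "K' \<subseteq> Z" "K \<subseteq> K'" "\<And>n::nat. s n > (0::real)"
  and s': "\<forall>\<phi>. continuous_on UNIV \<phi> \<longrightarrow> (\<forall>x. x \<notin> K \<longrightarrow> \<phi> x = 0) \<longrightarrow>
   (\<forall>n x. x \<notin> K' \<longrightarrow> moll (s n) \<phi> x = 0) \<and>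
   (\<forall>e>0. \<exists>N. \<forall>n\<ge>N. \<forall>x. norm (moll (s n) \<phi> x - \<phi> x) \<le> e)"
  using moll_sequence[OF K(1,2) assms(1)] by (elim exE conjE) blast
 have s5: "moll (s n) \<phi> x = 0" if "continuous_on UNIV \<phi>" "\<And>x. x \<notin> K \<Longrightarrow> \<phi> x = 0" "x \<notin> K'" for \<phi> n x
  using s'[rule_format, OF that(1)] that(2,3) by simp
 have s6: "\<exists>N. \<forall>n\<ge>N. \<forall>x. norm (moll (s n) \<phi> x - \<phi> x) \<le> e"
  if "continuous_on UNIV \<phi>" "\<And>x. x \<notin> K \<Longrightarrow> \<phi> x = 0" "e > 0" for \<phi> e
  using s'[rule_format, OF that(1)] that(2,3) by simp
 have tf: "test_function Z (moll (s n) \<phi>)" for n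
  by (rule test_functionI[OF Ck_moll[OF c B s(4)] s(1,2) s5[OF c K(3)]])
 have "(\<lambda>n. LINT x|mu Z. g x * moll (s n) \<phi> x) \<longlonglongrightarrow> (LINT x|mu Z. g x * \<phi> x)"
  by (rule lint_uniform_limit[OF _ s(2) _ s5[OF c K(3)] locally_integrableD[OF li s(1,2)] c Ck_continuous[OF Ck_moll[OF c B s(4)]] s(1) s6[OF c K(3)]])
    (use assms(1) s(3) K in auto)
 then show ?thesis using t[OF tf] by (simp add: LIMSEQ_const_iff)
qed

lemma fundamental_compact:
 assumes "open Z" and li: "locally_integrable Z g"
  and t: "\<And>\<phi>. test_function Z \<phi> \<Longrightarrow> (LINT x|mu Z. g x * \<phi> x) = 0"
  and K: "compact K" "K \<subseteq> Z"
 shows "(LINT x|lebesgue. indicator K x *\<^sub>R g x) = 0"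
proof (cases "K = {}")
 case False
 obtain d K' where d: "d > 0" "compact K'" "K' \<subseteq> Z" "K \<subseteq> K'" "\<And>x y. x \<in> K \<Longrightarrow> norm (y - x) \<le> d \<Longrightarrow> y \<in> K'"
  using compact_neighbourhood[OF K assms(1)] by blast
 define r where "r n = (real n + 1) / d" for n
 define \<psi> where "\<psi> n x = max 0 (1 - r n * infdist x K)" for n x
 have r: "r n \<ge> 1 / d" "r n > 0" for n using d(1) by (auto simp: r_def field_simps)
 have \<psi>c: "continuous_on UNIV (\<psi> n)" for n
  unfolding \<psi>_def by (intro continuous_intros)
 have \<psi>1: "\<bar>\<psi> n x\<bar> \<le> 1" for n x
  using r(2)[of n] infdist_nonneg[of x K] by (simp add: \<psi>_def)
 have \<psi>0: "\<psi> n x = 0" if "x \<notin> K'" for n x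
 proof -
  obtain a where a: "a \<in> K" "infdist x K = dist x a"
   using infdist_attains_inf[OF compact_imp_closed[OF K(1)] False] by metis
  then have "infdist x K > d" using d(5)[OF a(1), of x] that by (force simp: dist_norm)
  then have "r n * infdist x K \<ge> (1 / d) * d" using r[of n] d(1) by (intro mult_mono) auto
  then show ?thesis using d(1) by (simp add: \<psi>_def)
 qed
 have \<psi>K: "\<psi> n x = 1" if "x \<in> K" for n x using that by (simp add: \<psi>_def)
 have gK': "integrable lebesgue (\<lambda>x. indicator K' x *\<^sub>R g x)"
  using locally_integrableD[OF li d(2,3)] by (simp add: set_integrable_def)
 note gm = borel_measurable_integrable[OF gK']
 have z: "(LINT x|lebesgue. indicator K' x *\<^sub>R g x * of_real (\<psi> n x)) = 0" for n
 proof -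
  have "(LINT x|mu Z. g x * of_real (\<psi> n x)) = 0"
   by (rule fundamental_continuous[OF assms(1) li t d(2,3)]) (auto simp: \<psi>0 intro!: continuous_intros \<psi>c)
  then show ?thesis
   by (subst (asm) lint_support(1)[OF _ d(3)]) (use assms(1) \<psi>0 in auto)
 qed
 have "(\<lambda>n. LINT x|lebesgue. indicator K' x *\<^sub>R g x * of_real (\<psi> n x)) \<longlonglongrightarrow> (LINT x|lebesgue. indicator K x *\<^sub>R g x)"
 proof (rule integral_dominated_convergence[where w="\<lambda>x. norm (indicator K' x *\<^sub>R g x)"])
  show "integrable lebesgue (\<lambda>x. norm (indicator K' x *\<^sub>R g x))" by (intro integrable_norm gK')
  have [measurable]: "\<psi> n \<in> borel_measurable lebesgue" for n
   using continuous_bm[OF \<psi>c[of n]] by (simp add: measurable_completion)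
  note [measurable] = gm
  show "(\<lambda>x. indicator K' x *\<^sub>R g x * complex_of_real (\<psi> n x)) \<in> borel_measurable lebesgue" for n
   by measurable
  have Ks: "K \<in> sets lebesgue" using compact_imp_closed[OF K(1)] by auto
  then have "(\<lambda>x. indicator K x *\<^sub>R (indicator K' x *\<^sub>R g x)) \<in> borel_measurable lebesgue" by measurable
  also have "(\<lambda>x. indicator K x *\<^sub>R (indicator K' x *\<^sub>R g x)) = (\<lambda>x. indicator K x *\<^sub>R g x)"
   using d(4) by (intro ext) (auto simp: indicator_def)
  finally show "(\<lambda>x. indicator K x *\<^sub>R g x) \<in> borel_measurable lebesgue" .
  show "AE x in lebesgue. norm (indicator K' x *\<^sub>R g x * complex_of_real (\<psi> n x)) \<le> norm (indicator K' x *\<^sub>R g x)" for n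
   using \<psi>1[of n] by (intro AE_I2) (auto simp: norm_mult intro!: mult_left_mono mult_left_le)
  show "AE x in lebesgue. (\<lambda>n. indicator K' x *\<^sub>R g x * complex_of_real (\<psi> n x)) \<longlonglongrightarrow> indicator K x *\<^sub>R g x"
  proof (rule AE_I2)
   fix x
   show "(\<lambda>n. indicator K' x *\<^sub>R g x * complex_of_real (\<psi> n x)) \<longlonglongrightarrow> indicator K x *\<^sub>R g x"
   proof (cases "x \<in> K")
    case True
    then show ?thesis using d(4) by (auto simp: \<psi>K)
   next
    case False
    then have pos: "infdist x K > 0"
     using \<open>K \<noteq> {}\<close> compact_imp_closed[OF K(1)] in_closed_iff_infdist_zero[of K x] infdist_nonneg[of x K] by auto
    obtain N :: nat where N: "d / infdist x K < N" using reals_Archimedean2 by blast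
    have "\<psi> n x = 0" if "n \<ge> N" for n
    proof -
     have "d / infdist x K < real n + 1" using N that by linarith
     then have "r n * infdist x K \<ge> 1" using pos d(1) by (simp add: r_def field_simps)
     then show ?thesis by (simp add: \<psi>_def)
    qed
    then have "eventually (\<lambda>n. indicator K' x *\<^sub>R g x * complex_of_real (\<psi> n x) = indicator K x *\<^sub>R g x) sequentially"
     using False by (auto simp: eventually_sequentially)
    then show ?thesis by (rule tendsto_eventually)
   qed
  qed
 qed
 then show ?thesis unfolding z by (simp add: LIMSEQ_const_iff)
qed simp

lemma null_if_compact_integrals_zero:
 fixes h :: "complex \<Rightarrow> real"
 assumes C: "compact C" and h: "integrable lebesgue (\<lambda>x. indicator C x *\<^sub>R h x)"
  and z: "\<And>K. compact K \<Longrightarrow> K \<subseteq> C \<Longrightarrow> (LINT x|lebesgue. indicator K x *\<^sub>R h x) = 0"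
 shows "AE x in lebesgue. x \<in> C \<longrightarrow> h x \<le> 0"
proof -
 note [measurable] = borel_measurable_integrable[OF h]
 define E where "E = {x. 0 < indicator C x *\<^sub>R h x}"
 have E: "E \<in> sets lebesgue"
 proof -
  have "{x \<in> space lebesgue. 0 < indicator C x *\<^sub>R h x} \<in> sets lebesgue" by measurable
  then show ?thesis by (simp add: E_def)
 qed
 have Epos: "x \<in> C \<and> 0 < h x" if "x \<in> E" for x
  using that by (cases "x \<in> C") (auto simp: E_def)
 then have EC: "E \<subseteq> C" by blast
 have "emeasure lebesgue E \<le> ennreal e" if "e > 0" for e
 proof -
  obtain K where K: "closed K" "K \<subseteq> E" "E - K \<in> lmeasurable" "emeasure lebesgue (E - K) < ennreal e"
   using sets_lebesgue_inner_closed[OF E \<open>e > 0\<close>] by blast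
  have cK: "compact K" using K(1,2) EC C using compact_Int_closed[OF C K(1)] by (simp add: inf.absorb2)
  have Ks: "K \<in> sets lebesgue" using K(1) by auto
  have eq: "(\<lambda>x. indicator K x *\<^sub>R (indicator C x *\<^sub>R h x)) = (\<lambda>x. indicator K x *\<^sub>R h x)"
   using K(2) EC by (intro ext) (auto simp: indicator_def)
  have i: "integrable lebesgue (\<lambda>x. indicator K x *\<^sub>R h x)"
   using integrable_mult_indicator[OF Ks h] unfolding eq .
  have "AE x in lebesgue. indicator K x *\<^sub>R h x = 0"
  proof (subst integral_nonneg_eq_0_iff_AE[OF i, symmetric])
   show "AE x in lebesgue. 0 \<le> indicator K x *\<^sub>R h x"
    using K(2) Epos by (intro AE_I2) (auto simp: indicator_def less_imp_le subset_iff)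
   show "(LINT x|lebesgue. indicator K x *\<^sub>R h x) = 0" by (rule z[OF cK]) (use K(2) EC in auto)
  qed
  then have "AE x in lebesgue. x \<notin> K"
   by eventually_elim (use K(2) Epos in \<open>force simp: indicator_def\<close>)
  then have "emeasure lebesgue K = 0"
   by (subst (asm) AE_iff_measurable[OF Ks]) auto
  moreover have "emeasure lebesgue E \<le> emeasure lebesgue K + emeasure lebesgue (E - K)"
   using emeasure_subadditive[OF Ks, of "E - K"] K E Ks by (simp add: Un_absorb1)
  ultimately show ?thesis using K(4) by simp
 qed
 then have "emeasure lebesgue E = 0"
  by (metis ennreal_le_epsilon add.left_neutral le_zero_eq)
 then have "AE x in lebesgue. x \<notin> E"
  using E by (intro AE_not_in) (auto simp: null_sets_def)
 then show ?thesis by eventually_elim (auto simp: E_def indicator_def split: if_splits)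
qed

theorem fundamental_lemma:
 assumes "open Z" and li: "locally_integrable Z g"
  and t: "\<And>\<phi>. test_function Z \<phi> \<Longrightarrow> (LINT x|mu Z. g x * \<phi> x) = 0"
 shows "AE x in mu Z. g x = 0"
proof -
 have *: "AE x in lebesgue. x \<in> C \<longrightarrow> g x = 0" if C: "compact C" "C \<subseteq> Z" for C
 proof -
  have i: "integrable lebesgue (\<lambda>x. indicator K x *\<^sub>R g x)" if "compact K" "K \<subseteq> C" for K
   using locally_integrableD[OF li, of K] that C by (auto simp: set_integrable_def)
  have z: "(LINT x|lebesgue. indicator K x *\<^sub>R g x) = 0" if "compact K" "K \<subseteq> C" for K
   by (rule fundamental_compact[OF assms that(1)]) (use that C in auto)
  have g1: "AE x in lebesgue. x \<in> C \<longrightarrow> L (g x) \<le> 0" if L: "bounded_linear L" for L :: "complex \<Rightarrow> real"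
  proof (rule null_if_compact_integrals_zero[OF C(1)])
   have eq: "L (indicator K x *\<^sub>R g x) = indicator K x *\<^sub>R L (g x)" for K x
    by (rule linear_scale[OF bounded_linear.linear[OF L]])
   show "integrable lebesgue (\<lambda>x. indicator C x *\<^sub>R L (g x))"
    using integrable_bounded_linear[OF L i[OF C(1)]] unfolding eq by simp
   show "(LINT x|lebesgue. indicator K x *\<^sub>R L (g x)) = 0" if "compact K" "K \<subseteq> C" for K
    using integral_bounded_linear[OF L i[OF that]] z[OF that] linear_0[OF bounded_linear.linear[OF L]]
    unfolding eq by simp
  qed
  have "AE x in lebesgue. (x \<in> C \<longrightarrow> Re (g x) \<le> 0) \<and> (x \<in> C \<longrightarrow> - Re (g x) \<le> 0)
    \<and> (x \<in> C \<longrightarrow> Im (g x) \<le> 0) \<and> (x \<in> C \<longrightarrow> - Im (g x) \<le> 0)"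
   by (intro AE_conjI g1[of Re] g1[of "\<lambda>x. - Re x"] g1[of Im] g1[of "\<lambda>x. - Im x"]
     bounded_linear_Re bounded_linear_Im bounded_linear_minus)
  then show ?thesis by eventually_elim (auto simp: complex_eq_iff)
 qed
 obtain C where C: "\<And>n::nat. compact (C n)" "\<And>n. C n \<subseteq> Z" "\<Union> (range C) = Z"
  using open_Union_compact_subsets[OF assms(1)] by metis
 have "AE x in lebesgue. \<forall>n. x \<in> C n \<longrightarrow> g x = 0"
  unfolding AE_all_countable using * C by blast
 then have "AE x in lebesgue. x \<in> Z \<longrightarrow> g x = 0"
  by eventually_elim (use C(3) in blast)
 then show ?thesis
  using assms(1) by (subst AE_restrict_space_iff) auto
qed

lemma locally_integrable_diff:
 "locally_integrable Z u \<Longrightarrow> locally_integrable Z v \<Longrightarrow> locally_integrable Z (\<lambda>x. u x - v x)"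
 by (auto simp: locally_integrable_def intro: set_integral_diff)

lemma test_function_integrable:
 assumes "open Z" "locally_integrable Z u" "C1c Z \<phi>"
 shows "integrable (mu Z) (\<lambda>x. u x * \<phi> x)"
  "integrable (mu Z) (\<lambda>x. u x * der \<phi> x b)"
proof -
 obtain K where K: "compact K" "K \<subseteq> Z" "\<And>x. x \<notin> K \<Longrightarrow> \<phi> x = 0" and C1: "Ck 1 \<phi>"
  using assms(3) unfolding C1c_def by blast
 have *: "integrable (mu Z) (\<lambda>x. u x * f x)" if f: "continuous_on UNIV f" "\<And>x. x \<notin> K \<Longrightarrow> f x = 0" for f
 proof -
  have "bounded (f ` K)"
   by (intro compact_imp_bounded compact_continuous_image K continuous_on_subset[OF f(1)]) auto
  then obtain C where C: "\<And>x. x \<in> K \<Longrightarrow> norm (f x) \<le> C" unfolding bounded_iff by blast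
  have "norm (f x) \<le> max C 0" for x using C[of x] f(2)[of x] by (cases "x \<in> K") auto
  then show ?thesis
   using lint_bound(1)[of Z K f, OF _ K(2) f(2) locally_integrableD[OF assms(2) K(1,2)] continuous_bm[OF f(1)]]
    sets_lebesgue_open[OF assms(1)] by blast
 qed
 show "integrable (mu Z) (\<lambda>x. u x * \<phi> x)" by (rule *[OF Ck_continuous[OF C1] K(3)])
 have "der \<phi> x b = Re b *\<^sub>R der \<phi> x 1 + Im b *\<^sub>R der \<phi> x \<i>" for x
  by (rule frechet_complex[OF Ck_1D(1)[OF C1]])
 moreover have "continuous_on UNIV (\<lambda>x. Re b *\<^sub>R der \<phi> x 1 + Im b *\<^sub>R der \<phi> x \<i>)"
  by (intro continuous_intros Ck_1D[OF C1])
 ultimately have Dc: "continuous_on UNIV (\<lambda>x. der \<phi> x b)" by presburger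
 have Ds: "der \<phi> x b = 0" if "x \<notin> K" for x
 proof -
  have "((\<lambda>_. 0) has_derivative (\<lambda>_. 0)) (at x)" by simp
  then have "(\<phi> has_derivative (\<lambda>_. 0)) (at x)"
   by (rule has_derivative_transform_within_open[where s="- K"])
     (use K that compact_imp_closed in auto)
  then show ?thesis using frechet_derivative_at by metis
 qed
 show "integrable (mu Z) (\<lambda>x. u x * der \<phi> x b)"
  by (rule *[OF Dc Ds])
qed

lemma weak_partial_unique:
 assumes "open Z" "has_weak_partial Z b u g" "has_weak_partial Z b u h"
 shows "AE x in mu Z. g x = h x"
proof -
 have l: "locally_integrable Z g" "locally_integrable Z h" using assms(2,3) by (auto simp: has_weak_partial_def)
 have "AE x in mu Z. g x - h x = 0"
 proof (rule fundamental_lemma[OF assms(1) locally_integrable_diff[OF l]])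
  fix \<phi> assume t: "test_function Z \<phi>"
  note i = test_function_integrable(1)[OF assms(1) _ test_function_C1c[OF t]]
  have "(LINT x|mu Z. g x * \<phi> x) = (LINT x|mu Z. h x * \<phi> x)"
  proof -
   have "(LINT x|mu Z. u x * der \<phi> x b) = - (LINT x|mu Z. g x * \<phi> x)"
    "(LINT x|mu Z. u x * der \<phi> x b) = - (LINT x|mu Z. h x * \<phi> x)"
    using assms(2,3) t unfolding has_weak_partial_def by blast+
   then show ?thesis by simp
  qed
  then show "(LINT x|mu Z. (g x - h x) * \<phi> x) = 0"
   using i[OF l(1)] i[OF l(2)] by (simp add: left_diff_distrib)
 qed
 then show ?thesis by simp
qed

lemma Ck_1I:
 assumes "\<And>x. f differentiable (at x)" "continuous_on UNIV (\<lambda>x. der f x 1)"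
  "continuous_on UNIV (\<lambda>x. der f x \<i>)"
 shows "Ck 1 f"
 using assms by (simp add: Basis_complex_def)

definition C1on :: "complex set \<Rightarrow> cfun \<Rightarrow> bool" where
 "C1on Z f \<longleftrightarrow> (\<forall>x\<in>Z. f differentiable (at x)) \<and> continuous_on Z (\<lambda>x. der f x 1)
   \<and> continuous_on Z (\<lambda>x. der f x \<i>)"

lemma C1onI:
 assumes "open Z" "\<And>x. x \<in> Z \<Longrightarrow> (f has_derivative f' x) (at x)"
  "continuous_on Z (\<lambda>x. f' x 1)" "continuous_on Z (\<lambda>x. f' x \<i>)"
 shows "C1on Z f"
proof -
 have "der f x = f' x" if "x \<in> Z" for x
  using frechet_derivative_at[OF assms(2)[OF that]] by simp
 then show ?thesis using assms unfolding C1on_def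
  by (auto intro: differentiableI cong: continuous_on_cong)
qed

lemma C1onD:
 assumes "C1on Z f"
 shows "x \<in> Z \<Longrightarrow> (f has_derivative der f x) (at x)"
  "continuous_on Z (\<lambda>x. der f x 1)" "continuous_on Z (\<lambda>x. der f x \<i>)"
 using assms by (auto simp: C1on_def frechet_derivative_works[symmetric])

lemma C1on_continuous: "C1on Z f \<Longrightarrow> continuous_on Z f"
 unfolding C1on_def
 by (meson continuous_at_imp_continuous_on differentiable_imp_continuous_within)

lemma Ck_C1on: "Ck 1 f \<Longrightarrow> C1on Z f"
 unfolding C1on_def by (auto simp: Basis_complex_def intro: continuous_on_subset)

lemma C1on_mult:
 assumes "open Z" "C1on Z f" "C1on Z g" shows "C1on Z (\<lambda>x. f x * g x)"
 by (rule C1onI[OF assms(1) has_derivative_mult[OF C1onD(1)[OF assms(2)] C1onD(1)[OF assms(3)]]])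
   (assumption | intro continuous_intros C1onD(2,3)[OF assms(2)] C1onD(2,3)[OF assms(3)] C1on_continuous[OF assms(2)] C1on_continuous[OF assms(3)])+

lemma frechet_derivative_outside:
 fixes f :: "cfun"
 assumes "closed K" "\<And>x. x \<notin> K \<Longrightarrow> f x = 0" "x \<notin> K"
 shows "(f has_derivative (\<lambda>_. 0)) (at x)" "der f x h = 0"
proof -
 have "((\<lambda>_. 0) has_derivative (\<lambda>_. 0)) (at x)" by simp
 then show *: "(f has_derivative (\<lambda>_. 0)) (at x)"
  by (rule has_derivative_transform_within_open[where s="- K"]) (use assms in auto)
 show "der f x h = 0"
  using frechet_derivative_at[OF *] by metis
qed

lemma continuous_on_cover:
 fixes f :: "cfun"
 assumes "open Z" "continuous_on Z f" "closed K" "K \<subseteq> Z" "\<And>x. x \<notin> K \<Longrightarrow> f x = 0"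
 shows "continuous_on UNIV f"
proof -
 have "continuous_on (- K) (\<lambda>_. 0 :: complex)" by simp
 then have "continuous_on (- K) f" by (rule continuous_on_cong[THEN iffD2, rotated 2]) (use assms in auto)
 then have "continuous_on (Z \<union> - K) f"
  by (intro continuous_on_open_Un) (use assms in auto)
 moreover have "Z \<union> - K = UNIV" using assms(4) by blast
 ultimately show ?thesis by simp
qed

lemma C1_extend:
 assumes "open Z" "C1on Z f" "compact K" "K \<subseteq> Z" "\<And>x. x \<notin> K \<Longrightarrow> f x = 0"
 shows "Ck 1 f"
proof (rule Ck_1I)
 note cl = compact_imp_closed[OF assms(3)]
 show "f differentiable (at x)" for x
 proof (cases "x \<in> K")
  case True
  then show ?thesis using C1onD(1)[OF assms(2), of x] assms(4) by (auto intro: differentiableI)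
 next
  case False
  show ?thesis using frechet_derivative_outside(1)[of K f x] cl assms(5) False by (auto intro: differentiableI)
 qed
 show "continuous_on UNIV (\<lambda>x. der f x 1)"
  "continuous_on UNIV (\<lambda>x. der f x \<i>)"
  by (rule continuous_on_cover[OF assms(1) C1onD(2)[OF assms(2)] cl assms(4)];
    rule frechet_derivative_outside(2)[OF cl]; use assms(5) in blast)
    (rule continuous_on_cover[OF assms(1) C1onD(3)[OF assms(2)] cl assms(4)];
    rule frechet_derivative_outside(2)[OF cl]; use assms(5) in blast)
qed

lemma integrable_lebesgue_lborel:
 fixes f :: "complex \<Rightarrow> 'b::{banach, second_countable_topology}"
 assumes "integrable lborel f" shows "integrable lebesgue f"
 using integrable_completion[OF borel_measurable_integrable[OF assms]] assms by simp

lemma integrable_lebesgue_on_subset: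
 fixes f :: "complex \<Rightarrow> 'b::euclidean_space"
 assumes "Z \<in> sets lebesgue" "Z' \<in> sets lebesgue" "Z' \<subseteq> Z" "integrable (mu Z) f"
 shows "integrable (mu Z') f"
proof -
 have "integrable lebesgue (\<lambda>x. indicator Z x *\<^sub>R f x)"
  using assms by (simp add: integrable_restrict_space)
 from integrable_mult_indicator[OF assms(2) this]
 have "integrable lebesgue (\<lambda>x. indicator Z' x *\<^sub>R (indicator Z x *\<^sub>R f x))" .
 moreover have "(\<lambda>x. indicator Z' x *\<^sub>R (indicator Z x *\<^sub>R f x)) = (\<lambda>x. indicator Z' x *\<^sub>R f x)"
  using assms(3) by (intro ext) (auto simp: indicator_def)
 ultimately show ?thesis using assms(2) by (simp add: integrable_restrict_space)
qed

lemma l2_subset: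
 fixes f :: "complex \<Rightarrow> 'b::euclidean_space"
 assumes "Z \<in> sets lebesgue" "Z' \<in> sets lebesgue" "Z' \<subseteq> Z" "l2 (mu Z) f"
 shows "l2 (mu Z') f"
 unfolding l2_def
proof
 have "mu Z' = restrict_space (mu Z) Z'"
  using assms by (simp add: restrict_restrict_space inf.absorb2)
 then show "f \<in> borel_measurable (mu Z')"
  using l2_measurable[OF assms(4)] by (simp add: measurable_restrict_space1)
 show "integrable (mu Z') (\<lambda>x. (norm (f x))^2)"
  by (rule integrable_lebesgue_on_subset[OF assms(1-3) l2_integrable[OF assms(4)]])
qed

lemma integrable_lebesgue_on:
 fixes f :: "complex \<Rightarrow> 'b::euclidean_space"
 assumes "Z \<in> sets lebesgue" "integrable lebesgue f" shows "integrable (mu Z) f"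
 using integrable_mult_indicator[OF assms] assms(1) by (simp add: integrable_restrict_space)

lemma locally_integrable_continuous:
 assumes "continuous_on Z f" shows "locally_integrable Z f"
 unfolding locally_integrable_def
proof (intro allI impI)
 fix K assume K: "compact K \<and> K \<subseteq> Z"
 then have "integrable lborel (\<lambda>x. indicator K x *\<^sub>R f x)"
  by (intro borel_integrable_compact) (auto intro: continuous_on_subset[OF assms])
 then show "f absolutely_integrable_on K"
  unfolding set_integrable_def by (rule integrable_lebesgue_lborel)
qed

lemma locally_integrable_measurable:
 assumes "open Z" "locally_integrable Z u" shows "u \<in> borel_measurable (mu Z)"
proof -
 obtain C where C: "\<And>n::nat. compact (C n)" "\<And>n. C n \<subseteq> Z" "\<And>n. C n \<subseteq> interior (C (Suc n))" "\<Union> (range C) = Z"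
  using open_Union_compact_subsets[OF assms(1)] by metis
 have mono: "C m \<subseteq> C n" if "m \<le> n" for m n
  using that by (rule lift_Suc_mono_le[rotated]) (use C(3) interior_subset in blast)
 have "(\<lambda>x. indicator Z x *\<^sub>R u x) \<in> borel_measurable lebesgue"
 proof (rule borel_measurable_LIMSEQ_metric)
  show "(\<lambda>x. indicator (C n) x *\<^sub>R u x) \<in> borel_measurable lebesgue" for n
   using locally_integrableD[OF assms(2) C(1,2)] unfolding set_integrable_def by (rule borel_measurable_integrable)
  show "(\<lambda>n. indicator (C n) x *\<^sub>R u x) \<longlonglongrightarrow> indicator Z x *\<^sub>R u x" for x
  proof (rule tendsto_eventually)
   show "\<forall>\<^sub>F n in sequentially. indicator (C n) x *\<^sub>R u x = indicator Z x *\<^sub>R u x"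
   proof (cases "x \<in> Z")
    case True
    then obtain m where "x \<in> C m" using C(4) by blast
    then have "x \<in> C n" if "n \<ge> m" for n using mono[OF that] by blast
    then show ?thesis using True by (auto simp: eventually_sequentially intro!: exI[of _ m])
   next
    case False
    then have "x \<notin> C n" for n using C(2) by blast
    then show ?thesis using False by simp
   qed
  qed
 qed
 then show ?thesis using assms(1) by (subst borel_measurable_restrict_space_iff) auto
qed

lemma integral_lebesgue_on_borel:
 fixes F :: "cfun"
 assumes "Z \<in> sets lebesgue" "\<And>x. x \<notin> Z \<Longrightarrow> F x = 0" "F \<in> bm"
 shows "(LINT x|mu Z. F x) = (LINT x|lborel. F x)"
proof -
 have "(LINT x|mu Z. F x) = (LINT x|lebesgue. indicator Z x *\<^sub>R F x)"
  using assms(1) by (subst integral_restrict_space) auto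
 also have "... = (LINT x|lebesgue. F x)"
  by (rule arg_cong[where f="integral\<^sup>L lebesgue"]) (use assms(2) in \<open>force simp: indicator_def\<close>)
 also have "... = (LINT x|lborel. F x)" by (rule integral_completion) (use assms(3) in simp)
 finally show ?thesis .
qed

lemma classical_weak_partial:
 assumes "open Z" "C1on Z f" "b \<in> Basis"
 shows "has_weak_partial Z b f (\<lambda>x. der f x b)"
proof -
 have b: "b = 1 \<or> b = \<i>" using assms(3) by (auto simp: Basis_complex_def)
 have Dc: "continuous_on Z (\<lambda>x. der f x b)" using b C1onD[OF assms(2)] by auto
 have l: "locally_integrable Z f" "locally_integrable Z (\<lambda>x. der f x b)"
  by (intro locally_integrable_continuous C1on_continuous assms Dc)+
 have "(LINT x|mu Z. f x * der \<phi> x b) = - (LINT x|mu Z. der f x b * \<phi> x)"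
  if "test_function Z \<phi>" for \<phi>
 proof -
  have c: "C1c Z \<phi>" by (rule test_function_C1c[OF that])
  then obtain K where K: "compact K" "K \<subseteq> Z" "\<And>x. x \<notin> K \<Longrightarrow> \<phi> x = 0" and C1: "Ck 1 \<phi>"
   unfolding C1c_def by blast
  let ?F = "\<lambda>x. f x * \<phi> x"
  have F0: "?F x = 0" if "x \<notin> K" for x using K(3)[OF that] by simp
  have "\<exists>B. \<forall>y. norm y > B \<longrightarrow> ?F y = 0" by (rule compact_bound[OF K(1)]) (rule F0)
  then obtain B where B: "\<And>y. norm y > B \<Longrightarrow> ?F y = 0" by blast
  have F1: "Ck 1 ?F"
   by (rule C1_extend[OF assms(1) C1on_mult[OF assms(1,2) Ck_C1on[OF C1]] K(1,2) F0])
  have D: "der ?F x b = f x * der \<phi> x b + der f x b * \<phi> x"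
   if "x \<in> Z" for x
   using frechet_derivative_at[OF has_derivative_mult[OF C1onD(1)[OF assms(2) that] Ck_1D(1)[OF C1, of x]]] by metis
  have "(LINT x|mu Z. f x * der \<phi> x b) + (LINT x|mu Z. der f x b * \<phi> x)
   = (LINT x|mu Z. f x * der \<phi> x b + der f x b * \<phi> x)"
   by (rule Bochner_Integration.integral_add[symmetric])
     (intro test_function_integrable[OF assms(1) _ c] l)+
  also have "... = (LINT x|mu Z. der ?F x b)"
   by (rule Bochner_Integration.integral_cong) (auto simp: D)
  also have "... = (LINT x|lborel. der ?F x b)"
  proof (rule integral_lebesgue_on_borel)
   show "der ?F x b = 0" if "x \<notin> Z" for x
    by (rule frechet_derivative_outside(2)[OF compact_imp_closed[OF K(1)] F0]) (use that K in auto)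
   show "(\<lambda>x. der ?F x b) \<in> bm"
    using Ck_1D(2,3)[OF F1] b by (auto intro: continuous_bm)
  qed (use assms in auto)
  also have "... = 0" by (rule integral_derivative_zero[OF F1 B])
  finally show ?thesis by (simp add: eq_neg_iff_add_eq_0)
 qed
 then show ?thesis using l unfolding has_weak_partial_def by blast
qed

lemma locally_integrable_add:
 "locally_integrable Z u \<Longrightarrow> locally_integrable Z v \<Longrightarrow> locally_integrable Z (\<lambda>x. u x + v x)"
 by (auto simp: locally_integrable_def intro: set_integral_add)

lemma locally_integrable_cmult:
 "locally_integrable Z u \<Longrightarrow> locally_integrable Z (\<lambda>x. c * u x)"
 by (auto simp: locally_integrable_def)

lemma has_weak_partial_add:
 assumes "open Z" "has_weak_partial Z b u g" "has_weak_partial Z b v h"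
 shows "has_weak_partial Z b (\<lambda>x. u x + v x) (\<lambda>x. g x + h x)"
proof -
 have l: "locally_integrable Z u" "locally_integrable Z g" "locally_integrable Z v" "locally_integrable Z h"
  using assms by (auto simp: has_weak_partial_def)
 show ?thesis
  unfolding has_weak_partial_def
 proof (intro conjI allI impI locally_integrable_add l)
  fix \<phi> assume t: "test_function Z \<phi>"
  note i = test_function_integrable[OF assms(1) _ test_function_C1c[OF t]]
  show "(LINT x|mu Z. (u x + v x) * der \<phi> x b) = - (LINT x|mu Z. (g x + h x) * \<phi> x)"
   using assms(2,3) t unfolding has_weak_partial_def by (simp add: distrib_right i l)
 qed
qed

lemma has_weak_partial_cmult:
 assumes "has_weak_partial Z b u g"
 shows "has_weak_partial Z b (\<lambda>x. c * u x) (\<lambda>x. c * g x)"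
 using assms unfolding has_weak_partial_def
 by (auto simp: locally_integrable_cmult mult.assoc)

lemma has_weak_partial_cong:
 assumes "open Z" "has_weak_partial Z b u g" "locally_integrable Z u'" "locally_integrable Z g'"
  "AE x in mu Z. u x = u' x" "AE x in mu Z. g x = g' x"
 shows "has_weak_partial Z b u' g'"
 unfolding has_weak_partial_def
proof (intro conjI allI impI assms)
 fix \<phi> assume t: "test_function Z \<phi>"
 note i = test_function_integrable[OF assms(1) _ test_function_C1c[OF t], THEN borel_measurable_integrable]
 have l: "locally_integrable Z u" "locally_integrable Z g" using assms(2) by (auto simp: has_weak_partial_def)
 have "(LINT x|mu Z. u x * der \<phi> x b) = (LINT x|mu Z. u' x * der \<phi> x b)"
  by (intro integral_cong_AE i l assms) (use assms(5) in auto)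
 moreover have "(LINT x|mu Z. g x * \<phi> x) = (LINT x|mu Z. g' x * \<phi> x)"
  by (intro integral_cong_AE i l assms) (use assms(6) in auto)
 ultimately show "(LINT x|mu Z. u' x * der \<phi> x b) = - (LINT x|mu Z. g' x * \<phi> x)"
  using assms(2) t unfolding has_weak_partial_def by simp
qed

lemma locally_integrable_mono: "locally_integrable Z u \<Longrightarrow> Z' \<subseteq> Z \<Longrightarrow> locally_integrable Z' u"
 unfolding locally_integrable_def by blast

lemma has_weak_partial_mono:
 assumes "open Z" "open Z'" "Z' \<subseteq> Z" "has_weak_partial Z b u g"
 shows "has_weak_partial Z' b u g"
 unfolding has_weak_partial_def
proof (intro conjI allI impI)
 fix \<phi> assume t: "test_function Z' \<phi>"
 then obtain K where K: "compact K" "K \<subseteq> Z'" "\<And>x. x \<notin> K \<Longrightarrow> \<phi> x = 0"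
  using test_function_C1c[OF t] unfolding C1c_def by blast
 have z: "der \<phi> x b = 0" if "x \<notin> K" for x
  by (rule frechet_derivative_outside(2)[OF compact_imp_closed[OF K(1)] K(3) that])
 have K': "K \<subseteq> Z" using K(2) assms(3) by blast
 have 1: "(LINT x|mu Z. u x * der \<phi> x b) = (LINT x|mu Z'. u x * der \<phi> x b)"
  using lint_support(1)[of Z K "\<lambda>x. der \<phi> x b" u]
   lint_support(1)[of Z' K "\<lambda>x. der \<phi> x b" u] assms(1,2) z K(2) K' by auto
 have 2: "(LINT x|mu Z. g x * \<phi> x) = (LINT x|mu Z'. g x * \<phi> x)"
  using lint_support(1)[of Z K \<phi> g] lint_support(1)[of Z' K \<phi> g] assms(1,2) K K' by auto
 show "(LINT x|mu Z'. u x * der \<phi> x b) = - (LINT x|mu Z'. g x * \<phi> x)"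
  using assms(4) test_function_mono[OF t assms(3)] 1 2 unfolding has_weak_partial_def by simp
qed (use assms locally_integrable_mono in \<open>auto simp: has_weak_partial_def\<close>)

section \<open>The space of square integrable functions with square integrable gradient\<close>

lemma l2_locally_integrable:
 assumes "open Z" "l2 (mu Z) u" shows "locally_integrable Z u"
 unfolding locally_integrable_def set_integrable_def
proof (intro allI impI)
 fix K assume K: "compact K \<and> K \<subseteq> Z"
 have Z: "Z \<in> sets lebesgue" using assms(1) by auto
 have Ks: "K \<in> sets lebesgue" "K \<in> lmeasurable" using K lmeasurable_compact by (auto intro: fmeasurableD)
 have m: "(\<lambda>x. indicator Z x *\<^sub>R u x) \<in> borel_measurable lebesgue"
  using l2_measurable[OF assms(2)] Z by (simp add: borel_measurable_restrict_space_iff)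
 have "integrable lebesgue (\<lambda>x. indicator Z x *\<^sub>R (norm (u x))^2)"
  using l2_integrable[OF assms(2)] Z by (simp add: integrable_restrict_space)
 moreover have "integrable lebesgue (indicator K :: _ \<Rightarrow> real)" 
  using Ks(2) by (intro integrable_real_indicator) (auto simp: fmeasurable_def)
 ultimately have i: "integrable lebesgue (\<lambda>x. indicator Z x *\<^sub>R (norm (u x))^2 + indicator K x)" by simp
 have eq: "(\<lambda>x. indicator K x *\<^sub>R (indicator Z x *\<^sub>R u x)) = (\<lambda>x. indicator K x *\<^sub>R u x)"
  using K by (intro ext) (auto simp: indicator_def)
 have "(\<lambda>x. indicator K x *\<^sub>R (indicator Z x *\<^sub>R u x)) \<in> borel_measurable lebesgue"
  using m Ks by measurable
 then have m': "(\<lambda>x. indicator K x *\<^sub>R u x) \<in> borel_measurable lebesgue" unfolding eq .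
 show "integrable lebesgue (\<lambda>x. indicator K x *\<^sub>R u x)"
 proof (rule Bochner_Integration.integrable_bound[OF i m'], rule AE_I2)
  fix x
  have "norm (u x) \<le> (norm (u x))^2 + 1"
   using zero_le_power2[of "norm (u x) - 1/2"] by (simp add: power2_eq_square algebra_simps)
  then show "norm (indicator K x *\<^sub>R u x) \<le> norm (indicator Z x *\<^sub>R (norm (u x))^2 + indicator K x)"
   using K by (auto simp: indicator_def)
 qed
qed

lemma l2_C1c:
 assumes "C1c UNIV \<phi>" "Z \<in> sets lebesgue"
 shows "l2 (mu Z) \<phi>" "b \<in> Basis \<Longrightarrow> l2 (mu Z) (\<lambda>x. der \<phi> x b)"
proof -
 obtain K where K: "compact K" "\<And>x. x \<notin> K \<Longrightarrow> \<phi> x = 0" and C1: "Ck 1 \<phi>"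
  using assms(1) unfolding C1c_def by blast
 have "\<exists>B. \<forall>y. norm y > B \<longrightarrow> \<phi> y = 0" by (rule compact_bound[OF K(1)]) (rule K(2))
 then obtain B where B: "\<And>y. norm y > B \<Longrightarrow> \<phi> y = 0" by blast
 have *: "l2 (mu Z) f" if f: "continuous_on UNIV f" "\<And>y. norm y > B \<Longrightarrow> f y = 0" for f :: "cfun"
 proof -
  have "integrable lborel (\<lambda>x. (norm (f x))^2)"
   by (rule integrable_compact_support[where B=B]) (auto intro!: continuous_intros f simp: f)
  then have "integrable lebesgue (\<lambda>x. (norm (f x))^2)"
   by (rule integrable_lebesgue_lborel)
  then have "integrable (mu Z) (\<lambda>x. (norm (f x))^2)"
   by (rule integrable_lebesgue_on[OF assms(2)])
  moreover have "f \<in> borel_measurable (mu Z)"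
   using continuous_bm[OF f(1)] by (intro measurable_restrict_space1) (simp add: measurable_completion)
  ultimately show ?thesis by (simp add: l2_def)
 qed
 show "l2 (mu Z) \<phi>" by (rule *[OF Ck_continuous[OF C1] B])
 show "l2 (mu Z) (\<lambda>x. der \<phi> x b)" if "b \<in> Basis"
  by (rule *[OF _ frechet_derivative_support[OF B]]) (use that Ck_1D[OF C1] in \<open>auto simp: Basis_complex_def\<close>)
qed

definition jet :: "complex set \<Rightarrow> cfun \<Rightarrow> cfun \<Rightarrow> cfun \<Rightarrow> bool" where
 "jet Z u p q \<longleftrightarrow> l2 (mu Z) u \<and> l2 (mu Z) p \<and> l2 (mu Z) q \<and>
   has_weak_partial Z 1 u p \<and> has_weak_partial Z \<i> u q"

abbreviation jn :: "complex set \<Rightarrow> cfun \<Rightarrow> cfun \<Rightarrow> cfun \<Rightarrow> real" where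
 "jn Z u p q \<equiv> n2 (mu Z) (\<lambda>x. (p x, q x, u x))"

lemma norm_triple_power2: "(norm (a, b, c))^2 = (norm a)^2 + (norm b)^2 + (norm c)^2"
 by (simp add: norm_prod_def)

lemma l2_triple: "l2 M p \<Longrightarrow> l2 M q \<Longrightarrow> l2 M u \<Longrightarrow> l2 M (\<lambda>x. (p x, q x, u x))"
 unfolding l2_def norm_triple_power2 by auto

lemma L2_iff: "u \<in> L2 Z \<longleftrightarrow> l2 (mu Z) u"
 by (auto simp: L2_def l2_def)

lemma W12_iff: "u \<in> W12 Z \<longleftrightarrow> (\<exists>p q. jet Z u p q)"
 unfolding W12_def jet_def L2_iff[symmetric] Basis_complex_def by auto

lemma W12_l2: "u \<in> W12 Z \<Longrightarrow> l2 (mu Z) u"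
 by (auto simp: W12_iff jet_def)

lemma jet_W12: "jet Z u p q \<Longrightarrow> u \<in> W12 Z"
 by (auto simp: W12_iff)

lemma jet_l2: "jet Z u p q \<Longrightarrow> l2 (mu Z) (\<lambda>x. (p x, q x, u x))"
 by (auto simp: jet_def intro: l2_triple)

lemma jet_unique:
 assumes "open Z" "jet Z u p q" "jet Z u' p' q'" "AE x in mu Z. u x = u' x"
 shows "AE x in mu Z. p x = p' x" "AE x in mu Z. q x = q' x"
  "AE x in mu Z. (p x, q x, u x) = (p' x, q' x, u' x)"
proof -
 have l: "locally_integrable Z u'" "locally_integrable Z p" "locally_integrable Z q"
  using assms by (auto simp: jet_def intro: l2_locally_integrable)
 have "has_weak_partial Z 1 u' p" "has_weak_partial Z \<i> u' q"
  using assms(2) by (auto simp: jet_def intro!: has_weak_partial_cong[OF assms(1) _ l(1) _ assms(4)] l)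
 have w': "has_weak_partial Z 1 u' p'" "has_weak_partial Z \<i> u' q'"
  using assms(3) by (auto simp: jet_def)
 show a: "AE x in mu Z. p x = p' x" and b: "AE x in mu Z. q x = q' x"
  by (rule weak_partial_unique[OF assms(1) \<open>has_weak_partial Z 1 u' p\<close> w'(1)],
    rule weak_partial_unique[OF assms(1) \<open>has_weak_partial Z \<i> u' q\<close> w'(2)])
 show "AE x in mu Z. (p x, q x, u x) = (p' x, q' x, u' x)"
  using a b assms(4) by eventually_elim simp
qed

lemma W12_norm_jet:
 assumes "open Z" "jet Z u p q" shows "W12_norm Z u = jn Z u p q"
proof -
 have w: "has_weak_partial Z 1 u (weak_partial Z 1 u)" "has_weak_partial Z \<i> u (weak_partial Z \<i> u)"
  unfolding weak_partial_def using assms(2) someI[of "has_weak_partial Z 1 u" p] someI[of "has_weak_partial Z \<i> u" q]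
  by (auto simp: jet_def)
 have li: "locally_integrable Z (weak_partial Z b u)" if "b \<in> {1, \<i>}" for b
  using w that by (auto simp: has_weak_partial_def)
 have ae: "AE x in mu Z. p x = weak_partial Z 1 u x" "AE x in mu Z. q x = weak_partial Z \<i> u x"
  using assms w by (auto simp: jet_def intro: weak_partial_unique)
 have m: "weak_partial Z 1 u \<in> borel_measurable (mu Z)" "weak_partial Z \<i> u \<in> borel_measurable (mu Z)"
  by (intro locally_integrable_measurable assms li; simp)+
 have "W12_norm Z u = jn Z u (weak_partial Z 1 u) (weak_partial Z \<i> u)"
  by (simp add: W12_norm_def n2_def norm_triple_power2 Basis_complex_def)
 also have "... = jn Z u p q"
 proof (rule n2_cong_AE)
  show "(\<lambda>x. (p x, q x, u x)) \<in> borel_measurable (mu Z)"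
   using jet_l2[OF assms(2)] by (simp add: l2_def)
  show "(\<lambda>x. (weak_partial Z 1 u x, weak_partial Z \<i> u x, u x)) \<in> borel_measurable (mu Z)"
   using m assms(2) by (auto simp: jet_def l2_def)
  show "AE x in mu Z. (weak_partial Z 1 u x, weak_partial Z \<i> u x, u x) = (p x, q x, u x)"
   using ae by eventually_elim simp
 qed
 finally show ?thesis .
qed

lemma jet_add:
 "open Z \<Longrightarrow> jet Z u p q \<Longrightarrow> jet Z u' p' q' \<Longrightarrow> jet Z (\<lambda>x. u x + u' x) (\<lambda>x. p x + p' x) (\<lambda>x. q x + q' x)"
 by (auto simp: jet_def intro: l2_add has_weak_partial_add)

lemma jet_cmult:
 "jet Z u p q \<Longrightarrow> jet Z (\<lambda>x. c * u x) (\<lambda>x. c * p x) (\<lambda>x. c * q x)"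
 by (auto simp: jet_def intro: l2_cmult has_weak_partial_cmult)

lemma jet_diff:
 "open Z \<Longrightarrow> jet Z u p q \<Longrightarrow> jet Z u' p' q' \<Longrightarrow> jet Z (\<lambda>x. u x - u' x) (\<lambda>x. p x - p' x) (\<lambda>x. q x - q' x)"
 using jet_add[of Z u p q, OF _ _ jet_cmult[of Z u' p' q' "-1"]] by simp

lemma jet_mono:
 assumes "open Z" "open Z'" "Z' \<subseteq> Z" "jet Z u p q" shows "jet Z' u p q"
proof -
 have "l2 (mu Z') f" if "l2 (mu Z) f" for f :: "cfun"
  by (rule l2_subset[OF _ _ assms(3) that]) (use assms(1,2) in auto)
 then show ?thesis using assms(4) has_weak_partial_mono[OF assms(1-3)] by (auto simp: jet_def)
qed

lemma W12_add: "open Z \<Longrightarrow> u \<in> W12 Z \<Longrightarrow> v \<in> W12 Z \<Longrightarrow> (\<lambda>x. u x + v x) \<in> W12 Z"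
 unfolding W12_iff using jet_add by blast

lemma W12_cmult: "u \<in> W12 Z \<Longrightarrow> (\<lambda>x. c * u x) \<in> W12 Z"
 unfolding W12_iff using jet_cmult by blast

lemma W12_diff: "open Z \<Longrightarrow> u \<in> W12 Z \<Longrightarrow> v \<in> W12 Z \<Longrightarrow> (\<lambda>x. u x - v x) \<in> W12 Z"
 unfolding W12_iff using jet_diff by blast

lemma W12_norm_nonneg: "0 \<le> W12_norm Z u"
 unfolding W12_norm_def by (intro real_sqrt_ge_zero Bochner_Integration.integral_nonneg) (auto intro!: add_nonneg_nonneg sum_nonneg)

lemma W12_norm_cong:
 assumes "open Z" "u \<in> W12 Z" "v \<in> W12 Z" "AE x in mu Z. u x = v x"
 shows "W12_norm Z u = W12_norm Z v"
proof -
 obtain p q p' q' where j: "jet Z u p q" "jet Z v p' q'" using assms by (auto simp: W12_iff)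
 show ?thesis
  unfolding W12_norm_jet[OF assms(1) j(1)] W12_norm_jet[OF assms(1) j(2)]
  using jet_unique(3)[OF assms(1) j assms(4)] j[THEN jet_l2] by (intro n2_cong_AE) (auto simp: l2_def)
qed

lemma W12_norm_cmult:
 assumes "open Z" "u \<in> W12 Z" shows "W12_norm Z (\<lambda>x. c * u x) = norm c * W12_norm Z u"
proof -
 obtain p q where j: "jet Z u p q" using assms by (auto simp: W12_iff)
 have "jn Z (\<lambda>x. c * u x) (\<lambda>x. c * p x) (\<lambda>x. c * q x) = norm c * jn Z u p q"
  unfolding n2_def norm_triple_power2
  by (simp add: norm_mult power_mult_distrib real_sqrt_mult flip: distrib_left)
 then show ?thesis unfolding W12_norm_jet[OF assms(1) j] W12_norm_jet[OF assms(1) jet_cmult[OF j]] .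
qed

lemma W12_norm_triangle:
 assumes "open Z" "u \<in> W12 Z" "v \<in> W12 Z"
 shows "W12_norm Z (\<lambda>x. u x + v x) \<le> W12_norm Z u + W12_norm Z v"
proof -
 obtain p q p' q' where j: "jet Z u p q" "jet Z v p' q'" using assms by (auto simp: W12_iff)
 show ?thesis
  unfolding W12_norm_jet[OF assms(1) j(1)] W12_norm_jet[OF assms(1) j(2)] W12_norm_jet[OF assms(1) jet_add[OF assms(1) j]]
  using n2_triangle[OF j[THEN jet_l2]] by simp
qed

lemma W12_norm_minus_commute:
 assumes "open Z" "u \<in> W12 Z" "v \<in> W12 Z"
 shows "W12_norm Z (\<lambda>x. u x - v x) = W12_norm Z (\<lambda>x. v x - u x)"
 using W12_norm_cmult[OF assms(1) W12_diff[OF assms], of "-1"] by simp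

lemma W12_norm_triangle_diff:
 assumes "open Z" "u \<in> W12 Z" "v \<in> W12 Z" "w \<in> W12 Z"
 shows "W12_norm Z (\<lambda>x. u x - w x) \<le> W12_norm Z (\<lambda>x. u x - v x) + W12_norm Z (\<lambda>x. v x - w x)"
 using W12_norm_triangle[OF assms(1) W12_diff[OF assms(1,2,3)] W12_diff[OF assms(1,3,4)]] by simp

lemma W12_norm_le_diff:
 assumes "open Z" "u \<in> W12 Z" "v \<in> W12 Z"
 shows "\<bar>W12_norm Z u - W12_norm Z v\<bar> \<le> W12_norm Z (\<lambda>x. u x - v x)"
 using W12_norm_triangle[OF assms(1) W12_diff[OF assms] assms(3)]
  W12_norm_triangle[OF assms(1) W12_diff[OF assms(1,3,2)] assms(2)]
  W12_norm_minus_commute[OF assms] by simp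

lemma W12_norm_parallelogram:
 assumes "open Z" "u \<in> W12 Z" "v \<in> W12 Z"
 shows "(W12_norm Z (\<lambda>x. u x - v x))^2 + (W12_norm Z (\<lambda>x. u x + v x))^2 = 2 * (W12_norm Z u)^2 + 2 * (W12_norm Z v)^2"
proof -
 obtain p q p' q' where j: "jet Z u p q" "jet Z v p' q'" using assms by (auto simp: W12_iff)
 show ?thesis
  unfolding W12_norm_jet[OF assms(1) j(1)] W12_norm_jet[OF assms(1) j(2)] W12_norm_jet[OF assms(1) jet_add[OF assms(1) j]]
   W12_norm_jet[OF assms(1) jet_diff[OF assms(1) j]]
  using n2_parallelogram[OF j[THEN jet_l2]] by simp
qed

lemma n2_components_le:
 fixes p q u :: "_ \<Rightarrow> complex"
 assumes "l2 M p" "l2 M q" "l2 M u"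
 shows "n2 M p \<le> n2 M (\<lambda>x. (p x, q x, u x))" "n2 M q \<le> n2 M (\<lambda>x. (p x, q x, u x))" "n2 M u \<le> n2 M (\<lambda>x. (p x, q x, u x))"
proof -
 have "norm a \<le> norm (a, b, c)" "norm b \<le> norm (a, b, c)" "norm c \<le> norm (a, b, c)" for a b c :: complex
  by (auto simp: norm_prod_def intro!: real_le_rsqrt)
 note * = this
 show "n2 M p \<le> n2 M (\<lambda>x. (p x, q x, u x))" "n2 M q \<le> n2 M (\<lambda>x. (p x, q x, u x))" "n2 M u \<le> n2 M (\<lambda>x. (p x, q x, u x))"
  by (intro n2_mono l2_triple assms AE_I2 *)+
qed

lemma W12_norm_eq_0:
 assumes "open Z" "u \<in> W12 Z" "W12_norm Z u = 0" shows "AE x in mu Z. u x = 0"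
proof -
 obtain p q where j: "jet Z u p q" using assms by (auto simp: W12_iff)
 then have l: "l2 (mu Z) p" "l2 (mu Z) q" "l2 (mu Z) u" by (auto simp: jet_def)
 have "n2 (mu Z) u = 0"
  using n2_components_le(3)[OF l] n2_nonneg[of "mu Z" u] assms(3) unfolding W12_norm_jet[OF assms(1) j] by linarith
 then have "(LINT x|mu Z. (norm (u x))^2) = 0" by (simp add: n2_def)
 then have "AE x in mu Z. (norm (u x))^2 = 0"
  by (subst (asm) integral_nonneg_eq_0_iff_AE) (auto intro: l2_integrable l)
 then show ?thesis by simp
qed

lemma has_weak_partial_limit:
 assumes "open Z" "b \<in> Basis" "\<And>n. has_weak_partial Z b (u n) (g n)"
  and l: "\<And>n. l2 (mu Z) (u n)" "\<And>n. l2 (mu Z) (g n)" "l2 (mu Z) U" "l2 (mu Z) G"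
  and lim: "(\<lambda>n. n2 (mu Z) (\<lambda>x. u n x - U x)) \<longlonglongrightarrow> 0" "(\<lambda>n. n2 (mu Z) (\<lambda>x. g n x - G x)) \<longlonglongrightarrow> 0"
 shows "has_weak_partial Z b U G"
 unfolding has_weak_partial_def
proof (intro conjI allI impI)
 fix \<phi> assume t: "test_function Z \<phi>"
 have c: "C1c UNIV \<phi>" using test_function_C1c[OF t] by (auto simp: C1c_def)
 have s: "Z \<in> sets lebesgue" using assms(1) by auto
 note p = l2_C1c[OF c s]
 have *: "(\<lambda>n. LINT x|mu Z. f n x * \<psi> x) \<longlonglongrightarrow> (LINT x|mu Z. F x * \<psi> x)"
  if "\<And>n. l2 (mu Z) (f n)" "l2 (mu Z) F" "l2 (mu Z) \<psi>"
   "(\<lambda>n. n2 (mu Z) (\<lambda>x. f n x - F x)) \<longlonglongrightarrow> 0" for f :: "nat \<Rightarrow> cfun" and F \<psi>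
 proof (rule LIM_zero_cancel, rule Lim_null_comparison)
  show "(\<lambda>n. n2 (mu Z) (\<lambda>x. f n x - F x) * n2 (mu Z) \<psi>) \<longlonglongrightarrow> 0"
   by (rule tendsto_mult_left_zero[OF that(4)])
  show "\<forall>\<^sub>F n in sequentially. norm ((LINT x|mu Z. f n x * \<psi> x) - (LINT x|mu Z. F x * \<psi> x))
   \<le> n2 (mu Z) (\<lambda>x. f n x - F x) * n2 (mu Z) \<psi>"
  proof (intro always_eventually allI)
   fix n
   have "(LINT x|mu Z. f n x * \<psi> x) - (LINT x|mu Z. F x * \<psi> x) = (LINT x|mu Z. (f n x - F x) * \<psi> x)"
    using n2_mult_bound(1)[OF that(1,3)] n2_mult_bound(1)[OF that(2,3)] by (simp add: left_diff_distrib)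
   then show "norm ((LINT x|mu Z. f n x * \<psi> x) - (LINT x|mu Z. F x * \<psi> x))
    \<le> n2 (mu Z) (\<lambda>x. f n x - F x) * n2 (mu Z) \<psi>"
    using n2_mult_bound(3)[OF l2_diff[OF that(1,2)] that(3)] by simp
  qed
 qed
 have e: "(LINT x|mu Z. u n x * der \<phi> x b) = - (LINT x|mu Z. g n x * \<phi> x)" for n
  using assms(3)[of n] t unfolding has_weak_partial_def by simp
 show "(LINT x|mu Z. U x * der \<phi> x b) = - (LINT x|mu Z. G x * \<phi> x)"
  using *[OF l(1,3) p(2)[OF assms(2)] lim(1)] tendsto_minus[OF *[OF l(2,4) p(1) lim(2)]] unfolding e
  by (rule LIMSEQ_unique)
qed (intro l2_locally_integrable assms)+

lemma l2_triple_D: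
 fixes p q u :: "cfun"
 assumes "l2 M (\<lambda>x. (p x, q x, u x))" shows "l2 M p" "l2 M q" "l2 M u"
proof -
 have m: "(\<lambda>x. (p x, q x, u x)) \<in> borel_measurable M" by (rule l2_measurable[OF assms])
 have c: "continuous_on UNIV (fst :: complex \<times> complex \<times> complex \<Rightarrow> complex)"
  "continuous_on UNIV (\<lambda>x :: complex \<times> complex \<times> complex. fst (snd x))"
  "continuous_on UNIV (\<lambda>x :: complex \<times> complex \<times> complex. snd (snd x))" by (intro continuous_intros)+
 have "p \<in> borel_measurable M" "q \<in> borel_measurable M" "u \<in> borel_measurable M"
  using c[THEN continuous_bm, THEN measurable_compose[OF m]] by simp_all
 then show "l2 M p" "l2 M q" "l2 M u"
  by (auto intro!: l2_bound[OF _ l2_integrable[OF assms]] simp: norm_triple_power2)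
qed

lemma W12_complete:
 assumes "open Z" and w: "\<And>n. w n \<in> W12 Z"
  and c: "\<And>e. e > 0 \<Longrightarrow> \<exists>N. \<forall>m\<ge>N. \<forall>n\<ge>N. W12_norm Z (\<lambda>x. w m x - w n x) < e"
 shows "\<exists>u\<in>W12 Z. (\<lambda>n. W12_norm Z (\<lambda>x. w n x - u x)) \<longlonglongrightarrow> 0"
proof -
 obtain p q where j: "\<And>n. jet Z (w n) (p n) (q n)" using w unfolding W12_iff by metis
 obtain r where r: "strict_mono r" "\<And>m n. n \<le> m \<Longrightarrow> W12_norm Z (\<lambda>x. w (r m) x - w (r n) x) \<le> (1/2)^n"
  using fast_subsequence[of "\<lambda>m n. W12_norm Z (\<lambda>x. w m x - w n x)"] c by blast
 let ?M = "mu Z"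
 have jl: "l2 ?M (w n)" "l2 ?M (p n)" "l2 ?M (q n)" for n using j[of n] by (auto simp: jet_def)
 define F where "F n x = (p (r n) x, q (r n) x, w (r n) x)" for n x
 have Fl: "l2 ?M (F n)" for n unfolding F_def by (intro l2_triple jl)
 have Fd: "n2 ?M (\<lambda>x. F m x - F n x) \<le> (1/2)^n" if "n \<le> m" for m n
  using r(2)[OF that] unfolding W12_norm_jet[OF assms(1) jet_diff[OF assms(1) j j]] by (simp add: F_def)
 define L where "L x = lim (\<lambda>n. F n x)" for x
 note lim = l2_complete[of ?M F, OF Fl Fd, folded L_def]
 define P where "P x = fst (L x)" for x
 define Q where "Q x = fst (snd (L x))" for x
 define U where "U x = snd (snd (L x))" for x
 have L: "L x = (P x, Q x, U x)" for x by (simp add: P_def Q_def U_def)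
 have l: "l2 ?M P" "l2 ?M Q" "l2 ?M U" using l2_triple_D[OF lim(2)[unfolded L[abs_def]]] by simp_all
 have lims: "(\<lambda>n. n2 ?M (\<lambda>x. F n x - L x)) \<longlonglongrightarrow> 0"
  by (rule Lim_null_comparison[OF _ LIMSEQ_power_zero[of "1/2::real"]])
    (use lim(3) in \<open>auto intro: always_eventually\<close>)
 note ld = l2_diff[OF jl(2) l(1)] l2_diff[OF jl(3) l(2)] l2_diff[OF jl(1) l(3)]
 have t: "(\<lambda>n. n2 ?M (\<lambda>x. p (r n) x - P x)) \<longlonglongrightarrow> 0" "(\<lambda>n. n2 ?M (\<lambda>x. q (r n) x - Q x)) \<longlonglongrightarrow> 0"
  "(\<lambda>n. n2 ?M (\<lambda>x. w (r n) x - U x)) \<longlonglongrightarrow> 0"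
  by (rule Lim_null_comparison[OF _ lims]; use n2_components_le[OF ld, of "r n" "r n" "r n" for n] in \<open>auto simp: F_def L intro: always_eventually\<close>)+
 have J: "jet Z U P Q"
  unfolding jet_def
 proof (intro conjI l)
  show "has_weak_partial Z 1 U P"
   by (rule has_weak_partial_limit[where u="\<lambda>n. w (r n)" and g="\<lambda>n. p (r n)", OF assms(1) _ _ jl(1) jl(2) l(3) l(1) t(3) t(1)])
     (use j in \<open>auto simp: jet_def Basis_complex_def\<close>)
  show "has_weak_partial Z \<i> U Q"
   by (rule has_weak_partial_limit[where u="\<lambda>n. w (r n)" and g="\<lambda>n. q (r n)", OF assms(1) _ _ jl(1) jl(3) l(3) l(2) t(3) t(2)])
     (use j in \<open>auto simp: jet_def Basis_complex_def\<close>)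
 qed
 have UW: "U \<in> W12 Z" by (rule jet_W12[OF J])
 have sub: "W12_norm Z (\<lambda>x. w (r n) x - U x) = n2 ?M (\<lambda>x. F n x - L x)" for n
  unfolding W12_norm_jet[OF assms(1) jet_diff[OF assms(1) j J]] by (simp add: F_def L)
 have "(\<lambda>n. W12_norm Z (\<lambda>x. w n x - U x)) \<longlonglongrightarrow> 0"
 proof (rule LIMSEQ_I)
  fix e :: real assume "e > 0"
  obtain N where N: "\<And>m n. m \<ge> N \<Longrightarrow> n \<ge> N \<Longrightarrow> W12_norm Z (\<lambda>x. w m x - w n x) < e / 2"
   using c[of "e/2"] \<open>e > 0\<close> by auto
  obtain N' where N': "\<And>n. n \<ge> N' \<Longrightarrow> n2 ?M (\<lambda>x. F n x - L x) < e / 2"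
   using LIMSEQ_D[OF lims, of "e/2"] \<open>e > 0\<close> by auto
  show "\<exists>N. \<forall>n\<ge>N. norm (W12_norm Z (\<lambda>x. w n x - U x) - 0) < e"
  proof (intro exI[of _ N] allI impI)
   fix n assume "n \<ge> N"
   define m where "m = max N N'"
   have "r m \<ge> N" using seq_suble[OF r(1), of m] by (simp add: m_def)
   have "W12_norm Z (\<lambda>x. w n x - U x) \<le> W12_norm Z (\<lambda>x. w n x - w (r m) x) + W12_norm Z (\<lambda>x. w (r m) x - U x)"
    by (intro W12_norm_triangle_diff assms w UW)
   also have "... < e / 2 + e / 2"
    using N[OF \<open>n \<ge> N\<close> \<open>r m \<ge> N\<close>] N'[of m] unfolding sub by (intro add_strict_mono) (auto simp: m_def)
   finally show "norm (W12_norm Z (\<lambda>x. w n x - U x) - 0) < e" using W12_norm_nonneg[of Z] by simp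
  qed
 qed
 then show ?thesis using UW by blast
qed

section \<open>Change of variables in the plane\<close>

lemma lborel_complex_prod: "distr (lborel \<Otimes>\<^sub>M lborel) borel (\<lambda>(x, y). Complex x y) = lborel"
proof (rule lborel_eqI[symmetric])
 fix l u :: complex assume lu: "\<And>b. b \<in> Basis \<Longrightarrow> l \<bullet> b \<le> u \<bullet> b"
 have le: "Re l \<le> Re u" "Im l \<le> Im u" using lu[of 1] lu[of \<i>] by (auto simp: Basis_complex_def)
 have [measurable]: "(\<lambda>(x, y). Complex x y) \<in> borel_measurable (lborel \<Otimes>\<^sub>M lborel)"
  unfolding Complex_eq by measurable
 have "(\<lambda>(x, y). Complex x y) -` box l u \<inter> space (lborel \<Otimes>\<^sub>M lborel) = {Re l<..<Re u} \<times> {Im l<..<Im u}"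
  by (auto simp: space_pair_measure box_def Basis_complex_def)
 then have "emeasure (distr (lborel \<Otimes>\<^sub>M lborel) borel (\<lambda>(x, y). Complex x y)) (box l u)
  = emeasure (lborel \<Otimes>\<^sub>M lborel) ({Re l<..<Re u} \<times> {Im l<..<Im u})"
  by (subst emeasure_distr) auto
 also have "... = ennreal (Re u - Re l) * ennreal (Im u - Im l)"
  by (subst lborel.emeasure_pair_measure_Times) (auto simp: le)
 also have "... = (\<Prod>b\<in>Basis. (u - l) \<bullet> b)"
  using le by (simp add: Basis_complex_def ennreal_mult)
 finally show "emeasure (distr (lborel \<Otimes>\<^sub>M lborel) borel (\<lambda>(x, y). Complex x y)) (box l u) = (\<Prod>b\<in>Basis. (u - l) \<bullet> b)" .
qed simp

lemma measurable_Complex [measurable (raw)]: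
 "f \<in> borel_measurable M \<Longrightarrow> g \<in> borel_measurable M \<Longrightarrow> (\<lambda>x. Complex (f x) (g x)) \<in> borel_measurable M"
 unfolding Complex_eq by (intro borel_measurable_add borel_measurable_times borel_measurable_const)
  (auto intro!: measurable_compose[of _ M borel complex_of_real])

lemma nn_integral_complex:
 assumes [measurable]: "f \<in> bm"
 shows "(NN z. f z) = (NN y. NN x. f (Complex x y))"
proof -
 have "(NN z. f z) = (\<integral>\<^sup>+z. f z \<partial>distr (lborel \<Otimes>\<^sub>M lborel) borel (\<lambda>(x, y). Complex x y))"
  by (simp add: lborel_complex_prod)
 also have "... = (\<integral>\<^sup>+p. f (Complex (fst p) (snd p)) \<partial>(lborel \<Otimes>\<^sub>M lborel))"
  by (subst nn_integral_distr) (auto simp: case_prod_beta')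
 also have "... = (NN y. NN x. f (Complex x y))"
  by (subst lborel_pair.nn_integral_snd[symmetric]) auto
 finally show ?thesis .
qed

definition to_complex :: "real^2 \<Rightarrow> complex" where "to_complex v = Complex (v $ 1) (v $ 2)"
definition of_complex :: "complex \<Rightarrow> real^2" where "of_complex z = vector [Re z, Im z]"

lemma to_of_complex [simp]: "to_complex (of_complex z) = z" "of_complex (to_complex v) = v"
 by (auto simp: to_complex_def of_complex_def vec_eq_iff forall_2)

lemma bounded_linear_to_complex: "bounded_linear to_complex"
 by (intro linear_conv_bounded_linear[THEN iffD1] linearI) (auto simp: to_complex_def complex_eq_iff)

lemma bounded_linear_of_complex: "bounded_linear of_complex"
 by (intro linear_conv_bounded_linear[THEN iffD1] linearI) (auto simp: of_complex_def vec_eq_iff forall_2)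

lemma measurable_to_complex [measurable]: "to_complex \<in> bm"
 by (intro continuous_bm bounded_linear.continuous_on[OF bounded_linear_to_complex] continuous_on_id)

lemma measurable_of_complex [measurable]: "of_complex \<in> bm"
 by (intro continuous_bm bounded_linear.continuous_on[OF bounded_linear_of_complex] continuous_on_id)

lemma distr_to_complex: "distr lborel borel to_complex = lborel"
proof (rule lborel_eqI[symmetric])
 fix l u :: complex assume lu: "\<And>b. b \<in> Basis \<Longrightarrow> l \<bullet> b \<le> u \<bullet> b"
 have le: "Re l \<le> Re u" "Im l \<le> Im u" using lu[of 1] lu[of \<i>] by (auto simp: Basis_complex_def)
 have v: "to_complex -` box l u = box (of_complex l) (of_complex u)"
  unfolding set_eq_iff vimage_eq mem_box_cart forall_2
  by (auto simp: to_complex_def of_complex_def mem_box Basis_complex_def)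
 have ne: "cbox (of_complex l) (of_complex u) \<noteq> {}"
  using le by (auto simp: interval_ne_empty_cart forall_2 of_complex_def)
 have "emeasure (distr lborel borel to_complex) (box l u) = emeasure lborel (box (of_complex l) (of_complex u))"
  by (subst emeasure_distr) (auto simp: v)
 also have "... = ennreal (measure lborel (box (of_complex l) (of_complex u)))"
  using emeasure_lborel_box_finite[of "of_complex l" "of_complex u"] by (intro emeasure_eq_ennreal_measure) simp
 also have "measure lborel (box (of_complex l) (of_complex u)) = measure lborel (cbox (of_complex l) (of_complex u))"
  by (simp add: measure_lborel_box_eq measure_lborel_cbox_eq)
 also have "... = (Re u - Re l) * (Im u - Im l)"
  using content_cbox_cart[OF ne] by (simp add: UNIV_2 of_complex_def)
 also have "ennreal ((Re u - Re l) * (Im u - Im l)) = ennreal (\<Prod>b\<in>Basis. (u - l) \<bullet> b)"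
  by (simp add: Basis_complex_def)
 finally show "emeasure (distr lborel borel to_complex) (box l u) = (\<Prod>b\<in>Basis. (u - l) \<bullet> b)" .
qed simp

definition jac :: "cfun \<Rightarrow> real" where
 "jac L = \<bar>Re (L 1) * Im (L \<i>) - Im (L 1) * Re (L \<i>)\<bar>"

lemma det_of_complex: "\<bar>det (matrix (of_complex \<circ> L \<circ> to_complex))\<bar> = jac L"
proof -
 have "to_complex (axis 1 1) = 1" "to_complex (axis 2 1) = \<i>"
  by (auto simp: to_complex_def axis_def complex_eq_iff)
 then show ?thesis by (simp add: jac_def det_2 matrix_def of_complex_def mult.commute)
qed

lemma emeasure_change_of_variables:
 assumes S: "S \<in> sets borel" and g: "\<And>x. x \<in> S \<Longrightarrow> (g has_derivative g' x) (at x)"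
  and inj: "inj_on g S" and c: "continuous_on S (\<lambda>x. g' x 1)" "continuous_on S (\<lambda>x. g' x \<i>)"
  and E: "E \<in> sets borel" "emeasure lborel E < \<infinity>" "E \<subseteq> g ` S"
 shows "emeasure lborel E = (NN x. ennreal (jac (g' x)) * indicator {x\<in>S. g x \<in> E} x)"
proof -
 have gc: "continuous_on S g"
  using g by (meson continuous_at_imp_continuous_on has_derivative_continuous)
 define P where "P = {x\<in>S. g x \<in> E}"
 have P: "P \<in> sets borel"
 proof -
  have "g \<in> borel_measurable (restrict_space borel S)"
   by (rule borel_measurable_continuous_on_restrict[OF gc])
  from measurable_sets[OF this E(1)] have "g -` E \<inter> S \<in> sets (restrict_space borel S)"
   by (simp add: space_restrict_space)
  then have "g -` E \<inter> S \<in> sets borel" using S by (simp add: sets_restrict_space_iff)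
  moreover have "P = g -` E \<inter> S" by (auto simp: P_def)
  ultimately show ?thesis by simp
 qed
 have gP: "g ` P = E" using E(3) by (auto simp: P_def)
 define G where "G = of_complex \<circ> g \<circ> to_complex"
 define Q where "Q = to_complex -` P"
 have Qb: "Q \<in> sets borel" using measurable_sets[OF measurable_to_complex P] by (simp add: Q_def)
 then have Q: "Q \<in> sets lebesgue" by simp
 have GQ: "G ` Q = to_complex -` E"
 proof -
  have "G ` Q = of_complex ` g ` P"
   unfolding G_def Q_def image_comp[symmetric]
   by (metis surj_image_vimage_eq surjI to_of_complex(1))
  also have "... = to_complex -` E" unfolding gP using to_of_complex by (force simp: image_iff)
  finally show ?thesis .
 qed
 have injG: "inj_on G Q"
  using inj unfolding G_def Q_def inj_on_def P_def by (metis (no_types, lifting) comp_apply mem_Collect_eq to_of_complex vimage_eq)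
 have dG: "(G has_derivative (of_complex \<circ> g' (to_complex x) \<circ> to_complex)) (at x within Q)" if "x \<in> Q" for x
 proof -
  have "(g has_derivative g' (to_complex x)) (at (to_complex x))" using that by (intro g) (auto simp: Q_def P_def)
  then show ?thesis
   unfolding G_def
   by (intro diff_chain_within bounded_linear_imp_has_derivative[OF bounded_linear_to_complex]
    bounded_linear_imp_has_derivative[OF bounded_linear_of_complex]) (auto intro: has_derivative_at_withinI)
 qed
 have em: "emeasure lborel (to_complex -` E) = emeasure lborel E"
  using emeasure_distr[of to_complex lborel borel E] E by (simp add: distr_to_complex)
 have Eb: "to_complex -` E \<in> sets borel" using measurable_sets[OF measurable_to_complex E(1)] by simp
 have lm: "to_complex -` E \<in> lmeasurable"
  using Eb em E(2) by (auto simp: fmeasurable_def)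
 let ?J = "\<lambda>x. jac (g' (to_complex x))"
 have hq: "(?J has_integral measure lebesgue (G ` Q)) Q"
  using has_measure_differentiable_image[OF Q dG injG, of "measure lebesgue (G ` Q)"] lm
  unfolding det_of_complex by (simp add: GQ)
 have hi: "((\<lambda>x. indicator Q x * ?J x) has_integral measure lebesgue (G ` Q)) UNIV"
 proof -
  have "(\<lambda>x. if x \<in> Q then ?J x else 0) = (\<lambda>x. indicator Q x * ?J x)" by (intro ext) auto
  then show ?thesis using hq has_integral_restrict_UNIV[of Q ?J "measure lebesgue (G ` Q)"] by simp
 qed
 have [measurable]: "P \<in> sets borel" "Q \<in> sets borel" by fact+
 have jm: "(\<lambda>x. indicator P x * jac (g' x)) \<in> bm"
 proof -
  have "continuous_on S (\<lambda>x. jac (g' x))" unfolding jac_def by (intro continuous_intros c)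
  then have "(\<lambda>x. indicator S x *\<^sub>R jac (g' x)) \<in> bm"
   using S by (intro borel_measurable_continuous_on_indicator) auto
  then have "(\<lambda>x. indicator P x * (indicator S x *\<^sub>R jac (g' x))) \<in> bm" by measurable
  moreover have "(\<lambda>x. indicator P x * (indicator S x *\<^sub>R jac (g' x))) = (\<lambda>x. indicator P x * jac (g' x))"
   by (intro ext) (auto simp: indicator_def P_def)
  ultimately show ?thesis by simp
 qed
 have eq: "(\<lambda>x. indicator Q x * ?J x) = (\<lambda>x. (\<lambda>x. indicator P x * jac (g' x)) (to_complex x))"
  by (auto simp: Q_def indicator_def)
 have eqx: "indicat_real Q x = indicat_real P (to_complex x)" for x by (auto simp: Q_def indicator_def)
 have "(NN x. ennreal (indicator Q x * ?J x)) = ennreal (measure lebesgue (G ` Q))"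
  using has_integral_iff_nn_integral_lebesgue[of "\<lambda>x. indicator Q x * ?J x", THEN iffD1, OF _ hi]
  by (simp add: jac_def nn_integral_completion)
 also have "... = emeasure lborel E"
 proof -
  have "ennreal (measure lborel (to_complex -` E)) = emeasure lborel (to_complex -` E)"
   using E(2) em by (intro emeasure_eq_ennreal_measure[symmetric]) auto
  moreover have "measure lebesgue (to_complex -` E) = measure lborel (to_complex -` E)"
   using Eb by (intro measure_completion) simp
  ultimately show ?thesis using em by (simp add: GQ)
 qed
 finally have 1: "emeasure lborel E = (NN x. ennreal (indicator Q x * ?J x))" by simp
 also have "... = (\<integral>\<^sup>+x. ennreal (indicator P x * jac (g' x)) \<partial>distr lborel borel to_complex)"
  using jm by (subst nn_integral_distr) (auto simp: eqx)
 also have "... = (NN x. ennreal (jac (g' x)) * indicator P x)"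
  unfolding distr_to_complex by (intro nn_integral_cong) (auto simp: indicator_def)
 finally show ?thesis by (simp add: P_def)
qed

theorem nn_integral_change_of_variables:
 assumes S: "S \<in> sets borel" "g ` S \<in> sets borel" and g: "\<And>x. x \<in> S \<Longrightarrow> (g has_derivative g' x) (at x)"
  and inj: "inj_on g S" and c: "continuous_on S (\<lambda>x. g' x 1)" "continuous_on S (\<lambda>x. g' x \<i>)"
  and f: "f \<in> bm"
 shows "(NN z. f z * indicator (g ` S) z) = (NN x. ennreal (jac (g' x)) * f (g x) * indicator S x)"
proof -
 note [measurable] = S f
 have gc: "continuous_on S g"
  using g by (meson continuous_at_imp_continuous_on has_derivative_continuous)
 define gg where "gg x = indicator S x *\<^sub>R g x" for x
 define w where "w x = ennreal (indicator S x *\<^sub>R jac (g' x))" for x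
 have [measurable]: "gg \<in> bm"
  unfolding gg_def using S(1) gc by (intro borel_measurable_continuous_on_indicator) auto
 have [measurable]: "w \<in> bm"
 proof -
  have "continuous_on S (\<lambda>x. jac (g' x))" unfolding jac_def by (intro continuous_intros c)
  then have "(\<lambda>x. indicator S x *\<^sub>R jac (g' x)) \<in> bm"
   using S by (intro borel_measurable_continuous_on_indicator) auto
  then show ?thesis unfolding w_def by measurable
 qed
 define M1 where "M1 = distr (density lborel w) borel gg"
 define M2 where "M2 = density lborel (indicator (g ` S))"
 have "M1 = M2"
 proof (rule measure_eqI)
  show "sets M1 = sets M2" by (simp add: M1_def M2_def)
  fix A assume "A \<in> sets M1"
  then have A [measurable]: "A \<in> sets borel" by (simp add: M1_def)
  define B where "B n = A \<inter> ball 0 (real n)" for n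
  have B [measurable]: "B n \<in> sets borel" for n by (simp add: B_def)
  have UB: "(\<Union>n. B n) = A"
  proof -
   have "\<exists>n. norm x < real n" for x :: complex using reals_Archimedean2 by blast
   then show ?thesis by (auto simp: B_def)
  qed
  have rB: "range B \<subseteq> sets borel" using B by blast
  have inc: "incseq B" by (auto simp: B_def incseq_def)
  have e: "emeasure M1 (B n) = emeasure M2 (B n)" for n
  proof -
   define E where "E = B n \<inter> g ` S"
   have [measurable]: "E \<in> sets borel" by (simp add: E_def)
   have "emeasure lborel E \<le> emeasure lborel (ball (0::complex) (real n))"
    by (intro emeasure_mono) (auto simp: E_def B_def)
   also have "... < \<infinity>" by (rule emeasure_lborel_ball_finite)
   finally have Ef: "emeasure lborel E < \<infinity>" .
   have "emeasure M2 (B n) = (NN x. indicator (g ` S) x * indicator (B n) x)"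
    unfolding M2_def by (subst emeasure_density) auto
   also have "... = (NN x. indicator E x)"
    by (intro nn_integral_cong) (auto simp: E_def indicator_def)
   also have "... = emeasure lborel E" by simp
   also have "... = (NN x. ennreal (jac (g' x)) * indicator {x\<in>S. g x \<in> E} x)"
    by (rule emeasure_change_of_variables[OF S(1) g inj c _ Ef]) (auto simp: E_def)
   also have "... = (NN x. w x * indicator (gg -` B n) x)"
    by (intro nn_integral_cong) (auto simp: w_def gg_def E_def indicator_def)
   also have "... = emeasure M1 (B n)"
    unfolding M1_def using measurable_sets[of gg borel borel "B n"]
    by (subst emeasure_distr, simp, simp, subst emeasure_density) auto
   finally show ?thesis by simp
  qed
  have "emeasure M1 A = (SUP n. emeasure M1 (B n))"
   using SUP_emeasure_incseq[of B M1] inc rB by (auto simp: UB M1_def)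
  also have "... = emeasure M2 A"
   using SUP_emeasure_incseq[of B M2] inc rB by (auto simp: UB M2_def e)
  finally show "emeasure M1 A = emeasure M2 A" .
 qed
 have "(NN z. f z * indicator (g ` S) z) = (\<integral>\<^sup>+z. f z \<partial>M2)"
  unfolding M2_def by (subst nn_integral_density) (auto simp: mult.commute)
 also have "... = (\<integral>\<^sup>+z. f z \<partial>M1)" using \<open>M1 = M2\<close> by simp
 also have "... = (NN x. w x * f (gg x))"
  unfolding M1_def by (subst nn_integral_distr, simp, simp, subst nn_integral_density) auto
 also have "... = (NN x. ennreal (jac (g' x)) * f (g x) * indicator S x)"
  by (intro nn_integral_cong) (auto simp: w_def gg_def indicator_def)
 finally show ?thesis .
qed

lemma distr_rotate:
 assumes "norm d = 1" shows "distr lborel borel (\<lambda>z. z * d) = (lborel :: complex measure)"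
proof (rule measure_eqI)
 fix A :: "complex set" assume "A \<in> sets (distr lborel borel (\<lambda>z. z * d))"
 then have [measurable]: "A \<in> sets borel" by simp
 have d0: "d \<noteq> 0" using assms by auto
 have im: "range (\<lambda>z. z * d) = UNIV"
  using d0 by (auto intro!: image_eqI[of _ _ "_ / d"])
 have j: "jac (\<lambda>z. z * d) = 1"
 proof -
  have "jac (\<lambda>z. z * d) = (Re d)^2 + (Im d)^2" by (simp add: jac_def power2_eq_square)
  also have "... = (norm d)^2" by (simp add: cmod_def)
  finally show ?thesis using assms by simp
 qed
 have "emeasure lborel A = (NN z. indicator A z * indicator (range (\<lambda>z. z * d)) z)"
  by (simp add: im)
 also have "... = (NN x. ennreal (jac (\<lambda>z. z * d)) * indicator A (x * d) * indicator UNIV x)"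
  by (rule nn_integral_change_of_variables)
    (use d0 in \<open>auto simp: im inj_on_def intro!: derivative_eq_intros\<close>)
 also have "... = (NN x. indicator A (x * d))" by (simp add: j)
 also have "... = (\<integral>\<^sup>+x. indicator A x \<partial>distr lborel borel (\<lambda>z. z * d))"
  by (subst nn_integral_distr) auto
 finally show "emeasure (distr lborel borel (\<lambda>z. z * d)) A = emeasure lborel A" by simp
qed simp

lemma nn_integral_rotate:
 fixes d :: complex
 assumes "norm d = 1" "f \<in> bm"
 shows "(NN z. f z) = (NN z. f (z * d))"
proof -
 have "(NN z. f z) = (\<integral>\<^sup>+z. f z \<partial>distr lborel borel (\<lambda>z. z * d))"
  by (simp add: distr_rotate[OF assms(1)])
 also have "... = (NN z. f (z * d))" using assms(2) by (subst nn_integral_distr) auto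
 finally show ?thesis .
qed

section \<open>Sectors as epigraphs\<close>

text \<open>In coordinates \<open>z = (x + \<i> y) d\<close>, the sector of half opening \<open>h\<close> about the direction \<open>d\<close>
 is \<open>{x > cot h \<bar>y\<bar>}\<close>, for all \<open>0 < h < \<pi>\<close>.\<close>

definition Sec :: "complex \<Rightarrow> real \<Rightarrow> complex set" where
 "Sec d m = {z. m * \<bar>Im (z * cnj d)\<bar> < Re (z * cnj d)}"

lemma open_Sec: "open (Sec d m)"
 unfolding Sec_def by (intro open_Collect_less continuous_intros)

lemma unit_cnj: "norm d = 1 \<Longrightarrow> d * cnj d = 1" "norm d = 1 \<Longrightarrow> cnj d * d = 1"
 by (metis complex_norm_square of_real_1 power_one, metis complex_norm_square mult.commute of_real_1 power_one)

lemma Sec_coord: "norm d = 1 \<Longrightarrow> z * d \<in> Sec d m \<longleftrightarrow> m * \<bar>Im z\<bar> < Re z"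
 by (simp add: Sec_def mult.assoc unit_cnj del: times_complex.sel)

lemma closure_Sec:
 assumes "norm d = 1" shows "closure (Sec d m) = {z. m * \<bar>Im (z * cnj d)\<bar> \<le> Re (z * cnj d)}"
proof
 have "closed {z. m * \<bar>Im (z * cnj d)\<bar> \<le> Re (z * cnj d)}" by (intro closed_Collect_le continuous_intros)
 then show "closure (Sec d m) \<subseteq> {z. m * \<bar>Im (z * cnj d)\<bar> \<le> Re (z * cnj d)}"
  by (rule closure_minimal[rotated]) (auto simp: Sec_def)
 show "{z. m * \<bar>Im (z * cnj d)\<bar> \<le> Re (z * cnj d)} \<subseteq> closure (Sec d m)"
 proof
  fix z assume z: "z \<in> {z. m * \<bar>Im (z * cnj d)\<bar> \<le> Re (z * cnj d)}"
  have "(\<lambda>n. z + of_real (1 / (real n + 1)) * d) \<longlonglongrightarrow> z + of_real 0 * d"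
   by (intro tendsto_intros) real_asymp
  moreover have "z + of_real (1 / (real n + 1)) * d \<in> Sec d m" for n
  proof -
   define e where "e = 1 / (real n + 1)"
   have "(z + of_real e * d) * cnj d = z * cnj d + of_real e"
    using unit_cnj[OF assms] by (simp add: distrib_right mult.assoc)
   moreover have "0 < e" by (simp add: e_def)
   ultimately show ?thesis using z unfolding e_def[symmetric] by (simp add: Sec_def del: times_complex.sel)
  qed
  ultimately show "z \<in> closure (Sec d m)" unfolding closure_sequential
   by (intro exI[of _ "\<lambda>n. z + of_real (1 / (real n + 1)) * d"]) simp
 qed
qed

lemma Sec_complement:
 assumes "norm d = 1" shows "- closure (Sec d m) = Sec (- d) (- m)"
 unfolding closure_Sec[OF assms] by (auto simp: Sec_def not_le simp del: times_complex.sel)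

lemma Sec_shift:
 assumes "norm d = 1" "z \<in> closure (Sec d m)" "\<bar>m\<bar> * \<bar>Im y\<bar> < Re y" shows "z + y * d \<in> Sec d m"
proof -
 have "(z + y * d) * cnj d = z * cnj d + y" using unit_cnj[OF assms(1)] by (simp add: distrib_right mult.assoc)
 moreover have "m * \<bar>Im (z * cnj d) + Im y\<bar> \<le> m * \<bar>Im (z * cnj d)\<bar> + \<bar>m\<bar> * \<bar>Im y\<bar>"
 proof (cases "m \<ge> 0")
  case True
  then show ?thesis using mult_left_mono[OF abs_triangle_ineq[of "Im (z * cnj d)" "Im y"] True] by (simp add: distrib_left)
 next
  case False
  have "- m * (\<bar>Im (z * cnj d)\<bar> - \<bar>Im y\<bar>) \<le> - m * \<bar>Im (z * cnj d) + Im y\<bar>"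
   using False by (intro mult_left_mono) auto
  then show ?thesis using False by (simp add: algebra_simps)
 qed
 ultimately show ?thesis using assms(2,3) unfolding closure_Sec[OF assms(1)] by (simp add: Sec_def del: times_complex.sel)
qed

text \<open>The shear \<open>(s, y) \<mapsto> (s + m \<bar>y\<bar>, y)\<close> flattens the boundary.\<close>

definition flatten :: "complex \<Rightarrow> real \<Rightarrow> real \<Rightarrow> real \<Rightarrow> complex" where
 "flatten d m s y = Complex (s + m * \<bar>y\<bar>) y * d"

lemma flatten_Sec: "norm d = 1 \<Longrightarrow> flatten d m s y \<in> Sec d m \<longleftrightarrow> 0 < s"
 unfolding flatten_def by (subst Sec_coord) auto

lemma flatten_closure: "norm d = 1 \<Longrightarrow> flatten d m s y \<in> closure (Sec d m) \<longleftrightarrow> 0 \<le> s"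
 unfolding flatten_def closure_Sec mem_Collect_eq by (simp add: mult.assoc unit_cnj del: times_complex.sel)

lemma norm_flatten: "norm d = 1 \<Longrightarrow> \<bar>y\<bar> \<le> norm (flatten d m s y)"
 by (simp add: flatten_def norm_mult) (metis abs_Im_le_cmod complex.sel(2))

lemma continuous_flatten [continuous_intros]:
 "continuous_on A f \<Longrightarrow> continuous_on A g \<Longrightarrow> continuous_on A (\<lambda>x. flatten d m (f x) (g x))"
 unfolding flatten_def Complex_eq by (intro continuous_intros)

lemma measurable_flatten [measurable (raw)]:
 "f \<in> borel_measurable M \<Longrightarrow> g \<in> borel_measurable M \<Longrightarrow> (\<lambda>x. flatten d m (f x) (g x)) \<in> borel_measurable M"
 unfolding flatten_def by (intro borel_measurable_times measurable_Complex borel_measurable_add borel_measurable_const borel_measurable_abs)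

lemma nn_integral_flatten:
 assumes d: "norm d = 1" and [measurable]: "f \<in> bm"
 shows "(NN z. f z) = (NN y. NN s. f (flatten d m s y))"
proof -
 have "(NN z. f z) = (NN z. f (z * d))" by (rule nn_integral_rotate[OF d]) simp
 also have "... = (NN y. NN x. f (Complex x y * d))" by (rule nn_integral_complex) simp
 also have "... = (NN y. NN s. f (flatten d m s y))"
 proof (rule nn_integral_cong)
  fix y :: real
  show "(NN x. f (Complex x y * d)) = (NN s. f (flatten d m s y))"
   using nn_integral_real_affine[of "\<lambda>x. f (Complex x y * d)" 1 "m * \<bar>y\<bar>"] by (simp add: flatten_def add.commute)
 qed
 finally show ?thesis .
qed

section \<open>Continuity of translations in the mean\<close>

lemma n2_bounded_support:
 fixes f :: "cfun"
 assumes "f \<in> bm" "\<And>x. norm x > R \<Longrightarrow> f x = 0" "\<And>x. norm (f x) \<le> c" "R \<ge> 0"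
 shows "l2 lborel f" "n2 lborel f \<le> c * sqrt (measure lborel (cball (0::complex) R))"
proof -
 have c: "c \<ge> 0" using assms(3)[of 0] norm_ge_zero[of "f 0"] by linarith
 have i: "integrable lborel (\<lambda>x::complex. c^2 * indicator (cball 0 R) x)"
  by (intro integrable_mult_right integrable_real_indicator emeasure_lborel_cball_finite) auto
 have b: "(norm (f x))^2 \<le> c^2 * indicator (cball 0 R) x" for x
  using power_mono[OF assms(3)[of x], of 2] assms(2)[of x] by (auto simp: indicator_def)
 show l: "l2 lborel f" by (rule l2_bound[OF _ i]) (use assms(1) b in auto)
 have "(LINT x|lborel. (norm (f x))^2) \<le> (LINT x|lborel. c^2 * indicator (cball (0::complex) R) x)"
  by (rule integral_mono[OF l2_integrable[OF l] i b])
 also have "... = c^2 * measure lborel (cball (0::complex) R)" by simp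
 finally have "n2 lborel f \<le> sqrt (c^2 * measure lborel (cball (0::complex) R))" unfolding n2_def by (rule real_sqrt_le_mono)
 then show "n2 lborel f \<le> c * sqrt (measure lborel (cball (0::complex) R))" using c by (simp add: real_sqrt_mult)
qed

lemma n2_dominated_limit:
 fixes f :: "nat \<Rightarrow> 'a \<Rightarrow> 'b::euclidean_space"
 assumes "\<And>n. f n \<in> borel_measurable M" "integrable M g" "AE x in M. (\<lambda>n. f n x) \<longlonglongrightarrow> 0"
  "\<And>n. AE x in M. (norm (f n x))^2 \<le> g x"
 shows "(\<lambda>n. n2 M (f n)) \<longlonglongrightarrow> 0"
proof -
 note [measurable] = assms(1)
 have "(\<lambda>n. LINT x|M. (norm (f n x))^2) \<longlonglongrightarrow> (LINT x|M. 0)"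
 proof (rule integral_dominated_convergence[OF _ _ assms(2)])
  show "AE x in M. (\<lambda>n. (norm (f n x))^2) \<longlonglongrightarrow> 0"
   using assms(3) by eventually_elim (auto intro!: tendsto_eq_intros)
 qed (use assms(4) in auto)
 then have "(\<lambda>n. sqrt (LINT x|M. (norm (f n x))^2)) \<longlonglongrightarrow> sqrt 0" by (intro tendsto_real_sqrt) simp
 then show ?thesis by (simp add: n2_def)
qed

lemma l2_dense_continuous:
 fixes f :: "cfun"
 assumes f: "l2 lborel f" and "e > 0"
 obtains \<phi> R where "continuous_on UNIV \<phi>" "\<And>x. norm x > R \<Longrightarrow> \<phi> x = 0" "n2 lborel (\<lambda>x. f x - \<phi> x) < e" "l2 lborel \<phi>"
proof -
 have [measurable]: "f \<in> bm" using l2_measurable[OF f] by simp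
 define T where "T n x = (if norm x \<le> real n \<and> norm (f x) \<le> real n then f x else 0)" for n x
 have [measurable]: "T n \<in> bm" for n unfolding T_def by measurable
 have "(\<lambda>n. n2 lborel (\<lambda>x. f x - T n x)) \<longlonglongrightarrow> 0"
 proof (rule n2_dominated_limit[OF _ l2_integrable[OF f]])
  show "AE x in lborel. (\<lambda>n. f x - T n x) \<longlonglongrightarrow> 0"
  proof (rule AE_I2, rule tendsto_eventually)
   fix x
   obtain N :: nat where N: "max (norm x) (norm (f x)) < real N" using reals_Archimedean2 by blast
   show "\<forall>\<^sub>F n in sequentially. f x - T n x = 0"
    using eventually_ge_at_top[of N]
   proof eventually_elim
    case (elim n)
    then have "real N \<le> real n" by simp
    then have "norm x \<le> real n" "norm (f x) \<le> real n" using N by linarith+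
    then show ?case by (simp add: T_def)
   qed
  qed
 qed (auto simp: T_def)
 then obtain n where n: "n2 lborel (\<lambda>x. f x - T n x) < e / 2"
  using LIMSEQ_D[of _ 0 "e/2"] \<open>e > 0\<close> by fastforce
 define h where "h = T n"
 define R where "R = real n"
 have h: "norm (h x) \<le> R" "norm x > R \<Longrightarrow> h x = 0" for x by (auto simp: h_def T_def R_def)
 have R: "R \<ge> 0" by (simp add: R_def)
 have hm [measurable]: "h \<in> bm" by (simp add: h_def)
 have hl: "l2 lborel h" by (rule n2_bounded_support(1)[OF hm h(2,1) R])
 have "h measurable_on UNIV"
  using hm by (intro lebesgue_measurable_imp_measurable_on) (auto simp: measurable_completion)
 then obtain N g where g: "negligible N" "\<And>k. continuous_on UNIV (g k)" "\<And>x. x \<notin> N \<Longrightarrow> (\<lambda>k. g k x) \<longlonglongrightarrow> h x"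
  unfolding measurable_on_def by auto
 have aeN: "AE x in lborel. (\<lambda>k. g k x) \<longlonglongrightarrow> h x"
 proof -
  have "AE x in lebesgue. x \<notin> N" using g(1) by (intro AE_not_in) (simp add: negligible_iff_null_sets)
  then have "AE x in lborel. x \<notin> N" by (simp add: AE_completion_iff)
  then show ?thesis by eventually_elim (rule g(3))
 qed
 define cl where "cl z = (R / max R (norm z)) *\<^sub>R z" for z :: complex
 define cut where "cut x = max 0 (min 1 (R + 1 - norm x))" for x :: complex
 define \<phi> where "\<phi> k x = cut x *\<^sub>R cl (g k x)" for k x
 show thesis
 proof (cases "R = 0")
  case True
  have "n2 lborel (\<lambda>x. f x - 0) < e"
  proof -
   have "h x = 0" for x using h(1)[of x] True by simp
   then show ?thesis using n \<open>e > 0\<close> by (simp add: h_def)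
  qed
  then show ?thesis by (intro that[of "\<lambda>_. 0" 0]) (auto simp: l2_def)
 next
  case False
  then have R0: "R > 0" using R by simp
  have clc: "continuous_on UNIV cl" unfolding cl_def using R0 by (intro continuous_intros) (auto simp: max_def)
  have clb: "norm (cl z) \<le> R" for z using R0 by (auto simp: cl_def max_def field_simps)
  have cli: "norm z \<le> R \<Longrightarrow> cl z = z" for z using R0 by (auto simp: cl_def max_def)
  have cutc: "continuous_on UNIV cut" unfolding cut_def by (intro continuous_intros)
  have cutb: "0 \<le> cut x" "cut x \<le> 1" for x by (auto simp: cut_def)
  have \<phi>c: "continuous_on UNIV (\<phi> k)" for k
   unfolding \<phi>_def by (intro continuous_intros cutc continuous_on_compose2[OF clc g(2)]) auto
  have \<phi>b: "norm (\<phi> k x) \<le> R" for k x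
   using mult_mono[OF cutb(2)[of x] clb[of "g k x"]] cutb(1)[of x] by (simp add: \<phi>_def)
  have \<phi>0: "norm x > R + 1 \<Longrightarrow> \<phi> k x = 0" for k x by (simp add: \<phi>_def cut_def)
  have \<phi>m [measurable]: "\<phi> k \<in> bm" for k by (rule continuous_bm[OF \<phi>c])
  have \<phi>l: "l2 lborel (\<phi> k)" for k by (rule n2_bounded_support(1)[OF \<phi>m, of "R + 1" k R]) (use R \<phi>0 \<phi>b in auto)
  have "(\<lambda>k. n2 lborel (\<lambda>x. h x - \<phi> k x)) \<longlonglongrightarrow> 0"
  proof (rule n2_dominated_limit)
   show "integrable lborel (\<lambda>x::complex. (2 * R)^2 * indicator (cball 0 (R + 1)) x)"
    by (intro integrable_mult_right integrable_real_indicator emeasure_lborel_cball_finite) auto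
   show "AE x in lborel. (\<lambda>k. h x - \<phi> k x) \<longlonglongrightarrow> 0"
    using aeN
   proof eventually_elim
    case (elim x)
    have "isCont cl (h x)" using clc by (simp add: continuous_on_eq_continuous_at)
    then have "(\<lambda>k. cut x *\<^sub>R cl (g k x)) \<longlonglongrightarrow> cut x *\<^sub>R cl (h x)"
     using elim by (intro tendsto_intros isCont_tendsto_compose[of _ cl])
    moreover have "cut x *\<^sub>R cl (h x) = h x"
     using h(1)[of x] h(2)[of x] cli[of "h x"] by (cases "norm x > R") (auto simp: cut_def)
    ultimately have "(\<lambda>k. \<phi> k x) \<longlonglongrightarrow> h x" by (simp add: \<phi>_def)
    then show ?case using tendsto_diff[OF tendsto_const[of "h x"]] by fastforce
   qed
   show "AE x in lborel. (norm (h x - \<phi> k x))^2 \<le> (2 * R)^2 * indicator (cball 0 (R + 1)) x" for k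
   proof (rule AE_I2)
    fix x :: complex
    show "(norm (h x - \<phi> k x))^2 \<le> (2 * R)^2 * indicator (cball 0 (R + 1)) x"
    proof (cases "norm x > R + 1")
     case True
     then show ?thesis using h(2)[of x] \<phi>0[of x k] by simp
    next
     case False
     have "norm (h x - \<phi> k x) \<le> 2 * R"
      using norm_triangle_ineq4[of "h x" "\<phi> k x"] h(1)[of x] \<phi>b[of k x] by linarith
     then have "(norm (h x - \<phi> k x))^2 \<le> (2 * R)^2" by (intro power_mono) auto
     then show ?thesis using False by simp
    qed
   qed
  qed auto
  then obtain k where k: "n2 lborel (\<lambda>x. h x - \<phi> k x) < e / 2"
   using LIMSEQ_D[of _ 0 "e/2"] \<open>e > 0\<close> by fastforce
  have "n2 lborel (\<lambda>x. f x - \<phi> k x) \<le> n2 lborel (\<lambda>x. f x - h x) + n2 lborel (\<lambda>x. h x - \<phi> k x)"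
   by (rule n2_triangle_diff[OF f hl \<phi>l])
  also have "... < e" using n k by (simp add: h_def)
  finally show ?thesis by (intro that[OF \<phi>c \<phi>0 _ \<phi>l])
 qed
qed

lemma l2_translate:
 fixes f :: "cfun"
 assumes "l2 lborel f" shows "l2 lborel (\<lambda>x. f (x + h))" "n2 lborel (\<lambda>x. f (x + h)) = n2 lborel f"
proof -
 have [measurable]: "f \<in> bm" using l2_measurable[OF assms] by simp
 have "integrable lborel (\<lambda>x. (norm (f (h + 1 *\<^sub>R x)))^2)"
  using lborel_integral_affine(2)[of 1 "\<lambda>x. (norm (f x))^2" h] l2_integrable[OF assms] by simp
 then show "l2 lborel (\<lambda>x. f (x + h))" by (simp add: l2_def add.commute)
 show "n2 lborel (\<lambda>x. f (x + h)) = n2 lborel f"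
  using lborel_integral_affine(1)[of 1 "\<lambda>x. (norm (f x))^2" h] by (simp add: n2_def add.commute)
qed

lemma l2_translation_continuous:
 fixes f :: "cfun"
 assumes f: "l2 lborel f" and "e > 0"
 obtains \<delta> where "\<delta> > 0" "\<And>h. norm h \<le> \<delta> \<Longrightarrow> n2 lborel (\<lambda>x. f (x + h) - f x) \<le> e"
proof -
 obtain \<phi> R0 where \<phi>: "continuous_on UNIV \<phi>" "\<And>x. norm x > R0 \<Longrightarrow> \<phi> x = 0" "n2 lborel (\<lambda>x. f x - \<phi> x) < e / 3" "l2 lborel \<phi>"
  using l2_dense_continuous[OF f, of "e/3"] \<open>e > 0\<close> by auto
 define R where "R = max R0 0 + 1"
 define c where "c = e / (3 * (sqrt (measure lborel (cball (0::complex) R)) + 1))"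
 have s: "0 \<le> sqrt (measure lborel (cball (0::complex) R))" by simp
 have "c > 0" using s \<open>e > 0\<close> by (simp add: c_def add_nonneg_pos)
 obtain d where d: "d > 0" "\<And>x y. norm (x - y) \<le> d \<Longrightarrow> norm (\<phi> x - \<phi> y) \<le> c"
  using uniformly_continuous_compact_support[OF \<phi>(1,2) \<open>c > 0\<close>] by blast
 show thesis
 proof (rule that[of "min d 1"])
  fix h :: complex assume h: "norm h \<le> min d 1"
  have [measurable]: "\<phi> \<in> bm" by (rule continuous_bm[OF \<phi>(1)])
  have "n2 lborel (\<lambda>x. \<phi> (x + h) - \<phi> x) \<le> c * sqrt (measure lborel (cball (0::complex) R))"
  proof (rule n2_bounded_support(2))
   fix x :: complex
   show "\<phi> (x + h) - \<phi> x = 0" if "norm x > R"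
    using that h \<phi>(2)[of x] \<phi>(2)[of "x + h"] norm_triangle_ineq2[of x "-h"] by (auto simp: R_def)
   show "norm (\<phi> (x + h) - \<phi> x) \<le> c" using h by (intro d(2)) auto
  qed (auto simp: R_def)
  also have "... \<le> c * (sqrt (measure lborel (cball (0::complex) R)) + 1)" using \<open>c > 0\<close> by simp
  also have "... = e / 3"
  proof -
   have "sqrt (measure lborel (cball (0::complex) R)) + 1 \<noteq> 0" using s by linarith
   then show ?thesis unfolding c_def by (metis nonzero_eq_divide_eq mult.commute divide_divide_eq_left')
  qed
  finally have 1: "n2 lborel (\<lambda>x. \<phi> (x + h) - \<phi> x) \<le> e / 3" .
  have 2: "n2 lborel (\<lambda>x. f (x + h) - \<phi> (x + h)) < e / 3"
   using l2_translate(2)[OF l2_diff[OF f \<phi>(4)], of h] \<phi>(3) by simp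
  have 3: "n2 lborel (\<lambda>x. \<phi> x - f x) < e / 3" using \<phi>(3) n2_minus_commute[of lborel f \<phi>] by simp
  have "n2 lborel (\<lambda>x. f (x + h) - f x) \<le> n2 lborel (\<lambda>x. f (x + h) - \<phi> (x + h)) + n2 lborel (\<lambda>x. \<phi> (x + h) - f x)"
   by (rule n2_triangle_diff[OF l2_translate(1)[OF f] l2_translate(1)[OF \<phi>(4)] f])
  also have "n2 lborel (\<lambda>x. \<phi> (x + h) - f x) \<le> n2 lborel (\<lambda>x. \<phi> (x + h) - \<phi> x) + n2 lborel (\<lambda>x. \<phi> x - f x)"
   by (rule n2_triangle_diff[OF l2_translate(1)[OF \<phi>(4)] \<phi>(4) f])
  finally show "n2 lborel (\<lambda>x. f (x + h) - f x) \<le> e" using 1 2 3 by simp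
 qed (use d in auto)
qed

section \<open>Approximation by functions smooth up to the boundary\<close>

definition avg_kernel :: "complex \<Rightarrow> real \<Rightarrow> cfun" where
 "avg_kernel a e x = of_real (bump (- inverse e *\<^sub>R x + - a) / e^2)"

definition avg :: "complex \<Rightarrow> real \<Rightarrow> cfun \<Rightarrow> cfun" where
 "avg a e f z = (LINT y|lborel. f y * avg_kernel a e (z - y))"

lemma Ck_avg_kernel: "Ck k (avg_kernel a e)"
 unfolding avg_kernel_def divide_inverse of_real_mult
 by (intro Ck_mult Ck_const Ck_affine[OF Ck_bump])

lemma avg_kernel_0: "e > 0 \<Longrightarrow> norm (inverse e *\<^sub>R x + a) > 1 \<Longrightarrow> avg_kernel a e x = 0"
 using bump_eq_0[of "- inverse e *\<^sub>R x + - a"] norm_minus_cancel[of "inverse e *\<^sub>R x + a"]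
 by (simp add: avg_kernel_def minus_add_distrib scaleR_minus_left del: add_uminus_conv_diff norm_minus_cancel)

lemma avg_kernel_support: "e > 0 \<Longrightarrow> norm x > e * (norm a + 1) \<Longrightarrow> avg_kernel a e x = 0"
proof (rule avg_kernel_0)
 assume e: "e > 0" "norm x > e * (norm a + 1)"
 have "norm (inverse e *\<^sub>R x) > norm a + 1" using e by (simp add: field_simps)
 then show "norm (inverse e *\<^sub>R x + a) > 1" using norm_triangle_ineq2[of "inverse e *\<^sub>R x" "- a"] by simp
qed

lemma l2_set_integrable:
 fixes f :: "cfun"
 assumes "l2 lborel f" shows "set_integrable lborel (cball 0 R) f"
proof -
 have [measurable]: "f \<in> bm" using l2_measurable[OF assms] by simp
 have i: "integrable lborel (\<lambda>x. (norm (f x))^2 + indicator (cball 0 R) x)"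
  using l2_integrable[OF assms] by (intro Bochner_Integration.integrable_add integrable_real_indicator emeasure_lborel_cball_finite) auto
 show ?thesis
  unfolding set_integrable_def
 proof (rule Bochner_Integration.integrable_bound[OF i] , goal_cases)
  case 1
  have "f \<in> borel_measurable lborel" by simp
  then show ?case by (intro borel_measurable_scaleR borel_measurable_indicator) auto
 next
  case 2
  show ?case
  proof (rule AE_I2)
  fix x
  have "norm (f x) \<le> (norm (f x))^2 + 1"
   using zero_le_power2[of "norm (f x) - 1/2"] by (simp add: power2_eq_square algebra_simps)
  then show "norm (indicator (cball 0 R) x *\<^sub>R f x) \<le> norm ((norm (f x))^2 + indicator (cball 0 R) x)"
   by (auto simp: indicator_def)
  qed
 qed
qed

context
 fixes f :: "cfun" and a :: complex and e :: real
 assumes f: "l2 lborel f" and e: "e > 0"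
begin

lemma avg_meas: "f \<in> bm"
 using l2_measurable[OF f] by simp

lemma Ck_avg: "Ck k (avg a e f)"
 unfolding avg_def
 by (rule conv_Ck[OF avg_meas l2_set_integrable[OF f] Ck_avg_kernel avg_kernel_support[OF e]])

lemma avg_derivative: "der (avg a e f) z h = (LINT y|lborel. f y * der (avg_kernel a e) (z - y) h)"
proof -
 have "(avg a e f has_derivative (\<lambda>h. LINT y|lborel. f y * der (avg_kernel a e) (z - y) h)) (at z)"
  unfolding avg_def
  by (rule conv_has_derivative[OF avg_meas l2_set_integrable[OF f] Ck_avg_kernel avg_kernel_support[OF e]])
 from fun_cong[OF frechet_derivative_at[OF this], of h] show ?thesis by simp
qed

lemma avg_kernel_shift: "avg_kernel a e (z - (z + e *\<^sub>R y)) = of_real (bump (y - a) / e^2)"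
 using e by (simp add: avg_kernel_def)

lemma avg_integrable: "integrable lborel (\<lambda>y. f (z + e *\<^sub>R y) * of_real (bump (y - a)))"
proof -
 note [measurable] = avg_meas continuous_bm[OF Ck_continuous[OF Ck_avg_kernel[of 0 a e]]]
 have i: "integrable lborel (\<lambda>y. f y * avg_kernel a e (z - y))"
  by (rule conv_integrable[OF avg_meas l2_set_integrable[OF f] Ck_continuous[OF Ck_avg_kernel] avg_kernel_support[OF e]])
 have "integrable lborel (\<lambda>y. f (z + e *\<^sub>R y) * avg_kernel a e (z - (z + e *\<^sub>R y)))"
  using lborel_integral_affine(2)[of e "\<lambda>y. f y * avg_kernel a e (z - y)" z] i e by simp
 then have "integrable lborel (\<lambda>y. of_real (e^2) * (f (z + e *\<^sub>R y) * of_real (bump (y - a) / e^2)))"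
  unfolding avg_kernel_shift by (rule integrable_mult_right)
 moreover have "of_real (e^2) * (f (z + e *\<^sub>R y) * of_real (bump (y - a) / e^2)) = f (z + e *\<^sub>R y) * of_real (bump (y - a))" for y
  using e by (simp add: field_simps)
 ultimately show ?thesis by simp
qed

lemma avg_alt: "avg a e f z = (LINT y|lborel. f (z + e *\<^sub>R y) * of_real (bump (y - a)))"
proof -
 note [measurable] = avg_meas continuous_bm[OF Ck_continuous[OF Ck_avg_kernel[of 0 a e]]]
 have "avg a e f z = e^2 *\<^sub>R (LINT y|lborel. f (z + e *\<^sub>R y) * avg_kernel a e (z - (z + e *\<^sub>R y)))"
  unfolding avg_def by (rule lborel_integral_affine) (use e in auto)
 also have "... = (LINT y|lborel. f (z + e *\<^sub>R y) * of_real (bump (y - a)))"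
  unfolding avg_kernel_shift integral_scaleR_right[symmetric]
  using e by (intro Bochner_Integration.integral_cong) (auto simp: scaleR_conv_of_real)
 finally show ?thesis .
qed

lemma bump_shift_integral: "(LINT y|lborel. bump (y - a)) = 1" "integrable lborel (\<lambda>y. bump (y - a))"
proof -
 have [measurable]: "bump \<in> bm" by (rule continuous_bm[OF continuous_bump])
 show "(LINT y|lborel. bump (y - a)) = 1" "integrable lborel (\<lambda>y. bump (y - a))"
  using lborel_integral_affine[of 1 bump "- a"] integral_bump integrable_bump by simp_all
qed

lemma avg_diff: "avg a e f z - f z = (LINT y|lborel. of_real (bump (y - a)) * (f (z + e *\<^sub>R y) - f z))"
proof -
 have i: "integrable lborel (\<lambda>y. f z * of_real (bump (y - a)))"
  using bump_shift_integral(2) by (intro integrable_mult_right integrable_of_real)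
 have "f z = (LINT y|lborel. f z * of_real (bump (y - a)))"
  using bump_shift_integral by simp
 then have "avg a e f z - f z = (LINT y|lborel. f (z + e *\<^sub>R y) * of_real (bump (y - a)) - f z * of_real (bump (y - a)))"
  unfolding avg_alt using avg_integrable i by (subst Bochner_Integration.integral_diff) auto
 then show ?thesis by (simp add: algebra_simps)
qed

lemma avg_jensen: "ennreal ((norm (avg a e f z - f z))^2) \<le> (NN y. ennreal (bump (y - a) * (norm (f (z + e *\<^sub>R y) - f z))^2))"
proof -
 have [measurable]: "bump \<in> bm" "f \<in> bm"
  by (rule continuous_bm[OF continuous_bump], rule avg_meas)
 define M where "M = density lborel (\<lambda>y. ennreal (bump (y - a)))"
 define g where "g y = f (z + e *\<^sub>R y) - f z" for y
 have [measurable]: "g \<in> bm" unfolding g_def by measurable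
 have one: "emeasure M (space M) = 1"
 proof -
  have "emeasure M (space M) = (NN y. ennreal (bump (y - a)))"
   unfolding M_def by (subst emeasure_density) auto
  also have "... = ennreal (LINT y|lborel. bump (y - a))"
   by (rule nn_integral_eq_integral) (use bump_shift_integral bump_nonneg in auto)
  finally show ?thesis using bump_shift_integral by simp
 qed
 have nn: "(NN y. ennreal (bump (y - a) * (norm (g y))^2)) = (\<integral>\<^sup>+y. ennreal ((norm (g y))^2) \<partial>M)"
  unfolding M_def by (subst nn_integral_density) (auto simp: ennreal_mult' bump_nonneg)
 show ?thesis
 proof (cases "(\<integral>\<^sup>+y. ennreal ((norm (g y))^2) \<partial>M) = \<infinity>")
  case True
  then show ?thesis using nn by (simp add: g_def)
 next
  case False
  have i: "integrable M (\<lambda>y. (norm (g y))^2)"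
   by (rule integrableI_bounded) (use False in \<open>auto simp: M_def less_top\<close>)
  then have l: "l2 M g" by (auto simp: l2_def M_def)
  have i1: "integrable M (\<lambda>y. 1 :: real)" using one by (intro integrableI_bounded) auto
  then have l1: "l2 M (\<lambda>y. 1 :: complex)" by (auto simp: l2_def)
  have m1: "n2 M (\<lambda>y. 1 :: complex) = 1" using one by (simp add: n2_def measure_def)
  have "avg a e f z - f z = (LINT y|lborel. bump (y - a) *\<^sub>R g y)"
   unfolding avg_diff g_def by (simp add: scaleR_conv_of_real)
  also have "... = (LINT y|M. g y)" unfolding M_def by (subst integral_density) (auto simp: bump_nonneg)
  finally have "norm (avg a e f z - f z) \<le> n2 M g" using n2_mult_bound(3)[OF l1 l] m1 by simp
  then have "(norm (avg a e f z - f z))^2 \<le> (n2 M g)^2" by (intro power_mono) auto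
  then have "ennreal ((norm (avg a e f z - f z))^2) \<le> ennreal (LINT y|M. (norm (g y))^2)"
   unfolding n2_power2 by (rule ennreal_leI)
  also have "... = (\<integral>\<^sup>+y. ennreal ((norm (g y))^2) \<partial>M)"
   by (rule nn_integral_eq_integral[symmetric, OF i]) auto
  finally show ?thesis using nn by (simp add: g_def)
 qed
qed

lemma avg_close:
 assumes c: "c \<ge> 0" "\<And>h. norm h \<le> e * (norm a + 1) \<Longrightarrow> n2 lborel (\<lambda>x. f (x + h) - f x) \<le> c"
 shows "l2 lborel (\<lambda>z. avg a e f z - f z)" "n2 lborel (\<lambda>z. avg a e f z - f z) \<le> c"
proof -
 have [measurable]: "bump \<in> bm" "f \<in> bm" "avg a e f \<in> bm"
  by (rule continuous_bm[OF continuous_bump], rule avg_meas,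
    rule continuous_bm[OF Ck_continuous[OF Ck_avg[of 0]]])
 have inner: "(NN z. ennreal ((norm (f (z + e *\<^sub>R y) - f z))^2)) * ennreal (bump (y - a)) \<le> ennreal (c^2) * ennreal (bump (y - a))" for y
 proof (cases "norm (y - a) > 1")
  case True
  then show ?thesis by (simp add: bump_eq_0)
 next
  case False
  then have "norm y \<le> norm a + 1" using norm_triangle_ineq2[of y a] by linarith
  then have h: "norm (e *\<^sub>R y) \<le> e * (norm a + 1)" using e by simp
  have l: "l2 lborel (\<lambda>x. f (x + e *\<^sub>R y) - f x)" by (intro l2_diff l2_translate f)
  have "(NN z. ennreal ((norm (f (z + e *\<^sub>R y) - f z))^2)) = ennreal ((n2 lborel (\<lambda>x. f (x + e *\<^sub>R y) - f x))^2)"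
   unfolding n2_power2 by (rule nn_integral_eq_integral) (auto intro: l2_integrable l)
  also have "... \<le> ennreal (c^2)" using c(2)[OF h] by (intro ennreal_leI power_mono) auto
  finally show ?thesis by (intro mult_right_mono) auto
 qed
 have "(NN z. ennreal ((norm (avg a e f z - f z))^2))
  \<le> (NN z. NN y. ennreal (bump (y - a) * (norm (f (z + e *\<^sub>R y) - f z))^2))"
  by (intro nn_integral_mono avg_jensen)
 also have "... = (NN y. NN z. ennreal (bump (y - a) * (norm (f (z + e *\<^sub>R y) - f z))^2))"
  by (rule lborel_pair.Fubini') measurable
 also have "... = (NN y. (NN z. ennreal ((norm (f (z + e *\<^sub>R y) - f z))^2)) * ennreal (bump (y - a)))"
  by (intro nn_integral_cong, subst nn_integral_multc[symmetric]) (auto simp: ennreal_mult' bump_nonneg mult.commute)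
 also have "... \<le> (NN y. ennreal (c^2) * ennreal (bump (y - a)))"
  by (intro nn_integral_mono inner)
 also have "... = ennreal (c^2) * ennreal (LINT y|lborel. bump (y - a))"
  by (subst nn_integral_cmult, simp, subst nn_integral_eq_integral) (use bump_shift_integral bump_nonneg in auto)
 also have "... = ennreal (c^2)" using bump_shift_integral by simp
 finally have b: "(NN z. ennreal ((norm (avg a e f z - f z))^2)) \<le> ennreal (c^2)" .
 have i: "integrable lborel (\<lambda>z. (norm (avg a e f z - f z))^2)"
  by (rule integrableI_bounded) (use b in \<open>auto simp: less_top[symmetric] top_unique\<close>)
 then show "l2 lborel (\<lambda>z. avg a e f z - f z)" by (auto simp: l2_def)
 have "ennreal ((n2 lborel (\<lambda>z. avg a e f z - f z))^2) = (NN z. ennreal ((norm (avg a e f z - f z))^2))"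
  unfolding n2_power2 by (rule nn_integral_eq_integral[symmetric, OF i]) auto
 then have "(n2 lborel (\<lambda>z. avg a e f z - f z))^2 \<le> c^2" using b by (metis ennreal_le_iff zero_le_power2)
 then show "n2 lborel (\<lambda>z. avg a e f z - f z) \<le> c" using c(1) by (rule power2_le_imp_le)
qed

end

lemma borel_representative:
 fixes u :: "cfun"
 assumes Z: "open Z" and u: "l2 (mu Z) u"
 shows "\<exists>u'. l2 lborel u' \<and> (AE x in lebesgue. u' x = indicator Z x *\<^sub>R u x)
  \<and> (continuous_on Z u \<longrightarrow> u' = (\<lambda>x. indicator Z x *\<^sub>R u x))"
proof -
 have s: "Z \<in> sets lebesgue" "Z \<in> sets borel" using Z by auto
 let ?v = "\<lambda>x. indicator Z x *\<^sub>R u x"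
 have m: "?v \<in> borel_measurable lebesgue"
  using l2_measurable[OF u] s by (simp add: borel_measurable_restrict_space_iff)
 have "integrable lebesgue (\<lambda>x. indicator Z x *\<^sub>R (norm (u x))^2)"
  using l2_integrable[OF u] s by (simp add: integrable_restrict_space)
 moreover have "(\<lambda>x. indicator Z x *\<^sub>R (norm (u x))^2) = (\<lambda>x. (norm (?v x))^2)"
  by (intro ext) (auto simp: indicator_def)
 ultimately have i: "integrable lebesgue (\<lambda>x. (norm (?v x))^2)" by simp
 have "\<exists>u'. u' \<in> bm \<and> (AE x in lebesgue. u' x = ?v x) \<and> (continuous_on Z u \<longrightarrow> u' = ?v)"
 proof (cases "continuous_on Z u")
  case True
  then have "?v \<in> bm" by (intro borel_measurable_continuous_on_indicator s)
  then show ?thesis by blast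
 next
  case False
  obtain r where r: "r \<in> borel_measurable lborel" "AE x in lborel. Re (?v x) = r x"
   using completion_ex_borel_measurable_real[OF measurable_compose[OF m borel_measurable_Re]] by blast
  obtain j where j: "j \<in> borel_measurable lborel" "AE x in lborel. Im (?v x) = j x"
   using completion_ex_borel_measurable_real[OF measurable_compose[OF m borel_measurable_Im]] by blast
  have "(\<lambda>x. Complex (r x) (j x)) \<in> bm" using r j by (intro measurable_Complex) auto
  moreover have "AE x in lebesgue. Complex (r x) (j x) = ?v x"
  proof (rule AE_completion)
   show "AE x in lborel. Complex (r x) (j x) = ?v x"
    using r(2) j(2) by eventually_elim (simp add: complex_eq_iff)
  qed
  ultimately show ?thesis using False by (intro exI[of _ "\<lambda>x. Complex (r x) (j x)"]) simp
 qed
 then obtain u' where u': "u' \<in> bm" "AE x in lebesgue. u' x = ?v x" "continuous_on Z u \<longrightarrow> u' = ?v" by blast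
 have "u' \<in> borel_measurable lebesgue" using u'(1) by (simp add: measurable_completion)
 then have "integrable lebesgue (\<lambda>x. (norm (u' x))^2)"
  by (intro integrable_cong_AE_imp[OF i]) (use u'(2) in auto)
 then have "integrable lborel (\<lambda>x. (norm (u' x))^2)"
  using u'(1) by (subst (asm) integrable_completion) auto
 then have "l2 lborel u'" using u'(1) by (simp add: l2_def)
 then show ?thesis using u'(2,3) by blast
qed

lemma lint_representative:
 fixes u u' F :: "cfun"
 assumes s: "Z \<in> sets lebesgue" and u: "u \<in> borel_measurable (mu Z)"
  and u': "u' \<in> bm" "AE x in lebesgue. u' x = indicator Z x *\<^sub>R u x"
  and F: "F \<in> bm"
 shows "(LINT x|mu Z. u x * F x) = (LINT x|lborel. u' x * F x)"
proof -
 have m: "(\<lambda>x. indicator Z x *\<^sub>R u x) \<in> borel_measurable lebesgue"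
  using u s by (simp add: borel_measurable_restrict_space_iff)
 have [measurable]: "u' \<in> borel_measurable lebesgue" "F \<in> borel_measurable lebesgue"
  using u' F by (simp_all add: measurable_completion)
 have "(LINT x|mu Z. u x * F x) = (LINT x|lebesgue. indicator Z x *\<^sub>R (u x * F x))"
  using s by (subst integral_restrict_space) auto
 also have "... = (LINT x|lebesgue. (indicator Z x *\<^sub>R u x) * F x)"
  by (rule Bochner_Integration.integral_cong) auto
 also have "... = (LINT x|lebesgue. u' x * F x)"
  by (intro integral_cong_AE borel_measurable_times m) (use u'(2) in auto)
 also have "... = (LINT x|lborel. u' x * F x)"
  using u' F by (intro integral_completion) auto
 finally show ?thesis .
qed

lemma l2_lebesgue_on:
 fixes F :: "complex \<Rightarrow> 'b::euclidean_space"
 assumes s: "Z \<in> sets lebesgue" and F: "l2 lborel F"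
 shows "l2 (mu Z) F" "n2 (mu Z) F \<le> n2 lborel F"
proof -
 have [measurable]: "F \<in> bm" using l2_measurable[OF F] by simp
 have i: "integrable lebesgue (\<lambda>x. (norm (F x))^2)"
  by (rule integrable_lebesgue_lborel[OF l2_integrable[OF F]])
 have "F \<in> borel_measurable (mu Z)"
  by (rule measurable_restrict_space1) (simp add: measurable_completion)
 then show "l2 (mu Z) F" using integrable_lebesgue_on[OF s i] by (simp add: l2_def)
 have "(LINT x|mu Z. (norm (F x))^2) = (LINT x|lebesgue. indicator Z x *\<^sub>R (norm (F x))^2)"
  using s by (subst integral_restrict_space) auto
 also have "... \<le> (LINT x|lebesgue. (norm (F x))^2)"
  by (rule integral_mono[OF integrable_mult_indicator[OF s i] i]) (auto simp: indicator_def)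
 also have "... = (LINT x|lborel. (norm (F x))^2)" by (rule integral_completion) simp
 finally show "n2 (mu Z) F \<le> n2 lborel F" by (simp add: n2_def)
qed

lemma n2_triple_le:
 fixes p q u :: "_ \<Rightarrow> complex"
 assumes "l2 M p" "l2 M q" "l2 M u"
 shows "n2 M (\<lambda>x. (p x, q x, u x)) \<le> n2 M p + n2 M q + n2 M u"
proof (rule power2_le_imp_le)
 have "(n2 M (\<lambda>x. (p x, q x, u x)))^2 = (n2 M p)^2 + (n2 M q)^2 + (n2 M u)^2"
  unfolding n2_power2 norm_triple_power2 using assms[THEN l2_integrable] by simp
 also have "... \<le> (n2 M p + n2 M q + n2 M u)^2"
  by (simp add: power2_eq_square algebra_simps)
 finally show "(n2 M (\<lambda>x. (p x, q x, u x)))^2 \<le> (n2 M p + n2 M q + n2 M u)^2" .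
qed simp

context
 fixes d :: complex and m :: real
 assumes d: "norm d = 1"
begin

definition shift_dir :: complex where "shift_dir = of_real (\<bar>m\<bar> + 2) * d"

lemma shift_dir_Sec:
 assumes "z \<in> closure (Sec d m)" "e > 0" "norm (y - shift_dir) \<le> 1"
 shows "z + e *\<^sub>R y \<in> Sec d m"
proof -
 define w where "w = y * cnj d"
 have yw: "y = w * d" using unit_cnj[OF d] by (simp add: w_def mult.assoc)
 have "y - shift_dir = (w - of_real (\<bar>m\<bar> + 2)) * d" by (simp add: yw shift_dir_def algebra_simps)
 then have n: "norm (w - of_real (\<bar>m\<bar> + 2)) \<le> 1" using assms(3) d by (simp add: norm_mult)
 have im: "\<bar>Im w\<bar> \<le> 1" using abs_Im_le_cmod[of "w - of_real (\<bar>m\<bar> + 2)"] n by simp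
 have re: "Re w \<ge> \<bar>m\<bar> + 1" using abs_Re_le_cmod[of "w - of_real (\<bar>m\<bar> + 2)"] n by simp
 have "\<bar>m\<bar> * \<bar>Im w\<bar> \<le> \<bar>m\<bar> * 1" using im by (intro mult_left_mono) auto
 then have "\<bar>m\<bar> * \<bar>Im w\<bar> < Re w" using re by simp
 then have "e * (\<bar>m\<bar> * \<bar>Im w\<bar>) < e * Re w" using assms(2) by simp
 then have "\<bar>m\<bar> * \<bar>Im (e *\<^sub>R w)\<bar> < Re (e *\<^sub>R w)" using assms(2) by (simp add: abs_mult mult_ac)
 from Sec_shift[OF d assms(1) this] show ?thesis by (simp add: yw)
qed

lemma C1c_avg_kernel:
 assumes "z \<in> closure (Sec d m)" "e > 0"
 shows "C1c (Sec d m) (\<lambda>y. avg_kernel shift_dir e (z - y))"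
 unfolding C1c_def
proof (intro conjI exI[of _ "cball (z + e *\<^sub>R shift_dir) e"] allI impI)
 have "Ck 1 (\<lambda>y. avg_kernel shift_dir e ((-1) *\<^sub>R y + z))" by (rule Ck_affine[OF Ck_avg_kernel])
 then show "Ck 1 (\<lambda>y. avg_kernel shift_dir e (z - y))" by simp
 show "cball (z + e *\<^sub>R shift_dir) e \<subseteq> Sec d m"
 proof
  fix y assume "y \<in> cball (z + e *\<^sub>R shift_dir) e"
  then have "norm (e *\<^sub>R ((y - z) /\<^sub>R e - shift_dir)) \<le> e"
   using assms(2) by (simp add: dist_norm norm_minus_commute algebra_simps)
  then have "norm ((y - z) /\<^sub>R e - shift_dir) \<le> 1" using assms(2) by simp
  from shift_dir_Sec[OF assms this] show "y \<in> Sec d m" using assms(2) by simp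
 qed
 fix y assume "y \<notin> cball (z + e *\<^sub>R shift_dir) e"
 then have "norm (e *\<^sub>R (inverse e *\<^sub>R (z - y) + shift_dir)) > e"
  using assms(2) by (simp add: dist_norm algebra_simps)
 then have "norm (inverse e *\<^sub>R (z - y) + shift_dir) > 1" using assms(2) by simp
 then show "avg_kernel shift_dir e (z - y) = 0" by (rule avg_kernel_0[OF assms(2)])
qed simp

lemma avg_weak_derivative:
 assumes z: "z \<in> closure (Sec d m)" and e: "e > 0" and w: "has_weak_partial (Sec d m) b u p" and b: "b \<in> Basis"
  and u: "u \<in> borel_measurable (mu (Sec d m))" "l2 lborel u'" "AE x in lebesgue. u' x = indicator (Sec d m) x *\<^sub>R u x"
  and p: "p \<in> borel_measurable (mu (Sec d m))" "l2 lborel p'" "AE x in lebesgue. p' x = indicator (Sec d m) x *\<^sub>R p x"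
 shows "der (avg shift_dir e u') z b = avg shift_dir e p' z"
proof -
 have s: "Sec d m \<in> sets lebesgue" using open_Sec by auto
 let ?K = "avg_kernel shift_dir e"
 let ?\<phi> = "\<lambda>y. ?K (z - y)"
 have c: "C1c (Sec d m) ?\<phi>" by (rule C1c_avg_kernel[OF z e])
 have C1: "Ck 1 ?\<phi>" using c by (simp add: C1c_def)
 have K1: "Ck 1 ?K" by (rule Ck_avg_kernel)
 have D: "der ?\<phi> y b = - der ?K (z - y) b" for y
 proof -
  have "(?\<phi> has_derivative (\<lambda>h. der ?K (z - y) (- h))) (at y)"
   by (rule has_derivative_compose[of "\<lambda>y. z - y" "\<lambda>h. - h" y UNIV ?K])
     (auto intro!: derivative_eq_intros Ck_1D(1)[OF K1])
  then have "der ?\<phi> y b = der ?K (z - y) (- b)"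
   using frechet_derivative_at by metis
  also have "... = - der ?K (z - y) b"
   by (rule linear_neg[OF has_derivative_linear[OF Ck_1D(1)[OF K1]]])
  finally show ?thesis .
 qed
 have Dm: "(\<lambda>y. der ?\<phi> y b) \<in> bm"
  using Ck_1D(2,3)[OF C1] b by (auto simp: Basis_complex_def intro: continuous_bm)
 have "der (avg shift_dir e u') z b = (LINT y|lborel. u' y * der ?K (z - y) b)"
  by (rule avg_derivative[OF u(2) e])
 also have "... = - (LINT y|lborel. u' y * der ?\<phi> y b)" by (simp add: D)
 also have "... = - (LINT y|mu (Sec d m). u y * der ?\<phi> y b)"
  using l2_measurable[OF u(2)] by (subst lint_representative[OF s u(1) _ u(3) Dm]) auto
 also have "... = (LINT y|mu (Sec d m). p y * ?\<phi> y)"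
  using weak_partial_C1c[OF open_Sec w c] by simp
 also have "... = (LINT y|lborel. p' y * ?\<phi> y)"
  using l2_measurable[OF p(2)]
  by (subst lint_representative[OF s p(1) _ p(3) continuous_bm[OF Ck_continuous[OF C1]]]) auto
 finally show ?thesis by (simp add: avg_def)
qed

theorem Sec_density:
 assumes u: "u \<in> W12 (Sec d m)"
 shows "\<exists>w :: nat \<Rightarrow> cfun. (\<forall>n. Ck 1 (w n) \<and> w n \<in> W12 (Sec d m)) \<and>
  (\<lambda>n. W12_norm (Sec d m) (\<lambda>x. w n x - u x)) \<longlonglongrightarrow> 0 \<and>
  (continuous_on (closure (Sec d m)) u \<longrightarrow> (\<forall>z\<in>closure (Sec d m). (\<lambda>n. w n z) \<longlonglongrightarrow> u z))"
proof -
 let ?S = "Sec d m"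
 let ?M = "mu ?S"
 have s: "?S \<in> sets lebesgue" using open_Sec by auto
 obtain p q where j: "jet ?S u p q" using u by (auto simp: W12_iff)
 then have l: "l2 ?M u" "l2 ?M p" "l2 ?M q" and wp: "has_weak_partial ?S 1 u p" "has_weak_partial ?S \<i> u q"
  by (auto simp: jet_def)
 obtain u' where u': "l2 lborel u'" "AE x in lebesgue. u' x = indicator ?S x *\<^sub>R u x"
   "continuous_on ?S u \<longrightarrow> u' = (\<lambda>x. indicator ?S x *\<^sub>R u x)"
  using borel_representative[OF open_Sec l(1)] by blast
 obtain p' where p': "l2 lborel p'" "AE x in lebesgue. p' x = indicator ?S x *\<^sub>R p x"
  using borel_representative[OF open_Sec l(2)] by blast
 obtain q' where q': "l2 lborel q'" "AE x in lebesgue. q' x = indicator ?S x *\<^sub>R q x"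
  using borel_representative[OF open_Sec l(3)] by blast
 define e where "e n = 1 / (real n + 1)" for n
 have e: "e n > 0" for n by (simp add: e_def)
 have elim: "e \<longlonglongrightarrow> 0" unfolding e_def by real_asymp
 let ?T = "\<lambda>n. avg shift_dir (e n)"
 have conv: "(\<lambda>n. n2 ?M (\<lambda>x. ?T n f' x - f x)) \<longlonglongrightarrow> 0 \<and> (\<forall>n. l2 ?M (?T n f'))"
  if f: "l2 ?M f" "l2 lborel f'" "AE x in lebesgue. f' x = indicator ?S x *\<^sub>R f x" for f f'
 proof -
  have aeS: "AE x in ?M. f' x = f x"
  proof -
   have "AE x in lebesgue. x \<in> ?S \<longrightarrow> f' x = f x" using f(3) by eventually_elim simp
   then show ?thesis using s by (subst AE_restrict_space_iff) auto
  qed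
  have m: "?T n f' \<in> borel_measurable ?M" for n
   by (rule measurable_restrict_space1)
     (simp add: measurable_completion continuous_bm[OF Ck_continuous[OF Ck_avg[OF f(2) e, of 0]]])
  have f'm: "f' \<in> borel_measurable ?M" by (rule l2_measurable[OF l2_lebesgue_on(1)[OF s f(2)]])
  have eqn: "n2 ?M (\<lambda>x. ?T n f' x - f x) = n2 ?M (\<lambda>x. ?T n f' x - f' x)" for n
   by (rule n2_cong_AE) (use m f'm l2_measurable[OF f(1)] aeS in auto)
  have big: "\<exists>N. \<forall>n\<ge>N. l2 lborel (\<lambda>x. ?T n f' x - f' x) \<and> n2 lborel (\<lambda>x. ?T n f' x - f' x) \<le> c" if "c > 0" for c
  proof -
   obtain \<delta> where \<delta>: "\<delta> > 0" "\<And>h. norm h \<le> \<delta> \<Longrightarrow> n2 lborel (\<lambda>x. f' (x + h) - f' x) \<le> c"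
    using l2_translation_continuous[OF f(2) \<open>c > 0\<close>] by blast
   have "(\<lambda>n. e n * (norm shift_dir + 1)) \<longlonglongrightarrow> 0" by (rule tendsto_mult_left_zero[OF elim])
   then obtain N where N: "\<And>n. n \<ge> N \<Longrightarrow> e n * (norm shift_dir + 1) < \<delta>"
    using LIMSEQ_D[of _ 0 \<delta>] \<delta>(1) by (metis abs_less_iff diff_zero real_norm_def)
   have "l2 lborel (\<lambda>x. ?T n f' x - f' x) \<and> n2 lborel (\<lambda>x. ?T n f' x - f' x) \<le> c" if "n \<ge> N" for n
    using avg_close[OF f(2) e[of n], of c shift_dir] \<delta>(2) N[OF that] \<open>c > 0\<close> by auto
   then show ?thesis by blast
  qed
  have l2all: "l2 ?M (?T n f')" for n
  proof -
   have "n2 lborel (\<lambda>x. f' (x + h) - f' x) \<le> 2 * n2 lborel f'" for h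
    using n2_triangle[OF l2_translate(1)[OF f(2), of h] l2_uminus[OF f(2)]] l2_translate(2)[OF f(2), of h]
    by (simp add: n2_def)
   then have "l2 lborel (\<lambda>x. ?T n f' x - f' x)"
    using avg_close(1)[OF f(2) e[of n], of "2 * n2 lborel f'" shift_dir] by simp
   from l2_add[OF this f(2)] have "l2 lborel (?T n f')" by simp
   then show ?thesis by (rule l2_lebesgue_on(1)[OF s])
  qed
  have "(\<lambda>n. n2 ?M (\<lambda>x. ?T n f' x - f x)) \<longlonglongrightarrow> 0"
  proof (rule LIMSEQ_I)
   fix c :: real assume "c > 0"
   obtain N where N: "\<And>n. n \<ge> N \<Longrightarrow> l2 lborel (\<lambda>x. ?T n f' x - f' x) \<and> n2 lborel (\<lambda>x. ?T n f' x - f' x) \<le> c / 2"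
    using big[of "c/2"] \<open>c > 0\<close> by auto
   have "norm (n2 ?M (\<lambda>x. ?T n f' x - f x) - 0) < c" if "n \<ge> N" for n
    using N[OF that] l2_lebesgue_on(2)[OF s, of "\<lambda>x. ?T n f' x - f' x"] \<open>c > 0\<close> by (simp add: eqn)
   then show "\<exists>N. \<forall>n\<ge>N. norm (n2 ?M (\<lambda>x. ?T n f' x - f x) - 0) < c" by blast
  qed
  then show ?thesis using l2all by blast
 qed
 note cu = conv[OF l(1) u'(1,2)] and cp = conv[OF l(2) p'] and cq = conv[OF l(3) q']
 define w where "w n = ?T n u'" for n
 have Ckw: "Ck 1 (w n)" for n unfolding w_def by (rule Ck_avg[OF u'(1) e])
 have D: "der (w n) z 1 = ?T n p' z" "der (w n) z \<i> = ?T n q' z" if "z \<in> ?S" for n z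
 proof -
  have z: "z \<in> closure ?S" using that closure_subset by blast
  show "der (w n) z 1 = ?T n p' z" unfolding w_def
   by (rule avg_weak_derivative[OF z e wp(1) _ l2_measurable[OF l(1)] u'(1,2) l2_measurable[OF l(2)] p'])
     (simp add: Basis_complex_def)
  show "der (w n) z \<i> = ?T n q' z" unfolding w_def
   by (rule avg_weak_derivative[OF z e wp(2) _ l2_measurable[OF l(1)] u'(1,2) l2_measurable[OF l(3)] q'])
     (simp add: Basis_complex_def)
 qed
 have J: "jet ?S (w n) (?T n p') (?T n q')" for n
  unfolding jet_def
 proof (intro conjI)
  show "l2 ?M (w n)" "l2 ?M (?T n p')" "l2 ?M (?T n q')" using cu cp cq by (auto simp: w_def)
  have li: "locally_integrable ?S (w n)" "locally_integrable ?S (?T n p')" "locally_integrable ?S (?T n q')"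
   using cu cp cq by (auto simp: w_def intro!: l2_locally_integrable open_Sec)
  have cl: "has_weak_partial ?S 1 (w n) (\<lambda>x. der (w n) x 1)"
   "has_weak_partial ?S \<i> (w n) (\<lambda>x. der (w n) x \<i>)"
   by (rule classical_weak_partial[OF open_Sec Ck_C1on[OF Ckw]]; simp add: Basis_complex_def)+
  show "has_weak_partial ?S 1 (w n) (?T n p')"
   by (rule has_weak_partial_cong[OF open_Sec cl(1) li(1,2)]) (auto intro!: AE_I2 D(1))
  show "has_weak_partial ?S \<i> (w n) (?T n q')"
   by (rule has_weak_partial_cong[OF open_Sec cl(2) li(1,3)]) (auto intro!: AE_I2 D(2))
 qed
 have lim: "(\<lambda>n. W12_norm ?S (\<lambda>x. w n x - u x)) \<longlonglongrightarrow> 0"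
 proof (rule Lim_null_comparison)
  show "(\<lambda>n. n2 ?M (\<lambda>x. ?T n p' x - p x) + n2 ?M (\<lambda>x. ?T n q' x - q x) + n2 ?M (\<lambda>x. w n x - u x)) \<longlonglongrightarrow> 0"
   using cu cp cq by (auto simp: w_def intro!: tendsto_eq_intros)
  have "W12_norm ?S (\<lambda>x. w n x - u x) \<le> n2 ?M (\<lambda>x. ?T n p' x - p x) + n2 ?M (\<lambda>x. ?T n q' x - q x) + n2 ?M (\<lambda>x. w n x - u x)" for n
   unfolding W12_norm_jet[OF open_Sec jet_diff[OF open_Sec J j]]
   by (intro n2_triple_le l2_diff l) (use cu cp cq in \<open>auto simp: w_def\<close>)
  then show "\<forall>\<^sub>F n in sequentially. norm (W12_norm ?S (\<lambda>x. w n x - u x))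
   \<le> n2 ?M (\<lambda>x. ?T n p' x - p x) + n2 ?M (\<lambda>x. ?T n q' x - q x) + n2 ?M (\<lambda>x. w n x - u x)"
   by (simp add: W12_norm_nonneg)
 qed
 have pt: "(\<lambda>n. w n z) \<longlonglongrightarrow> u z" if c: "continuous_on (closure ?S) u" and z: "z \<in> closure ?S" for z
 proof (rule LIMSEQ_I)
  fix r :: real assume "r > 0"
  have u'e: "u' x = u x" if "x \<in> ?S" for x
   using u'(3) continuous_on_subset[OF c closure_subset] that by simp
  obtain \<delta> where \<delta>: "\<delta> > 0" "\<And>x. x \<in> closure ?S \<Longrightarrow> dist x z < \<delta> \<Longrightarrow> dist (u x) (u z) < r / 2"
   using c z \<open>r > 0\<close> unfolding continuous_on_iff by (meson half_gt_zero)
  have "(\<lambda>n. e n * (norm shift_dir + 1)) \<longlonglongrightarrow> 0" by (rule tendsto_mult_left_zero[OF elim])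
  then obtain N where N: "\<And>n. n \<ge> N \<Longrightarrow> e n * (norm shift_dir + 1) < \<delta>"
   using LIMSEQ_D[of _ 0 \<delta>] \<delta>(1) by (metis abs_less_iff diff_zero real_norm_def)
  have "norm (w n z - u z) < r" if "n \<ge> N" for n
  proof -
   let ?b = "\<lambda>y. bump (y - shift_dir)"
   note bi = bump_shift_integral[OF u'(1) e[of n], of shift_dir]
   have i1: "integrable lborel (\<lambda>y. u' (z + e n *\<^sub>R y) * of_real (?b y))" by (rule avg_integrable[OF u'(1) e])
   have i2: "integrable lborel (\<lambda>y. u z * of_real (?b y))"
    using bi(2) by (intro integrable_mult_right integrable_of_real)
   have "w n z - u z = (LINT y|lborel. u' (z + e n *\<^sub>R y) * of_real (?b y)) - (LINT y|lborel. u z * of_real (?b y))"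
    unfolding w_def avg_alt[OF u'(1) e] using bi by simp
   also have "... = (LINT y|lborel. (u' (z + e n *\<^sub>R y) - u z) * of_real (?b y))"
    using i1 i2 by (simp add: left_diff_distrib)
   also have "norm ... \<le> (LINT y|lborel. norm ((u' (z + e n *\<^sub>R y) - u z) * of_real (?b y)))"
    by (rule integral_norm_bound)
   also have "... \<le> (LINT y|lborel. r / 2 * ?b y)"
   proof (rule integral_mono)
    show "integrable lborel (\<lambda>y. norm ((u' (z + e n *\<^sub>R y) - u z) * of_real (?b y)))"
     unfolding left_diff_distrib using i1 i2 by (intro integrable_norm Bochner_Integration.integrable_diff)
    show "integrable lborel (\<lambda>y. r / 2 * ?b y)" using bi by (intro integrable_mult_right)
    fix y
    show "norm ((u' (z + e n *\<^sub>R y) - u z) * of_real (?b y)) \<le> r / 2 * ?b y"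
    proof (cases "norm (y - shift_dir) > 1")
     case True
     then show ?thesis by (simp add: bump_eq_0)
    next
     case False
     then have S: "z + e n *\<^sub>R y \<in> ?S" by (intro shift_dir_Sec[OF z e]) simp
     have "norm y \<le> norm shift_dir + 1" using False norm_triangle_ineq2[of y shift_dir] by linarith
     then have "e n * norm y \<le> e n * (norm shift_dir + 1)" using e[of n] by (intro mult_left_mono) auto
     also have "... < \<delta>" by (rule N[OF that])
     finally have "dist (z + e n *\<^sub>R y) z < \<delta>" using e[of n] by (simp add: dist_norm)
     then have "norm (u (z + e n *\<^sub>R y) - u z) \<le> r / 2"
      using \<delta>(2)[of "z + e n *\<^sub>R y"] S closure_subset[of ?S] by (auto simp: dist_norm)
     then show ?thesis using bump_nonneg[of "y - shift_dir"] u'e[OF S]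
      by (simp only: norm_mult norm_of_real abs_of_nonneg) (rule mult_right_mono)
    qed
   qed
   also have "... = r / 2" using bi by simp
   finally show ?thesis using \<open>r > 0\<close> by simp
  qed
  then show "\<exists>N. \<forall>n\<ge>N. norm (w n z - u z) < r" by blast
 qed
 show ?thesis using Ckw jet_W12[OF J] lim pt by (intro exI[of _ w]) blast
qed

end

section \<open>Traces on the sides of a sector\<close>

lemma nn_lebesgue_on:
 fixes f :: "complex \<Rightarrow> real"
 assumes "Z \<in> sets borel" "f \<in> bm" "\<And>x. 0 \<le> f x" "integrable (mu Z) f"
 shows "(NN z. ennreal (f z) * indicator Z z) = ennreal (LINT x|mu Z. f x)"
proof -
 note [measurable] = assms(1,2)
 have s: "Z \<in> sets lebesgue" using assms(1) by simp
 have "integrable lebesgue (\<lambda>x. indicator Z x *\<^sub>R f x)"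
  using assms(4) s by (simp add: integrable_restrict_space)
 then have i: "integrable lborel (\<lambda>x. indicator Z x *\<^sub>R f x)"
  by (subst (asm) integrable_completion) auto
 have "(LINT x|mu Z. f x) = (LINT x|lebesgue. indicator Z x *\<^sub>R f x)"
  using s by (subst integral_restrict_space) auto
 also have "... = (LINT x|lborel. indicator Z x *\<^sub>R f x)" by (rule integral_completion) simp
 finally have "ennreal (LINT x|mu Z. f x) = (NN z. ennreal (indicator Z z *\<^sub>R f z))"
  using nn_integral_eq_integral[OF i] assms(3) by simp
 also have "... = (NN z. ennreal (f z) * indicator Z z)"
  by (intro nn_integral_cong) (auto simp: indicator_def)
 finally show ?thesis by simp
qed

lemma jet_classical:
 assumes "open Z" "Ck 1 w" "w \<in> W12 Z"
 shows "jet Z w (\<lambda>x. der w x 1) (\<lambda>x. der w x \<i>)"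
proof -
 obtain p q where j: "jet Z w p q" using assms(3) by (auto simp: W12_iff)
 have cl: "has_weak_partial Z 1 w (\<lambda>x. der w x 1)"
   "has_weak_partial Z \<i> w (\<lambda>x. der w x \<i>)"
  by (rule classical_weak_partial[OF assms(1) Ck_C1on[OF assms(2)]]; simp add: Basis_complex_def)+
 have m: "(\<lambda>x. der w x 1) \<in> borel_measurable (mu Z)"
  "(\<lambda>x. der w x \<i>) \<in> borel_measurable (mu Z)"
  using cl assms(1) by (auto simp: has_weak_partial_def intro: locally_integrable_measurable)
 have "l2 (mu Z) (\<lambda>x. der w x 1)"
  by (rule l2_cong_AE[of _ p, OF _ m(1)]) (use j weak_partial_unique[OF assms(1) _ cl(1), of p] in \<open>auto simp: jet_def\<close>)
 moreover have "l2 (mu Z) (\<lambda>x. der w x \<i>)"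
  by (rule l2_cong_AE[of _ q, OF _ m(2)]) (use j weak_partial_unique[OF assms(1) _ cl(2), of q] in \<open>auto simp: jet_def\<close>)
 ultimately show ?thesis using j cl by (simp add: jet_def)
qed

lemma directional:
 assumes "Ck 1 w"
 shows "der w x h = of_real (Re h) * der w x 1 + of_real (Im h) * der w x \<i>"
 using frechet_complex[OF Ck_1D(1)[OF assms], of x h] by (simp add: scaleR_conv_of_real)

lemma continuous_directional:
 assumes "Ck 1 w" shows "continuous_on UNIV (\<lambda>x. der w x h)"
proof -
 have "continuous_on UNIV (\<lambda>x. of_real (Re h) * der w x 1 + of_real (Im h) * der w x \<i>)"
  by (intro continuous_intros Ck_1D[OF assms])
 then show ?thesis by (rule continuous_on_eq) (rule directional[OF assms, symmetric])
qed

lemma norm_directional: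
 assumes "Ck 1 w" "norm h = 1"
 shows "(norm (der w x h))^2 \<le> (norm (der w x 1))^2 + (norm (der w x \<i>))^2"
proof -
 define P where "P = norm (der w x 1)"
 define Q where "Q = norm (der w x \<i>)"
 have h: "(Re h)^2 + (Im h)^2 = 1" using assms(2) cmod_power2[of h] by simp
 have "norm (der w x h) \<le> \<bar>Re h\<bar> * P + \<bar>Im h\<bar> * Q"
  unfolding directional[OF assms(1), of x h] P_def Q_def by (rule order_trans[OF norm_triangle_ineq]) (simp add: norm_mult)
 then have "(norm (der w x h))^2 \<le> (\<bar>Re h\<bar> * P + \<bar>Im h\<bar> * Q)^2" by (intro power_mono) auto
 also have "... \<le> ((Re h)^2 + (Im h)^2) * (P^2 + Q^2)"
 proof -
  have "0 \<le> (\<bar>Re h\<bar> * Q - \<bar>Im h\<bar> * P)^2" by simp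
  then show ?thesis by (simp add: power2_sum power2_diff power_mult_distrib algebra_simps)
 qed
 finally show ?thesis using h by (simp add: P_def Q_def)
qed

context
 fixes d :: complex and m :: real
 assumes d: "norm d = 1"
begin

lemma flatten_has_derivative:
 "((\<lambda>s. flatten d m s y) has_vector_derivative d) (at s within X)"
proof -
 have "((\<lambda>s. flatten d m 0 y + of_real s * d) has_vector_derivative d) (at s within X)"
  by (auto intro!: derivative_eq_intros)
 moreover have "(\<lambda>s. flatten d m 0 y + of_real s * d) = (\<lambda>s. flatten d m s y)"
  by (rule ext) (simp add: flatten_def Complex_eq algebra_simps)
 ultimately show ?thesis by (simp only:)
qed

lemma compose_vector_derivative:
 assumes "Ck 1 w" "(g has_vector_derivative g') (at s within X)"
 shows "((\<lambda>s. w (g s)) has_vector_derivative der w (g s) g') (at s within X)"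
proof -
 have "((\<lambda>s. w (g s)) has_derivative (\<lambda>h. der w (g s) (h *\<^sub>R g'))) (at s within X)"
  using assms(2) unfolding has_vector_derivative_def
  by (rule has_derivative_compose[OF _ Ck_1D(1)[OF assms(1)]])
 moreover have "der w (g s) (h *\<^sub>R g') = h *\<^sub>R der w (g s) g'" for h
  by (rule linear_scale[OF has_derivative_linear[OF Ck_1D(1)[OF assms(1)]]])
 ultimately show ?thesis unfolding has_vector_derivative_def by (simp only:)
qed

text \<open>The boundary value is \<open>\<integral>\<^sub>0\<^sup>1 - d/ds ((1 - s) w) ds\<close>.\<close>

lemma trace_pointwise:
 assumes w: "Ck 1 w"
 shows "ennreal ((norm (w (flatten d m 0 y)))^2) \<le>
  (NN s. ennreal (2 * (norm (w (flatten d m s y)))^2 + 2 * (norm (der w (flatten d m s y) d))^2)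
   * indicator {0..1} s)"
proof -
 let ?w = "\<lambda>s. w (flatten d m s y)"
 let ?D = "\<lambda>s. der w (flatten d m s y) d"
 define g where "g s = of_real (1 - s) * ?D s - ?w s" for s
 have wc: "continuous_on UNIV ?w"
  by (rule continuous_on_compose2[OF Ck_continuous[OF w]]) (auto intro!: continuous_intros)
 have Dc: "continuous_on UNIV ?D"
  by (rule continuous_on_compose2[OF continuous_directional[OF w]]) (auto intro!: continuous_intros)
 have gc: "continuous_on UNIV g" unfolding g_def by (intro continuous_intros wc Dc)
 have "has_bochner_integral lborel (\<lambda>s. indicator {0..1} s *\<^sub>R g s) (of_real (1 - 1) * ?w 1 - of_real (1 - 0) * ?w 0)"
 proof (rule has_bochner_integral_FTC_Icc)
  fix s :: real
  show "((\<lambda>s. of_real (1 - s) * ?w s) has_vector_derivative g s) (at s within {0..1})"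
   unfolding g_def
   by (auto intro!: derivative_eq_intros compose_vector_derivative[OF w flatten_has_derivative])
 qed (auto intro: continuous_on_subset[OF gc])
 then have I: "(LINT s|lborel. indicator {0..1} s *\<^sub>R g s) = - w (flatten d m 0 y)" and gi: "integrable lborel (\<lambda>s. indicator {0..1} s *\<^sub>R g s)"
  by (auto simp: has_bochner_integral_iff)
 define i1 where "i1 s = indicator {0..1} s *\<^sub>R (1 :: complex)" for s :: real
 have l1: "l2 lborel i1"
 proof -
  have "(\<lambda>s. (norm (i1 s))^2) = (\<lambda>s. indicator {0..1} s)" by (auto simp: i1_def indicator_def)
  moreover have "i1 \<in> borel_measurable lborel" unfolding i1_def[abs_def] by measurable
  ultimately show ?thesis by (auto simp: l2_def)
 qed
 have n1: "n2 lborel i1 = 1"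
 proof -
  have "(\<lambda>s. (norm (i1 s))^2) = (\<lambda>s. indicator {0..1} s)" by (auto simp: i1_def indicator_def)
  then show ?thesis by (simp add: n2_def)
 qed
 have sq: "(\<lambda>s. (norm (indicator {0..1} s *\<^sub>R g s))^2) = (\<lambda>s. indicator {0..1} s *\<^sub>R (norm (g s))^2)"
  by (auto simp: indicator_def)
 have gi2: "integrable lborel (\<lambda>s. indicator {0..1} s *\<^sub>R (norm (g s))^2)"
  by (rule borel_integrable_compact) (auto intro!: continuous_intros continuous_on_subset[OF gc])
 have l2: "l2 lborel (\<lambda>s. indicator {0..1} s *\<^sub>R g s)"
  unfolding l2_def sq using gi2 borel_measurable_integrable[OF gi] by simp
 have "(\<lambda>s. i1 s * (indicator {0..1} s *\<^sub>R g s)) = (\<lambda>s. indicator {0..1} s *\<^sub>R g s)"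
  by (auto simp: i1_def indicator_def)
 then have "norm (w (flatten d m 0 y)) \<le> n2 lborel (\<lambda>s. indicator {0..1} s *\<^sub>R g s)"
  using n2_mult_bound(3)[OF l1 l2] n1 I by simp
 then have "(norm (w (flatten d m 0 y)))^2 \<le> (n2 lborel (\<lambda>s. indicator {0..1} s *\<^sub>R g s))^2" by (intro power_mono) auto
 also have "... = (LINT s|lborel. indicator {0..1} s *\<^sub>R (norm (g s))^2)" unfolding n2_power2 sq by simp
 finally have "ennreal ((norm (w (flatten d m 0 y)))^2) \<le> ennreal (LINT s|lborel. indicator {0..1} s *\<^sub>R (norm (g s))^2)"
  by (rule ennreal_leI)
 also have "... = (NN s. ennreal (indicator {0..1} s *\<^sub>R (norm (g s))^2))"
  by (rule nn_integral_eq_integral[symmetric, OF gi2]) auto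
 also have "... \<le> (NN s. ennreal (2 * (norm (?w s))^2 + 2 * (norm (?D s))^2) * indicator {0..1} s)"
 proof (rule nn_integral_mono)
  fix s :: real
  have "(norm (g s))^2 \<le> 2 * (norm (?w s))^2 + 2 * (norm (?D s))^2" if "s \<in> {0..1}"
  proof -
   have "(norm (g s))^2 \<le> 2 * (norm (of_real (1 - s) * ?D s))^2 + 2 * (norm (- ?w s))^2"
    unfolding g_def using norm_add_power2_le[of "of_real (1 - s) * ?D s" "- ?w s"] by simp
   moreover have "(norm (of_real (1 - s) * ?D s))^2 \<le> (norm (?D s))^2"
    using that by (intro power_mono) (auto simp: norm_mult simp del: of_real_diff intro!: mult_left_le_one_le)
   ultimately show ?thesis by (simp only: norm_minus_cancel)
  qed
  then show "ennreal (indicator {0..1} s *\<^sub>R (norm (g s))^2) \<le> ennreal (2 * (norm (?w s))^2 + 2 * (norm (?D s))^2) * indicator {0..1} s"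
   by (auto simp: indicator_def simp del: ennreal_plus intro!: ennreal_leI)
 qed
 finally show ?thesis .
qed

lemma trace_C1:
 assumes w: "Ck 1 w" "w \<in> W12 (Sec d m)"
 shows "(NN y. ennreal ((norm (w (flatten d m 0 y)))^2)) \<le> ennreal (2 * (W12_norm (Sec d m) w)^2)"
proof -
 let ?S = "Sec d m"
 let ?p = "\<lambda>x. der w x 1"
 let ?q = "\<lambda>x. der w x \<i>"
 have j: "jet ?S w ?p ?q" by (rule jet_classical[OF open_Sec w])
 define G where "G z = (norm (?p z, ?q z, w z))^2" for z
 define H where "H z = 2 * (norm (w z))^2 + 2 * (norm (der w z d))^2" for z
 have HG: "H z \<le> 2 * G z" for z
  using norm_directional[OF w(1) d, of z] by (simp add: H_def G_def norm_triple_power2)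
 have "continuous_on UNIV G" unfolding G_def norm_triple_power2
  by (intro continuous_intros Ck_continuous[OF w(1)] Ck_1D[OF w(1)])
 then have Gm [measurable]: "G \<in> bm" by (rule continuous_bm)
 have Sm [measurable]: "?S \<in> sets borel" using open_Sec by auto
 have ae: "AE s in lborel. s \<noteq> (0 :: real)" by (rule AE_lborel_singleton)
 have "(NN y. ennreal ((norm (w (flatten d m 0 y)))^2))
  \<le> (NN y. NN s. ennreal (H (flatten d m s y)) * indicator {0..1} s)"
  unfolding H_def by (intro nn_integral_mono trace_pointwise w)
 also have "... \<le> (NN y. NN s. ennreal (2 * G (flatten d m s y)) * indicator ?S (flatten d m s y))"
 proof (rule nn_integral_mono, rule nn_integral_mono_AE)
  fix y :: real
  show "AE s in lborel. ennreal (H (flatten d m s y)) * indicator {0..1} s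
    \<le> ennreal (2 * G (flatten d m s y)) * indicator ?S (flatten d m s y)"
   using ae by eventually_elim (auto simp: indicator_def flatten_Sec[OF d] intro!: ennreal_leI HG)
 qed
 also have "... = (NN z. ennreal (2 * G z) * indicator ?S z)"
  by (rule nn_integral_flatten[OF d, symmetric]) measurable
 also have "... = ennreal (LINT x|mu ?S. 2 * G x)"
 proof (rule nn_lebesgue_on[OF Sm])
  have "integrable (mu ?S) G" using l2_integrable[OF jet_l2[OF j]] by (simp add: G_def[abs_def])
  then show "integrable (mu ?S) (\<lambda>z. 2 * G z)" by simp
  show "0 \<le> 2 * G z" for z by (simp add: G_def)
 qed simp
 also have "(LINT x|mu ?S. 2 * G x) = 2 * (W12_norm ?S w)^2"
  unfolding W12_norm_jet[OF open_Sec j] n2_power2 G_def by simp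
 finally show ?thesis .
qed

lemma trace_continuous:
 assumes w: "w \<in> W12 (Sec d m)" "continuous_on (closure (Sec d m)) w"
 shows "(NN y. ennreal ((norm (w (flatten d m 0 y)))^2)) \<le> ennreal (2 * (W12_norm (Sec d m) w)^2)"
proof -
 let ?S = "Sec d m"
 obtain v where v: "\<And>n. Ck 1 (v n)" "\<And>n. v n \<in> W12 ?S" "(\<lambda>n. W12_norm ?S (\<lambda>x. v n x - w x)) \<longlonglongrightarrow> 0"
  "\<And>z. z \<in> closure ?S \<Longrightarrow> (\<lambda>n. v n z) \<longlonglongrightarrow> w z"
  using Sec_density[OF d w(1)] w(2) by blast
 have lim: "(\<lambda>n. W12_norm ?S (v n)) \<longlonglongrightarrow> W12_norm ?S w"
 proof (rule LIM_zero_cancel, rule Lim_null_comparison[OF _ v(3)])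
  show "\<forall>\<^sub>F n in sequentially. norm (W12_norm ?S (v n) - W12_norm ?S w) \<le> W12_norm ?S (\<lambda>x. v n x - w x)"
   using W12_norm_le_diff[OF open_Sec v(2) w(1)] by simp
 qed
 have [measurable]: "v n \<in> bm" for n
  by (rule continuous_bm[OF Ck_continuous[OF v(1)]])
 have cl: "flatten d m 0 y \<in> closure ?S" for y by (simp add: flatten_closure[OF d])
 have "(NN y. ennreal ((norm (w (flatten d m 0 y)))^2))
  = (NN y. liminf (\<lambda>n. ennreal ((norm (v n (flatten d m 0 y)))^2)))"
 proof (intro nn_integral_cong)
  fix y
  have "(\<lambda>n. ennreal ((norm (v n (flatten d m 0 y)))^2)) \<longlonglongrightarrow> ennreal ((norm (w (flatten d m 0 y)))^2)"
   by (intro tendsto_intros v(4)[OF cl])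
  from lim_imp_Liminf[OF _ this] show "ennreal ((norm (w (flatten d m 0 y)))^2) = liminf (\<lambda>n. ennreal ((norm (v n (flatten d m 0 y)))^2))"
   by simp
 qed
 also have "... \<le> liminf (\<lambda>n. NN y. ennreal ((norm (v n (flatten d m 0 y)))^2))"
  by (rule nn_integral_liminf) measurable
 also have "... \<le> liminf (\<lambda>n. ennreal (2 * (W12_norm ?S (v n))^2))"
  by (rule Liminf_mono) (intro always_eventually allI trace_C1 v)
 also have "... = ennreal (2 * (W12_norm ?S w)^2)"
  by (rule lim_imp_Liminf) (auto intro!: tendsto_intros lim)
 finally show ?thesis .
qed

lemma boundary_integrable:
 fixes f :: "cfun"
 assumes f: "continuous_on UNIV f" "\<And>y. norm y > B \<Longrightarrow> f y = 0"
 shows "integrable lborel (\<lambda>y. f (flatten d m 0 y))"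
proof -
 have "integrable lborel (\<lambda>y. indicator {-B..B} y *\<^sub>R f (flatten d m 0 y))"
  by (rule borel_integrable_compact) (auto intro!: continuous_on_compose2[OF f(1)] continuous_intros)
 moreover have "(\<lambda>y. indicator {-B..B} y *\<^sub>R f (flatten d m 0 y)) = (\<lambda>y. f (flatten d m 0 y))"
 proof
  fix y show "indicator {-B..B} y *\<^sub>R f (flatten d m 0 y) = f (flatten d m 0 y)"
   using norm_flatten[OF d, of y m 0] f(2)[of "flatten d m 0 y"] by (cases "\<bar>y\<bar> \<le> B") (auto simp: indicator_def)
 qed
 ultimately show ?thesis by simp
qed

text \<open>The integral of \<open>\<partial>\<^sub>b f\<close> over the sector is the derivative of the integral of \<open>f\<close> over its
 translates, which differ from it by thin strips along the boundary.\<close>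

theorem Sec_boundary_estimate:
 assumes f: "Ck 1 f" "\<And>y. norm y > B \<Longrightarrow> f y = 0" and b: "norm b = 1"
 shows "norm (LINT z|lborel. indicator (Sec d m) z *\<^sub>R der f z b)
  \<le> 2 * (1 + \<bar>m\<bar>) * (LINT y|lborel. norm (f (flatten d m 0 y)))"
proof -
 let ?S = "Sec d m"
 note fc = Ck_continuous[OF f(1)]
 define A where "A = (LINT y|lborel. norm (f (flatten d m 0 y)))"
 define c where "c = 1 + \<bar>m\<bar>"
 define J where "J z = (LINT x|lborel. indicator ?S (x - z) *\<^sub>R f x)" for z
 have Sm [measurable]: "?S \<in> sets borel" using open_Sec by auto
 have fm [measurable]: "f \<in> bm" by (rule continuous_bm[OF fc])
 have Dm [measurable]: "(\<lambda>z. der f z b) \<in> bm"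
  by (rule continuous_bm[OF continuous_directional[OF f(1)]])
 have fi: "integrable lborel f" by (rule integrable_compact_support[OF fc f(2)])
 have si: "integrable lborel (\<lambda>x. indicator ?S (x - z) *\<^sub>R f x)" for z
  by (rule Bochner_Integration.integrable_bound[OF fi]) (auto simp: indicator_def)
 have A: "A \<ge> 0" by (simp add: A_def)
 have ind: "indicator ?S x *\<^sub>R w = indicator ?S x * w" for x and w :: complex by (simp add: indicator_def)
 have c: "c > 0" by (simp add: c_def)
 have sI: "set_integrable lborel (cball 0 R) (\<lambda>y. indicator ?S (- y) :: complex)" for R
 proof -
  have "set_integrable lborel (cball 0 R) (\<lambda>y. 1 :: complex)"
   unfolding set_integrable_def by (rule borel_integrable_compact) auto
  then show ?thesis unfolding set_integrable_def
   by (rule Bochner_Integration.integrable_bound) (auto simp: indicator_def)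
 qed
 have "((\<lambda>z. LINT y|lborel. indicator ?S (- y) * f (z - y)) has_derivative
   (\<lambda>h. LINT y|lborel. indicator ?S (- y) * der f (0 - y) h)) (at 0)"
  by (rule conv_has_derivative[OF _ sI f]) auto
 moreover have "(LINT y|lborel. indicator ?S (- y) * f (z - y)) = J z" for z
  unfolding J_def using lborel_integral_affine(1)[of "-1" "\<lambda>x. indicator ?S (x - z) *\<^sub>R f x" z]
  by (simp add: ind)
 ultimately have dJ: "(J has_derivative (\<lambda>h. LINT y|lborel. indicator ?S (- y) * der f (0 - y) h)) (at 0)"
  by simp
 have db: "(LINT y|lborel. indicator ?S (- y) * der f (0 - y) b) = (LINT z|lborel. indicator ?S z *\<^sub>R der f z b)"
  using lborel_integral_affine(1)[of "-1" "\<lambda>z. indicator ?S z *\<^sub>R der f z b" 0]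
  by (simp add: ind)
 define I where "I = (LINT z|lborel. indicator ?S z *\<^sub>R der f z b)"
 define r where "r t = norm (J (t *\<^sub>R b) - J 0 - t *\<^sub>R I) / \<bar>t\<bar>" for t
 have v: "((\<lambda>t::real. t *\<^sub>R b) has_vector_derivative b) (at 0)" by (auto intro!: derivative_eq_intros)
 have "(J has_derivative (\<lambda>h. LINT y|lborel. indicator ?S (- y) * der f (0 - y) h)) (at (0 *\<^sub>R b) within range (\<lambda>t. t *\<^sub>R b))"
  using has_derivative_at_withinI[OF dJ] by simp
 from vector_derivative_diff_chain_within[OF v this]
 have "((\<lambda>t::real. J (t *\<^sub>R b)) has_vector_derivative I) (at 0)" unfolding o_def db I_def .
 then have "(r \<longlongrightarrow> 0) (at 0)" by (simp add: has_vector_derivative_def has_derivative_at r_def[abs_def])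
 then have "(r \<longlongrightarrow> 0) (at_right 0)" by (rule tendsto_mono[OF at_le, rotated]) simp
 then have lim: "((\<lambda>t. x + r t) \<longlongrightarrow> x + 0) (at_right 0)" for x by (intro tendsto_intros)
 have main: "norm I \<le> 2 * c * (A + 2 * \<bar>B\<bar> * e)" if e: "e > 0" for e
 proof -
  obtain \<delta> where \<delta>: "\<delta> > 0" "\<And>x y. norm (x - y) \<le> \<delta> \<Longrightarrow> norm (f x - f y) \<le> e"
   using uniformly_continuous_compact_support[of f B e] fc f(2) e by blast
  have est: "norm I \<le> 2 * c * (A + 2 * \<bar>B\<bar> * e) + r t" if t: "0 < t" "c * t < \<delta>" for t
  proof -
   let ?h = "\<lambda>x. indicator ?S (x - t *\<^sub>R b) *\<^sub>R f x - indicator ?S x *\<^sub>R f x"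
   let ?G = "\<lambda>y. norm (f (flatten d m 0 y)) + e * indicator {-\<bar>B\<bar>..\<bar>B\<bar>} y"
   have hi: "integrable lborel ?h" using si[of "t *\<^sub>R b"] si[of 0] by simp
   have pt: "norm (?h (flatten d m s y)) \<le> indicator {- (c * t)..c * t} s * ?G y" for s y
   proof (cases "\<bar>s\<bar> \<le> c * t")
    case True
    have "norm (f (flatten d m s y)) \<le> ?G y"
    proof (cases "\<bar>y\<bar> \<le> \<bar>B\<bar>")
     case True
     have "flatten d m s y - flatten d m 0 y = of_real s * d" by (simp add: flatten_def complex_eq_iff algebra_simps)
     then have "norm (flatten d m s y - flatten d m 0 y) \<le> \<delta>" using \<open>\<bar>s\<bar> \<le> c * t\<close> t d by (simp add: norm_mult)
     from \<delta>(2)[OF this] have "norm (f (flatten d m s y)) \<le> norm (f (flatten d m 0 y)) + e"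
      using norm_triangle_sub[of "f (flatten d m s y)" "f (flatten d m 0 y)"] by linarith
     moreover have "y \<in> {-\<bar>B\<bar>..\<bar>B\<bar>}" using True by auto
     ultimately show ?thesis by simp
    next
     case False
     then have "f (flatten d m s y) = 0" using norm_flatten[OF d, of y m s] by (intro f(2)) linarith
     then show ?thesis using e by simp
    qed
    moreover have "norm (?h z) \<le> norm (f z)" for z by (auto simp: indicator_def)
    ultimately show ?thesis using True order_trans by (fastforce simp: abs_le_iff)
   next
    case False
    define z where "z = flatten d m s y * cnj d"
    define k where "k = t *\<^sub>R b * cnj d"
    have z: "Re z = s + m * \<bar>y\<bar>" "Im z = y" using unit_cnj[OF d] by (simp_all add: z_def flatten_def mult.assoc del: times_complex.sel)
    have "norm k = t" using b d t by (simp add: k_def norm_mult)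
    then have k: "\<bar>Re k\<bar> \<le> t" "\<bar>Im k\<bar> \<le> t" using abs_Re_le_cmod[of k] abs_Im_le_cmod[of k] by auto
    have "\<bar>m * \<bar>Im (z - k)\<bar> - m * \<bar>Im z\<bar>\<bar> \<le> \<bar>m\<bar> * t"
    proof -
     have "\<bar>\<bar>Im (z - k)\<bar> - \<bar>Im z\<bar>\<bar> \<le> t" using k by simp
     then show ?thesis by (simp add: abs_mult mult_left_mono flip: right_diff_distrib)
    qed
    moreover have "t + \<bar>m\<bar> * t < \<bar>s\<bar>" using False by (simp add: c_def distrib_right)
    moreover have "p < s + q - e \<longleftrightarrow> 0 < s" if "\<bar>p - q\<bar> \<le> x" "\<bar>e\<bar> \<le> t" "t + x < \<bar>s\<bar>" for p q e x :: real
     using that by (smt (verit))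
    ultimately have "m * \<bar>Im (z - k)\<bar> < Re (z - k) \<longleftrightarrow> m * \<bar>Im z\<bar> < Re z"
     using k(1) z by simp
    then have "flatten d m s y - t *\<^sub>R b \<in> ?S \<longleftrightarrow> flatten d m s y \<in> ?S"
     unfolding Sec_def mem_Collect_eq left_diff_distrib z_def k_def .
    then show ?thesis using False by (auto simp: indicator_def)
   qed
   have Gi: "integrable lborel ?G"
    using integrable_norm[OF boundary_integrable[OF fc f(2)]] by (intro Bochner_Integration.integrable_add integrable_mult_right) auto
   have GI: "(LINT y|lborel. ?G y) = A + 2 * \<bar>B\<bar> * e"
    using integrable_norm[OF boundary_integrable[OF fc f(2)]] by (subst Bochner_Integration.integral_add) (auto simp: A_def)
   have "ennreal (LINT x|lborel. norm (?h x)) = (NN x. ennreal (norm (?h x)))"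
    using hi by (intro nn_integral_eq_integral[symmetric]) auto
   also have "... = (NN y. NN s. ennreal (norm (?h (flatten d m s y))))"
    by (rule nn_integral_flatten[OF d]) measurable
   also have "... \<le> (NN y. NN s. ennreal (?G y) * indicator {- (c * t)..c * t} s)"
   proof (intro nn_integral_mono)
    fix y s
    show "ennreal (norm (?h (flatten d m s y))) \<le> ennreal (?G y) * indicator {- (c * t)..c * t} s"
     using ennreal_leI[OF pt[of s y]] by (cases "s \<in> {- (c * t)..c * t}") simp_all
   qed
   also have "... = (NN y. ennreal (2 * c * t * ?G y))"
   proof (rule nn_integral_cong)
    fix y
    have "0 \<le> ?G y" "0 \<le> c * t" using c t e by simp_all
    then show "(NN s. ennreal (?G y) * indicator {- (c * t)..c * t} s) = ennreal (2 * c * t * ?G y)"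
     by (subst nn_integral_cmult_indicator) (simp_all del: ennreal_plus add: mult_ac flip: ennreal_mult)
   qed
   also have "... = ennreal (LINT y|lborel. 2 * c * t * ?G y)"
    using Gi c t e by (intro nn_integral_eq_integral) auto
   also have "(LINT y|lborel. 2 * c * t * ?G y) = 2 * c * t * (A + 2 * \<bar>B\<bar> * e)" unfolding GI[symmetric] by simp
   finally have "(LINT x|lborel. norm (?h x)) \<le> 2 * c * t * (A + 2 * \<bar>B\<bar> * e)"
    using A c t e by (subst (asm) ennreal_le_iff) auto
   moreover have "J (t *\<^sub>R b) - J 0 = (LINT x|lborel. ?h x)"
    unfolding J_def using si[of "t *\<^sub>R b"] si[of 0] by simp
   then have "norm (J (t *\<^sub>R b) - J 0) \<le> (LINT x|lborel. norm (?h x))" by (simp only: integral_norm_bound)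
   ultimately have "norm (J (t *\<^sub>R b) - J 0) \<le> t * (2 * c * (A + 2 * \<bar>B\<bar> * e))" by (simp add: mult_ac)
   moreover have "t * norm I \<le> norm (J (t *\<^sub>R b) - J 0) + t * r t"
    using norm_triangle_ineq2[of "t *\<^sub>R I" "J (t *\<^sub>R b) - J 0"] t by (simp add: r_def norm_minus_commute)
   ultimately have "t * norm I \<le> t * (2 * c * (A + 2 * \<bar>B\<bar> * e) + r t)" by (simp add: distrib_left)
   then show ?thesis using t by simp
  qed
  have "\<forall>\<^sub>F t in at_right 0. norm I \<le> 2 * c * (A + 2 * \<bar>B\<bar> * e) + r t"
   unfolding eventually_at_right_field using c \<delta>(1) est by (intro exI[of _ "\<delta> / c"]) (auto simp: field_simps)
  from tendsto_lowerbound[OF lim this] show ?thesis by simp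
 qed
 have "((\<lambda>e. 2 * c * (A + 2 * \<bar>B\<bar> * e)) \<longlongrightarrow> 2 * c * (A + 2 * \<bar>B\<bar> * 0)) (at_right 0)" by (intro tendsto_intros)
 moreover have "\<forall>\<^sub>F e in at_right 0. norm I \<le> 2 * c * (A + 2 * \<bar>B\<bar> * e)"
  using main by (auto simp: eventually_at_right_field intro!: exI[of _ 1])
 ultimately have "norm I \<le> 2 * c * (A + 2 * \<bar>B\<bar> * 0)"
  by (intro tendsto_lowerbound) auto
 then show ?thesis by (simp add: A_def c_def I_def)
qed

end

lemma Sec_polar:
 assumes d: "norm d = 1" and h: "0 < h" "h < pi" and t: "\<bar>t\<bar> \<le> pi" and r: "r > 0"
 shows "of_real r * cis t * d \<in> Sec d (cot h) \<longleftrightarrow> \<bar>t\<bar> < h"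
proof -
 have sh: "sin h > 0" using h by (rule sin_gt_zero)
 have st: "\<bar>sin t\<bar> = sin \<bar>t\<bar>"
  using t sin_ge_zero[of "\<bar>t\<bar>"] by (auto simp: abs_if)
 have "of_real r * cis t * d \<in> Sec d (cot h) \<longleftrightarrow> cot h * \<bar>r * sin t\<bar> < r * cos t"
  by (subst Sec_coord[OF d]) simp
 also have "... \<longleftrightarrow> r * (cot h * \<bar>sin t\<bar>) < r * cos t" using r by (simp add: abs_mult mult_ac)
 also have "... \<longleftrightarrow> cot h * \<bar>sin t\<bar> < cos t" using r by simp
 also have "... \<longleftrightarrow> cos h * \<bar>sin t\<bar> < sin h * cos t" using sh by (simp add: cot_def field_simps)
 also have "... \<longleftrightarrow> 0 < sin (h - \<bar>t\<bar>)" by (simp add: st sin_diff algebra_simps)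
 also have "... \<longleftrightarrow> \<bar>t\<bar> < h"
 proof
  assume a: "0 < sin (h - \<bar>t\<bar>)"
  show "\<bar>t\<bar> < h"
  proof (rule ccontr)
   assume "\<not> \<bar>t\<bar> < h"
   then have "sin (\<bar>t\<bar> - h) \<ge> 0" using t h by (intro sin_ge_zero) auto
   then show False using a by (simp add: sin_diff mult.commute)
  qed
 next
  assume "\<bar>t\<bar> < h"
  then show "0 < sin (h - \<bar>t\<bar>)" using h by (intro sin_gt_zero) auto
 qed
 finally show ?thesis .
qed

locale sector_angle =
 fixes \<alpha> :: real
 assumes \<alpha>: "0 < \<alpha>" "\<alpha> < 2 * pi"
begin

definition dir :: complex where "dir = cis (\<alpha> / 2)"
definition slope :: real where "slope = cot (\<alpha> / 2)"

lemma norm_dir: "norm dir = 1" "norm (- dir) = 1"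
 by (simp_all add: dir_def)

lemma sin_half: "0 < sin (\<alpha> / 2)"
 using \<alpha> by (intro sin_gt_zero) auto

lemma sector_eq: "sector \<alpha> = Sec dir slope"
proof (intro set_eqI)
 fix z :: complex
 show "z \<in> sector \<alpha> \<longleftrightarrow> z \<in> Sec dir slope"
 proof (cases "z = 0")
  case True
  then show ?thesis by (simp add: sector_def Sec_def)
 next
  case False
  define \<theta> where "\<theta> = Arg2pi z"
  have \<theta>: "0 \<le> \<theta>" "\<theta> < 2 * pi" "z = of_real (norm z) * cis \<theta>"
   using Arg2pi[of z] by (auto simp: \<theta>_def is_Arg_def cis_conv_exp)
  have zd: "z = of_real (norm z) * cis (\<theta> - \<alpha> / 2) * dir"
   unfolding dir_def mult.assoc cis_mult using \<theta>(3) by simp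
  have r: "norm z > 0" using False by simp
  show ?thesis
  proof (cases "\<theta> - \<alpha> / 2 \<le> pi")
   case True
   have "z \<in> Sec dir slope \<longleftrightarrow> \<bar>\<theta> - \<alpha> / 2\<bar> < \<alpha> / 2"
    unfolding slope_def by (subst zd, rule Sec_polar[OF norm_dir(1) _ _ _ r]) (use \<alpha> \<theta> True in auto)
   also have "... \<longleftrightarrow> 0 < \<theta> \<and> \<theta> < \<alpha>" unfolding abs_less_iff by (auto simp: field_simps)
   finally show ?thesis by (simp add: sector_def \<theta>_def)
  next
   case False
   have c: "cis (\<theta> - \<alpha> / 2) = cis (\<theta> - \<alpha> / 2 - 2 * pi)"
    by (simp add: complex_eq_iff cos_diff sin_diff)
   have "z \<in> Sec dir slope \<longleftrightarrow> \<bar>\<theta> - \<alpha> / 2 - 2 * pi\<bar> < \<alpha> / 2"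
    unfolding slope_def by (subst zd, subst c, rule Sec_polar[OF norm_dir(1) _ _ _ r]) (use \<alpha> \<theta> False in auto)
   then show ?thesis using False \<theta> \<alpha> by (auto simp: sector_def \<theta>_def[symmetric] abs_less_iff)
  qed
 qed
qed

lemma cosector_eq: "cosector \<alpha> = Sec (- dir) (- slope)"
 unfolding cosector_def sector_eq by (rule Sec_complement[OF norm_dir(1)])

lemma flatten_ray:
 assumes "y \<ge> 0"
 shows "flatten dir slope 0 y = ray \<alpha> (y / sin (\<alpha> / 2))" "flatten dir slope 0 (- y) = ray 0 (y / sin (\<alpha> / 2))"
proof -
 have a: "Complex (slope * y) y = of_real (y / sin (\<alpha> / 2)) * cis (\<alpha> / 2)"
  "Complex (slope * y) (- y) = of_real (y / sin (\<alpha> / 2)) * cis (- (\<alpha> / 2))"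
  using sin_half by (auto simp: complex_eq_iff slope_def cot_def)
 show "flatten dir slope 0 y = ray \<alpha> (y / sin (\<alpha> / 2))" "flatten dir slope 0 (- y) = ray 0 (y / sin (\<alpha> / 2))"
  using assms by (simp_all add: flatten_def a ray_def dir_def mult.assoc cis_mult)
qed

lemma flatten_cosector: "flatten (- dir) (- slope) 0 y = flatten dir slope 0 (- y)"
 by (simp add: flatten_def complex_eq_iff)

definition sides :: "complex set set" where "sides = {sector \<alpha>, cosector \<alpha>}"

lemma open_sides: "Z \<in> sides \<Longrightarrow> open Z"
 by (auto simp: sides_def sector_eq cosector_eq open_Sec)

lemma sets_sides: "Z \<in> sides \<Longrightarrow> Z \<in> sets lebesgue"
 using open_sides by auto

lemma ray_closure:
 assumes "Z \<in> sides" "\<theta> \<in> {0, \<alpha>}" "t \<ge> 0" shows "ray \<theta> t \<in> closure Z"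
proof -
 have "ray \<theta> t = flatten dir slope 0 (t * sin (\<alpha> / 2)) \<or> ray \<theta> t = flatten dir slope 0 (- (t * sin (\<alpha> / 2)))"
  using assms(2) flatten_ray[of "t * sin (\<alpha> / 2)"] sin_half assms(3) by auto
 moreover have "flatten dir slope 0 y \<in> closure Z" for y
  using assms(1) flatten_closure[OF norm_dir(1), of slope 0 y] flatten_closure[OF norm_dir(2), of "- slope" 0 "- y"]
  by (auto simp: sides_def sector_eq cosector_eq flatten_cosector)
 ultimately show ?thesis by auto
qed

lemma continuous_ray: "continuous_on X (ray \<theta>)"
 unfolding ray_def by (intro continuous_intros)

text \<open>Both boundary rays together are parametrized by \<open>y \<mapsto> flatten dir slope 0 y\<close>, with
 speed \<open>1 / sin (\<alpha> / 2)\<close>.\<close>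

lemma nn_integral_ray_le:
 fixes F :: "complex \<Rightarrow> ennreal"
 assumes "\<theta> \<in> {0, \<alpha>}" and m: "\<And>\<theta>. \<theta> \<in> {0, \<alpha>} \<Longrightarrow> (\<lambda>t. F (ray \<theta> t) * indicator {0..} t) \<in> bm"
 shows "(NN t. F (ray \<theta> t) * indicator {0..} t) \<le> ennreal (1 / sin (\<alpha> / 2)) * (NN y. F (flatten dir slope 0 y))"
proof -
 define \<sigma> :: real where "\<sigma> = (if \<theta> = \<alpha> then 1 else -1)"
 have \<sigma>: "\<sigma> = 1 \<or> \<sigma> = -1" by (simp add: \<sigma>_def)
 have r: "ray \<theta> (\<sigma> / sin (\<alpha> / 2) * y) = flatten dir slope 0 y" if "\<sigma> * y \<ge> 0" for y
 proof (cases "\<theta> = \<alpha>")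
  case True
  then show ?thesis using that flatten_ray(1)[of y] by (simp add: \<sigma>_def)
 next
  case False
  then show ?thesis using that flatten_ray(2)[of "- y"] assms(1) by (simp add: \<sigma>_def)
 qed
 have "(NN t. F (ray \<theta> t) * indicator {0..} t)
  = ennreal \<bar>\<sigma> / sin (\<alpha> / 2)\<bar> * (NN y. F (ray \<theta> (0 + \<sigma> / sin (\<alpha> / 2) * y)) * indicator {0..} (0 + \<sigma> / sin (\<alpha> / 2) * y))"
  using \<sigma> sin_half by (intro nn_integral_real_affine m assms(1)) auto
 also have "\<bar>\<sigma> / sin (\<alpha> / 2)\<bar> = 1 / sin (\<alpha> / 2)" using \<sigma> sin_half by auto
 also have "(NN y. F (ray \<theta> (0 + \<sigma> / sin (\<alpha> / 2) * y)) * indicator {0..} (0 + \<sigma> / sin (\<alpha> / 2) * y))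
   \<le> (NN y. F (flatten dir slope 0 y))"
 proof (rule nn_integral_mono)
  fix y :: real
  show "F (ray \<theta> (0 + \<sigma> / sin (\<alpha> / 2) * y)) * indicator {0..} (0 + \<sigma> / sin (\<alpha> / 2) * y) \<le> F (flatten dir slope 0 y)"
   using r[of y] sin_half by (auto simp: indicator_def zero_le_divide_iff)
 qed
 finally show ?thesis by (simp add: mult_left_mono)
qed

lemma boundary_trace:
 assumes "Z \<in> sides" "w \<in> W12 Z" "continuous_on (closure Z) w"
 shows "(NN y. ennreal ((norm (w (flatten dir slope 0 y)))^2)) \<le> ennreal (2 * (W12_norm Z w)^2)"
proof (cases "Z = sector \<alpha>")
 case True
 then show ?thesis using trace_continuous[OF norm_dir(1)] assms by (simp add: sector_eq)
next
 case False
 then have Z: "Z = Sec (- dir) (- slope)" using assms(1) by (simp add: sides_def cosector_eq)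
 have "continuous_on UNIV (\<lambda>y. flatten dir slope 0 y)" by (intro continuous_intros)
 then have "continuous_on UNIV (\<lambda>y. w (flatten dir slope 0 y))"
  by (rule continuous_on_compose2[OF assms(3)])
    (use flatten_closure[OF norm_dir(2), of "- slope" 0] flatten_cosector in \<open>auto simp: Z image_iff\<close>, metis minus_minus order_refl)
 then have [measurable]: "(\<lambda>y. w (flatten dir slope 0 y)) \<in> bm" by (rule continuous_bm)
 have "(NN y. ennreal ((norm (w (flatten dir slope 0 y)))^2)) = (NN y. ennreal ((norm (w (flatten dir slope 0 (- y))))^2))"
  using nn_integral_real_affine[of "\<lambda>y. ennreal ((norm (w (flatten dir slope 0 y)))^2)" "-1" 0] by simp
 then show ?thesis using trace_continuous[OF norm_dir(2), of w "- slope"] assms by (simp add: Z flatten_cosector)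
qed

definition Ctr :: real where "Ctr = sqrt (2 / sin (\<alpha> / 2))"

lemma l2_interval:
 fixes f :: "real \<Rightarrow> complex"
 assumes "continuous_on {0..} f" shows "l2 (mu {0..R}) f"
proof -
 have c: "continuous_on {0..R} f" using assms by (rule continuous_on_subset) auto
 have m: "f \<in> borel_measurable (mu {0..R})" by (rule continuous_imp_measurable_on_sets_lebesgue[OF c]) simp
 have "integrable (mu {0..R}) (\<lambda>x. (norm (f x))^2)"
 proof -
  have i: "integrable lborel (\<lambda>x. indicator {0..R} x *\<^sub>R (norm (f x))^2)"
   by (rule borel_integrable_compact) (auto intro!: continuous_intros c)
  have "integrable lebesgue (\<lambda>x. indicator {0..R} x *\<^sub>R (norm (f x))^2)"
   using integrable_completion[OF borel_measurable_integrable[OF i]] i by simp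
  then show ?thesis by (simp add: integrable_restrict_space)
 qed
 then show ?thesis using m by (simp add: l2_def)
qed

lemma continuous_on_ray:
 assumes "Z \<in> sides" "continuous_on (closure Z) w" "\<theta> \<in> {0, \<alpha>}"
 shows "continuous_on {0..} (\<lambda>t. w (ray \<theta> t))"
 by (rule continuous_on_compose2[OF assms(2) continuous_ray]) (use ray_closure[OF assms(1,3)] in auto)

lemma trace_inequality:
 assumes "Z \<in> sides" "w \<in> W12 Z" "continuous_on (closure Z) w" "\<theta> \<in> {0, \<alpha>}"
 shows "l2 (mu {0..R}) (\<lambda>t. w (ray \<theta> t))" "n2 (mu {0..R}) (\<lambda>t. w (ray \<theta> t)) \<le> Ctr * W12_norm Z w"
proof -
 have c: "continuous_on {0..} (\<lambda>t. w (ray \<theta> t))" if "\<theta> \<in> {0, \<alpha>}" for \<theta>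
  by (rule continuous_on_ray[OF assms(1,3) that])
 show l: "l2 (mu {0..R}) (\<lambda>t. w (ray \<theta> t))" by (rule l2_interval[OF c[OF assms(4)]])
 have m: "(\<lambda>t. ennreal ((norm (w (ray \<theta> t)))^2) * indicator {0..} t) \<in> bm" if "\<theta> \<in> {0, \<alpha>}" for \<theta>
 proof -
  have "(\<lambda>t. indicator {0..} t *\<^sub>R w (ray \<theta> t)) \<in> bm"
   by (rule borel_measurable_continuous_on_indicator[OF _ c[OF that]]) simp
  then have "(\<lambda>t. ennreal ((norm (indicator {0..} t *\<^sub>R w (ray \<theta> t)))^2)) \<in> bm" by measurable
  moreover have "(\<lambda>t. ennreal ((norm (indicator {0..} t *\<^sub>R w (ray \<theta> t)))^2)) = (\<lambda>t. ennreal ((norm (w (ray \<theta> t)))^2) * indicator {0..} t)"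
   by (intro ext) (auto simp: indicator_def)
  ultimately show ?thesis by (simp only:)
 qed
 have i: "integrable lebesgue (\<lambda>t. indicator {0..R} t *\<^sub>R (norm (w (ray \<theta> t)))^2)"
  using l2_integrable[OF l] by (simp add: integrable_restrict_space)
 have "ennreal ((n2 (mu {0..R}) (\<lambda>t. w (ray \<theta> t)))^2) = ennreal (LINT t|lebesgue. indicator {0..R} t *\<^sub>R (norm (w (ray \<theta> t)))^2)"
  unfolding n2_power2 by (subst integral_restrict_space) auto
 also have "... = (\<integral>\<^sup>+t. ennreal (indicator {0..R} t *\<^sub>R (norm (w (ray \<theta> t)))^2) \<partial>lebesgue)"
  by (rule nn_integral_eq_integral[symmetric, OF i]) auto
 also have "... = (NN t. ennreal (indicator {0..R} t *\<^sub>R (norm (w (ray \<theta> t)))^2))" by (rule nn_integral_completion)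
 also have "... \<le> (NN t. ennreal ((norm (w (ray \<theta> t)))^2) * indicator {0..} t)"
  by (intro nn_integral_mono) (auto simp: indicator_def)
 also have "... \<le> ennreal (1 / sin (\<alpha> / 2)) * (NN y. ennreal ((norm (w (flatten dir slope 0 y)))^2))"
  by (rule nn_integral_ray_le[OF assms(4) m])
 also have "... \<le> ennreal (1 / sin (\<alpha> / 2)) * ennreal (2 * (W12_norm Z w)^2)"
  by (intro mult_left_mono boundary_trace assms) simp
 also have "... = ennreal ((Ctr * W12_norm Z w)^2)"
  using sin_half by (simp add: Ctr_def power_mult_distrib flip: ennreal_mult)
 finally have "(n2 (mu {0..R}) (\<lambda>t. w (ray \<theta> t)))^2 \<le> (Ctr * W12_norm Z w)^2"
  by (metis ennreal_le_iff zero_le_power2)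
 then show "n2 (mu {0..R}) (\<lambda>t. w (ray \<theta> t)) \<le> Ctr * W12_norm Z w"
  by (rule power2_le_imp_le) (use sin_half in \<open>simp add: Ctr_def W12_norm_nonneg\<close>)
qed

lemma density:
 assumes "Z \<in> sides" "u \<in> W12 Z"
 shows "\<exists>w :: nat \<Rightarrow> cfun. (\<forall>n. Ck 1 (w n) \<and> w n \<in> W12 Z) \<and> (\<lambda>n. W12_norm Z (\<lambda>x. w n x - u x)) \<longlonglongrightarrow> 0"
 using assms Sec_density[OF norm_dir(1)] Sec_density[OF norm_dir(2)]
 unfolding sides_def sector_eq cosector_eq by blast

abbreviation rn :: "real \<Rightarrow> real \<Rightarrow> cfun \<Rightarrow> real" where
 "rn \<theta> R g \<equiv> n2 (mu {0..R}) (\<lambda>t. g (ray \<theta> t))"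

lemma L2loc_iff:
 "g \<in> L2loc_rays \<alpha> \<longleftrightarrow> (\<forall>\<theta>\<in>{0, \<alpha>}. (\<lambda>t. g (ray \<theta> t)) \<in> borel_measurable (mu {0..}) \<and> (\<forall>R. l2 (mu {0..R}) (\<lambda>t. g (ray \<theta> t))))"
proof -
 have "(\<lambda>t. g (ray \<theta> t)) \<in> borel_measurable (mu {0..R})" if "(\<lambda>t. g (ray \<theta> t)) \<in> borel_measurable (mu {0..})" for \<theta> R
 proof -
  have "mu {0..R} = restrict_space (mu {0..}) {0..R}"
   by (simp add: restrict_restrict_space inf.absorb2)
  then show ?thesis using that by (simp add: measurable_restrict_space1)
 qed
 note * = this
 show ?thesis
 proof
  assume g: "g \<in> L2loc_rays \<alpha>"
  show "\<forall>\<theta>\<in>{0, \<alpha>}. (\<lambda>t. g (ray \<theta> t)) \<in> borel_measurable (mu {0..}) \<and> (\<forall>R. l2 (mu {0..R}) (\<lambda>t. g (ray \<theta> t)))"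
  proof (intro ballI conjI allI)
   fix \<theta> R assume \<theta>: "\<theta> \<in> {0, \<alpha>}"
   show m: "(\<lambda>t. g (ray \<theta> t)) \<in> borel_measurable (mu {0..})" using g \<theta> by (auto simp: L2loc_rays_def)
   show "l2 (mu {0..R}) (\<lambda>t. g (ray \<theta> t))"
    unfolding l2_def using *[OF m] g \<theta> by (auto simp: L2loc_rays_def)
  qed
 qed (auto simp: L2loc_rays_def l2_def)
qed

lemma L2loc_l2: "g \<in> L2loc_rays \<alpha> \<Longrightarrow> \<theta> \<in> {0, \<alpha>} \<Longrightarrow> l2 (mu {0..R}) (\<lambda>t. g (ray \<theta> t))"
 unfolding L2loc_iff by blast

lemma L2loc_linear:
 assumes "g \<in> L2loc_rays \<alpha>" "h \<in> L2loc_rays \<alpha>" shows "(\<lambda>z. a * g z + b * h z) \<in> L2loc_rays \<alpha>"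
 unfolding L2loc_iff
proof (intro ballI conjI allI)
 fix \<theta> R assume \<theta>: "\<theta> \<in> {0, \<alpha>}"
 show "(\<lambda>t. a * g (ray \<theta> t) + b * h (ray \<theta> t)) \<in> borel_measurable (mu {0..})"
  using assms \<theta> by (auto simp: L2loc_rays_def)
 show "l2 (mu {0..R}) (\<lambda>t. a * g (ray \<theta> t) + b * h (ray \<theta> t))"
  by (intro l2_add l2_cmult L2loc_l2 assms \<theta>)
qed

lemma n2_tendsto_iff: "(\<lambda>n. LINT x|M. (norm (f n x))^2) \<longlonglongrightarrow> 0 \<longleftrightarrow> (\<lambda>n. n2 M (f n)) \<longlonglongrightarrow> 0"
proof
 assume "(\<lambda>n. LINT x|M. (norm (f n x))^2) \<longlonglongrightarrow> 0"
 then have "(\<lambda>n. sqrt (LINT x|M. (norm (f n x))^2)) \<longlonglongrightarrow> sqrt 0" by (rule tendsto_real_sqrt)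
 then show "(\<lambda>n. n2 M (f n)) \<longlonglongrightarrow> 0" by (simp add: n2_def)
next
 assume "(\<lambda>n. n2 M (f n)) \<longlonglongrightarrow> 0"
 then have "(\<lambda>n. (n2 M (f n))^2) \<longlonglongrightarrow> 0^2" by (rule tendsto_power)
 then show "(\<lambda>n. LINT x|M. (norm (f n x))^2) \<longlonglongrightarrow> 0" by (simp add: n2_power2)
qed

lemma has_trace_iff:
 "has_trace \<alpha> Z u g \<longleftrightarrow> g \<in> L2loc_rays \<alpha> \<and>
   (\<exists>w :: nat \<Rightarrow> cfun. (\<forall>n. w n \<in> W12 Z \<and> continuous_on (closure Z) (w n)) \<and>
    (\<lambda>n. W12_norm Z (\<lambda>x. w n x - u x)) \<longlonglongrightarrow> 0 \<and>
    (\<forall>\<theta>\<in>{0, \<alpha>}. \<forall>R. (\<lambda>n. rn \<theta> R (\<lambda>z. w n z - g z)) \<longlonglongrightarrow> 0))"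
 unfolding has_trace_def n2_tendsto_iff ..

lemma has_trace_any_sequence:
 assumes Z: "Z \<in> sides" and u: "u \<in> W12 Z" and t: "has_trace \<alpha> Z u g"
  and v: "\<And>n. v n \<in> W12 Z" "\<And>n. continuous_on (closure Z) (v n)" "(\<lambda>n. W12_norm Z (\<lambda>x. v n x - u x)) \<longlonglongrightarrow> 0"
  and \<theta>: "\<theta> \<in> {0, \<alpha>}"
 shows "(\<lambda>n. rn \<theta> R (\<lambda>z. v n z - g z)) \<longlonglongrightarrow> 0"
proof -
 obtain w where w: "\<And>n. w n \<in> W12 Z" "\<And>n. continuous_on (closure Z) (w n)" "(\<lambda>n. W12_norm Z (\<lambda>x. w n x - u x)) \<longlonglongrightarrow> 0"
   "(\<lambda>n. rn \<theta> R (\<lambda>z. w n z - g z)) \<longlonglongrightarrow> 0" and g: "g \<in> L2loc_rays \<alpha>"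
  using t \<theta> unfolding has_trace_iff by blast
 note op = open_sides[OF Z]
 have l: "l2 (mu {0..R}) (\<lambda>t. w n (ray \<theta> t))" "l2 (mu {0..R}) (\<lambda>t. v n (ray \<theta> t))" for n
  by (intro trace_inequality[OF Z] w v \<theta>)+
 have b: "rn \<theta> R (\<lambda>z. v n z - g z) \<le> Ctr * (W12_norm Z (\<lambda>x. v n x - u x) + W12_norm Z (\<lambda>x. w n x - u x)) + rn \<theta> R (\<lambda>z. w n z - g z)" for n
 proof -
  have "rn \<theta> R (\<lambda>z. v n z - g z) \<le> rn \<theta> R (\<lambda>z. v n z - w n z) + rn \<theta> R (\<lambda>z. w n z - g z)"
   by (rule n2_triangle_diff[OF l(2,1) L2loc_l2[OF g \<theta>]])
  also have "rn \<theta> R (\<lambda>z. v n z - w n z) \<le> Ctr * W12_norm Z (\<lambda>z. v n z - w n z)"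
   by (intro trace_inequality[OF Z] W12_diff op v w \<theta> continuous_intros)
  also have "W12_norm Z (\<lambda>z. v n z - w n z) \<le> W12_norm Z (\<lambda>x. v n x - u x) + W12_norm Z (\<lambda>x. w n x - u x)"
   using W12_norm_triangle_diff[OF op v(1) u w(1), of n n] W12_norm_minus_commute[OF op u w(1), of n] by simp
  finally show ?thesis using sin_half by (simp add: Ctr_def mult_left_mono)
 qed
 show ?thesis
 proof (rule Lim_null_comparison)
  show "\<forall>\<^sub>F n in sequentially. norm (rn \<theta> R (\<lambda>z. v n z - g z)) \<le> Ctr * (W12_norm Z (\<lambda>x. v n x - u x) + W12_norm Z (\<lambda>x. w n x - u x)) + rn \<theta> R (\<lambda>z. w n z - g z)"
   using b by simp
  show "(\<lambda>n. Ctr * (W12_norm Z (\<lambda>x. v n x - u x) + W12_norm Z (\<lambda>x. w n x - u x)) + rn \<theta> R (\<lambda>z. w n z - g z)) \<longlonglongrightarrow> 0"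
   using v(3) w(3,4) by (auto intro!: tendsto_eq_intros)
 qed
qed

lemma has_trace_unique:
 assumes Z: "Z \<in> sides" and u: "u \<in> W12 Z" and t: "has_trace \<alpha> Z u g" "has_trace \<alpha> Z u g'" and \<theta>: "\<theta> \<in> {0, \<alpha>}"
 shows "rn \<theta> R (\<lambda>z. g z - g' z) = 0"
proof -
 obtain w where w: "\<And>n. w n \<in> W12 Z" "\<And>n. continuous_on (closure Z) (w n)" "(\<lambda>n. W12_norm Z (\<lambda>x. w n x - u x)) \<longlonglongrightarrow> 0"
   and g: "g \<in> L2loc_rays \<alpha>" "g' \<in> L2loc_rays \<alpha>"
  using t unfolding has_trace_iff by blast
 have l: "l2 (mu {0..R}) (\<lambda>t. w n (ray \<theta> t))" for n
  by (intro trace_inequality[OF Z] w \<theta>)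
 have b: "rn \<theta> R (\<lambda>z. g z - g' z) \<le> rn \<theta> R (\<lambda>z. w n z - g z) + rn \<theta> R (\<lambda>z. w n z - g' z)" for n
  using n2_triangle_diff[OF L2loc_l2[OF g(1) \<theta>, of R] l[of n] L2loc_l2[OF g(2) \<theta>, of R]]
   n2_minus_commute[of "mu {0..R}" "\<lambda>t. g (ray \<theta> t)" "\<lambda>t. w n (ray \<theta> t)"] by simp
 have "(\<lambda>n. rn \<theta> R (\<lambda>z. w n z - g z) + rn \<theta> R (\<lambda>z. w n z - g' z)) \<longlonglongrightarrow> 0"
  using has_trace_any_sequence[OF Z u t(1) w \<theta>, of R] has_trace_any_sequence[OF Z u t(2) w \<theta>, of R]
  by (auto intro!: tendsto_eq_intros)
 then have "rn \<theta> R (\<lambda>z. g z - g' z) \<le> 0" using b by (intro LIMSEQ_le_const) auto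
 then show ?thesis using n2_nonneg[of "mu {0..R}"] by (simp add: antisym)
qed

lemma has_trace_cong:
 assumes Z: "Z \<in> sides" and t: "has_trace \<alpha> Z u g" and g': "g' \<in> L2loc_rays \<alpha>"
  and eq: "\<And>\<theta> R. \<theta> \<in> {0, \<alpha>} \<Longrightarrow> rn \<theta> R (\<lambda>z. g z - g' z) = 0"
 shows "has_trace \<alpha> Z u g'"
proof -
 obtain w where w: "\<And>n. w n \<in> W12 Z" "\<And>n. continuous_on (closure Z) (w n)" "(\<lambda>n. W12_norm Z (\<lambda>x. w n x - u x)) \<longlonglongrightarrow> 0"
   and c: "\<And>\<theta> R. \<theta> \<in> {0, \<alpha>} \<Longrightarrow> (\<lambda>n. rn \<theta> R (\<lambda>z. w n z - g z)) \<longlonglongrightarrow> 0" and g: "g \<in> L2loc_rays \<alpha>"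
  using t unfolding has_trace_iff by blast
 have "(\<lambda>n. rn \<theta> R (\<lambda>z. w n z - g' z)) \<longlonglongrightarrow> 0" if \<theta>: "\<theta> \<in> {0, \<alpha>}" for \<theta> R
 proof (rule Lim_null_comparison[OF _ c[OF \<theta>]])
  have l: "l2 (mu {0..R}) (\<lambda>t. w n (ray \<theta> t))" for n
   by (intro trace_inequality[OF Z] w \<theta>)
  show "\<forall>\<^sub>F n in sequentially. norm (rn \<theta> R (\<lambda>z. w n z - g' z)) \<le> rn \<theta> R (\<lambda>z. w n z - g z)"
   using n2_triangle_diff[OF l L2loc_l2[OF g \<theta>, of R] L2loc_l2[OF g' \<theta>, of R]] eq[OF \<theta>, of R] by simp
 qed
 then show ?thesis unfolding has_trace_iff using w g' by blast
qed

lemma has_trace_linear: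
 assumes Z: "Z \<in> sides" and u: "u \<in> W12 Z" "v \<in> W12 Z" and t: "has_trace \<alpha> Z u g" "has_trace \<alpha> Z v h"
 shows "has_trace \<alpha> Z (\<lambda>x. a * u x + b * v x) (\<lambda>x. a * g x + b * h x)"
proof -
 note op = open_sides[OF Z]
 obtain w where w: "\<And>n. w n \<in> W12 Z" "\<And>n. continuous_on (closure Z) (w n)" "(\<lambda>n. W12_norm Z (\<lambda>x. w n x - u x)) \<longlonglongrightarrow> 0"
   and cw: "\<And>\<theta> R. \<theta> \<in> {0, \<alpha>} \<Longrightarrow> (\<lambda>n. rn \<theta> R (\<lambda>z. w n z - g z)) \<longlonglongrightarrow> 0" and g: "g \<in> L2loc_rays \<alpha>"
  using t unfolding has_trace_iff by blast
 obtain y where y: "\<And>n. y n \<in> W12 Z" "\<And>n. continuous_on (closure Z) (y n)" "(\<lambda>n. W12_norm Z (\<lambda>x. y n x - v x)) \<longlonglongrightarrow> 0"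
   and cy: "\<And>\<theta> R. \<theta> \<in> {0, \<alpha>} \<Longrightarrow> (\<lambda>n. rn \<theta> R (\<lambda>z. y n z - h z)) \<longlonglongrightarrow> 0" and h: "h \<in> L2loc_rays \<alpha>"
  using t unfolding has_trace_iff by blast
 define x where "x n z = a * w n z + b * y n z" for n z
 have xW: "x n \<in> W12 Z" for n unfolding x_def by (intro W12_add W12_cmult op w y)
 have xc: "continuous_on (closure Z) (x n)" for n unfolding x_def by (intro continuous_intros w y)
 have 1: "(\<lambda>n. W12_norm Z (\<lambda>z. x n z - (a * u z + b * v z))) \<longlonglongrightarrow> 0"
 proof (rule Lim_null_comparison)
  have "W12_norm Z (\<lambda>z. x n z - (a * u z + b * v z)) \<le> norm a * W12_norm Z (\<lambda>z. w n z - u z) + norm b * W12_norm Z (\<lambda>z. y n z - v z)" for n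
  proof -
   have "(\<lambda>z. x n z - (a * u z + b * v z)) = (\<lambda>z. a * (w n z - u z) + b * (y n z - v z))" by (simp add: x_def algebra_simps)
   then show ?thesis
    using W12_norm_triangle[OF op W12_cmult[OF W12_diff[OF op w(1) u(1)], of a n] W12_cmult[OF W12_diff[OF op y(1) u(2)], of b n]]
     W12_norm_cmult[OF op W12_diff[OF op w(1) u(1)], of a n] W12_norm_cmult[OF op W12_diff[OF op y(1) u(2)], of b n] by simp
  qed
  then show "\<forall>\<^sub>F n in sequentially. norm (W12_norm Z (\<lambda>z. x n z - (a * u z + b * v z))) \<le> norm a * W12_norm Z (\<lambda>z. w n z - u z) + norm b * W12_norm Z (\<lambda>z. y n z - v z)"
   by (simp add: W12_norm_nonneg)
  show "(\<lambda>n. norm a * W12_norm Z (\<lambda>z. w n z - u z) + norm b * W12_norm Z (\<lambda>z. y n z - v z)) \<longlonglongrightarrow> 0"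
   using w(3) y(3) by (auto intro!: tendsto_eq_intros)
 qed
 have 2: "(\<lambda>n. rn \<theta> R (\<lambda>z. x n z - (a * g z + b * h z))) \<longlonglongrightarrow> 0" if \<theta>: "\<theta> \<in> {0, \<alpha>}" for \<theta> R
 proof (rule Lim_null_comparison)
  let ?M = "mu {0..R}"
  have lw: "l2 ?M (\<lambda>t. w n (ray \<theta> t) - g (ray \<theta> t))" for n
   by (intro l2_diff L2loc_l2[OF g \<theta>] trace_inequality(1)[OF Z w(1,2) \<theta>])
  have ly: "l2 ?M (\<lambda>t. y n (ray \<theta> t) - h (ray \<theta> t))" for n
   by (intro l2_diff L2loc_l2[OF h \<theta>] trace_inequality(1)[OF Z y(1,2) \<theta>])
  have cm: "n2 ?M (\<lambda>t. c * f t) = norm c * n2 ?M f" for c :: complex and f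
   by (simp add: n2_def norm_mult power_mult_distrib real_sqrt_mult)
  have "rn \<theta> R (\<lambda>z. x n z - (a * g z + b * h z)) \<le> norm a * rn \<theta> R (\<lambda>z. w n z - g z) + norm b * rn \<theta> R (\<lambda>z. y n z - h z)" for n
  proof -
   have "(\<lambda>t. x n (ray \<theta> t) - (a * g (ray \<theta> t) + b * h (ray \<theta> t))) = (\<lambda>t. a * (w n (ray \<theta> t) - g (ray \<theta> t)) + b * (y n (ray \<theta> t) - h (ray \<theta> t)))"
    by (simp add: x_def algebra_simps)
   then show ?thesis using n2_triangle[OF l2_cmult[OF lw, of a n] l2_cmult[OF ly, of b n]] by (simp add: cm)
  qed
  then show "\<forall>\<^sub>F n in sequentially. norm (rn \<theta> R (\<lambda>z. x n z - (a * g z + b * h z))) \<le> norm a * rn \<theta> R (\<lambda>z. w n z - g z) + norm b * rn \<theta> R (\<lambda>z. y n z - h z)"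
   by simp
  show "(\<lambda>n. norm a * rn \<theta> R (\<lambda>z. w n z - g z) + norm b * rn \<theta> R (\<lambda>z. y n z - h z)) \<longlonglongrightarrow> 0"
   using cw[OF \<theta>, of R] cy[OF \<theta>, of R] by (auto intro!: tendsto_eq_intros)
 qed
 show ?thesis unfolding has_trace_iff using L2loc_linear[OF g h] xW xc 1 2 by blast
qed

lemma has_trace_of_sequence:
 assumes Z: "Z \<in> sides"
  and w: "\<And>n. w n \<in> W12 Z" "\<And>n. continuous_on (closure Z) (w n)" "\<And>n. W12_norm Z (\<lambda>x. w n x - u x) \<le> 1 / (real n + 1)"
  and g: "g \<in> L2loc_rays \<alpha>" "\<And>n \<theta>. \<theta> \<in> {0, \<alpha>} \<Longrightarrow> rn \<theta> (real n) (\<lambda>z. w n z - g z) \<le> 1 / (real n + 1)"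
 shows "has_trace \<alpha> Z u g"
 unfolding has_trace_iff
proof (intro conjI exI[of _ w] ballI allI g(1) w)
 have lim: "(\<lambda>n. 1 / (real n + 1)) \<longlonglongrightarrow> 0" by real_asymp
 show "(\<lambda>n. W12_norm Z (\<lambda>x. w n x - u x)) \<longlonglongrightarrow> 0"
  by (rule Lim_null_comparison[OF _ lim]) (simp add: W12_norm_nonneg w)
 fix \<theta> R assume \<theta>: "\<theta> \<in> {0, \<alpha>}"
 show "(\<lambda>n. rn \<theta> R (\<lambda>z. w n z - g z)) \<longlonglongrightarrow> 0"
 proof (rule Lim_null_comparison[OF _ lim])
  obtain N :: nat where N: "R < real N" using reals_Archimedean2 by blast
  show "\<forall>\<^sub>F n in sequentially. norm (rn \<theta> R (\<lambda>z. w n z - g z)) \<le> 1 / (real n + 1)"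
   using eventually_ge_at_top[of N]
  proof eventually_elim
   case (elim n)
   have RN: "R \<le> real n" using N elim by linarith
   have l: "l2 (mu {0..real n}) (\<lambda>t. w n (ray \<theta> t) - g (ray \<theta> t))"
    by (intro l2_diff L2loc_l2[OF g(1) \<theta>] trace_inequality(1)[OF Z w(1,2) \<theta>])
   have i: "integrable lebesgue (\<lambda>t. indicator {0..real n} t *\<^sub>R (norm (w n (ray \<theta> t) - g (ray \<theta> t)))^2)"
    using l2_integrable[OF l] by (simp add: integrable_restrict_space)
   have l': "l2 (mu {0..R}) (\<lambda>t. w n (ray \<theta> t) - g (ray \<theta> t))"
    by (intro l2_diff L2loc_l2[OF g(1) \<theta>] trace_inequality(1)[OF Z w(1,2) \<theta>])
   have i': "integrable lebesgue (\<lambda>t. indicator {0..R} t *\<^sub>R (norm (w n (ray \<theta> t) - g (ray \<theta> t)))^2)"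
    using l2_integrable[OF l'] by (simp add: integrable_restrict_space)
   have "(LINT t|lebesgue. indicator {0..R} t *\<^sub>R (norm (w n (ray \<theta> t) - g (ray \<theta> t)))^2)
    \<le> (LINT t|lebesgue. indicator {0..real n} t *\<^sub>R (norm (w n (ray \<theta> t) - g (ray \<theta> t)))^2)"
    by (rule integral_mono[OF i' i]) (use RN in \<open>auto simp: indicator_def\<close>)
   then have "rn \<theta> R (\<lambda>z. w n z - g z) \<le> rn \<theta> (real n) (\<lambda>z. w n z - g z)"
    unfolding n2_def by (subst (1 2) integral_restrict_space) (auto intro: real_sqrt_le_mono)
   then show ?case using g(2)[OF \<theta>, of n] by simp
  qed
 qed
qed

lemma has_trace_closed:
 assumes Z: "Z \<in> sides" and v: "v \<in> W12 Z" "\<And>k. V k \<in> W12 Z" "(\<lambda>k. W12_norm Z (\<lambda>x. V k x - v x)) \<longlonglongrightarrow> 0"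
  and t: "\<And>k. has_trace \<alpha> Z (V k) g"
 shows "has_trace \<alpha> Z v g"
proof -
 note op = open_sides[OF Z]
 have g: "g \<in> L2loc_rays \<alpha>" using t[of 0] by (simp add: has_trace_iff)
 define P where "P n x \<longleftrightarrow> x \<in> W12 Z \<and> continuous_on (closure Z) x \<and> W12_norm Z (\<lambda>z. x z - v z) \<le> 1 / (real n + 1)
  \<and> (\<forall>\<theta>\<in>{0, \<alpha>}. rn \<theta> (real n) (\<lambda>z. x z - g z) \<le> 1 / (real n + 1))" for n x
 have "\<exists>x. P n x" for n
 proof -
  define e where "e = 1 / (real n + 1)"
  have e: "e > 0" by (simp add: e_def)
  have "\<exists>N. \<forall>k\<ge>N. norm (W12_norm Z (\<lambda>x. V k x - v x) - 0) < e / 2"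
   by (rule LIMSEQ_D[OF v(3)]) (use e in simp)
  then obtain k where "norm (W12_norm Z (\<lambda>x. V k x - v x) - 0) < e / 2" by blast
  then have k: "W12_norm Z (\<lambda>x. V k x - v x) < e / 2" by (simp add: W12_norm_nonneg)
  obtain w where w: "\<And>n. w n \<in> W12 Z" "\<And>n. continuous_on (closure Z) (w n)" "(\<lambda>n. W12_norm Z (\<lambda>x. w n x - V k x)) \<longlonglongrightarrow> 0"
    and c: "\<And>\<theta> R. \<theta> \<in> {0, \<alpha>} \<Longrightarrow> (\<lambda>n. rn \<theta> R (\<lambda>z. w n z - g z)) \<longlonglongrightarrow> 0"
   using t[of k] unfolding has_trace_iff by blast
  have "\<forall>\<^sub>F j in sequentially. W12_norm Z (\<lambda>x. w j x - V k x) < e / 2 \<and> rn 0 (real n) (\<lambda>z. w j z - g z) < e \<and> rn \<alpha> (real n) (\<lambda>z. w j z - g z) < e"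
   by (intro eventually_conj order_tendstoD(2)[OF w(3)] order_tendstoD(2)[OF c]) (use e in auto)
  then obtain j where j: "W12_norm Z (\<lambda>x. w j x - V k x) < e / 2" "rn 0 (real n) (\<lambda>z. w j z - g z) < e" "rn \<alpha> (real n) (\<lambda>z. w j z - g z) < e"
   using eventually_happens' sequentially_bot by blast
  have "W12_norm Z (\<lambda>z. w j z - v z) \<le> e"
   using W12_norm_triangle_diff[OF op w(1) v(2,1), of j k] j(1) k by linarith
  then show ?thesis unfolding P_def using w(1,2) j by (intro exI[of _ "w j"]) (auto simp: e_def)
 qed
 then obtain x where "\<And>n. P n (x n)" by metis
 then have x: "x n \<in> W12 Z" "continuous_on (closure Z) (x n)" "W12_norm Z (\<lambda>z. x n z - v z) \<le> 1 / (real n + 1)"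
  "\<theta> \<in> {0, \<alpha>} \<Longrightarrow> rn \<theta> (real n) (\<lambda>z. x n z - g z) \<le> 1 / (real n + 1)" for n \<theta>
  unfolding P_def by blast+
 show ?thesis by (rule has_trace_of_sequence[OF Z x(1-3) g x(4)])
qed

lemma trace_exists:
 assumes Z: "Z \<in> sides" and w: "\<And>n. w n \<in> W12 Z" "\<And>n. continuous_on (closure Z) (w n)"
  and u: "u \<in> W12 Z" "(\<lambda>n. W12_norm Z (\<lambda>x. w n x - u x)) \<longlonglongrightarrow> 0"
 shows "\<exists>g. has_trace \<alpha> Z u g"
proof -
 note op = open_sides[OF Z]
 have C0: "Ctr \<ge> 0" using sin_half by (simp add: Ctr_def)
 have ca: "\<exists>N. \<forall>m\<ge>N. \<forall>n\<ge>N. (Ctr + 1) * W12_norm Z (\<lambda>x. w m x - w n x) < e" if "e > 0" for e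
 proof -
  define K where "K = Ctr + 1"
  have K: "K > 0" using C0 by (simp add: K_def)
  define e' where "e' = e / 2 / K"
  have "e' > 0" using that K by (simp add: e'_def)
  then obtain N where N: "\<And>n. n \<ge> N \<Longrightarrow> W12_norm Z (\<lambda>x. w n x - u x) < e'"
   
  proof -
   have "\<exists>N. \<forall>n\<ge>N. norm (W12_norm Z (\<lambda>x. w n x - u x) - 0) < e'"
    by (rule LIMSEQ_D[OF u(2) \<open>e' > 0\<close>])
   then show ?thesis using that by (auto simp: W12_norm_nonneg)
  qed
  have "(Ctr + 1) * W12_norm Z (\<lambda>x. w m x - w n x) < e" if "m \<ge> N" "n \<ge> N" for m n
  proof -
   have "W12_norm Z (\<lambda>x. w m x - w n x) < e' + e'"
    using W12_norm_triangle_diff[OF op w(1) u(1) w(1), of m n] N[OF that(1)] N[OF that(2)] W12_norm_minus_commute[OF op u(1) w(1), of n]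
    by linarith
   then have "(Ctr + 1) * W12_norm Z (\<lambda>x. w m x - w n x) < (Ctr + 1) * (e' + e')" using C0 by (intro mult_strict_left_mono) auto
   also have "... = e" unfolding K_def[symmetric] using K by (simp add: e'_def)
   finally show ?thesis .
  qed
  then show ?thesis by blast
 qed
 obtain r where r: "strict_mono r" "\<And>m n. n \<le> m \<Longrightarrow> (Ctr + 1) * W12_norm Z (\<lambda>x. w (r m) x - w (r n) x) \<le> (1/2)^n"
  using fast_subsequence[of "\<lambda>m n. (Ctr + 1) * W12_norm Z (\<lambda>x. w m x - w n x)"] ca by blast
 define g where "g z = lim (\<lambda>n. w (r n) z)" for z
 have l: "l2 (mu {0..R}) (\<lambda>t. w (r n) (ray \<theta> t))" if "\<theta> \<in> {0, \<alpha>}" for n \<theta> R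
  by (intro trace_inequality(1)[OF Z] w that)
 have b: "rn \<theta> R (\<lambda>z. w (r m) z - w (r n) z) \<le> (1/2)^n" if "n \<le> m" "\<theta> \<in> {0, \<alpha>}" for m n \<theta> R
 proof -
  have "rn \<theta> R (\<lambda>z. w (r m) z - w (r n) z) \<le> Ctr * W12_norm Z (\<lambda>z. w (r m) z - w (r n) z)"
   by (intro trace_inequality(2)[OF Z] W12_diff op w that continuous_intros)
  also have "... \<le> (Ctr + 1) * W12_norm Z (\<lambda>z. w (r m) z - w (r n) z)" by (intro mult_right_mono) (auto simp: W12_norm_nonneg)
  also have "... \<le> (1/2)^n" by (rule r(2)[OF that(1)])
  finally show ?thesis .
 qed
 note lim = l2_complete[where M="mu {0..R}" and f="\<lambda>n t. w (r n) (ray \<theta> t)" for R \<theta>, folded g_def]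
 have gl: "l2 (mu {0..R}) (\<lambda>t. g (ray \<theta> t))" "rn \<theta> R (\<lambda>z. w (r n) z - g z) \<le> (1/2)^n" if "\<theta> \<in> {0, \<alpha>}" for \<theta> R n
  using lim(2,3)[of R \<theta>] l[OF that] b[OF _ that] by blast+
 have gm: "(\<lambda>t. g (ray \<theta> t)) \<in> borel_measurable (mu {0..})" if "\<theta> \<in> {0, \<alpha>}" for \<theta>
  unfolding g_def
 proof (rule borel_measurable_lim_metric)
  show "(\<lambda>t. w (r n) (ray \<theta> t)) \<in> borel_measurable (mu {0..})" for n
   by (rule continuous_imp_measurable_on_sets_lebesgue[OF continuous_on_ray[OF Z w(2) that]]) simp
 qed
 have g: "g \<in> L2loc_rays \<alpha>" unfolding L2loc_iff using gl gm by blast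
 have "has_trace \<alpha> Z u g"
  unfolding has_trace_iff
 proof (intro conjI exI[of _ "\<lambda>n. w (r n)"] ballI allI g w)
  show "(\<lambda>n. W12_norm Z (\<lambda>x. w (r n) x - u x)) \<longlonglongrightarrow> 0"
   using LIMSEQ_subseq_LIMSEQ[OF u(2) r(1)] by (simp add: o_def)
  show "(\<lambda>n. rn \<theta> R (\<lambda>z. w (r n) z - g z)) \<longlonglongrightarrow> 0" if "\<theta> \<in> {0, \<alpha>}" for \<theta> R
   by (rule Lim_null_comparison[OF _ LIMSEQ_power_zero[of "1/2::real"]]) (use gl(2)[OF that] in auto)
 qed
 then show ?thesis by blast
qed

end

section \<open>Gluing along the boundary\<close>

lemma lint_l2_limit:
 fixes f :: "nat \<Rightarrow> _ \<Rightarrow> complex"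
 assumes "\<And>n. l2 M (f n)" "l2 M F" "l2 M \<psi>" "(\<lambda>n. n2 M (\<lambda>x. f n x - F x)) \<longlonglongrightarrow> 0"
 shows "(\<lambda>n. LINT x|M. f n x * \<psi> x) \<longlonglongrightarrow> (LINT x|M. F x * \<psi> x)"
proof (rule LIM_zero_cancel, rule Lim_null_comparison)
 show "(\<lambda>n. n2 M (\<lambda>x. f n x - F x) * n2 M \<psi>) \<longlonglongrightarrow> 0"
  by (rule tendsto_mult_left_zero[OF assms(4)])
 have "norm ((LINT x|M. f n x * \<psi> x) - (LINT x|M. F x * \<psi> x)) \<le> n2 M (\<lambda>x. f n x - F x) * n2 M \<psi>" for n
 proof -
  have "(LINT x|M. f n x * \<psi> x) - (LINT x|M. F x * \<psi> x) = (LINT x|M. (f n x - F x) * \<psi> x)"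
   using n2_mult_bound(1)[OF assms(1,3)] n2_mult_bound(1)[OF assms(2,3)] by (simp add: left_diff_distrib)
  then show ?thesis using n2_mult_bound(3)[OF l2_diff[OF assms(1,2)] assms(3)] by simp
 qed
 then show "\<forall>\<^sub>F n in sequentially. norm ((LINT x|M. f n x * \<psi> x) - (LINT x|M. F x * \<psi> x)) \<le> n2 M (\<lambda>x. f n x - F x) * n2 M \<psi>"
  by simp
qed

lemma jet_limit:
 assumes "open Z" "jet Z u p q" "\<And>n. jet Z (w n) (a n) (b n)" "(\<lambda>n. W12_norm Z (\<lambda>x. w n x - u x)) \<longlonglongrightarrow> 0"
 shows "(\<lambda>n. n2 (mu Z) (\<lambda>x. w n x - u x)) \<longlonglongrightarrow> 0" "(\<lambda>n. n2 (mu Z) (\<lambda>x. a n x - p x)) \<longlonglongrightarrow> 0"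
  "(\<lambda>n. n2 (mu Z) (\<lambda>x. b n x - q x)) \<longlonglongrightarrow> 0"
proof -
 have j: "jet Z (\<lambda>x. w n x - u x) (\<lambda>x. a n x - p x) (\<lambda>x. b n x - q x)" for n by (rule jet_diff[OF assms(1,3,2)])
 have l: "l2 (mu Z) (\<lambda>x. a n x - p x)" "l2 (mu Z) (\<lambda>x. b n x - q x)" "l2 (mu Z) (\<lambda>x. w n x - u x)" for n
  using j[of n] by (auto simp: jet_def)
 have c: "n2 (mu Z) (\<lambda>x. a n x - p x) \<le> W12_norm Z (\<lambda>x. w n x - u x)"
  "n2 (mu Z) (\<lambda>x. b n x - q x) \<le> W12_norm Z (\<lambda>x. w n x - u x)"
  "n2 (mu Z) (\<lambda>x. w n x - u x) \<le> W12_norm Z (\<lambda>x. w n x - u x)" for n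
  unfolding W12_norm_jet[OF assms(1) j] by (rule n2_components_le[OF l])+
 show "(\<lambda>n. n2 (mu Z) (\<lambda>x. w n x - u x)) \<longlonglongrightarrow> 0" by (rule Lim_null_comparison[OF _ assms(4)]) (simp add: c)
 show "(\<lambda>n. n2 (mu Z) (\<lambda>x. a n x - p x)) \<longlonglongrightarrow> 0" by (rule Lim_null_comparison[OF _ assms(4)]) (simp add: c)
 show "(\<lambda>n. n2 (mu Z) (\<lambda>x. b n x - q x)) \<longlonglongrightarrow> 0" by (rule Lim_null_comparison[OF _ assms(4)]) (simp add: c)
qed

context sector_angle
begin

abbreviation "A \<equiv> sector \<alpha>"
abbreviation "B \<equiv> cosector \<alpha>"

lemma sides_AB [simp]: "A \<in> sides" "B \<in> sides" by (auto simp: sides_def)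
lemma open_AB: "open A" "open B" by (auto intro: open_sides)
lemma sets_AB [measurable]: "A \<in> sets borel" "B \<in> sets borel" "A \<in> sets lebesgue" "B \<in> sets lebesgue"
 using open_AB by auto
lemma disjoint_AB: "x \<in> B \<Longrightarrow> x \<notin> A" unfolding cosector_def using closure_subset by blast

lemma AE_AB: "AE z in lborel. z \<in> A \<or> z \<in> B"
proof -
 let ?N = "- (A \<union> B)"
 have N: "flatten dir slope s y \<in> ?N \<longleftrightarrow> s = 0" for s y
 proof -
  have "flatten dir slope s y \<in> A \<longleftrightarrow> 0 < s" by (simp add: sector_eq flatten_Sec[OF norm_dir(1)])
  moreover have "flatten dir slope s y \<in> B \<longleftrightarrow> s < 0"
   by (simp add: cosector_def sector_eq flatten_closure[OF norm_dir(1)] not_le)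
  ultimately show ?thesis by auto
 qed
 have N2: "indicator ?N (flatten dir slope s y) = (indicator {0} s :: ennreal)" for s y
  unfolding indicator_def N by simp
 have Nm: "?N \<in> sets borel" using sets_AB by auto
 have "emeasure lborel ?N = (NN z. indicator ?N z)" using Nm by simp
 also have "... = (NN y. NN s. indicator ?N (flatten dir slope s y))"
  by (rule nn_integral_flatten[OF norm_dir(1)]) (use Nm in measurable)
 also have "... = (NN y::real. NN s. indicator {0::real} s)"
  by (simp only: N2)
 also have "... = 0" by simp
 finally have "?N \<in> null_sets lborel" using Nm by auto
 from AE_not_in[OF this] show ?thesis by eventually_elim auto
qed

lemma AE_AB_lebesgue: "AE z in lebesgue. z \<in> A \<or> z \<in> B"
 by (rule AE_completion[OF AE_AB])

lemma integral_split:
 fixes f :: "complex \<Rightarrow> 'b::euclidean_space"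
 assumes "integrable (mu A) f" "integrable (mu B) f"
 shows "integrable (mu UNIV) f" "(LINT x|mu UNIV. f x) = (LINT x|mu A. f x) + (LINT x|mu B. f x)"
proof -
 let ?g = "\<lambda>x. indicator A x *\<^sub>R f x + indicator B x *\<^sub>R f x"
 have i: "integrable lebesgue (\<lambda>x. indicator A x *\<^sub>R f x)" "integrable lebesgue (\<lambda>x. indicator B x *\<^sub>R f x)"
  using assms by (simp_all add: integrable_restrict_space)
 then have g: "integrable lebesgue ?g" by (rule Bochner_Integration.integrable_add)
 have ae: "AE x in lebesgue. ?g x = f x"
  using AE_AB_lebesgue by eventually_elim (auto simp: disjoint_AB indicator_def)
 have fm: "f \<in> borel_measurable lebesgue" by (rule borel_measurable_AE[OF borel_measurable_integrable[OF g] ae])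
 have fi: "integrable lebesgue f" by (rule integrable_cong_AE_imp[OF g fm]) (use ae in auto)
 then show "integrable (mu UNIV) f" by (simp add: lebesgue_on_UNIV_eq)
 have "(LINT x|lebesgue. f x) = (LINT x|lebesgue. ?g x)"
  by (rule integral_cong_AE[OF fm borel_measurable_integrable[OF g]]) (use ae in auto)
 also have "... = (LINT x|mu A. f x) + (LINT x|mu B. f x)"
  using i by (simp add: integral_restrict_space)
 finally show "(LINT x|mu UNIV. f x) = (LINT x|mu A. f x) + (LINT x|mu B. f x)"
  by (simp add: lebesgue_on_UNIV_eq)
qed

definition cmb :: "(complex \<Rightarrow> 'b) \<Rightarrow> (complex \<Rightarrow> 'b) \<Rightarrow> complex \<Rightarrow> 'b" where
 "cmb u v z = (if z \<in> A then u z else v z)"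

lemma cmb_A: "x \<in> A \<Longrightarrow> cmb u v x = u x" and cmb_B: "x \<in> B \<Longrightarrow> cmb u v x = v x"
 using disjoint_AB by (auto simp: cmb_def)

lemma l2_cmb:
 fixes u v :: "complex \<Rightarrow> 'b::euclidean_space"
 assumes "l2 (mu A) u" "l2 (mu B) v"
 shows "l2 (mu UNIV) (cmb u v)" "(n2 (mu UNIV) (cmb u v))^2 = (n2 (mu A) u)^2 + (n2 (mu B) v)^2"
proof -
 have iA: "integrable (mu A) (\<lambda>x. (norm (cmb u v x))^2)"
  using l2_integrable[OF assms(1)] by (rule Bochner_Integration.integrable_cong[THEN iffD1, rotated 2]) (auto simp: cmb_A)
 have iB: "integrable (mu B) (\<lambda>x. (norm (cmb u v x))^2)"
  using l2_integrable[OF assms(2)] by (rule Bochner_Integration.integrable_cong[THEN iffD1, rotated 2]) (auto simp: cmb_B)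
 have "(\<lambda>x. indicator A x *\<^sub>R u x) \<in> borel_measurable lebesgue" "(\<lambda>x. indicator B x *\<^sub>R v x) \<in> borel_measurable lebesgue"
  using assms[THEN l2_measurable] by (simp_all add: borel_measurable_restrict_space_iff)
 then have m: "(\<lambda>x. indicator A x *\<^sub>R u x + indicator B x *\<^sub>R v x) \<in> borel_measurable lebesgue" by measurable
 have ae: "AE x in lebesgue. indicator A x *\<^sub>R u x + indicator B x *\<^sub>R v x = cmb u v x"
  using AE_AB_lebesgue by eventually_elim (auto simp: disjoint_AB cmb_def indicator_def)
 show "l2 (mu UNIV) (cmb u v)"
  using borel_measurable_AE[OF m ae] integral_split(1)[OF iA iB] by (simp add: l2_def lebesgue_on_UNIV_eq)
 have "(LINT x|mu A. (norm (cmb u v x))^2) = (LINT x|mu A. (norm (u x))^2)"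
  "(LINT x|mu B. (norm (cmb u v x))^2) = (LINT x|mu B. (norm (v x))^2)"
  by (intro Bochner_Integration.integral_cong; simp add: cmb_A cmb_B)+
 then show "(n2 (mu UNIV) (cmb u v))^2 = (n2 (mu A) u)^2 + (n2 (mu B) v)^2"
  unfolding n2_power2 integral_split(2)[OF iA iB] by simp
qed

lemma nn_integral_rays:
 assumes [measurable]: "G \<in> bm"
 shows "(NN y. G (flatten dir slope 0 y)) \<le>
  ennreal (sin (\<alpha> / 2)) * (NN t. G (ray \<alpha> t) * indicator {0..} t) +
  ennreal (sin (\<alpha> / 2)) * (NN t. G (ray 0 t) * indicator {0..} t)"
proof -
 let ?s = "sin (\<alpha> / 2)"
 have [measurable]: "ray \<theta> \<in> bm" for \<theta> by (rule continuous_bm[OF continuous_ray])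
 have r: "flatten dir slope 0 (?s * t) = ray \<alpha> t" "flatten dir slope 0 (- ?s * t) = ray 0 t" if "t \<ge> 0" for t
  using flatten_ray[of "?s * t"] sin_half that by auto
 let ?b = "\<lambda>y. G (flatten dir slope 0 y)"
 have "(NN y. ?b y) \<le> (NN y. ?b y * indicator {0..} y + ?b y * indicator {..0} y)"
  by (intro nn_integral_mono) (auto simp: indicator_def)
 also have "... = (NN y. ?b y * indicator {0..} y) + (NN y. ?b y * indicator {..0} y)"
  by (rule nn_integral_add) measurable
 also have "(NN y. ?b y * indicator {0..} y) = ennreal \<bar>?s\<bar> * (NN t. ?b (0 + ?s * t) * indicator {0..} (0 + ?s * t))"
  using sin_half by (intro nn_integral_real_affine) auto
 also have "(NN t. ?b (0 + ?s * t) * indicator {0..} (0 + ?s * t)) = (NN t. G (ray \<alpha> t) * indicator {0..} t)"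
  using sin_half r(1) by (intro nn_integral_cong) (auto simp: indicator_def zero_le_mult_iff)
 also have "(NN y. ?b y * indicator {..0} y) = ennreal \<bar>- ?s\<bar> * (NN t. ?b (0 + - ?s * t) * indicator {..0} (0 + - ?s * t))"
  using sin_half by (intro nn_integral_real_affine) auto
 also have "(NN t. ?b (0 + - ?s * t) * indicator {..0} (0 + - ?s * t)) = (NN t. G (ray 0 t) * indicator {0..} t)"
  using sin_half r(2) by (intro nn_integral_cong) (auto simp: indicator_def mult_le_0_iff zero_le_mult_iff)
 finally show ?thesis using sin_half by simp
qed

lemma ray_product_bound:
 fixes f \<phi> :: "cfun"
 assumes f: "continuous_on UNIV f" and \<phi>: "\<And>z. norm (\<phi> z) \<le> C" "\<And>z. norm z > R \<Longrightarrow> \<phi> z = 0" and "R \<ge> 0"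
 shows "(NN t. ennreal (norm (f (ray \<theta> t) * \<phi> (ray \<theta> t))) * indicator {0..} t) \<le> ennreal (C * (sqrt R * rn \<theta> R f))"
proof -
 have fm [measurable]: "f \<in> bm" by (rule continuous_bm[OF f])
 have [measurable]: "ray \<theta> \<in> bm" by (rule continuous_bm[OF continuous_ray])
 have C: "C \<ge> 0" using \<phi>(1)[of 0] norm_ge_zero[of "\<phi> 0"] by linarith
 have nr: "norm (ray \<theta> t) = \<bar>t\<bar>" for t by (simp add: ray_def norm_mult)
 have fc: "continuous_on UNIV (\<lambda>t. f (ray \<theta> t))" by (rule continuous_on_compose2[OF f continuous_ray]) auto
 let ?M = "mu {0..R}"
 have l: "l2 ?M (\<lambda>t. f (ray \<theta> t))" by (rule l2_interval) (auto intro: continuous_on_subset[OF fc])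
 have l1: "l2 ?M (\<lambda>t. 1 :: complex)" by (rule l2_interval) auto
 have n1: "n2 ?M (\<lambda>t. 1 :: complex) = sqrt R" using \<open>R \<ge> 0\<close> by (simp add: n2_def measure_restrict_space)
 have i: "integrable lborel (\<lambda>t. indicator {0..R} t *\<^sub>R norm (f (ray \<theta> t)))"
  by (rule borel_integrable_compact) (auto intro!: continuous_intros continuous_on_subset[OF fc])
 have "(LINT t|lborel. indicator {0..R} t *\<^sub>R norm (f (ray \<theta> t))) = (LINT t|lebesgue. indicator {0..R} t *\<^sub>R norm (f (ray \<theta> t)))"
  by (rule integral_completion[symmetric]) simp
 also have "... = (LINT t|?M. norm (1::complex) * norm (f (ray \<theta> t)))" by (subst integral_restrict_space) auto
 also have "... \<le> sqrt R * rn \<theta> R f" using n2_mult_bound(2)[OF l1 l] n1 by simp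
 finally have b: "(LINT t|lborel. indicator {0..R} t *\<^sub>R norm (f (ray \<theta> t))) \<le> sqrt R * rn \<theta> R f" .
 have "(NN t. ennreal (norm (f (ray \<theta> t) * \<phi> (ray \<theta> t))) * indicator {0..} t)
  \<le> (NN t. ennreal (C * (indicator {0..R} t *\<^sub>R norm (f (ray \<theta> t)))))"
 proof (rule nn_integral_mono)
  fix t :: real
  show "ennreal (norm (f (ray \<theta> t) * \<phi> (ray \<theta> t))) * indicator {0..} t \<le> ennreal (C * (indicator {0..R} t *\<^sub>R norm (f (ray \<theta> t))))"
   using \<phi>(2)[of "ray \<theta> t"] mult_right_mono[OF \<phi>(1)[of "ray \<theta> t"], of "norm (f (ray \<theta> t))"]
   by (auto simp: indicator_def nr norm_mult mult.commute intro!: ennreal_leI)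
 qed
 also have "... = ennreal (LINT t|lborel. C * (indicator {0..R} t *\<^sub>R norm (f (ray \<theta> t))))"
  by (rule nn_integral_eq_integral) (use i C in auto)
 also have "... \<le> ennreal (C * (sqrt R * rn \<theta> R f))"
  using b C by (intro ennreal_leI) (simp add: mult_left_mono)
 finally show ?thesis .
qed

lemma glue_boundary_term:
 assumes w: "Ck 1 w" and \<phi>: "Ck 1 \<phi>" "\<And>z. norm z > R \<Longrightarrow> \<phi> z = 0" "\<And>z. norm (\<phi> z) \<le> C" and R: "R \<ge> 0" and b: "b \<in> Basis"
 shows "norm (LINT z|lborel. indicator A z *\<^sub>R der (\<lambda>z. w z * \<phi> z) z b)
  \<le> 2 * (1 + \<bar>slope\<bar>) * (C * sqrt R) * (rn 0 R w + rn \<alpha> R w)"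
proof -
 let ?f = "\<lambda>z. w z * \<phi> z"
 have f: "Ck 1 ?f" "norm z > R \<Longrightarrow> ?f z = 0" for z using Ck_mult[OF w \<phi>(1)] \<phi>(2) by auto
 have C: "C \<ge> 0" using \<phi>(3)[of 0] norm_ge_zero[of "\<phi> 0"] by linarith
 have [measurable]: "?f \<in> bm" by (rule continuous_bm[OF Ck_continuous[OF f(1)]])
 define X where "X = C * sqrt R * (rn 0 R w + rn \<alpha> R w)"
 have X: "X \<ge> 0" using C R by (simp add: X_def)
 have fi: "integrable lborel (\<lambda>y. ?f (flatten dir slope 0 y))" by (rule boundary_integrable[OF norm_dir(1) Ck_continuous[OF f(1)], of R]) (use \<phi>(2) in auto)
 have rb: "ennreal (sin (\<alpha> / 2)) * (NN t. ennreal (norm (?f (ray \<theta> t))) * indicator {0..} t) \<le> ennreal (C * (sqrt R * rn \<theta> R w))" for \<theta>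
 proof -
  have "ennreal (sin (\<alpha> / 2)) * (NN t. ennreal (norm (?f (ray \<theta> t))) * indicator {0..} t) \<le> 1 * ennreal (C * (sqrt R * rn \<theta> R w))"
   by (intro mult_mono ray_product_bound[OF Ck_continuous[OF w] \<phi>(3,2) R]) auto
  then show ?thesis by simp
 qed
 have "ennreal (LINT y|lborel. norm (?f (flatten dir slope 0 y))) = (NN y. ennreal (norm (?f (flatten dir slope 0 y))))"
  by (rule nn_integral_eq_integral[symmetric]) (use fi in auto)
 also have "... \<le> ennreal (sin (\<alpha> / 2)) * (NN t. ennreal (norm (?f (ray \<alpha> t))) * indicator {0..} t) +
  ennreal (sin (\<alpha> / 2)) * (NN t. ennreal (norm (?f (ray 0 t))) * indicator {0..} t)"
  by (rule nn_integral_rays) measurable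
 also have "... \<le> ennreal (C * (sqrt R * rn \<alpha> R w)) + ennreal (C * (sqrt R * rn 0 R w))"
  by (intro add_mono rb)
 also have "... = ennreal X" using C R by (simp add: X_def algebra_simps flip: ennreal_plus)
 finally have le: "(LINT y|lborel. norm (?f (flatten dir slope 0 y))) \<le> X" using X by (simp add: ennreal_le_iff)
 have "norm (LINT z|lborel. indicator A z *\<^sub>R der ?f z b) \<le> 2 * (1 + \<bar>slope\<bar>) * (LINT y|lborel. norm (?f (flatten dir slope 0 y)))"
  unfolding sector_eq by (rule Sec_boundary_estimate[OF norm_dir(1) f(1) _ norm_Basis[OF b], of R]) (use \<phi>(2) in auto)
 also have "... \<le> 2 * (1 + \<bar>slope\<bar>) * X" using le by (intro mult_left_mono) auto
 finally show ?thesis by (simp add: X_def mult.assoc)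
qed

lemma glue_weak_partial:
 assumes u: "u \<in> W12 A" "l2 (mu A) p" "has_weak_partial A b u p"
  and v: "v \<in> W12 B" "l2 (mu B) p'" "has_weak_partial B b v p'"
  and st: "same_trace \<alpha> u v" and b: "b \<in> Basis"
 shows "has_weak_partial UNIV b (cmb u v) (cmb p p')"
proof -
 obtain g where g: "has_trace \<alpha> A u g" "has_trace \<alpha> B v g" using st by (auto simp: same_trace_def)
 then have gl: "g \<in> L2loc_rays \<alpha>" by (simp add: has_trace_iff)
 obtain w where w: "\<And>n::nat. Ck 1 (w n)" "\<And>n. w n \<in> W12 A" "(\<lambda>n. W12_norm A (\<lambda>x. w n x - u x)) \<longlonglongrightarrow> 0"
  using density[OF sides_AB(1) u(1)] by blast
 obtain z where z: "\<And>n::nat. Ck 1 (z n)" "\<And>n. z n \<in> W12 B" "(\<lambda>n. W12_norm B (\<lambda>x. z n x - v x)) \<longlonglongrightarrow> 0"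
  using density[OF sides_AB(2) v(1)] by blast
 have wc: "continuous_on X (w n)" "continuous_on X (z n)" for n X
  using Ck_continuous[OF w(1)] Ck_continuous[OF z(1)] by (auto intro: continuous_on_subset)
 let ?A = "mu A" and ?B = "mu B"
 have b': "b = 1 \<or> b = \<i>" using b by (auto simp: Basis_complex_def)
 have lim: "(\<lambda>n. n2 (mu Z) (\<lambda>x. W n x - U x)) \<longlonglongrightarrow> 0 \<and> (\<lambda>n. n2 (mu Z) (\<lambda>x. der (W n) x b - P x)) \<longlonglongrightarrow> 0
   \<and> (\<forall>n. l2 (mu Z) (\<lambda>x. der (W n) x b))"
  if Z: "Z \<in> sides" and U: "U \<in> W12 Z" "l2 (mu Z) P" "has_weak_partial Z b U P" and W: "\<And>n. Ck 1 (W n)" "\<And>n. W n \<in> W12 Z" "(\<lambda>n. W12_norm Z (\<lambda>x. W n x - U x)) \<longlonglongrightarrow> 0" for Z U P W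
 proof -
  note op = open_sides[OF Z]
  obtain p0 q0 where j: "jet Z U p0 q0" using U(1) by (auto simp: W12_iff)
  have jW: "jet Z (W n) (\<lambda>x. der (W n) x 1) (\<lambda>x. der (W n) x \<i>)" for n
   by (intro jet_classical op W)
  show ?thesis
  proof (cases "b = 1")
   case True
   then have j': "jet Z U P q0" using j U by (auto simp: jet_def)
   show ?thesis using jet_limit(1,2)[OF op j' jW W(3)] jW True by (auto simp: jet_def)
  next
   case False
   then have j': "jet Z U p0 P" and bi: "b = \<i>" using j U b' by (auto simp: jet_def)
   show ?thesis using jet_limit(1,3)[OF op j' jW W(3)] jW bi by (auto simp: jet_def)
  qed
 qed
 note lu = lim[OF sides_AB(1) u w] and lv = lim[OF sides_AB(2) v z]
 have ul: "l2 ?A u" "l2 ?B v" "l2 ?A (w n)" "l2 ?B (z n)" for n using u v w z by (auto intro: W12_l2)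
 have li: "locally_integrable UNIV (cmb u v)" "locally_integrable UNIV (cmb p p')"
  by (intro l2_locally_integrable l2_cmb ul u v open_UNIV)+
 have "(LINT x|mu UNIV. cmb u v x * der \<phi> x b) = - (LINT x|mu UNIV. cmb p p' x * \<phi> x)"
  if t: "test_function UNIV \<phi>" for \<phi>
 proof -
  have c: "C1c UNIV \<phi>" by (rule test_function_C1c[OF t])
  then obtain K where K: "compact K" "\<And>x. x \<notin> K \<Longrightarrow> \<phi> x = 0" and C1: "Ck 1 \<phi>" unfolding C1c_def by blast
  have "\<exists>R. \<forall>y. norm y > R \<longrightarrow> \<phi> y = 0" by (rule compact_bound[OF K(1)]) (rule K(2))
  then obtain R0 where R0: "\<And>y. norm y > R0 \<Longrightarrow> \<phi> y = 0" by blast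
  define R where "R = max R0 0"
  have R: "R \<ge> 0" "\<And>y. norm y > R \<Longrightarrow> \<phi> y = 0" using R0 by (auto simp: R_def)
  have "bounded (\<phi> ` cball 0 R)"
   by (intro compact_imp_bounded compact_continuous_image continuous_on_subset[OF Ck_continuous[OF C1]]) auto
  then obtain C0 where C0: "\<forall>x\<in>cball 0 R. norm (\<phi> x) \<le> C0" unfolding bounded_iff by blast
  have C: "norm (\<phi> x) \<le> max C0 0" for x using C0 R(2)[of x] by (cases "norm x > R") (auto intro: max.coboundedI1)
  let ?D = "\<lambda>x. der \<phi> x b"
  have \<phi>l: "l2 ?A \<phi>" "l2 ?B \<phi>" "l2 ?A ?D" "l2 ?B ?D" using l2_C1c[OF c] b sets_AB by auto
  define EA where "EA f Df = (LINT x|?A. f x * ?D x) + (LINT x|?A. Df x * \<phi> x)" for f Df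
  define EB where "EB f Df = (LINT x|?B. f x * ?D x) + (LINT x|?B. Df x * \<phi> x)" for f Df
  define E where "E n = EA (w n) (\<lambda>x. der (w n) x b) + EB (z n) (\<lambda>x. der (z n) x b)" for n
  have "E \<longlonglongrightarrow> EA u p + EB v p'"
   unfolding E_def EA_def EB_def
   by (intro tendsto_add lint_l2_limit ul u(2) v(2) \<phi>l) (use lu lv in auto)
  moreover have "E \<longlonglongrightarrow> 0"
  proof (rule Lim_null_comparison)
   let ?k = "2 * (1 + \<bar>slope\<bar>) * (max C0 0 * sqrt R)"
   have prod: "der (\<lambda>x. f x * \<phi> x) x b = f x * ?D x + der f x b * \<phi> x" if "Ck 1 f" for f x
    using fun_cong[OF frechet_derivative_at[OF has_derivative_mult[OF Ck_1D(1)[OF that, of x] Ck_1D(1)[OF C1, of x]]], of b] by simp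
   have onset: "(LINT x|mu Z. f x * ?D x) + (LINT x|mu Z. der f x b * \<phi> x)
     = (LINT x|lborel. indicator Z x *\<^sub>R der (\<lambda>x. f x * \<phi> x) x b)"
    if f: "Ck 1 f" "l2 (mu Z) f" "l2 (mu Z) (\<lambda>x. der f x b)" and Z: "Z \<in> sides" for f Z
   proof -
    have \<phi>Z: "l2 (mu Z) \<phi>" "l2 (mu Z) ?D" using Z \<phi>l by (auto simp: sides_def)
    have [measurable]: "Z \<in> sets borel" using open_sides[OF Z] by simp
    have [measurable]: "(\<lambda>x. der (\<lambda>x. f x * \<phi> x) x b) \<in> bm"
     by (rule continuous_bm[OF continuous_directional[OF Ck_mult[OF f(1) C1]]])
    have "(LINT x|mu Z. f x * ?D x) + (LINT x|mu Z. der f x b * \<phi> x)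
     = (LINT x|mu Z. der (\<lambda>x. f x * \<phi> x) x b)"
     unfolding prod[OF f(1)]
     by (rule Bochner_Integration.integral_add[symmetric]) (intro n2_mult_bound f \<phi>Z)+
    also have "... = (LINT x|lebesgue. indicator Z x *\<^sub>R der (\<lambda>x. f x * \<phi> x) x b)"
     by (rule integral_restrict_space) (use sets_sides[OF Z] in auto)
    also have "... = (LINT x|lborel. indicator Z x *\<^sub>R der (\<lambda>x. f x * \<phi> x) x b)"
     by (rule integral_completion) simp
    finally show ?thesis .
   qed
   have bnd: "norm (E n) \<le> ?k * (rn 0 R (\<lambda>x. w n x - z n x) + rn \<alpha> R (\<lambda>x. w n x - z n x))" for n
   proof -
    let ?F = "\<lambda>f x. der (\<lambda>x. f x * \<phi> x) x b"
    have Fi: "integrable lborel (?F f)" if "Ck 1 f" for f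
     by (rule integrable_compact_support[OF continuous_directional[OF Ck_mult[OF that C1]] frechet_derivative_support[where B=R]])
       (use R in auto)
    have Fm: "(?F f) \<in> bm" if "Ck 1 f" for f using borel_measurable_integrable[OF Fi[OF that]] by simp
    have FA: "integrable lborel (\<lambda>x. indicator A x *\<^sub>R ?F f x)" "integrable lborel (\<lambda>x. indicator B x *\<^sub>R ?F f x)" if "Ck 1 f" for f
     by (intro integrable_mult_indicator Fi that; simp)+
    have z0: "(LINT x|lborel. indicator A x *\<^sub>R ?F (z n) x) + (LINT x|lborel. indicator B x *\<^sub>R ?F (z n) x) = 0"
    proof -
     have "(LINT x|lborel. indicator A x *\<^sub>R ?F (z n) x) + (LINT x|lborel. indicator B x *\<^sub>R ?F (z n) x)
      = (LINT x|lborel. indicator A x *\<^sub>R ?F (z n) x + indicator B x *\<^sub>R ?F (z n) x)"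
      using FA[OF z(1)] by simp
     also have "... = (LINT x|lborel. ?F (z n) x)"
     proof (rule integral_cong_AE)
      show "AE x in lborel. indicator A x *\<^sub>R ?F (z n) x + indicator B x *\<^sub>R ?F (z n) x = ?F (z n) x"
       using AE_AB by eventually_elim (auto simp: disjoint_AB indicator_def)
     qed (use Fm[OF z(1), of n] in measurable)
     also have "... = 0" by (rule integral_derivative_zero[OF Ck_mult[OF z(1) C1], of R]) (use R in auto)
     finally show ?thesis .
    qed
    have "E n = (LINT x|lborel. indicator A x *\<^sub>R ?F (w n) x) + (LINT x|lborel. indicator B x *\<^sub>R ?F (z n) x)"
    proof -
     have dl: "l2 ?A (\<lambda>x. der (w n) x b)" "l2 ?B (\<lambda>x. der (z n) x b)"
      using lu lv by blast+
     show ?thesis unfolding E_def EA_def EB_def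
      onset[OF w(1) ul(3) dl(1) sides_AB(1)] onset[OF z(1) ul(4) dl(2) sides_AB(2)] ..
    qed
    also have "... = (LINT x|lborel. indicator A x *\<^sub>R ?F (w n) x) - (LINT x|lborel. indicator A x *\<^sub>R ?F (z n) x)"
     using z0 by (simp add: add_eq_0_iff)
    also have "... = (LINT x|lborel. indicator A x *\<^sub>R ?F (w n) x - indicator A x *\<^sub>R ?F (z n) x)"
     using FA[OF w(1)] FA[OF z(1)] by simp
    also have "... = (LINT x|lborel. indicator A x *\<^sub>R ?F (\<lambda>x. w n x - z n x) x)"
    proof (rule Bochner_Integration.integral_cong[OF refl])
     fix x
     have e: "der (\<lambda>x. w n x - z n x) x b = der (w n) x b - der (z n) x b"
      using fun_cong[OF frechet_derivative_at[OF has_derivative_diff[OF Ck_1D(1)[OF w(1), of n x] Ck_1D(1)[OF z(1), of n x]]], of b] by simp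
     have "?F (\<lambda>x. w n x - z n x) x = ?F (w n) x - ?F (z n) x"
      unfolding prod[OF w(1)] prod[OF z(1)] prod[OF Ck_diff[OF w(1) z(1)]] e by (simp add: algebra_simps)
     then show "indicator A x *\<^sub>R ?F (w n) x - indicator A x *\<^sub>R ?F (z n) x = indicator A x *\<^sub>R ?F (\<lambda>x. w n x - z n x) x"
      by (simp add: scaleR_diff_right)
    qed
    finally have "norm (E n) = norm (LINT x|lborel. indicator A x *\<^sub>R ?F (\<lambda>x. w n x - z n x) x)" by simp
    also have "... \<le> ?k * (rn 0 R (\<lambda>x. w n x - z n x) + rn \<alpha> R (\<lambda>x. w n x - z n x))"
     by (rule glue_boundary_term[OF Ck_diff[OF w(1) z(1)] C1 R(2) C R(1) b])
    finally show ?thesis .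
   qed
   show "\<forall>\<^sub>F n in sequentially. norm (E n) \<le> ?k * (rn 0 R (\<lambda>x. w n x - z n x) + rn \<alpha> R (\<lambda>x. w n x - z n x))" using bnd by simp
   have rl: "(\<lambda>n. rn \<theta> R (\<lambda>x. w n x - z n x)) \<longlonglongrightarrow> 0" if \<theta>: "\<theta> \<in> {0, \<alpha>}" for \<theta>
   proof (rule Lim_null_comparison)
    have l: "l2 (mu {0..R}) (\<lambda>t. w n (ray \<theta> t))" "l2 (mu {0..R}) (\<lambda>t. z n (ray \<theta> t))" for n
     by (rule trace_inequality(1)[OF sides_AB(1) w(2) wc(1) \<theta>], rule trace_inequality(1)[OF sides_AB(2) z(2) wc(2) \<theta>])
    show "\<forall>\<^sub>F n in sequentially. norm (rn \<theta> R (\<lambda>x. w n x - z n x)) \<le> rn \<theta> R (\<lambda>x. w n x - g x) + rn \<theta> R (\<lambda>x. z n x - g x)"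
     using n2_triangle_diff[OF l(1) L2loc_l2[OF gl \<theta>, of R] l(2)] n2_minus_commute[of "mu {0..R}" "\<lambda>t. g (ray \<theta> t)"] by simp
    show "(\<lambda>n. rn \<theta> R (\<lambda>x. w n x - g x) + rn \<theta> R (\<lambda>x. z n x - g x)) \<longlonglongrightarrow> 0"
     using has_trace_any_sequence[OF sides_AB(1) u(1) g(1) w(2) wc(1) w(3) \<theta>, of R]
      has_trace_any_sequence[OF sides_AB(2) v(1) g(2) z(2) wc(2) z(3) \<theta>, of R] by (auto intro!: tendsto_eq_intros)
   qed
   show "(\<lambda>n. ?k * (rn 0 R (\<lambda>x. w n x - z n x) + rn \<alpha> R (\<lambda>x. w n x - z n x))) \<longlonglongrightarrow> 0"
    using rl[of 0] rl[of \<alpha>] by (auto intro!: tendsto_eq_intros)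
  qed
  ultimately have z0: "EA u p + EB v p' = 0" by (rule LIMSEQ_unique)
  have split: "(LINT x|mu UNIV. cmb f f' x * \<psi> x) = (LINT x|?A. f x * \<psi> x) + (LINT x|?B. f' x * \<psi> x)"
   if "l2 ?A f" "l2 ?B f'" "l2 ?A \<psi>" "l2 ?B \<psi>" for f f' \<psi> :: "cfun"
  proof -
   have 1: "integrable ?A (\<lambda>x. cmb f f' x * \<psi> x)"
    using n2_mult_bound(1)[OF that(1,3)] by (rule Bochner_Integration.integrable_cong[THEN iffD1, rotated 2]) (auto simp: cmb_A)
   have 2: "integrable ?B (\<lambda>x. cmb f f' x * \<psi> x)"
    using n2_mult_bound(1)[OF that(2,4)] by (rule Bochner_Integration.integrable_cong[THEN iffD1, rotated 2]) (auto simp: cmb_B)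
   have "(LINT x|?A. cmb f f' x * \<psi> x) = (LINT x|?A. f x * \<psi> x)" "(LINT x|?B. cmb f f' x * \<psi> x) = (LINT x|?B. f' x * \<psi> x)"
    by (intro Bochner_Integration.integral_cong; simp add: cmb_A cmb_B)+
   then show ?thesis using integral_split(2)[OF 1 2] by simp
  qed
  show ?thesis
   using z0 unfolding EA_def EB_def split[OF ul(1,2) \<phi>l(3,4)] split[OF u(2) v(2) \<phi>l(1,2)]
   by (simp add: add_eq_0_iff algebra_simps)
 qed
 then show ?thesis using li unfolding has_weak_partial_def by blast
qed

theorem glue:
 assumes u: "u \<in> W12 A" and v: "v \<in> W12 B" and st: "same_trace \<alpha> u v"
 shows "cmb u v \<in> W12 UNIV" "(W12_norm UNIV (cmb u v))^2 = (W12_norm A u)^2 + (W12_norm B v)^2"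
proof -
 obtain p q where j: "jet A u p q" using u by (auto simp: W12_iff)
 obtain p' q' where j': "jet B v p' q'" using v by (auto simp: W12_iff)
 have J: "jet UNIV (cmb u v) (cmb p p') (cmb q q')"
  using j j' unfolding jet_def
  by (intro conjI l2_cmb glue_weak_partial[OF u _ _ v _ _ st]) (auto simp: Basis_complex_def)
 then show "cmb u v \<in> W12 UNIV" by (rule jet_W12)
 have "(\<lambda>x. (cmb p p' x, cmb q q' x, cmb u v x)) = cmb (\<lambda>x. (p x, q x, u x)) (\<lambda>x. (p' x, q' x, v x))"
  by (auto simp: cmb_def)
 then show "(W12_norm UNIV (cmb u v))^2 = (W12_norm A u)^2 + (W12_norm B v)^2"
  unfolding W12_norm_jet[OF open_UNIV J] W12_norm_jet[OF open_AB(1) j] W12_norm_jet[OF open_AB(2) j']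
  using l2_cmb(2)[OF jet_l2[OF j] jet_l2[OF j']] by simp
qed

lemma norm_split:
 assumes j: "jet UNIV w p q"
 shows "(W12_norm UNIV w)^2 = (jn A w p q)^2 + (jn B w p q)^2"
proof -
 have l: "l2 (mu Z) (\<lambda>x. (p x, q x, w x))" if "Z \<in> sides" for Z
  by (rule jet_l2[OF jet_mono[OF open_UNIV open_sides[OF that] subset_UNIV j]])
 have "cmb f f = f" for f :: "complex \<Rightarrow> complex \<times> complex \<times> complex" by (auto simp: cmb_def)
 then show ?thesis unfolding W12_norm_jet[OF open_UNIV j] using l2_cmb(2)[OF l[OF sides_AB(1)] l[OF sides_AB(2)]] by simp
qed

end

section \<open>Logarithmic polar coordinates and the angular stretch\<close>

lemma jac_mult: "jac (\<lambda>k. E * k) = (norm E)^2"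
 by (simp add: jac_def cmod_power2) (simp add: power2_eq_square)

lemma exp_strip_image:
 assumes d: "norm d = 1" and h: "0 < h" "h < pi"
 shows "(\<lambda>z. exp z * d) ` {z. \<bar>Im z\<bar> < h} = Sec d (cot h)"
proof (intro equalityI subsetI)
 fix w assume "w \<in> (\<lambda>z. exp z * d) ` {z. \<bar>Im z\<bar> < h}"
 then obtain z where z: "\<bar>Im z\<bar> < h" "w = exp z * d" by auto
 have "w = of_real (exp (Re z)) * cis (Im z) * d" using z(2) by (simp add: exp_eq_polar)
 then show "w \<in> Sec d (cot h)" using Sec_polar[OF d h, of "Im z" "exp (Re z)"] z(1) h by simp
next
 fix w assume w: "w \<in> Sec d (cot h)"
 then have w0: "w \<noteq> 0" by (auto simp: Sec_def)
 define \<zeta> where "\<zeta> = w * cnj d"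
 have wz: "w = \<zeta> * d" using unit_cnj[OF d] by (simp add: \<zeta>_def mult.assoc)
 have z0: "\<zeta> \<noteq> 0" using w0 wz by auto
 have ex: "exp (Ln \<zeta>) = \<zeta>" using z0 by simp
 have ar: "\<bar>Im (Ln \<zeta>)\<bar> \<le> pi" using mpi_less_Im_Ln[OF z0] Im_Ln_le_pi[OF z0] by simp
 have "w = of_real (exp (Re (Ln \<zeta>))) * cis (Im (Ln \<zeta>)) * d"
  unfolding wz using ex exp_eq_polar[of "Ln \<zeta>"] by simp
 then have "\<bar>Im (Ln \<zeta>)\<bar> < h" using w Sec_polar[OF d h ar, of "exp (Re (Ln \<zeta>))"] by simp
 then show "w \<in> (\<lambda>z. exp z * d) ` {z. \<bar>Im z\<bar> < h}"
  using ex wz by (intro image_eqI[of _ _ "Ln \<zeta>"]) auto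
qed

lemma nn_integral_log_polar:
 assumes d: "norm d = 1" and h: "0 < h" "h < pi" and F [measurable]: "F \<in> bm"
 shows "(NN z. F z * indicator (Sec d (cot h)) z) =
  (NN t. NN s. F (exp (Complex s t) * d) * ennreal (exp (2 * s)) * indicator {-h<..<h} t)"
proof -
 let ?S = "{z::complex. \<bar>Im z\<bar> < h}"
 let ?g = "\<lambda>z. exp z * d"
 have oS: "open ?S" by (intro open_Collect_less continuous_intros)
 have "(NN z. F z * indicator (Sec d (cot h)) z) = (NN z. F z * indicator (?g ` ?S) z)"
  unfolding exp_strip_image[OF d h] ..
 also have "... = (NN x. ennreal (jac (\<lambda>k. (exp x * d) * k)) * F (?g x) * indicator ?S x)"
 proof (rule nn_integral_change_of_variables)
  show "?S \<in> sets borel" using oS by simp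
  show "?g ` ?S \<in> sets borel" unfolding exp_strip_image[OF d h] using open_Sec by simp
  show "(?g has_derivative (\<lambda>k. (exp x * d) * k)) (at x)" for x
   by (auto intro!: derivative_eq_intros simp: algebra_simps)
  show "inj_on ?g ?S"
  proof (rule inj_onI)
   fix x y assume xy: "x \<in> ?S" "y \<in> ?S" "exp x * d = exp y * d"
   have "d \<noteq> 0" using d by auto
   then have "exp x = exp y" using xy(3) by (simp only: mult_cancel_right) simp
   moreover have "\<bar>Im x - Im y\<bar> < 2 * pi" using xy(1,2) h by auto
   ultimately show "x = y" using exp_complex_eqI[of x y] by blast
  qed
  show "continuous_on ?S (\<lambda>x. exp x * d * 1)" "continuous_on ?S (\<lambda>x. exp x * d * \<i>)"
   by (intro continuous_intros)+
 qed (rule F)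
 also have "... = (NN x. ennreal (exp (2 * Re x)) * F (?g x) * indicator ?S x)"
 proof -
  have "jac (\<lambda>k. (exp x * d) * k) = exp (2 * Re x)" for x
   by (simp only: jac_mult norm_mult d norm_exp_eq_Re mult_1_right exp_double)
  then show ?thesis by (simp only:)
 qed
 also have "... = (NN t. NN s. ennreal (exp (2 * s)) * F (?g (Complex s t)) * indicator ?S (Complex s t))"
 proof (subst nn_integral_complex)
  have [measurable]: "?S \<in> sets borel" using oS by simp
  have [measurable]: "(\<lambda>z. exp z * d) \<in> bm" by (intro continuous_bm continuous_intros)
  show "(\<lambda>x. ennreal (exp (2 * Re x)) * F (?g x) * indicator ?S x) \<in> bm" by measurable
 qed simp
 also have "... = (NN t. NN s. F (exp (Complex s t) * d) * ennreal (exp (2 * s)) * indicator {-h<..<h} t)"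
  by (intro nn_integral_cong) (auto simp: indicator_def mult.commute abs_less_iff)
 finally show ?thesis .
qed

lemma nn_l2:
 fixes f :: "complex \<Rightarrow> 'b::euclidean_space"
 assumes "open Z" "continuous_on Z f" "(NN z. ennreal ((norm (f z))^2) * indicator Z z) \<le> ennreal c" "c \<ge> 0"
 shows "l2 (mu Z) f" "(n2 (mu Z) f)^2 \<le> c"
proof -
 have s: "Z \<in> sets borel" "Z \<in> sets lebesgue" using assms(1) by auto
 let ?g = "\<lambda>x. indicator Z x *\<^sub>R (norm (f x))^2"
 have gm: "?g \<in> bm"
  by (rule borel_measurable_continuous_on_indicator[OF s(1)]) (intro continuous_intros assms(2))
 have e: "(NN z. ennreal (?g z)) = (NN z. ennreal ((norm (f z))^2) * indicator Z z)"
  by (intro nn_integral_cong) (auto simp: indicator_def)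
 have i: "integrable lborel ?g"
 proof (rule integrableI_bounded)
  have "(NN z. ennreal (norm (?g z))) \<le> ennreal c" using e assms(3) by (simp add: abs_mult)
  then show "(NN z. ennreal (norm (?g z))) < \<infinity>" by (rule le_less_trans) simp
 qed (use gm in simp)
 have "f \<in> borel_measurable (mu Z)"
  by (rule continuous_imp_measurable_on_sets_lebesgue[OF assms(2) s(2)])
 then show "l2 (mu Z) f"
  using integrable_lebesgue_lborel[OF i] s by (simp add: l2_def integrable_restrict_space)
 have "(LINT x|mu Z. (norm (f x))^2) = (LINT x|lebesgue. ?g x)"
  using s by (subst integral_restrict_space) auto
 also have "... = (LINT x|lborel. ?g x)" by (rule integral_completion) (use gm in simp)
 finally have "ennreal ((n2 (mu Z) f)^2) = (NN z. ennreal (?g z))"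
  unfolding n2_power2 using nn_integral_eq_integral[OF i] by simp
 then have "ennreal ((n2 (mu Z) f)^2) \<le> ennreal c" using assms(3) unfolding e by simp
 then show "(n2 (mu Z) f)^2 \<le> c" using assms(4) by (simp add: ennreal_le_iff)
qed

lemma jet_C1on:
 assumes "open Z" "C1on Z v"
  and "(NN z. ennreal ((norm (der v z 1, der v z \<i>, v z))^2) * indicator Z z) \<le> ennreal c" "c \<ge> 0"
 shows "jet Z v (\<lambda>z. der v z 1) (\<lambda>z. der v z \<i>)" "(W12_norm Z v)^2 \<le> c"
proof -
 have cont: "continuous_on Z (\<lambda>z. (der v z 1, der v z \<i>, v z))"
  by (intro continuous_intros C1onD[OF assms(2)] C1on_continuous[OF assms(2)])
 note l = nn_l2[OF assms(1) cont assms(3,4)]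
 show j: "jet Z v (\<lambda>z. der v z 1) (\<lambda>z. der v z \<i>)"
  unfolding jet_def using l2_triple_D[OF l(1)]
  by (auto intro!: classical_weak_partial[OF assms(1,2)] simp: Basis_complex_def)
 show "(W12_norm Z v)^2 \<le> c" unfolding W12_norm_jet[OF assms(1) j] by (rule l(2))
qed

lemma W12_norm_C1:
 assumes "open Z" "Ck 1 w" "w \<in> W12 Z"
 shows "(NN z. ennreal ((norm (der w z 1, der w z \<i>, w z))^2) * indicator Z z)
  = ennreal ((W12_norm Z w)^2)"
proof -
 note j = jet_classical[OF assms]
 have "continuous_on UNIV (\<lambda>z. (norm (der w z 1, der w z \<i>, w z))^2)"
  by (intro continuous_intros Ck_1D[OF assms(2)] Ck_continuous[OF assms(2)])
 then have m: "(\<lambda>z. (norm (der w z 1, der w z \<i>, w z))^2) \<in> bm"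
  by (rule continuous_bm)
 show ?thesis unfolding W12_norm_jet[OF assms(1) j] n2_power2
  by (rule nn_lebesgue_on[OF _ m _ l2_integrable[OF jet_l2[OF j]]]) (use assms(1) in auto)
qed

lemma gradient_rotate:
 fixes T :: "cfun"
 assumes "linear T"
 shows "(norm (T z))^2 + (norm (T (\<i> * z)))^2 = (norm z)^2 * ((norm (T 1))^2 + (norm (T \<i>))^2)"
proof -
 have T: "T k = Re k *\<^sub>R T 1 + Im k *\<^sub>R T \<i>" for k
 proof -
  have "T (Re k *\<^sub>R 1 + Im k *\<^sub>R \<i>) = Re k *\<^sub>R T 1 + Im k *\<^sub>R T \<i>"
   using assms by (simp add: linear_add linear_scale)
  moreover have "Re k *\<^sub>R 1 + Im k *\<^sub>R \<i> = k" by (simp add: complex_eq_iff)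
  ultimately show ?thesis by simp
 qed
 obtain a b where ab: "T 1 = a" "T \<i> = b" by blast
 have 1: "T z = Re z *\<^sub>R a + Im z *\<^sub>R b" "T (\<i> * z) = (- Im z) *\<^sub>R a + Re z *\<^sub>R b"
  using T[of z] T[of "\<i> * z"] ab by simp_all
 show ?thesis unfolding 1 ab cmod_power2
  by (simp add: power2_eq_square algebra_simps)
qed

context sector_angle
begin

definition kap :: real where "kap = (\<alpha> / 2) / (pi - \<alpha> / 2)"

lemma kap_pos: "kap > 0" using \<alpha> by (simp add: kap_def)

lemma halfB: "0 < pi - \<alpha> / 2" "pi - \<alpha> / 2 < pi" using \<alpha> by auto

lemma A_cot: "A = Sec dir (cot (\<alpha> / 2))" by (simp add: sector_eq slope_def)

lemma B_cot: "B = Sec (- dir) (cot (pi - \<alpha> / 2))"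
 by (simp add: cosector_eq slope_def cot_def sin_diff cos_diff)

definition contract :: "cfun" where "contract k = Complex (Re k) (- kap * Im k)"

lemma bounded_linear_contract: "bounded_linear contract"
 by (intro linear_conv_bounded_linear[THEN iffD1] linearI) (auto simp: contract_def complex_eq_iff algebra_simps)

definition stretch :: "cfun" where
 "stretch z = of_real (norm z) * cis (- kap * Arg (- z * cnj dir)) * dir"

lemma norm_stretch: "norm (stretch z) = norm z"
 by (simp add: stretch_def norm_mult norm_dir)

lemma stretch_exp:
 assumes "z \<noteq> 0" shows "stretch z = exp (contract (Ln (- z * cnj dir))) * dir"
proof -
 have n: "- z * cnj dir \<noteq> 0" using assms norm_dir by auto
 have "contract (Ln (- z * cnj dir)) = Complex (ln (norm z)) (- kap * Arg (- z * cnj dir))"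
  using n Arg_eq_Im_Ln[OF n] by (simp add: contract_def Re_Ln norm_mult norm_dir)
 then show ?thesis using assms by (simp add: stretch_def exp_eq_polar)
qed

lemma stretch_polar:
 assumes "\<bar>t\<bar> < pi" shows "stretch (exp (Complex s t) * - dir) = exp (Complex s (- kap * t)) * dir"
proof -
 have e: "- (exp (Complex s t) * - dir) * cnj dir = exp (Complex s t)" using unit_cnj[OF norm_dir(1)] by (simp add: mult.assoc)
 have L: "Ln (exp (Complex s t)) = Complex s t" using assms by (intro Ln_exp) auto
 have "dir \<noteq> 0" using norm_dir by auto
 then have "exp (Complex s t) * - dir \<noteq> 0" by simp
 from stretch_exp[OF this] show ?thesis unfolding e L by (simp add: contract_def)
qed

lemma B_log_domain:
 assumes "z \<in> closure B" "z \<noteq> 0" shows "- z * cnj dir \<notin> \<real>\<^sub>\<le>\<^sub>0"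
proof
 assume "- z * cnj dir \<in> \<real>\<^sub>\<le>\<^sub>0"
 then have r: "Re (- z * cnj dir) \<le> 0" "Im (- z * cnj dir) = 0" by (auto simp: complex_nonpos_Reals_iff)
 have "- slope * \<bar>Im (z * cnj (- dir))\<bar> \<le> Re (z * cnj (- dir))"
  using assms(1) unfolding cosector_eq closure_Sec[OF norm_dir(2)] by simp
 then have "Re (- z * cnj dir) \<ge> 0" using r(2) by simp
 then have "- z * cnj dir = 0" using r by (simp add: complex_eq_iff)
 then show False using assms(2) norm_dir by auto
qed

lemma kap_half: "kap * (pi - \<alpha> / 2) = \<alpha> / 2"
 using nonzero_eq_divide_eq[of "pi - \<alpha> / 2" kap "\<alpha> / 2"] \<alpha> kap_def by simp

lemma zero_notin_B: "0 \<notin> B" by (simp add: cosector_eq Sec_def)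

lemma stretch_has_derivative:
 assumes "z \<in> B" shows "(stretch has_derivative (\<lambda>k. stretch z * contract (k / z))) (at z)"
proof -
 have z0: "z \<noteq> 0" using assms zero_notin_B by auto
 have dom: "- z * cnj dir \<notin> \<real>\<^sub>\<le>\<^sub>0" using assms closure_subset z0 by (intro B_log_domain) auto
 have "((\<lambda>z. Ln (- z * cnj dir)) has_field_derivative (1 / (- z * cnj dir)) * (- cnj dir)) (at z)"
  by (rule DERIV_chain2[where f=Ln and g="\<lambda>z. - z * cnj dir", OF has_field_derivative_Ln[OF dom, unfolded inverse_eq_divide]])
    (auto intro!: derivative_eq_intros)
 moreover have "(1 / (- z * cnj dir)) * (- cnj dir) = 1 / z"
 proof -
  have "cnj dir \<noteq> 0" using norm_dir by auto
  then show ?thesis using z0 by (simp add: field_simps)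
 qed
 ultimately have "((\<lambda>z. Ln (- z * cnj dir)) has_field_derivative 1 / z) (at z)" by (simp only:)
 then have "((\<lambda>z. Ln (- z * cnj dir)) has_derivative (\<lambda>k. (1 / z) * k)) (at z)"
  by (simp only: has_field_derivative_def)
 then have "((\<lambda>z. contract (Ln (- z * cnj dir))) has_derivative (\<lambda>k. contract ((1 / z) * k))) (at z)"
  by (rule bounded_linear.has_derivative[OF bounded_linear_contract])
 then have "((\<lambda>z. exp (contract (Ln (- z * cnj dir))) * dir) has_derivative
   (\<lambda>k. exp (contract (Ln (- z * cnj dir))) * contract ((1 / z) * k) * dir)) (at z)"
  by (intro has_derivative_mult_left has_derivative_compose[where g=exp, OF _ DERIV_exp[unfolded has_field_derivative_def]])
 then have "(stretch has_derivative (\<lambda>k. exp (contract (Ln (- z * cnj dir))) * contract ((1 / z) * k) * dir)) (at z)"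
  by (rule has_derivative_transform_within_open[where s="- {0}"]) (use z0 in \<open>auto simp: stretch_exp\<close>)
 then show ?thesis by (simp add: stretch_exp[OF z0] mult_ac divide_inverse)
qed

lemma continuous_stretch: "continuous_on (closure B) stretch"
 unfolding continuous_on_eq_continuous_within
proof (rule ballI)
 fix z assume z: "z \<in> closure B"
 show "continuous (at z within closure B) stretch"
 proof (cases "z = 0")
  case True
  have "((\<lambda>x. norm x) \<longlongrightarrow> norm (0::complex)) (at 0 within closure B)" by (intro tendsto_intros)
  then have "(stretch \<longlongrightarrow> 0) (at 0 within closure B)"
   by (intro Lim_null_comparison[where g=norm and f=stretch]) (auto simp: norm_stretch)
  moreover have "stretch 0 = 0" using norm_stretch[of 0] by simp
  ultimately show ?thesis using True by (simp add: continuous_within)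
 next
  case False
  have "isCont (\<lambda>z. exp (contract (Ln (- z * cnj dir))) * dir) z"
   using B_log_domain[OF z False]
   by (intro continuous_intros bounded_linear.isCont[OF bounded_linear_contract] isCont_Ln') auto
  moreover have "\<forall>\<^sub>F x in nhds z. exp (contract (Ln (- x * cnj dir))) * dir = stretch x"
  proof -
   have "\<forall>\<^sub>F x in nhds z. x \<in> - {0}" using False by (intro eventually_nhds_in_open) auto
   then show ?thesis by eventually_elim (auto simp: stretch_exp)
  qed
  ultimately have "isCont stretch z" by (rule iffD1[OF isCont_cong, rotated])
  then show ?thesis by (rule continuous_at_imp_continuous_within)
 qed
qed

lemma nn_integral_stretch:
 assumes F [measurable]: "F \<in> bm"
 shows "(NN z. F (stretch z) * indicator B z) = ennreal (1 / kap) * (NN z. F z * indicator A z)"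
proof -
 define st where "st z = indicator (closure B) z *\<^sub>R stretch z" for z
 have [measurable]: "st \<in> bm"
  unfolding st_def by (rule borel_measurable_continuous_on_indicator[OF _ continuous_stretch]) simp
 have a: "0 < \<alpha> / 2" "\<alpha> / 2 < pi" using \<alpha> by auto
 define G where "G t = (NN s. F (exp (Complex s t) * dir) * ennreal (exp (2 * s)) * indicator {- (\<alpha>/2)<..<\<alpha>/2} t)" for t
 have [measurable]: "(\<lambda>(t, s). exp (Complex s t) * dir) \<in> borel_measurable (borel \<Otimes>\<^sub>M borel)"
 proof -
  have "(\<lambda>p. exp (Complex (snd p) (fst p)) * dir) \<in> borel_measurable (borel :: (real \<times> real) measure)"
   unfolding Complex_eq by (intro continuous_bm continuous_intros)
  then show ?thesis by (simp add: borel_prod case_prod_beta')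
 qed
 have Gm [measurable]: "G \<in> bm" unfolding G_def by measurable
 have "(NN z. F (stretch z) * indicator B z) = (NN z. F (st z) * indicator (Sec (- dir) (cot (pi - \<alpha> / 2))) z)"
  using closure_subset[of B] by (intro nn_integral_cong) (auto simp: st_def indicator_def B_cot[symmetric])
 also have "... = (NN t. NN s. F (st (exp (Complex s t) * - dir)) * ennreal (exp (2 * s)) * indicator {- (pi - \<alpha>/2)<..<pi - \<alpha>/2} t)"
  by (rule nn_integral_log_polar[OF norm_dir(2) halfB]) measurable
 also have "... = (NN t. G (0 + (- kap) * t))"
 proof (rule nn_integral_cong)
  fix t :: real
  show "(NN s. F (st (exp (Complex s t) * - dir)) * ennreal (exp (2 * s)) * indicator {- (pi - \<alpha>/2)<..<pi - \<alpha>/2} t) = G (0 + (- kap) * t)"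
   unfolding G_def
  proof (rule nn_integral_cong)
   fix s :: real
   have iff: "\<bar>t\<bar> < pi - \<alpha>/2 \<longleftrightarrow> \<bar>kap * t\<bar> < \<alpha>/2"
   proof -
    have "\<bar>kap * t\<bar> < kap * (pi - \<alpha>/2) \<longleftrightarrow> \<bar>t\<bar> < pi - \<alpha>/2" using kap_pos by (simp add: abs_mult)
    then show ?thesis using kap_half by simp
   qed
   have iff_ind: "0 + (- kap) * t \<in> {- (\<alpha>/2)<..<\<alpha>/2} \<longleftrightarrow> t \<in> {- (pi - \<alpha>/2)<..<pi - \<alpha>/2}"
    using iff by (simp only: greaterThanLessThan_iff abs_less_iff) linarith
   show "F (st (exp (Complex s t) * - dir)) * ennreal (exp (2 * s)) * indicator {- (pi - \<alpha>/2)<..<pi - \<alpha>/2} t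
     = F (exp (Complex s (0 + (- kap) * t)) * dir) * ennreal (exp (2 * s)) * indicator {- (\<alpha>/2)<..<\<alpha>/2} (0 + (- kap) * t)"
   proof (cases "\<bar>t\<bar> < pi - \<alpha>/2")
    case True
    have "exp (Complex s t) * - dir \<in> (\<lambda>z. exp z * - dir) ` {z. \<bar>Im z\<bar> < pi - \<alpha>/2}"
     using True by (intro image_eqI[of _ _ "Complex s t"]) auto
    then have "exp (Complex s t) * - dir \<in> closure B"
     unfolding exp_strip_image[OF norm_dir(2) halfB] B_cot[symmetric] using closure_subset by blast
    then have "st (exp (Complex s t) * - dir) = exp (Complex s (- kap * t)) * dir"
     unfolding st_def using stretch_polar[of t s] True \<alpha> by simp
    then show ?thesis using True iff_ind by (simp add: indicator_def abs_less_iff)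
   next
    case False
    have "t \<notin> {- (pi - \<alpha>/2)<..<pi - \<alpha>/2}" using False by auto
    then have "t \<notin> {- (pi - \<alpha>/2)<..<pi - \<alpha>/2}" "0 + (- kap) * t \<notin> {- (\<alpha>/2)<..<\<alpha>/2}" unfolding iff_ind by auto
    then show ?thesis by simp
   qed
  qed
 qed
 also have "... = ennreal (1 / kap) * (NN t. G t)"
 proof -
  have "(NN t. G t) = ennreal \<bar>- kap\<bar> * (NN t. G (0 + (- kap) * t))"
   by (rule nn_integral_real_affine) (use kap_pos in auto)
  then have "ennreal (1 / kap) * (NN t. G t) = (ennreal (1 / kap) * ennreal kap) * (NN t. G (0 + (- kap) * t))"
   using kap_pos by (simp add: mult.assoc)
  also have "ennreal (1 / kap) * ennreal kap = 1" using kap_pos by (subst ennreal_mult[symmetric]) auto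
  finally show ?thesis by simp
 qed
 also have "(NN t. G t) = (NN z. F z * indicator A z)"
  unfolding G_def A_cot by (rule nn_integral_log_polar[OF norm_dir(1) a F, symmetric])
 finally show ?thesis .
qed

definition Mk :: real where "Mk = max 1 (kap^2) / kap"

lemma stretch_compose_derivative:
 assumes "Ck 1 w" "z \<in> B"
 shows "((\<lambda>z. w (stretch z)) has_derivative (\<lambda>k. der w (stretch z) (stretch z * contract (k / z)))) (at z)"
 by (rule has_derivative_compose[OF stretch_has_derivative[OF assms(2)] Ck_1D(1)[OF assms(1)]])

lemma stretch_energy:
 assumes w: "Ck 1 w" and z: "z \<in> B"
 defines "f' \<equiv> \<lambda>k. der w (stretch z) (stretch z * contract (k / z))"
 shows "(norm (f' 1))^2 + (norm (f' \<i>))^2 \<le> max 1 (kap^2) *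
  ((norm (der w (stretch z) 1))^2 + (norm (der w (stretch z) \<i>))^2)"
proof -
 have z0: "z \<noteq> 0" using z zero_notin_B by auto
 let ?T = "der w (stretch z)"
 have lT: "linear ?T" by (rule has_derivative_linear[OF Ck_1D(1)[OF w]])
 have lf: "linear f'" unfolding f'_def by (rule has_derivative_linear[OF stretch_compose_derivative[OF w z]])
 have c: "contract 1 = 1" "contract \<i> = (- kap) *\<^sub>R \<i>" by (auto simp: contract_def complex_eq_iff)
 have 1: "f' z = ?T (stretch z)" unfolding f'_def using z0 c by simp
 have "f' (\<i> * z) = ?T ((- kap) *\<^sub>R (\<i> * stretch z))" unfolding f'_def using z0 c by (simp add: mult.commute)
 also have "... = (- kap) *\<^sub>R ?T (\<i> * stretch z)" by (rule linear_scale[OF lT])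
 finally have 2: "(norm (f' (\<i> * z)))^2 = kap^2 * (norm (?T (\<i> * stretch z)))^2" by (simp add: power_mult_distrib)
 have "(norm z)^2 * ((norm (f' 1))^2 + (norm (f' \<i>))^2) = 1 * (norm (?T (stretch z)))^2 + kap^2 * (norm (?T (\<i> * stretch z)))^2"
  unfolding gradient_rotate[OF lf, symmetric] 1 2 by simp
 also have "... \<le> max 1 (kap^2) * (norm (?T (stretch z)))^2 + max 1 (kap^2) * (norm (?T (\<i> * stretch z)))^2"
  by (intro add_mono mult_right_mono) auto
 also have "... = (norm z)^2 * (max 1 (kap^2) * ((norm (?T 1))^2 + (norm (?T \<i>))^2))"
  using arg_cong[OF gradient_rotate[OF lT, of "stretch z"], of "\<lambda>x. max 1 (kap^2) * x"] unfolding norm_stretch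
  by (simp only: distrib_left mult.left_commute)
 finally have "(norm z)^2 * ((norm (f' 1))^2 + (norm (f' \<i>))^2) \<le> (norm z)^2 * (max 1 (kap^2) * ((norm (?T 1))^2 + (norm (?T \<i>))^2))" .
 moreover have "0 < (norm z)^2" using z0 by simp
 ultimately show ?thesis by (rule mult_left_le_imp_le)
qed

lemma stretch_C1:
 assumes w: "Ck 1 w" "w \<in> W12 A"
 shows "(\<lambda>z. w (stretch z)) \<in> W12 B" "continuous_on (closure B) (\<lambda>z. w (stretch z))"
  "(W12_norm B (\<lambda>z. w (stretch z)))^2 \<le> Mk * (W12_norm A w)^2"
proof -
 let ?v = "\<lambda>z. w (stretch z)"
 show "continuous_on (closure B) ?v" by (rule continuous_on_compose2[OF Ck_continuous[OF w(1)] continuous_stretch]) simp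
 define f' where "f' z k = der w (stretch z) (stretch z * contract (k / z))" for z k
 have D: "(?v has_derivative f' z) (at z)" if "z \<in> B" for z
  unfolding f'_def by (rule stretch_compose_derivative[OF w(1) that])
 have stc: "continuous_on B stretch" by (rule continuous_on_subset[OF continuous_stretch closure_subset])
 have c: "continuous_on B (\<lambda>z. f' z k)" for k
 proof -
  have "continuous_on B (\<lambda>z. of_real (Re (stretch z * contract (k / z))) * der w (stretch z) 1 +
   of_real (Im (stretch z * contract (k / z))) * der w (stretch z) \<i>)"
   using zero_notin_B
   by (intro continuous_intros stc continuous_on_compose2[OF Ck_1D(2)[OF w(1)] stc] continuous_on_compose2[OF Ck_1D(3)[OF w(1)] stc]
     bounded_linear.continuous_on[OF bounded_linear_contract]) auto
  then show ?thesis unfolding f'_def by (rule continuous_on_eq) (rule directional[OF w(1), symmetric])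
 qed
 have C1: "C1on B ?v" by (rule C1onI[OF open_AB(2) D c c])
 have fd: "der ?v z = f' z" if "z \<in> B" for z using frechet_derivative_at[OF D[OF that]] by simp
 let ?J = "\<lambda>z. (norm (der w z 1, der w z \<i>, w z))^2"
 have "continuous_on UNIV ?J" by (intro continuous_intros Ck_1D[OF w(1)] Ck_continuous[OF w(1)])
 then have Jm [measurable]: "?J \<in> bm" by (rule continuous_bm)
 have "(NN z. ennreal ((norm (der ?v z 1, der ?v z \<i>, ?v z))^2) * indicator B z)
  \<le> (NN z. ennreal (max 1 (kap^2) * ?J (stretch z)) * indicator B z)"
 proof (rule nn_integral_mono)
  fix z :: complex
  show "ennreal ((norm (der ?v z 1, der ?v z \<i>, ?v z))^2) * indicator B z
   \<le> ennreal (max 1 (kap^2) * ?J (stretch z)) * indicator B z"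
  proof (cases "z \<in> B")
   case True
   have "(norm (f' z 1))^2 + (norm (f' z \<i>))^2 + (norm (?v z))^2 \<le> max 1 (kap^2) * ?J (stretch z)"
   proof -
    have "(norm (?v z))^2 \<le> max 1 (kap^2) * (norm (?v z))^2" using mult_right_mono[of 1 "max 1 (kap^2)" "(norm (?v z))^2"] by simp
    then show ?thesis using stretch_energy[OF w(1) True] unfolding f'_def norm_triple_power2 distrib_left by linarith
   qed
   then show ?thesis unfolding fd[OF True] norm_triple_power2[of "f' z 1"] by (intro mult_right_mono ennreal_leI) auto
  qed simp
 qed
 also have "... = ennreal (1 / kap) * (NN z. ennreal (max 1 (kap^2) * ?J z) * indicator A z)"
  by (rule nn_integral_stretch) measurable
 also have "(NN z. ennreal (max 1 (kap^2) * ?J z) * indicator A z) = ennreal (max 1 (kap^2)) * (NN z. ennreal (?J z) * indicator A z)"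
  by (subst nn_integral_cmult[symmetric]) (auto simp: ennreal_mult mult.assoc)
 also have "(NN z. ennreal (?J z) * indicator A z) = ennreal ((W12_norm A w)^2)"
  by (rule W12_norm_C1[OF open_AB(1) w])
 also have "ennreal (1 / kap) * (ennreal (max 1 (kap^2)) * ennreal ((W12_norm A w)^2)) = ennreal (Mk * (W12_norm A w)^2)"
  using kap_pos by (simp add: Mk_def flip: ennreal_mult)
 finally have b: "(NN z. ennreal ((norm (der ?v z 1, der ?v z \<i>, ?v z))^2) * indicator B z)
  \<le> ennreal (Mk * (W12_norm A w)^2)" .
 have M0: "0 \<le> Mk * (W12_norm A w)^2" using kap_pos by (simp add: Mk_def)
 show "?v \<in> W12 B" by (rule jet_W12[OF jet_C1on(1)[OF open_AB(2) C1 b M0]])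
 show "(W12_norm B ?v)^2 \<le> Mk * (W12_norm A w)^2" by (rule jet_C1on(2)[OF open_AB(2) C1 b M0])
qed

lemma stretch_ray:
 assumes "\<theta> \<in> {0, \<alpha>}" "t \<ge> 0" shows "stretch (ray \<theta> t) = ray \<theta> t"
proof (cases "t = 0")
 case True
 then show ?thesis using norm_stretch[of 0] by (simp add: ray_def)
next
 case False
 then have t: "t > 0" using assms(2) by simp
 define b where "b = pi - \<alpha> / 2"
 have b: "\<bar>b\<bar> < pi" "\<bar>- b\<bar> < pi" "kap * b = \<alpha> / 2" using \<alpha> kap_half by (auto simp: b_def)
 have md: "- dir = cis (\<alpha> / 2 + pi)" by (simp add: dir_def complex_eq_iff)
 have e: "exp (Complex (ln t) x) = of_real t * cis x" for x using t by (simp add: exp_eq_polar)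
 have p: "of_real t * cis x * cis y = of_real t * cis (x + y)" for x y by (simp add: cis_mult mult.assoc)
 have 0: "ray 0 t = exp (Complex (ln t) b) * - dir" unfolding e md p ray_def by (simp add: b_def complex_eq_iff)
 have "cis (- b + (\<alpha> / 2 + pi)) = cis \<alpha>" by (simp add: b_def)
 then have 1: "ray \<alpha> t = exp (Complex (ln t) (- b)) * - dir" unfolding e md p ray_def by simp
 have "stretch (ray 0 t) = exp (Complex (ln t) (- kap * b)) * dir" unfolding 0 by (rule stretch_polar[OF b(1)])
 also have "... = ray 0 t" unfolding e dir_def p ray_def using b(3) by (simp only: minus_mult_left[symmetric]) simp
 finally have r0: "stretch (ray 0 t) = ray 0 t" .
 have "stretch (ray \<alpha> t) = exp (Complex (ln t) (- kap * - b)) * dir" unfolding 1 by (rule stretch_polar[OF b(2)])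
 also have "... = ray \<alpha> t" 
 proof -
  have "- kap * - b + \<alpha> / 2 = \<alpha>" using b(3) by simp
  then show ?thesis unfolding e dir_def p ray_def by (simp only:)
 qed
 finally have r1: "stretch (ray \<alpha> t) = ray \<alpha> t" .
 show ?thesis using assms(1) r0 r1 by auto
qed

theorem stretch_extension:
 assumes u: "u \<in> W12 A"
 shows "\<exists>v\<in>W12 B. same_trace \<alpha> u v \<and> (W12_norm B v)^2 \<le> Mk * (W12_norm A u)^2"
proof -
 obtain w where w: "\<And>n::nat. Ck 1 (w n)" "\<And>n. w n \<in> W12 A" "(\<lambda>n. W12_norm A (\<lambda>x. w n x - u x)) \<longlonglongrightarrow> 0"
  using density[OF sides_AB(1) u] by blast
 have wc: "continuous_on X (w n)" for n X using Ck_continuous[OF w(1)] by (rule continuous_on_subset) simp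
 define V where "V n z = w n (stretch z)" for n z
 have V: "V n \<in> W12 B" "continuous_on (closure B) (V n)" "(W12_norm B (V n))^2 \<le> Mk * (W12_norm A (w n))^2" for n
  unfolding V_def using stretch_C1[OF w(1,2)] by auto
 have Mk: "Mk > 0" using kap_pos by (simp add: Mk_def)
 have Vd: "W12_norm B (\<lambda>z. V m z - V n z) \<le> sqrt Mk * W12_norm A (\<lambda>z. w m z - w n z)" for m n
 proof (rule power2_le_imp_le)
  show "(W12_norm B (\<lambda>z. V m z - V n z))^2 \<le> (sqrt Mk * W12_norm A (\<lambda>z. w m z - w n z))^2"
   unfolding V_def using stretch_C1(3)[OF Ck_diff[OF w(1) w(1)] W12_diff[OF open_AB(1) w(2) w(2)], of m n] Mk
   by (simp add: power_mult_distrib)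
 qed (use Mk W12_norm_nonneg in auto)
 have "\<exists>v\<in>W12 B. (\<lambda>n. W12_norm B (\<lambda>x. V n x - v x)) \<longlonglongrightarrow> 0"
 proof (rule W12_complete[OF open_AB(2) V(1)])
  fix e :: real assume e: "e > 0"
  define e' where "e' = e / sqrt Mk / 2"
  have e': "e' > 0" using e Mk by (simp add: e'_def)
  have "\<exists>N. \<forall>n\<ge>N. norm (W12_norm A (\<lambda>x. w n x - u x) - 0) < e'" by (rule LIMSEQ_D[OF w(3) e'])
  then obtain N where N: "\<And>n. n \<ge> N \<Longrightarrow> W12_norm A (\<lambda>x. w n x - u x) < e'" by (auto simp: W12_norm_nonneg)
  have "W12_norm B (\<lambda>x. V m x - V n x) < e" if "m \<ge> N" "n \<ge> N" for m n
  proof -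
   have "W12_norm A (\<lambda>x. w m x - w n x) < e' + e'"
    using W12_norm_triangle_diff[OF open_AB(1) w(2) u w(2), of m n] N[OF that(1)] N[OF that(2)]
     W12_norm_minus_commute[OF open_AB(1) u w(2), of n] by linarith
   then have "sqrt Mk * W12_norm A (\<lambda>x. w m x - w n x) < sqrt Mk * (e' + e')" using Mk by (intro mult_strict_left_mono) auto
   also have "... = e" using Mk by (simp add: e'_def)
   finally show ?thesis using Vd[of m n] by linarith
  qed
  then show "\<exists>N. \<forall>m\<ge>N. \<forall>n\<ge>N. W12_norm B (\<lambda>x. V m x - V n x) < e" by blast
 qed
 then obtain v where v: "v \<in> W12 B" "(\<lambda>n. W12_norm B (\<lambda>x. V n x - v x)) \<longlonglongrightarrow> 0" by blast
 obtain g where g: "has_trace \<alpha> A u g" using trace_exists[OF sides_AB(1) w(2) wc u w(3)] by blast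
 have "has_trace \<alpha> B v g"
  unfolding has_trace_iff
 proof (intro conjI exI[of _ V] ballI allI V v(2))
  show "g \<in> L2loc_rays \<alpha>" using g by (simp add: has_trace_iff)
  fix \<theta> R assume \<theta>: "\<theta> \<in> {0, \<alpha>}"
  have "rn \<theta> R (\<lambda>z. V n z - g z) = rn \<theta> R (\<lambda>z. w n z - g z)" for n
   unfolding n2_def V_def
   by (intro arg_cong[where f=sqrt] Bochner_Integration.integral_cong) (auto simp: stretch_ray[OF \<theta>])
  then show "(\<lambda>n. rn \<theta> R (\<lambda>z. V n z - g z)) \<longlonglongrightarrow> 0"
   using has_trace_any_sequence[OF sides_AB(1) u g w(2) wc w(3) \<theta>, of R] by simp
 qed
 then have st: "same_trace \<alpha> u v" using g by (auto simp: same_trace_def)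
 have lv: "(\<lambda>n. W12_norm B (V n)) \<longlonglongrightarrow> W12_norm B v"
  by (rule LIM_zero_cancel, rule Lim_null_comparison[OF _ v(2)]) (simp add: W12_norm_le_diff[OF open_AB(2) V(1) v(1)])
 have lu: "(\<lambda>n. W12_norm A (w n)) \<longlonglongrightarrow> W12_norm A u"
  by (rule LIM_zero_cancel, rule Lim_null_comparison[OF _ w(3)]) (simp add: W12_norm_le_diff[OF open_AB(1) w(2) u])
 have "(W12_norm B v)^2 \<le> Mk * (W12_norm A u)^2"
  by (rule LIMSEQ_le[OF tendsto_power[OF lv] tendsto_mult[OF tendsto_const tendsto_power[OF lu]]]) (use V(3) in auto)
 then show ?thesis using v(1) st by blast
qed

end

lemma W12_norm_quadratic:
 assumes "open Z" "u \<in> W12 Z" "v \<in> W12 Z"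
 shows "\<exists>b. \<forall>t. (W12_norm Z (\<lambda>x. u x + of_real t * v x))^2 = (W12_norm Z u)^2 + 2 * b * t + (W12_norm Z v)^2 * t^2"
proof -
 obtain p q p' q' where j: "jet Z u p q" "jet Z v p' q'" using assms by (auto simp: W12_iff)
 define F where "F x = (p x, q x, u x)" for x
 define G where "G x = (p' x, q' x, v x)" for x
 have l: "l2 (mu Z) F" "l2 (mu Z) G" unfolding F_def G_def by (rule jet_l2[OF j(1)], rule jet_l2[OF j(2)])
 have "(W12_norm Z (\<lambda>x. u x + of_real t * v x))^2
  = (W12_norm Z u)^2 + 2 * (LINT x|mu Z. F x \<bullet> G x) * t + (W12_norm Z v)^2 * t^2" for t
 proof -
  have "W12_norm Z (\<lambda>x. u x + of_real t * v x) = n2 (mu Z) (\<lambda>x. F x + t *\<^sub>R G x)"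
   unfolding W12_norm_jet[OF assms(1) jet_add[OF assms(1) j(1) jet_cmult[OF j(2)]]] by (simp add: F_def G_def scaleR_conv_of_real)
  moreover have "W12_norm Z u = n2 (mu Z) F" "W12_norm Z v = n2 (mu Z) G"
   unfolding W12_norm_jet[OF assms(1) j(1)] W12_norm_jet[OF assms(1) j(2)] F_def G_def by simp_all
  ultimately show ?thesis
   by (simp add: n2_add_power2[OF l(1) l2_scaleR[OF l(2)]] n2_scaleR power_mult_distrib)
 qed
 then show ?thesis by blast
qed

context sector_angle begin

definition H0 :: "cfun set" where "H0 = {h \<in> W12 B. has_trace \<alpha> B h (\<lambda>_. 0)}"

lemma H0_scale: "h \<in> H0 \<Longrightarrow> (\<lambda>x. c * h x) \<in> H0"
 using has_trace_linear[OF sides_AB(2), of h h "\<lambda>_. 0" "\<lambda>_. 0" c 0] unfolding H0_def by (auto intro: W12_cmult)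

lemma same_trace_iff:
 assumes "u \<in> W12 A" "has_trace \<alpha> A u g"
 shows "same_trace \<alpha> u v \<longleftrightarrow> has_trace \<alpha> B v g"
proof
 assume "same_trace \<alpha> u v"
 then obtain g' where g': "has_trace \<alpha> A u g'" "has_trace \<alpha> B v g'" by (auto simp: same_trace_def)
 show "has_trace \<alpha> B v g"
 proof (rule has_trace_cong[OF sides_AB(2) g'(2)])
  show "g \<in> L2loc_rays \<alpha>" using assms(2) by (simp add: has_trace_def)
  show "rn \<theta> R (\<lambda>z. g' z - g z) = 0" if "\<theta> \<in> {0, \<alpha>}" for \<theta> R
   by (rule has_trace_unique[OF sides_AB(1) assms(1) g'(1) assms(2) that])
 qed
qed (use assms(2) in \<open>auto simp: same_trace_def\<close>)

lemma trace_on_A: "u \<in> W12 A \<Longrightarrow> \<exists>g. has_trace \<alpha> A u g"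
 using stretch_extension by (auto simp: same_trace_def)

lemma same_trace_add_H0:
 assumes u: "u \<in> W12 A" and v: "v \<in> W12 B" "same_trace \<alpha> u v" and h: "h \<in> H0"
 shows "(\<lambda>x. v x + h x) \<in> W12 B" "same_trace \<alpha> u (\<lambda>x. v x + h x)"
proof -
 obtain g where g: "has_trace \<alpha> A u g" using trace_on_A[OF u] by blast
 have h': "h \<in> W12 B" "has_trace \<alpha> B h (\<lambda>_. 0)" using h by (auto simp: H0_def)
 show "(\<lambda>x. v x + h x) \<in> W12 B" by (rule W12_add[OF open_AB(2) v(1) h'(1)])
 show "same_trace \<alpha> u (\<lambda>x. v x + h x)"
  using has_trace_linear[OF sides_AB(2) v(1) h'(1) v(2)[unfolded same_trace_iff[OF u g]] h'(2), of 1 1]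
  unfolding same_trace_iff[OF u g] by simp
qed

lemma same_trace_diff_H0:
 assumes u: "u \<in> W12 A" and v: "v \<in> W12 B" "same_trace \<alpha> u v" and v': "v' \<in> W12 B" "same_trace \<alpha> u v'"
 shows "(\<lambda>x. v' x - v x) \<in> H0"
proof -
 obtain g where g: "has_trace \<alpha> A u g" using trace_on_A[OF u] by blast
 show ?thesis
  using has_trace_linear[OF sides_AB(2) v'(1) v(1) v'(2)[unfolded same_trace_iff[OF u g]] v(2)[unfolded same_trace_iff[OF u g]], of 1 "-1"]
   W12_diff[OF open_AB(2) v'(1) v(1)]
  by (simp add: H0_def)
qed

lemma same_trace_linear:
 assumes "u \<in> W12 A" "u' \<in> W12 A" "v \<in> W12 B" "same_trace \<alpha> u v" "v' \<in> W12 B" "same_trace \<alpha> u' v'"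
 shows "same_trace \<alpha> (\<lambda>x. a * u x + b * u' x) (\<lambda>x. a * v x + b * v' x)"
proof -
 obtain g g' where "has_trace \<alpha> A u g" "has_trace \<alpha> B v g" "has_trace \<alpha> A u' g'" "has_trace \<alpha> B v' g'"
  using assms by (auto simp: same_trace_def)
 then show ?thesis unfolding same_trace_def
  using has_trace_linear[OF sides_AB(1) assms(1,2)] has_trace_linear[OF sides_AB(2) assms(3,5)] by blast
qed

definition orth :: "cfun \<Rightarrow> bool" where
 "orth v \<longleftrightarrow> v \<in> W12 B \<and> (\<forall>h\<in>H0. (W12_norm B (\<lambda>x. v x + h x))^2 = (W12_norm B v)^2 + (W12_norm B h)^2)"

lemma orthD: "orth v \<Longrightarrow> h \<in> H0 \<Longrightarrow> (W12_norm B (\<lambda>x. v x + h x))^2 = (W12_norm B v)^2 + (W12_norm B h)^2"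
 by (simp add: orth_def)

lemma is_T0_iff:
 assumes u: "u \<in> W12 A"
 shows "is_T0 \<alpha> u v \<longleftrightarrow> same_trace \<alpha> u v \<and> orth v"
proof
 assume T: "is_T0 \<alpha> u v"
 then have v: "v \<in> W12 B" "same_trace \<alpha> u v"
  and min: "\<And>v'. v' \<in> W12 B \<Longrightarrow> same_trace \<alpha> u v' \<Longrightarrow> (W12_norm B v)^2 \<le> (W12_norm B v')^2" by (auto simp: is_T0_def)
 have "(W12_norm B (\<lambda>x. v x + h x))^2 = (W12_norm B v)^2 + (W12_norm B h)^2" if h: "h \<in> H0" for h
 proof -
  have "h \<in> W12 B" using h by (simp add: H0_def)
  then obtain b where b: "\<And>t. (W12_norm B (\<lambda>x. v x + of_real t * h x))^2 = (W12_norm B v)^2 + 2 * b * t + (W12_norm B h)^2 * t^2"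
   using W12_norm_quadratic[OF open_AB(2) v(1)] by blast
  have "b^2 \<le> 0 * (W12_norm B h)^2"
  proof (rule quadratic_nonneg_imp)
   fix t show "0 \<le> 0 + 2 * b * t + (W12_norm B h)^2 * t^2"
    using min[OF same_trace_add_H0[OF u v H0_scale[OF h, of "of_real t"]]] unfolding b by simp
  qed simp
  then have "b = 0" by simp
  then show ?thesis using b[of 1] by simp
 qed
 then show "same_trace \<alpha> u v \<and> orth v" using v by (auto simp: orth_def)
next
 assume R: "same_trace \<alpha> u v \<and> orth v"
 then have v: "v \<in> W12 B" "same_trace \<alpha> u v" by (auto simp: orth_def)
 show "is_T0 \<alpha> u v" unfolding is_T0_def
 proof (intro conjI v ballI impI)
  fix v' assume v': "v' \<in> W12 B" "same_trace \<alpha> u v'"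
  have "(W12_norm B (\<lambda>x. v x + (v' x - v x)))^2 = (W12_norm B v)^2 + (W12_norm B (\<lambda>x. v' x - v x))^2"
   using R by (intro orthD same_trace_diff_H0[OF u v v']) auto
  then show "(W12_norm B v)^2 \<le> (W12_norm B v')^2" by simp
 qed
qed

text \<open>Additivity rests on the parallelogram law applied to \<open>v + h/2\<close> and \<open>v' + h/2\<close>.\<close>

lemma orth_add:
 assumes v: "orth v" "orth v'" shows "orth (\<lambda>x. v x + v' x)"
proof -
 let ?Q = "\<lambda>v. (W12_norm B v)^2"
 have w: "v \<in> W12 B" "v' \<in> W12 B" using v by (auto simp: orth_def)
 have "?Q (\<lambda>x. v x + v' x + h x) = ?Q (\<lambda>x. v x + v' x) + ?Q h" if h: "h \<in> H0" for h
 proof -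
  let ?k = "\<lambda>x. (1/2) * h x"
  have k: "?k \<in> H0" by (rule H0_scale[OF h])
  have hW: "h \<in> W12 B" and kW: "?k \<in> W12 B" using h k by (auto simp: H0_def)
  have "?Q (\<lambda>x. (v x + ?k x) - (v' x + ?k x)) + ?Q (\<lambda>x. (v x + ?k x) + (v' x + ?k x))
    = 2 * ?Q (\<lambda>x. v x + ?k x) + 2 * ?Q (\<lambda>x. v' x + ?k x)"
   by (intro W12_norm_parallelogram open_AB W12_add w kW)
  moreover have "(\<lambda>x. (v x + ?k x) + (v' x + ?k x)) = (\<lambda>x. v x + v' x + h x)" by (rule ext) simp
  moreover have "(\<lambda>x. (v x + ?k x) - (v' x + ?k x)) = (\<lambda>x. v x - v' x)" by (rule ext) simp
  moreover have "?Q (\<lambda>x. v x + ?k x) = ?Q v + ?Q ?k" "?Q (\<lambda>x. v' x + ?k x) = ?Q v' + ?Q ?k"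
   by (rule orthD[OF v(1) k], rule orthD[OF v(2) k])
  moreover have "?Q ?k = ?Q h / 4"
   unfolding W12_norm_cmult[OF open_AB(2) hW, of "1/2"] by (simp add: norm_divide power_divide)
  moreover have "?Q (\<lambda>x. v x - v' x) + ?Q (\<lambda>x. v x + v' x) = 2 * ?Q v + 2 * ?Q v'"
   by (rule W12_norm_parallelogram[OF open_AB(2) w])
  ultimately show ?thesis by simp
 qed
 then show ?thesis using W12_add[OF open_AB(2) w] unfolding orth_def by blast
qed

lemma orth_scale:
 assumes v: "orth v" shows "orth (\<lambda>x. a * v x)"
proof -
 have w: "v \<in> W12 B" using v by (simp add: orth_def)
 have "(W12_norm B (\<lambda>x. a * v x + h x))^2 = (W12_norm B (\<lambda>x. a * v x))^2 + (W12_norm B h)^2" if h: "h \<in> H0" for h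
 proof (cases "a = 0")
  case True
  then show ?thesis using W12_norm_cmult[OF open_AB(2) w, of 0] by simp
 next
  case False
  let ?k = "\<lambda>x. (1 / a) * h x"
  have k: "?k \<in> H0" by (rule H0_scale[OF h])
  have hW: "h \<in> W12 B" and kW: "?k \<in> W12 B" using h k by (auto simp: H0_def)
  have "(\<lambda>x. a * v x + h x) = (\<lambda>x. a * (v x + ?k x))" using False by (auto simp: field_simps)
  then have "(W12_norm B (\<lambda>x. a * v x + h x))^2 = (norm a)^2 * (W12_norm B (\<lambda>x. v x + ?k x))^2"
   using W12_norm_cmult[OF open_AB(2) W12_add[OF open_AB(2) w kW], of a] by (simp add: power_mult_distrib)
  also have "... = (norm a)^2 * ((W12_norm B v)^2 + (W12_norm B ?k)^2)"
   by (simp only: orthD[OF v k])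
  also have "... = (W12_norm B (\<lambda>x. a * v x))^2 + (W12_norm B h)^2"
   unfolding W12_norm_cmult[OF open_AB(2) w] W12_norm_cmult[OF open_AB(2) hW]
   using False by (simp add: power_mult_distrib distrib_left norm_divide power_divide)
  finally show ?thesis .
 qed
 then show ?thesis using W12_cmult[OF w] by (auto simp: orth_def)
qed

lemma is_T0_unique:
 assumes u: "u \<in> W12 A" and T: "is_T0 \<alpha> u v" "is_T0 \<alpha> u v'"
 shows "eq_ae B v v'"
proof -
 have v: "v \<in> W12 B" "same_trace \<alpha> u v" "orth v" and v': "v' \<in> W12 B" "same_trace \<alpha> u v'"
  using T is_T0_iff[OF u] by (auto simp: is_T0_def)
 have h: "(\<lambda>x. v' x - v x) \<in> H0" by (rule same_trace_diff_H0[OF u v(1,2) v'])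
 have "(W12_norm B (\<lambda>x. v x + (v' x - v x)))^2 = (W12_norm B v)^2 + (W12_norm B (\<lambda>x. v' x - v x))^2"
  by (rule orthD[OF v(3) h])
 moreover have "(W12_norm B v')^2 \<le> (W12_norm B v)^2" using T v by (auto simp: is_T0_def)
 ultimately have "(W12_norm B (\<lambda>x. v' x - v x))^2 \<le> 0" by simp
 then have "W12_norm B (\<lambda>x. v' x - v x) = 0" by simp
 then have "AE x in mu B. v' x - v x = 0" by (rule W12_norm_eq_0[OF open_AB(2) W12_diff[OF open_AB(2) v'(1) v(1)]])
 then show ?thesis unfolding eq_ae_def by eventually_elim simp
qed

theorem is_T0_exists:
 assumes u: "u \<in> W12 A" shows "\<exists>v. is_T0 \<alpha> u v"
proof -
 let ?Q = "\<lambda>v. (W12_norm B v)^2"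
 obtain g where g: "has_trace \<alpha> A u g" using trace_on_A[OF u] by blast
 note iff = same_trace_iff[OF u g]
 define K where "K = {v \<in> W12 B. has_trace \<alpha> B v g}"
 define I where "I = Inf (?Q ` K)"
 have ne: "K \<noteq> {}" using stretch_extension[OF u] by (auto simp: K_def iff)
 have bb: "bdd_below (?Q ` K)" by (rule bdd_belowI[of _ 0]) auto
 have I: "I \<le> ?Q v" if "v \<in> K" for v unfolding I_def using that bb by (intro cInf_lower) auto
 have "\<exists>v\<in>K. ?Q v < I + 1 / Suc n" for n
  using cInf_lessD[of "?Q ` K" "I + 1 / Suc n"] ne by (auto simp: I_def)
 then obtain V where V: "\<And>n. V n \<in> K" "\<And>n. ?Q (V n) < I + 1 / Suc n" by metis
 have VW: "V n \<in> W12 B" "has_trace \<alpha> B (V n) g" for n using V(1)[of n] by (auto simp: K_def)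
 have mid: "4 * I \<le> ?Q (\<lambda>x. V m x + V n x)" for m n
 proof -
  have "(\<lambda>x. (1/2) * V m x + (1/2) * V n x) \<in> K"
   using has_trace_linear[OF sides_AB(2) VW(1) VW(1) VW(2) VW(2), of "1/2" m "1/2" n]
    W12_add[OF open_AB(2) W12_cmult[OF VW(1)] W12_cmult[OF VW(1)], of "1/2" m "1/2" n]
   by (simp add: K_def flip: add_divide_distrib)
  then have "I \<le> ?Q (\<lambda>x. (1/2) * V m x + (1/2) * V n x)" by (rule I)
  also have "(\<lambda>x. (1/2) * V m x + (1/2) * V n x) = (\<lambda>x. (1/2) * (V m x + V n x))" by (simp add: distrib_left)
  also have "?Q ... = ?Q (\<lambda>x. V m x + V n x) / 4"
   unfolding W12_norm_cmult[OF open_AB(2) W12_add[OF open_AB(2) VW(1) VW(1)], of "1/2"] by (simp add: norm_divide power_divide)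
  finally show ?thesis by simp
 qed
 have cau: "?Q (\<lambda>x. V m x - V n x) \<le> 2 / Suc m + 2 / Suc n" for m n
  using W12_norm_parallelogram[OF open_AB(2) VW(1) VW(1), of m n] mid[of m n] V(2)[of m] V(2)[of n] by simp
 have "\<exists>v\<in>W12 B. (\<lambda>n. W12_norm B (\<lambda>x. V n x - v x)) \<longlonglongrightarrow> 0"
 proof (rule W12_complete[OF open_AB(2) VW(1)])
  fix e :: real assume e: "e > 0"
  obtain N :: nat where N: "4 / e^2 < N" using reals_Archimedean2 by blast
  have "W12_norm B (\<lambda>x. V m x - V n x) < e" if "m \<ge> N" "n \<ge> N" for m n
  proof -
   have N0: "0 < real N" using N e by (meson divide_pos_pos order_less_trans zero_less_numeral zero_less_power)
   have "2 / real (Suc k) \<le> 2 / N" if "k \<ge> N" for k using N0 that by (intro divide_left_mono) auto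
   from this[OF that(1)] this[OF that(2)] have "?Q (\<lambda>x. V m x - V n x) \<le> 2 / N + 2 / N" using cau[of m n] by linarith
   also have "... < e^2" using N N0 e by (simp add: field_simps)
   finally show ?thesis using e by (rule power2_less_imp_less[OF _ less_imp_le])
  qed
  then show "\<exists>N. \<forall>m\<ge>N. \<forall>n\<ge>N. W12_norm B (\<lambda>x. V m x - V n x) < e" by blast
 qed
 then obtain v where v: "v \<in> W12 B" "(\<lambda>n. W12_norm B (\<lambda>x. V n x - v x)) \<longlonglongrightarrow> 0" by blast
 have vg: "has_trace \<alpha> B v g" by (rule has_trace_closed[OF sides_AB(2) v(1) VW(1) v(2) VW(2)])
 have "(\<lambda>n. W12_norm B (V n) - W12_norm B v) \<longlonglongrightarrow> 0"
  by (rule Lim_null_comparison[OF _ v(2)]) (use W12_norm_le_diff[OF open_AB(2) VW(1) v(1)] in auto)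
 then have "(\<lambda>n. W12_norm B (V n)) \<longlonglongrightarrow> W12_norm B v" by (simp add: LIM_zero_iff)
 then have "(\<lambda>n. ?Q (V n)) \<longlonglongrightarrow> ?Q v" by (rule tendsto_power)
 moreover have "(\<lambda>n. I + 1 / real (Suc n)) \<longlonglongrightarrow> I + 0"
  by (intro tendsto_add tendsto_const LIMSEQ_Suc[OF lim_inverse_n'])
 ultimately have "?Q v \<le> I + 0" by (rule LIMSEQ_le) (use V(2) less_imp_le in blast)
 then have le: "?Q v \<le> I" by simp
 have "is_T0 \<alpha> u v" unfolding is_T0_def iff
 proof (intro conjI ballI impI v(1) vg)
  fix v' assume "v' \<in> W12 B" "has_trace \<alpha> B v' g"
  then have "v' \<in> K" by (simp add: K_def)
  from I[OF this] le show "?Q v \<le> ?Q v'" by linarith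
 qed
 then show ?thesis by blast
qed

lemma is_T0_T0: "u \<in> W12 A \<Longrightarrow> is_T0 \<alpha> u (T0 \<alpha> u)"
 unfolding T0_def by (rule someI_ex[OF is_T0_exists])

lemma T0_cong:
 assumes u: "u \<in> W12 A" "u' \<in> W12 A" "eq_ae A u u'"
 shows "T0 \<alpha> u = T0 \<alpha> u'"
proof -
 have ae: "AE x in mu A. w x - u x = w x - u' x" for w
  using u(3) unfolding eq_ae_def by eventually_elim simp
 have n: "W12_norm A (\<lambda>x. w x - u x) = W12_norm A (\<lambda>x. w x - u' x)" if "w \<in> W12 A" for w
  by (rule W12_norm_cong[OF open_AB(1) _ _ ae]) (intro W12_diff open_AB that u)+
 have "(\<forall>k. w k \<in> W12 A \<and> continuous_on (closure A) (w k)) \<and> (\<lambda>k. W12_norm A (\<lambda>x. w k x - u x)) \<longlonglongrightarrow> 0 \<and> C \<longleftrightarrow>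
   (\<forall>k. w k \<in> W12 A \<and> continuous_on (closure A) (w k)) \<and> (\<lambda>k. W12_norm A (\<lambda>x. w k x - u' x)) \<longlonglongrightarrow> 0 \<and> C"
  for w :: "nat \<Rightarrow> cfun" and C
  by (rule conj_cong[OF refl]) (simp add: n)
 then have h: "has_trace \<alpha> A u g = has_trace \<alpha> A u' g" for g
  unfolding has_trace_def by (simp only:)
 show ?thesis unfolding T0_def is_T0_def same_trace_def h ..
qed

lemma E0_cmb: "E0 \<alpha> u = cmb u (T0 \<alpha> u)" by (simp add: fun_eq_iff E0_def cmb_def)

lemma AE_UNIV_split:
 assumes "AE x in mu A. P x" "AE x in mu B. P x" shows "AE x in mu UNIV. P x"
proof -
 have "AE x in lebesgue. x \<in> A \<longrightarrow> P x" "AE x in lebesgue. x \<in> B \<longrightarrow> P x"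
  using assms by (simp_all add: AE_restrict_space_iff)
 with AE_AB_lebesgue have "AE x in lebesgue. P x" by eventually_elim auto
 then show ?thesis by (simp add: AE_restrict_space_iff)
qed

lemma AE_cmb:
 "(AE x in mu A. cmb u v x = u x)" "(AE x in mu B. cmb u v x = v x)"
 by (rule AE_I2; simp add: cmb_A cmb_B)+

theorem extension_operator_E0: "extension_operator \<alpha> (E0 \<alpha>)"
 unfolding extension_operator_def E0_cmb
proof (intro conjI ballI impI allI)
 fix u assume u: "u \<in> W12 A"
 show "cmb u (T0 \<alpha> u) \<in> W12 UNIV" using is_T0_T0[OF u] by (auto simp: is_T0_def intro: glue(1)[OF u])
 show "eq_ae A (cmb u (T0 \<alpha> u)) u" unfolding eq_ae_def by (rule AE_cmb)
next
 fix u v assume uv: "u \<in> W12 A" "v \<in> W12 A" "eq_ae A u v"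
 show "eq_ae UNIV (cmb u (T0 \<alpha> u)) (cmb v (T0 \<alpha> v))"
  unfolding eq_ae_def
 proof (rule AE_UNIV_split)
  show "AE x in mu A. cmb u (T0 \<alpha> u) x = cmb v (T0 \<alpha> v) x"
   using uv(3)[unfolded eq_ae_def] AE_cmb(1)[of u "T0 \<alpha> u"] AE_cmb(1)[of v "T0 \<alpha> v"] by eventually_elim simp
  show "AE x in mu B. cmb u (T0 \<alpha> u) x = cmb v (T0 \<alpha> v) x"
   using AE_cmb(2)[of u "T0 \<alpha> u"] AE_cmb(2)[of v "T0 \<alpha> v"] by eventually_elim (simp add: T0_cong[OF uv])
 qed
next
 fix u v :: "cfun" and a b :: complex assume uv: "u \<in> W12 A" "v \<in> W12 A"
 let ?w = "\<lambda>x. a * u x + b * v x"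
 have w: "?w \<in> W12 A" by (intro W12_add W12_cmult open_AB uv)
 have T: "same_trace \<alpha> u (T0 \<alpha> u)" "orth (T0 \<alpha> u)" "same_trace \<alpha> v (T0 \<alpha> v)" "orth (T0 \<alpha> v)"
  using is_T0_T0[OF uv(1)] is_T0_T0[OF uv(2)] unfolding is_T0_iff[OF uv(1)] is_T0_iff[OF uv(2)] by auto
 then have TW: "T0 \<alpha> u \<in> W12 B" "T0 \<alpha> v \<in> W12 B" by (auto simp: orth_def)
 have "is_T0 \<alpha> ?w (\<lambda>x. a * T0 \<alpha> u x + b * T0 \<alpha> v x)"
  unfolding is_T0_iff[OF w] by (intro conjI same_trace_linear[OF uv TW(1) T(1) TW(2) T(3)] orth_add orth_scale T)
 then have eB: "AE x in mu B. T0 \<alpha> ?w x = a * T0 \<alpha> u x + b * T0 \<alpha> v x"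
  using is_T0_unique[OF w is_T0_T0[OF w]] by (simp add: eq_ae_def)
 show "eq_ae UNIV (cmb ?w (T0 \<alpha> ?w)) (\<lambda>x. a * cmb u (T0 \<alpha> u) x + b * cmb v (T0 \<alpha> v) x)"
  unfolding eq_ae_def
 proof (rule AE_UNIV_split)
  show "AE x in mu A. cmb ?w (T0 \<alpha> ?w) x = a * cmb u (T0 \<alpha> u) x + b * cmb v (T0 \<alpha> v) x"
   using AE_cmb(1)[of u "T0 \<alpha> u"] AE_cmb(1)[of v "T0 \<alpha> v"] AE_cmb(1)[of ?w "T0 \<alpha> ?w"] by eventually_elim simp
  show "AE x in mu B. cmb ?w (T0 \<alpha> ?w) x = a * cmb u (T0 \<alpha> u) x + b * cmb v (T0 \<alpha> v) x"
   using AE_cmb(2)[of u "T0 \<alpha> u"] AE_cmb(2)[of v "T0 \<alpha> v"] AE_cmb(2)[of ?w "T0 \<alpha> ?w"] eB by eventually_elim simp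
 qed
qed

definition Nval :: real where "Nval = 1 / min (sqrt (\<alpha> / (2 * pi))) (sqrt (1 - \<alpha> / (2 * pi)))"

lemma Nval: "0 < Nval" "Nval^2 = 1 + Mk" "Nval^2 = 2 * pi / min \<alpha> (2 * pi - \<alpha>)"
proof -
 let ?m = "min (sqrt (\<alpha> / (2 * pi))) (sqrt (1 - \<alpha> / (2 * pi)))"
 have e: "1 - \<alpha> / (2 * pi) = (2 * pi - \<alpha>) / (2 * pi)" by (simp add: field_simps)
 have "?m = sqrt (min \<alpha> (2 * pi - \<alpha>) / (2 * pi))"
  unfolding e min_divide_distrib_right by (simp add: min_def)
 moreover have p: "0 < min \<alpha> (2 * pi - \<alpha>)" using \<alpha> by auto
 ultimately have m: "?m^2 = min \<alpha> (2 * pi - \<alpha>) / (2 * pi)" "0 < ?m" by simp_all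
 show "0 < Nval" unfolding Nval_def using m(2) by (rule divide_pos_pos[OF zero_less_one])
 show N: "Nval^2 = 2 * pi / min \<alpha> (2 * pi - \<alpha>)" unfolding Nval_def power_divide m by simp
 have k: "kap = \<alpha> / (2 * pi - \<alpha>)" using \<alpha> by (simp add: kap_def field_simps)
 have "Mk = max (1 / kap) kap" unfolding Mk_def max_divide_distrib_right using kap_pos by (simp add: power2_eq_square)
 also have "... = (2 * pi - min \<alpha> (2 * pi - \<alpha>)) / min \<alpha> (2 * pi - \<alpha>)"
 proof (cases "\<alpha> \<le> pi")
  case True
  then have "kap \<le> 1" using \<alpha> by (simp add: k)
  then have "kap \<le> 1 / kap" using kap_pos mult_mono[of kap 1 kap 1] by (simp add: field_simps)
  then show ?thesis using True by (simp add: k min_def)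
 next
  case False
  then have "1 \<le> kap" using \<alpha> by (simp add: k)
  then have "1 / kap \<le> kap" using kap_pos mult_mono[of 1 kap 1 kap] by (simp add: field_simps)
  then show ?thesis using False by (simp add: k min_def)
 qed
 finally show "Nval^2 = 1 + Mk" unfolding N using p
  by (simp add: add_divide_eq_iff[of "min \<alpha> (2 * pi - \<alpha>)" 1, simplified] diff_divide_distrib)
qed

theorem op_norm_E0: "op_norm \<alpha> (E0 \<alpha>) \<le> ennreal Nval"
 unfolding op_norm_def
proof (rule SUP_least)
 fix u assume "u \<in> {u \<in> W12 A. W12_norm A u \<le> 1}"
 then have u: "u \<in> W12 A" "W12_norm A u \<le> 1" by auto
 have T: "T0 \<alpha> u \<in> W12 B" "same_trace \<alpha> u (T0 \<alpha> u)"
  and min: "\<And>v'. v' \<in> W12 B \<Longrightarrow> same_trace \<alpha> u v' \<Longrightarrow> (W12_norm B (T0 \<alpha> u))^2 \<le> (W12_norm B v')^2"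
  using is_T0_T0[OF u(1)] by (auto simp: is_T0_def)
 obtain v where v: "v \<in> W12 B" "same_trace \<alpha> u v" "(W12_norm B v)^2 \<le> Mk * (W12_norm A u)^2"
  using stretch_extension[OF u(1)] by blast
 have "(W12_norm A u)^2 \<le> 1" using u(2) W12_norm_nonneg[of A u] power_le_one by blast
 have "(W12_norm UNIV (E0 \<alpha> u))^2 = (W12_norm A u)^2 + (W12_norm B (T0 \<alpha> u))^2"
  unfolding E0_cmb by (rule glue(2)[OF u(1) T])
 also have "... \<le> (1 + Mk) * (W12_norm A u)^2" using min[OF v(1,2)] v(3) by (simp add: distrib_right)
 also have "... \<le> Nval^2" unfolding Nval(2)[symmetric] using \<open>(W12_norm A u)^2 \<le> 1\<close> mult_left_mono[of "(W12_norm A u)^2" 1 "Nval^2"] by simp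
 finally show "ennreal (W12_norm UNIV (E0 \<alpha> u)) \<le> ennreal Nval"
  using Nval(1) by (intro ennreal_leI) (auto intro: power2_le_imp_le)
qed

end

section \<open>The lower bound\<close>

lemma conv_swap:
 fixes f g :: "cfun"
 assumes "continuous_on UNIV f" "continuous_on UNIV g"
 shows "(LINT y|lborel. f y * g (z - y)) = (LINT y|lborel. g y * f (z - y))"
proof -
 have [measurable]: "f \<in> bm" "g \<in> bm"
  by (intro continuous_bm assms)+
 have "(LINT y|lborel. f y * g (z - y)) = (-1)^2 *\<^sub>R (LINT y|lborel. f (z + (-1) *\<^sub>R y) * g (z - (z + (-1) *\<^sub>R y)))"
  by (rule lborel_integral_affine) auto
 then show ?thesis by (simp add: mult.commute)
qed

lemma continuous_set_integrable:
 fixes f :: "cfun"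
 assumes "continuous_on UNIV f"
 shows "f \<in> bm" "set_integrable lborel (cball 0 R) f"
 by (rule continuous_bm[OF assms])
  (unfold set_integrable_def, rule borel_integrable_compact[OF compact_cball continuous_on_subset[OF assms subset_UNIV]])

text \<open>A mollification is a convolution in which either factor may be differentiated, so its mixed partials agree.\<close>

lemma moll_mixed_partials:
 assumes \<phi>: "Ck 1 \<phi>" "\<And>y. norm y > B \<Longrightarrow> \<phi> y = 0" and e: "e > 0"
 defines "m \<equiv> moll e \<phi>"
 shows "der (\<lambda>x. der m x h) z k = der (\<lambda>x. der m x k) z h"
proof -
 let ?\<rho> = "\<lambda>y. complex_of_real (bump_at e y)"
 let ?D = "\<lambda>x. der \<phi> x"
 let ?D\<rho> = "\<lambda>x. der ?\<rho> x"
 have \<rho>: "Ck n ?\<rho>" for n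
  using Ck_mult[OF Ck_affine[OF Ck_bump, of n "inverse e" 0] Ck_const[of n "of_real (inverse (e^2))"]]
  by (simp add: divide_inverse bump_at_def)
 have \<rho>s: "?\<rho> y = 0" if "norm y > e" for y using bump_e_supp[of "\<lambda>_. 0" 0, OF _ _ e that] by simp
 have cD: "continuous_on UNIV (\<lambda>x. ?D x k)" for k by (rule continuous_directional[OF \<phi>(1)])
 have c\<rho>: "continuous_on UNIV (\<lambda>x. ?D\<rho> x k)" for k by (rule continuous_directional[OF \<rho>])
 note c\<phi> = Ck_continuous[OF \<phi>(1)] and c\<rho>0 = Ck_continuous[OF \<rho>]
 have 1: "der m x h = (LINT y|lborel. ?D y h * ?\<rho> (x - y))" for x h
 proof -
  have "der m x h = moll e (\<lambda>x. ?D x h) x"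
   unfolding m_def by (rule moll_derivative[of \<phi> B, OF \<phi>(1) _ e]) (use \<phi>(2) in blast)
  then show ?thesis unfolding moll_def using conv_swap[OF c\<rho>0 cD] by simp
 qed
 have m: "m = (\<lambda>x. LINT y|lborel. \<phi> y * ?\<rho> (x - y))"
  unfolding m_def moll_def using conv_swap[OF c\<rho>0 c\<phi>] by (intro ext) simp
 have 2: "der m x h = (LINT y|lborel. \<phi> y * ?D\<rho> (x - y) h)" for x h
  unfolding m by (rule fun_cong[OF frechet_derivative_at[symmetric]], rule conv_has_derivative[OF continuous_set_integrable[OF c\<phi>] \<rho>])
   (rule \<rho>s)
 have "der (\<lambda>x. der m x h) z k = (LINT y|lborel. ?D y h * ?D\<rho> (z - y) k)"
  unfolding 1 by (rule fun_cong[OF frechet_derivative_at[symmetric]], rule conv_has_derivative[OF continuous_set_integrable[OF cD] \<rho>])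
   (rule \<rho>s)
 moreover have "der (\<lambda>x. der m x k) z h = (LINT y|lborel. ?D\<rho> y k * ?D (z - y) h)"
 proof -
  have "(\<lambda>x. der m x k) = (\<lambda>x. LINT y|lborel. ?D\<rho> y k * \<phi> (x - y))"
   unfolding 2 using conv_swap[OF c\<phi> c\<rho>] by (intro ext) simp
  then show ?thesis
   by (simp only:) (rule fun_cong[OF frechet_derivative_at[symmetric]],
    rule conv_has_derivative[of _ _ B, OF continuous_set_integrable[OF c\<rho>] \<phi>(1)], use \<phi>(2) in blast)
 qed
 ultimately show ?thesis using conv_swap[OF cD c\<rho>] by simp
qed

lemma C1c_derivative:
 assumes "\<And>k. Ck k \<phi>" "compact K" "\<And>x. x \<notin> K \<Longrightarrow> \<phi> x = 0" "b \<in> Basis"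
 shows "C1c UNIV (\<lambda>x. der \<phi> x b)"
 unfolding C1c_def
proof (intro conjI exI[of _ K] allI impI)
 show "Ck 1 (\<lambda>x. der \<phi> x b)" using Ck_SucD(2)[OF assms(1)[of "Suc 1"] assms(4)] .
 show "der \<phi> x b = 0" if "x \<notin> K" for x
  by (rule frechet_derivative_outside(2)[OF compact_imp_closed[OF assms(2)] assms(3) that])
qed (use assms(2) in auto)

lemma weak_curl:
 assumes w: "has_weak_partial UNIV 1 w p" "has_weak_partial UNIV \<i> w q" and \<Psi>: "C1c UNIV \<Psi>"
 shows "(LINT x|mu UNIV. p x * der \<Psi> x \<i>) = (LINT x|mu UNIV. q x * der \<Psi> x 1)"
proof -
 obtain K where K: "compact K" "\<And>x. x \<notin> K \<Longrightarrow> \<Psi> x = 0" and C1: "Ck 1 \<Psi>" using \<Psi> by (auto simp: C1c_def)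
 have "\<exists>B. \<forall>y. norm y > B \<longrightarrow> \<Psi> y = 0" by (rule compact_bound[OF K(1)]) (rule K(2))
 then obtain B where B: "\<And>y. norm y > B \<Longrightarrow> \<Psi> y = 0" by blast
 obtain s K' where s: "compact K'" "K \<subseteq> K'" "\<And>n::nat. s n > (0::real)"
  and ms: "\<And>\<phi>. continuous_on UNIV \<phi> \<Longrightarrow> (\<forall>x. x \<notin> K \<longrightarrow> \<phi> x = 0) \<Longrightarrow>
   (\<forall>n x. x \<notin> K' \<longrightarrow> moll (s n) \<phi> x = 0) \<and> (\<forall>e>0. \<exists>N. \<forall>n\<ge>N. \<forall>x. norm (moll (s n) \<phi> x - \<phi> x) \<le> e)"
  using moll_sequence[OF K(1) subset_UNIV open_UNIV] by blast
 define m where "m n = moll (s n) \<Psi>" for n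
 have mC: "Ck k (m n)" for k n unfolding m_def by (rule Ck_moll[of \<Psi> B, OF Ck_continuous[OF C1] _ s(3)]) (use B in blast)
 have m0: "m n x = 0" if "x \<notin> K'" for n x using ms[OF Ck_continuous[OF C1]] K(2) that unfolding m_def by blast
 have eq: "(LINT x|mu UNIV. p x * der (m n) x \<i>) = (LINT x|mu UNIV. q x * der (m n) x 1)" for n
 proof -
  have c: "C1c UNIV (\<lambda>x. der (m n) x b)" if "b \<in> Basis" for b
   by (rule C1c_derivative[OF mC s(1) m0 that])
  have b: "\<i> \<in> Basis" "(1::complex) \<in> Basis" by (auto simp: Basis_complex_def)
  have "der (\<lambda>x. der (m n) x \<i>) x 1 = der (\<lambda>x. der (m n) x 1) x \<i>" for x
   unfolding m_def by (rule moll_mixed_partials[of \<Psi> B, OF C1 _ s(3)]) (use B in blast)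
  then show ?thesis
   using weak_partial_C1c[OF open_UNIV w(1) c[OF b(1)]] weak_partial_C1c[OF open_UNIV w(2) c[OF b(2)]] by simp
 qed
 have lim: "(\<lambda>n. LINT x|mu UNIV. g x * der (m n) x b) \<longlonglongrightarrow> (LINT x|mu UNIV. g x * der \<Psi> x b)"
  if g: "locally_integrable UNIV g" for g b
 proof -
  let ?D = "\<lambda>x. der \<Psi> x b"
  have cD: "continuous_on UNIV ?D" by (rule continuous_directional[OF C1])
  have D0: "?D x = 0" if "x \<notin> K" for x by (rule frechet_derivative_outside(2)[OF compact_imp_closed[OF K(1)] K(2) that])
  have mD: "der (m n) x b = moll (s n) ?D x" for n x
   unfolding m_def by (rule moll_derivative[of \<Psi> B, OF C1 _ s(3)]) (use B in blast)
  have M: "moll (s n) ?D x = 0" if "x \<notin> K'" for n x using ms[OF cD] D0 that by blast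
  have L: "\<exists>N. \<forall>n\<ge>N. \<forall>x. norm (moll (s n) ?D x - ?D x) \<le> e" if "e > 0" for e using ms[OF cD] D0 that by blast
  have cM: "continuous_on UNIV (moll (s n) ?D)" for n
   using continuous_directional[OF mC[of 1 n], of b] unfolding mD by simp
  have g': "g absolutely_integrable_on K'" using g s(1) by (simp add: locally_integrable_def)
  show ?thesis unfolding mD
   by (rule lint_uniform_limit[where K=K', OF _ _ _ M g' cD cM s(1) L]) (use D0 s(2) in auto)
 qed
 have "locally_integrable UNIV p" "locally_integrable UNIV q" using w by (auto simp: has_weak_partial_def)
 from lim[OF this(1), of \<i>] lim[OF this(2), of 1] show ?thesis unfolding eq by (rule LIMSEQ_unique)
qed

lemma jet_C1c:
 assumes "C1c UNIV \<phi>" "open Z"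
 shows "jet Z \<phi> (\<lambda>x. der \<phi> x 1) (\<lambda>x. der \<phi> x \<i>)"
proof -
 have "C1on Z \<phi>" using assms(1) by (auto simp: C1c_def intro: Ck_C1on)
 then show ?thesis unfolding jet_def
  by (intro conjI l2_C1c assms classical_weak_partial) (use assms(2) in \<open>auto simp: Basis_complex_def\<close>)
qed

abbreviation curl :: "cfun \<Rightarrow> cfun \<Rightarrow> cfun" where
 "curl \<phi> \<psi> x \<equiv> der \<phi> x 1 * der \<psi> x \<i> - der \<phi> x \<i> * der \<psi> x 1"

abbreviation gnorm :: "complex set \<Rightarrow> cfun \<Rightarrow> real" where
 "gnorm Z \<phi> \<equiv> n2 (mu Z) (\<lambda>x. (der \<phi> x 1, der \<phi> x \<i>))"

lemma l2_pair:
 fixes f g :: "'a \<Rightarrow> complex"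
 assumes "l2 M f" "l2 M g" shows "l2 M (\<lambda>x. (f x, g x))"
 unfolding l2_def using assms by (auto simp: l2_def norm_prod_def)

lemma l2_pair_pairing:
 fixes f g x y :: "'a \<Rightarrow> complex"
 assumes l: "l2 M f" "l2 M g" "l2 M x" "l2 M y"
 shows "\<bar>Re (LINT z|M. f z * y z - g z * x z)\<bar> \<le> n2 M (\<lambda>z. (f z, g z)) * n2 M (\<lambda>z. (x z, y z))"
  "integrable M (\<lambda>z. f z * y z - g z * x z)"
proof -
 have c: "l2 M (\<lambda>z. cnj (h z))" if "l2 M h" for h
 proof -
  have "(\<lambda>z. cnj (h z)) \<in> borel_measurable M"
   by (rule borel_measurable_continuous_on[OF _ l2_measurable[OF that]]) (intro continuous_intros)
  then show ?thesis using that by (simp add: l2_def)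
 qed
 have p: "l2 M (\<lambda>z. (cnj (y z), - cnj (x z)))" using l2_pair[OF c[OF l(4)] l2_uminus[OF c[OF l(3)]]] .
 show i: "integrable M (\<lambda>z. f z * y z - g z * x z)" using l by (intro Bochner_Integration.integrable_diff n2_mult_bound)
 have "Re (f z * y z - g z * x z) = (f z, g z) \<bullet> (cnj (y z), - cnj (x z))" for z by (simp add: inner_prod_def inner_complex_def)
 then have "Re (LINT z|M. f z * y z - g z * x z) = (LINT z|M. (f z, g z) \<bullet> (cnj (y z), - cnj (x z)))"
  using integral_Re[OF i] by simp
 also have "\<bar>...\<bar> \<le> n2 M (\<lambda>z. (f z, g z)) * n2 M (\<lambda>z. (cnj (y z), - cnj (x z)))"
  by (rule n2_Cauchy_Schwarz[OF l2_pair[OF l(1,2)] p])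
 also have "n2 M (\<lambda>z. (cnj (y z), - cnj (x z))) = n2 M (\<lambda>z. (x z, y z))"
  by (simp add: n2_def norm_prod_def add.commute)
 finally show "\<bar>Re (LINT z|M. f z * y z - g z * x z)\<bar> \<le> n2 M (\<lambda>z. (f z, g z)) * n2 M (\<lambda>z. (x z, y z))" .
qed

context sector_angle begin

lemma lint_split:
 fixes f :: "cfun"
 assumes "integrable (mu UNIV) f"
 shows "(LINT x|mu UNIV. f x) = (LINT x|mu A. f x) + (LINT x|mu B. f x)"
 by (intro integral_split(2) integrable_lebesgue_on_subset[OF _ _ _ assms]) auto

theorem curl_lower_bound:
 assumes w: "jet UNIV w p q" and \<phi>: "C1c UNIV \<phi>" and \<psi>: "C1c UNIV \<psi>" and eq: "eq_ae A w \<phi>"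
 shows "\<bar>Re (LINT x|mu B. curl \<phi> \<psi> x)\<bar> \<le> jn B w p q * gnorm B \<psi>"
proof -
 let ?f = "\<lambda>x. p x - der \<phi> x 1" and ?g = "\<lambda>x. q x - der \<phi> x \<i>"
 let ?x = "\<lambda>x. der \<psi> x 1" and ?y = "\<lambda>x. der \<psi> x \<i>"
 note j\<phi> = jet_C1c[OF \<phi>] and j\<psi> = jet_C1c[OF \<psi>]
 have j: "jet UNIV (\<lambda>x. w x - \<phi> x) ?f ?g" by (rule jet_diff[OF open_UNIV w j\<phi>[OF open_UNIV]])
 have L: "l2 (mu UNIV) ?f" "l2 (mu UNIV) ?g" "l2 (mu UNIV) ?x" "l2 (mu UNIV) ?y"
  using j j\<psi>[OF open_UNIV] by (auto simp: jet_def)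
 have wB: "jet B w p q" and wA: "jet A w p q" using jet_mono[OF open_UNIV open_AB(2) subset_UNIV w] jet_mono[OF open_UNIV open_AB(1) subset_UNIV w] by auto
 have LB: "l2 (mu B) p" "l2 (mu B) q" "l2 (mu B) ?x" "l2 (mu B) ?y"
  "l2 (mu B) (\<lambda>x. der \<phi> x 1)" "l2 (mu B) (\<lambda>x. der \<phi> x \<i>)"
  using wB j\<psi>[OF open_AB(2)] j\<phi>[OF open_AB(2)] by (auto simp: jet_def)
 have i: "integrable (mu UNIV) (\<lambda>x. ?f x * ?y x - ?g x * ?x x)" by (rule l2_pair_pairing(2)[OF L])
 have "(LINT x|mu UNIV. ?f x * ?y x) = (LINT x|mu UNIV. ?g x * ?x x)"
  by (rule weak_curl[OF _ _ \<psi>]) (use j in \<open>auto simp: jet_def\<close>)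
 then have "0 = (LINT x|mu UNIV. ?f x * ?y x - ?g x * ?x x)"
  using n2_mult_bound(1)[OF L(1,4)] n2_mult_bound(1)[OF L(2,3)] by simp
 also have "... = (LINT x|mu A. ?f x * ?y x - ?g x * ?x x) + (LINT x|mu B. ?f x * ?y x - ?g x * ?x x)"
  by (rule lint_split[OF i])
 also have "(LINT x|mu A. ?f x * ?y x - ?g x * ?x x) = 0"
 proof -
  have "AE x in mu A. p x = der \<phi> x 1" "AE x in mu A. q x = der \<phi> x \<i>"
   using jet_unique(1,2)[OF open_AB(1) wA j\<phi>[OF open_AB(1)] eq[unfolded eq_ae_def]] by auto
  then have "AE x in mu A. ?f x * ?y x - ?g x * ?x x = 0" by eventually_elim simp
  then show ?thesis by (rule integral_eq_zero_AE)
 qed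
 also have "(LINT x|mu B. ?f x * ?y x - ?g x * ?x x) = (LINT x|mu B. (p x * ?y x - q x * ?x x) - curl \<phi> \<psi> x)"
  by (simp add: algebra_simps)
 also have "... = (LINT x|mu B. p x * ?y x - q x * ?x x) - (LINT x|mu B. curl \<phi> \<psi> x)"
  by (rule Bochner_Integration.integral_diff[OF l2_pair_pairing(2)[OF LB(1-4)] l2_pair_pairing(2)[OF LB(5,6,3,4)]])
 finally have "(LINT x|mu B. curl \<phi> \<psi> x) = (LINT x|mu B. p x * ?y x - q x * ?x x)" by simp
 then have "\<bar>Re (LINT x|mu B. curl \<phi> \<psi> x)\<bar> \<le> n2 (mu B) (\<lambda>x. (p x, q x)) * gnorm B \<psi>"
  using l2_pair_pairing(1)[OF LB(1-4)] by simp
 also have "... \<le> jn B w p q * gnorm B \<psi>"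
  by (intro mult_right_mono n2_mono jet_l2[OF wB] n2_nonneg) (auto simp: norm_prod_def)
 finally show ?thesis .
qed

lemma curl_AB:
 assumes "C1c UNIV \<phi>" "C1c UNIV \<psi>"
 shows "(LINT x|mu B. curl \<phi> \<psi> x) = - (LINT x|mu A. curl \<phi> \<psi> x)"
proof -
 note j = jet_C1c[OF assms(1) open_UNIV] and j' = jet_C1c[OF assms(2) open_UNIV]
 have L: "l2 (mu UNIV) (\<lambda>x. der \<phi> x b)" "l2 (mu UNIV) (\<lambda>x. der \<psi> x b)" if "b = 1 \<or> b = \<i>" for b
  using j j' that by (auto simp: jet_def)
 have "(LINT x|mu UNIV. der \<phi> x 1 * der \<psi> x \<i>)
   = (LINT x|mu UNIV. der \<phi> x \<i> * der \<psi> x 1)"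
  by (rule weak_curl[OF _ _ assms(2)]) (use j in \<open>auto simp: jet_def\<close>)
 then have "(LINT x|mu UNIV. curl \<phi> \<psi> x) = 0"
  using n2_mult_bound(1)[OF L(1)[of 1] L(2)[of \<i>]] n2_mult_bound(1)[OF L(1)[of \<i>] L(2)[of 1]] by simp
 then show ?thesis
  using lint_split[OF l2_pair_pairing(2)[OF L(1)[of 1] L(1)[of \<i>] L(2)[of 1] L(2)[of \<i>]]] by (simp add: eq_neg_iff_add_eq_0 add.commute)
qed

end

lemma pos_part_power_deriv:
 assumes "n \<ge> 1"
 shows "((\<lambda>x. (max 0 x) ^ Suc n) has_real_derivative (1 + real n) * (max 0 x) ^ n) (at x)"
proof -
 consider "x > 0" | "x < 0" | "x = 0" by linarith
 then show ?thesis
 proof cases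
  case 1
  have "((\<lambda>x. x ^ Suc n) has_real_derivative (1 + real n) * x ^ n) (at x)" using DERIV_pow[of "Suc n" x] by simp
  then have "((\<lambda>x. (max 0 x) ^ Suc n) has_real_derivative (1 + real n) * x ^ n) (at x)"
   by (rule has_field_derivative_transform_within_open[where S="{0<..}"]) (use 1 in \<open>auto simp: max_def\<close>)
  then show ?thesis using 1 by simp
 next
  case 2
  have "((\<lambda>x. 0) has_real_derivative 0) (at x)" by simp
  then have "((\<lambda>x. (max 0 x) ^ Suc n) has_real_derivative 0) (at x)"
   by (rule has_field_derivative_transform_within_open[where S="{..<0}"]) (use 2 in \<open>auto simp: max_def\<close>)
  moreover have "(1 + real n) * (max 0 x) ^ n = 0" using 2 assms by (simp add: max_absorb1)
  ultimately show ?thesis by (simp only:)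
 next
  case 3
  have "((\<lambda>h. \<bar>h\<bar> ^ n) \<longlongrightarrow> \<bar>0\<bar> ^ n) (at (0::real))" by (intro tendsto_intros)
  moreover have "\<bar>0\<bar> ^ n = (0::real)" using assms by simp
  ultimately have "((\<lambda>h. \<bar>h\<bar> ^ n) \<longlongrightarrow> 0) (at (0::real))" by (simp only:)
  then have "((\<lambda>h. ((max 0 (0 + h)) ^ Suc n - (max 0 0) ^ Suc n) / h) \<longlongrightarrow> 0) (at (0::real))"
   by (rule Lim_null_comparison[rotated]) (auto simp: eventually_at_filter max_def abs_mult power_abs)
  moreover have "(1 + real n) * (max 0 x) ^ n = 0" using 3 assms by simp
  ultimately show ?thesis unfolding DERIV_def using 3 by (simp only:)
 qed
qed

lemma cutoff_exists:
 assumes "0 < b" "0 < c"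
 shows "\<exists>H H1. (\<forall>t. (H has_real_derivative H1 t) (at t)) \<and> continuous_on UNIV H1 \<and>
  (\<forall>t. \<bar>t\<bar> < b \<longrightarrow> H t = t \<and> H1 t = 1) \<and> (\<forall>t. b + c < \<bar>t\<bar> \<longrightarrow> H t = 0)"
proof -
 define m where "m n x = (max 0 x) ^ n" for n and x :: real
 have md: "(m 2 has_real_derivative 2 * m 1 x) (at x)" for x
  using pos_part_power_deriv[of 1 x] unfolding m_def by (simp add: numeral_2_eq_2)
 have mc: "continuous_on UNIV (m n)" for n unfolding m_def by (intro continuous_intros)
 have mcc: "continuous_on UNIV (\<lambda>x. m n (f x))" if "continuous_on UNIV f" for n f
  using continuous_on_compose2[OF mc that] by simp
 define k where "k t = 1 - (m 2 (t - b) + m 2 (- t - b)) / c^2" for t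
 define k' where "k' t = - ((2 * m 1 (t - b) - 2 * m 1 (- t - b)) / c^2)" for t
 have kd: "(k has_real_derivative k' t) (at t)" for t
 proof -
  have "((\<lambda>t. m 2 (t - b)) has_real_derivative 2 * m 1 (t - b) * 1) (at t)"
   by (rule DERIV_chain2[OF md]) (auto intro!: derivative_eq_intros)
  moreover have "((\<lambda>t. m 2 (- t - b)) has_real_derivative 2 * m 1 (- t - b) * - 1) (at t)"
   by (rule DERIV_chain2[OF md]) (auto intro!: derivative_eq_intros)
  ultimately have "(k has_real_derivative 0 - (2 * m 1 (t - b) * 1 + 2 * m 1 (- t - b) * - 1) / c^2) (at t)"
   unfolding k_def by (intro DERIV_diff DERIV_const DERIV_cdivide DERIV_add)
  then show ?thesis by (simp add: k'_def)
 qed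
 have kc: "continuous_on UNIV k" "continuous_on UNIV k'" unfolding k_def k'_def by (intro continuous_intros mcc; use assms in auto)+
 define H where "H t = t * m 2 (k t)" for t
 define H1 where "H1 t = m 2 (k t) + t * (2 * m 1 (k t) * k' t)" for t
 have "(H has_real_derivative H1 t) (at t)" for t
  unfolding H_def H1_def using DERIV_mult[OF DERIV_ident DERIV_chain2[OF md kd]] by (simp add: mult.commute add.commute)
 moreover have "continuous_on UNIV H1" unfolding H1_def by (intro continuous_intros mcc kc)
 moreover have "H t = t" "H1 t = 1" if "\<bar>t\<bar> < b" for t
 proof -
  have "m 2 (t - b) = 0" "m 2 (- t - b) = 0" "m 1 (t - b) = 0" "m 1 (- t - b) = 0" using that by (auto simp: m_def max_def)
  then show "H t = t" "H1 t = 1" by (simp_all add: H_def H1_def k_def k'_def m_def)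
 qed
 moreover have "H t = 0" if "b + c < \<bar>t\<bar>" for t
 proof -
  have "c^2 \<le> m 2 (t - b) + m 2 (- t - b)"
  proof (cases "t \<ge> 0")
   case True
   then have "c^2 \<le> m 2 (t - b)" unfolding m_def using that assms by (intro power_mono) auto
   then show ?thesis by (simp add: m_def add_increasing2)
  next
   case False
   then have "c^2 \<le> m 2 (- t - b)" unfolding m_def using that assms by (intro power_mono) auto
   then show ?thesis by (simp add: m_def add_increasing)
  qed
  then have "k t \<le> 0" using assms by (simp add: k_def)
  then show ?thesis by (simp add: H_def m_def max_def)
 qed
 ultimately show ?thesis by (intro exI[of _ H] exI[of _ H1]) auto
qed

lemma profile_exists:
 "\<exists>P P1 P2. (\<forall>x. (P has_real_derivative P1 x) (at x)) \<and> (\<forall>x. (P1 has_real_derivative P2 x) (at x)) \<and>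
  continuous_on UNIV P2 \<and> (\<forall>x. 1 < \<bar>x\<bar> \<longrightarrow> P x = 0) \<and> (\<exists>x. P1 x \<noteq> 0)"
proof -
 define m where "m n x = (max 0 (1 - x^2)) ^ n" for n and x :: real
 have d: "(m (Suc n) has_real_derivative (1 + real n) * m n x * (- 2 * x)) (at x)" if "n \<ge> 1" for n x
  unfolding m_def by (rule DERIV_chain2[OF pos_part_power_deriv[OF that]]) (auto intro!: derivative_eq_intros)
 have mc: "continuous_on UNIV (m n)" for n unfolding m_def by (intro continuous_intros)
 have 1: "(m 3 has_real_derivative - 6 * x * m 2 x) (at x)" for x using d[of 2 x] by (simp add: numeral_3_eq_3 numeral_2_eq_2 mult_ac)
 have 2: "((\<lambda>x. - 6 * x * m 2 x) has_real_derivative - 6 * m 2 x + 24 * x^2 * m 1 x) (at x)" for x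
 proof -
  have "(m 2 has_real_derivative - 4 * x * m 1 x) (at x)" using d[of 1 x] by (simp add: numeral_2_eq_2 mult_ac)
  then show ?thesis by (auto intro!: derivative_eq_intros simp: power2_eq_square)
 qed
 have 3: "m 3 x = 0" if "1 < \<bar>x\<bar>" for x
  using that one_less_power[of "\<bar>x\<bar>" 2] by (simp add: m_def max_def)
 have 4: "- 6 * (1/2) * m 2 (1/2) \<noteq> 0" by (simp add: m_def power2_eq_square)
 have "continuous_on UNIV (\<lambda>x. - 6 * m 2 x + 24 * x^2 * m 1 x)" by (intro continuous_intros mc)
 then show ?thesis using 1 2 3 4
  by (intro exI[of _ "m 3"] exI[of _ "\<lambda>x. - 6 * x * m 2 x"] exI[of _ "\<lambda>x. - 6 * m 2 x + 24 * x^2 * m 1 x"] conjI allI impI exI[of _ "1/2"])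
qed

lemma real_integrable_support:
 fixes f :: "real \<Rightarrow> real"
 assumes "continuous_on UNIV f" "\<And>x. x \<notin> {l..r} \<Longrightarrow> f x = 0"
 shows "integrable lborel f"
proof -
 have "integrable lborel (\<lambda>x. indicator {l..r} x *\<^sub>R f x)"
  by (rule borel_integrable_compact) (auto intro: continuous_on_subset[OF assms(1)])
 moreover have "(\<lambda>x. indicator {l..r} x *\<^sub>R f x) = f"
 proof
  fix x show "indicator {l..r} x *\<^sub>R f x = f x" by (cases "x \<in> {l..r}") (simp_all add: assms(2))
 qed
 ultimately show ?thesis by simp
qed

lemma derivative_support:
 fixes f :: "real \<Rightarrow> real"
 assumes "\<And>x. (f has_real_derivative f' x) (at x)" "\<And>x. x \<notin> {l..r} \<Longrightarrow> f x = 0" "x \<notin> {l..r}"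
 shows "f' x = 0"
proof -
 have "((\<lambda>_. 0) has_real_derivative 0) (at x)" by simp
 then have "(f has_real_derivative 0) (at x)"
  by (rule has_field_derivative_transform_within_open[where S="- {l..r}"]) (use assms(2,3) in auto)
 then show ?thesis using DERIV_unique[OF assms(1)] by simp
qed

lemma log_polar_le:
 fixes F :: "complex \<Rightarrow> real"
 assumes d: "norm d = 1" and h: "0 < h" "h < pi" and F: "continuous_on UNIV F"
  and m: "integrable lborel m" "\<And>s. 0 \<le> m s" and le: "\<And>s t. \<bar>t\<bar> < h \<Longrightarrow> exp (2 * s) * F (exp (Complex s t) * d) \<le> m s"
 shows "(NN z. ennreal (F z) * indicator (Sec d (cot h)) z) \<le> ennreal (2 * h * (LINT s|lborel. m s))"
proof -
 have [measurable]: "F \<in> bm" by (rule continuous_bm[OF F])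
 have [measurable]: "m \<in> bm" using borel_measurable_integrable[OF m(1)] by simp
 have "(NN z. ennreal (F z) * indicator (Sec d (cot h)) z)
   = (NN t. NN s. ennreal (F (exp (Complex s t) * d)) * ennreal (exp (2 * s)) * indicator {-h<..<h} t)"
  by (rule nn_integral_log_polar[OF d h]) measurable
 also have "... \<le> (NN t. NN s. ennreal (m s) * indicator {-h<..<h} t)"
 proof (intro nn_integral_mono)
  fix s t :: real
  have "ennreal (F (exp (Complex s t) * d)) * ennreal (exp (2 * s)) \<le> ennreal (m s)" if "\<bar>t\<bar> < h"
   unfolding ennreal_mult''[OF exp_ge_zero, symmetric] using le[OF that, of s] by (intro ennreal_leI) (simp add: mult.commute)
  then show "ennreal (F (exp (Complex s t) * d)) * ennreal (exp (2 * s)) * indicator {-h<..<h} t \<le> ennreal (m s) * indicator {-h<..<h} t"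
   by (cases "\<bar>t\<bar> < h") (auto simp: indicator_def abs_less_iff)
 qed
 also have "... = (NN t. ennreal (LINT s|lborel. m s) * indicator {-h<..<h} t)"
  using nn_integral_eq_integral[OF m(1)] m(2) by (subst nn_integral_multc) auto
 also have "... = ennreal (2 * h * (LINT s|lborel. m s))"
  using h m(2) by (subst nn_integral_cmult_indicator) (auto simp: mult.commute simp flip: ennreal_mult)
 finally show ?thesis .
qed

lemma log_polar_eq:
 fixes F :: "complex \<Rightarrow> real"
 assumes d: "norm d = 1" and h: "0 < h" "h < pi" and F: "continuous_on UNIV F" "integrable (mu (Sec d (cot h))) F"
  and m: "integrable lborel m" "\<And>s. 0 \<le> m s" and eq: "\<And>s t. \<bar>t\<bar> < h \<Longrightarrow> exp (2 * s) * F (exp (Complex s t) * d) = m s"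
 shows "(LINT z|mu (Sec d (cot h)). F z) = 2 * h * (LINT s|lborel. m s)"
proof -
 let ?S = "Sec d (cot h)"
 have [measurable]: "F \<in> bm" by (rule continuous_bm[OF F(1)])
 have [measurable]: "m \<in> bm" using borel_measurable_integrable[OF m(1)] by simp
 have pos: "0 \<le> F z" if "z \<in> ?S" for z
 proof -
  from that obtain w where w: "\<bar>Im w\<bar> < h" "z = exp w * d" unfolding exp_strip_image[OF d h, symmetric] by auto
  have "exp (2 * Re w) * F (exp (Complex (Re w) (Im w)) * d) = m (Re w)" by (rule eq[OF w(1)])
  then have "0 \<le> exp (2 * Re w) * F z" using m(2)[of "Re w"] w(2) by simp
  then show ?thesis by (simp add: zero_le_mult_iff)
 qed
 have S: "?S \<in> sets borel" "?S \<in> sets lebesgue" using open_Sec[of d "cot h"] by auto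
 have "ennreal (LINT z|mu ?S. F z) = ennreal (LINT z|mu ?S. \<bar>F z\<bar>)"
  by (intro arg_cong[where f=ennreal] Bochner_Integration.integral_cong) (auto simp: pos)
 also have "... = (NN z. ennreal \<bar>F z\<bar> * indicator ?S z)"
  by (rule nn_lebesgue_on[symmetric]) (use S F(2) in auto)
 also have "... = (NN t. NN s. ennreal \<bar>F (exp (Complex s t) * d)\<bar> * ennreal (exp (2 * s)) * indicator {-h<..<h} t)"
  by (rule nn_integral_log_polar[OF d h]) measurable
 also have "... = (NN t. NN s. ennreal (m s) * indicator {-h<..<h} t)"
 proof (rule nn_integral_cong, rule nn_integral_cong)
  fix s t :: real
  have "ennreal \<bar>F (exp (Complex s t) * d)\<bar> * ennreal (exp (2 * s)) = ennreal (m s)" if "\<bar>t\<bar> < h"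
   unfolding ennreal_mult''[OF exp_ge_zero, symmetric] using eq[OF that, of s] m(2)[of s]
   by (intro arg_cong[where f=ennreal]) (metis abs_mult abs_of_nonneg exp_ge_zero mult.commute)
  then show "ennreal \<bar>F (exp (Complex s t) * d)\<bar> * ennreal (exp (2 * s)) * indicator {-h<..<h} t = ennreal (m s) * indicator {-h<..<h} t"
   by (cases "\<bar>t\<bar> < h") (auto simp: indicator_def abs_less_iff)
 qed
 also have "... = (NN t. ennreal (LINT s|lborel. m s) * indicator {-h<..<h} t)"
  using nn_integral_eq_integral[OF m(1)] m(2) by (subst nn_integral_multc) auto
 also have "... = ennreal (2 * h * (LINT s|lborel. m s))"
  using h m(2) by (subst nn_integral_cmult_indicator) (auto simp: mult.commute simp flip: ennreal_mult)
 finally show ?thesis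
  using pos h m(2) by (subst (asm) ennreal_inj) (auto intro!: Bochner_Integration.integral_nonneg)
qed

lemma Ln_has_derivative:
 assumes "norm d = 1" "z * cnj d \<notin> \<real>\<^sub>\<le>\<^sub>0"
 shows "((\<lambda>z. Ln (z * cnj d)) has_derivative (\<lambda>k. k / z)) (at z)"
proof -
 have nz: "z \<noteq> 0" "cnj d \<noteq> 0" using assms by auto
 have "((\<lambda>z. Ln (z * cnj d)) has_field_derivative (1 / (z * cnj d)) * cnj d) (at z)"
  by (rule DERIV_chain2[where f=Ln and g="\<lambda>z. z * cnj d", OF has_field_derivative_Ln[OF assms(2), unfolded inverse_eq_divide]])
    (auto intro!: derivative_eq_intros)
 moreover have "(1 / (z * cnj d)) * cnj d = 1 / z" using nz by (simp add: field_simps)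
 ultimately have "((\<lambda>z. Ln (z * cnj d)) has_derivative (*) (1 / z)) (at z)" by (simp only: has_field_derivative_def)
 then show ?thesis by (rule has_derivative_eq_rhs) auto
qed

locale polar_pair =
 fixes d :: complex and h c l r :: real and R R1 R2 H H1 :: "real \<Rightarrow> real"
 assumes d: "norm d = 1" and h: "0 < h" "0 < c" "h + c < pi" and r: "r < 0"
  and R: "\<And>s. (R has_real_derivative R1 s) (at s)" "\<And>s. (R1 has_real_derivative R2 s) (at s)" "continuous_on UNIV R2"
   "\<And>s. s \<notin> {l..r} \<Longrightarrow> R s = 0"
  and H: "\<And>t. (H has_real_derivative H1 t) (at t)" "continuous_on UNIV H1"
   "\<And>t. \<bar>t\<bar> < h \<Longrightarrow> H t = t" "\<And>t. \<bar>t\<bar> < h \<Longrightarrow> H1 t = 1" "\<And>t. h + c < \<bar>t\<bar> \<Longrightarrow> H t = 0"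
begin

lemma R1_support: "s \<notin> {l..r} \<Longrightarrow> R1 s = 0" by (rule derivative_support[OF R(1,4)])
lemma R2_support: "s \<notin> {l..r} \<Longrightarrow> R2 s = 0" by (rule derivative_support[OF R(2) R1_support])

lemma cont: "continuous_on UNIV R" "continuous_on UNIV R1" "continuous_on UNIV H"
 using R(1,2) H(1) by (auto intro!: continuous_at_imp_continuous_on DERIV_isCont)

definition X :: "cfun" where "X z = of_real (R (ln (norm z)))"

definition Y :: "cfun" where
 "Y z = (if z = 0 then 0 else of_real (R1 (Re (Ln (z * cnj d))) * H (Im (Ln (z * cnj d)))))"

lemma X_has_derivative:
 assumes "z \<noteq> 0" shows "(X has_derivative (\<lambda>k. of_real (R1 (ln (norm z)) * Re (k / z)))) (at z)"
proof -
 define e where "e = sgn z"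
 have e: "norm e = 1" using assms by (simp add: e_def norm_sgn)
 have "z * cnj e = of_real (norm z)"
  using complex_norm_square[of z] assms by (simp add: e_def sgn_eq power2_eq_square divide_eq_eq)
 then have n: "z * cnj e \<notin> \<real>\<^sub>\<le>\<^sub>0" using assms by (simp add: complex_nonpos_Reals_iff)
 have "((\<lambda>z. Re (Ln (z * cnj e))) has_derivative (\<lambda>k. Re (k / z))) (at z)"
  by (rule has_derivative_Re[OF Ln_has_derivative[OF e n]])
 from has_derivative_of_real[OF has_derivative_compose[OF this R(1)[unfolded has_field_derivative_def]]]
 have "((\<lambda>z. of_real (R (Re (Ln (z * cnj e))))) has_derivative (\<lambda>k. complex_of_real (R1 (Re (Ln (z * cnj e))) * Re (k / z)))) (at z)" .
 moreover have L: "Re (Ln (x * cnj e)) = ln (norm x)" if "x \<noteq> 0" for x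
  using that e by (subst Re_Ln) (auto simp: norm_mult)
 ultimately have "((\<lambda>z. of_real (R (Re (Ln (z * cnj e))))) has_derivative (\<lambda>k. complex_of_real (R1 (ln (norm z)) * Re (k / z)))) (at z)"
  using assms by simp
 then show ?thesis
  by (rule has_derivative_transform_within_open[where s="- {0}"]) (use assms in \<open>auto simp: X_def L\<close>)
qed

lemma X_C1c: "C1c UNIV X"
proof -
 define K where "K = cball 0 (exp r) - ball (0::complex) (exp l)"
 have K: "compact K" unfolding K_def by (intro compact_diff) auto
 have K0: "K \<subseteq> - {0}" by (auto simp: K_def)
 have off: "X z = 0" if "z \<notin> K" for z
 proof (cases "z = 0")
  case True
  then show ?thesis using R(4)[of 0] r by (simp add: X_def)
 next
  case False
  have "ln (norm z) \<notin> {l..r}"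
  proof
   assume "ln (norm z) \<in> {l..r}"
   then have "exp l \<le> exp (ln (norm z))" "exp (ln (norm z)) \<le> exp r" by simp_all
   then show False using that False by (simp add: K_def)
  qed
  then show ?thesis using R(4) by (simp add: X_def)
 qed
 have "C1on (- {0}) X"
  by (rule C1onI[OF _ X_has_derivative])
    (auto intro!: continuous_intros continuous_on_compose2[OF cont(2)])
 then have "Ck 1 X" by (intro C1_extend[OF _ _ K K0 off]) auto
 then show ?thesis using K off unfolding C1c_def by blast
qed

lemma exp_not_nonpos: "\<bar>Im w\<bar> < pi \<Longrightarrow> exp w \<notin> \<real>\<^sub>\<le>\<^sub>0" and Ln_point: "\<bar>Im w\<bar> < pi \<Longrightarrow> Ln (exp w * d * cnj d) = w"
proof -
 assume w: "\<bar>Im w\<bar> < pi"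
 then have L: "Ln (exp w) = w" by (intro Ln_exp) auto
 have "d * cnj d = 1" using d complex_norm_square[of d] by simp
 with L show "Ln (exp w * d * cnj d) = w" by (simp add: mult.assoc)
 show "exp w \<notin> \<real>\<^sub>\<le>\<^sub>0"
 proof
  assume "exp w \<in> \<real>\<^sub>\<le>\<^sub>0"
  then have "Im (Ln (exp w)) = pi" using Im_Ln_eq_pi[of "exp w"] exp_not_eq_zero[of w] by (auto simp del: exp_not_eq_zero simp: complex_nonpos_Reals_iff less_le complex_eq_iff)
  then show False using w L by simp
 qed
qed

lemma Y_has_derivative:
 assumes "z * cnj d \<notin> \<real>\<^sub>\<le>\<^sub>0"
 defines "s \<equiv> Re (Ln (z * cnj d))" and "t \<equiv> Im (Ln (z * cnj d))"
 shows "(Y has_derivative (\<lambda>k. of_real (R2 s * H t * Re (k / z) + R1 s * H1 t * Im (k / z)))) (at z)"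
proof -
 have z0: "z \<noteq> 0" using assms by auto
 note D = Ln_has_derivative[OF d assms(1)]
 have 1: "((\<lambda>z. R1 (Re (Ln (z * cnj d)))) has_derivative (\<lambda>k. R2 s * Re (k / z))) (at z)"
  unfolding s_def using has_derivative_compose[OF has_derivative_Re[OF D] R(2)[unfolded has_field_derivative_def]] .
 have 2: "((\<lambda>z. H (Im (Ln (z * cnj d)))) has_derivative (\<lambda>k. H1 t * Im (k / z))) (at z)"
  unfolding t_def using has_derivative_compose[OF has_derivative_Im[OF D] H(1)[unfolded has_field_derivative_def]] .
 have "((\<lambda>z. complex_of_real (R1 (Re (Ln (z * cnj d))) * H (Im (Ln (z * cnj d))))) has_derivative
  (\<lambda>k. of_real (R1 s * (H1 t * Im (k / z)) + R2 s * Re (k / z) * H t))) (at z)"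
  using has_derivative_of_real[OF has_derivative_mult[OF 1 2]] unfolding s_def t_def .
 then have "(Y has_derivative (\<lambda>k. of_real (R1 s * (H1 t * Im (k / z)) + R2 s * Re (k / z) * H t))) (at z)"
  by (rule has_derivative_transform_within_open[where s="- {0}"]) (use z0 in \<open>auto simp: Y_def\<close>)
 then show ?thesis by (rule has_derivative_eq_rhs) (auto simp: mult_ac add.commute)
qed

lemma Y_C1c: "C1c UNIV Y"
proof -
 define Z where "Z = {z. z * cnj d \<notin> \<real>\<^sub>\<le>\<^sub>0}"
 have "Z = (\<lambda>z. z * cnj d) -` (- \<real>\<^sub>\<le>\<^sub>0)" by (auto simp: Z_def)
 moreover have "open ((\<lambda>z. z * cnj d) -` (- \<real>\<^sub>\<le>\<^sub>0))"
  by (rule open_vimage) (auto intro!: continuous_intros closed_nonpos_Reals_complex open_Compl)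
 ultimately have op: "open Z" by simp
 define K where "K = (\<lambda>w. exp w * d) ` cbox (Complex l (- (h + c))) (Complex r (h + c))"
 have K: "compact K" unfolding K_def by (intro compact_continuous_image continuous_intros compact_cbox)
 have KZ: "K \<subseteq> Z"
 proof
  fix z assume "z \<in> K"
  then obtain w where w: "z = exp w * d" "w \<in> cbox (Complex l (- (h + c))) (Complex r (h + c))" by (auto simp: K_def)
  then have wpi: "\<bar>Im w\<bar> < pi" using h by (auto simp: in_cbox_complex_iff)
  have "d * cnj d = 1" using d complex_norm_square[of d] by simp
  then have "z * cnj d = exp w" using w(1) by (simp add: mult.assoc)
  then show "z \<in> Z" using exp_not_nonpos[OF wpi] by (simp add: Z_def)
 qed
 have off: "Y z = 0" if "z \<notin> K" for z
 proof (rule ccontr)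
  assume Y: "Y z \<noteq> 0"
  define w where "w = Ln (z * cnj d)"
  have z0: "z \<noteq> 0" and n: "R1 (Re w) \<noteq> 0" "H (Im w) \<noteq> 0" using Y by (auto simp: Y_def w_def split: if_splits)
  have "cnj d * d = 1" "cnj d \<noteq> 0" using d complex_norm_square[of d] by (auto simp: mult.commute)
  then have "exp w * d = z" using z0 by (simp add: w_def mult.assoc)
  moreover have "Re w \<in> {l..r}" using n(1) R1_support by blast
  moreover have "\<bar>Im w\<bar> \<le> h + c" using n(2) H(5) by (meson not_le)
  ultimately show False using that by (auto simp: K_def in_cbox_complex_iff image_iff abs_le_iff intro!: bexI[of _ w])
 qed
 have cL: "continuous_on Z (\<lambda>z. Ln (z * cnj d))" by (intro continuous_intros) (auto simp: Z_def)
 have z0: "z \<noteq> 0" if "z \<in> Z" for z using that by (auto simp: Z_def)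
 have cc: "continuous_on Z (\<lambda>z. f (Re (Ln (z * cnj d))))" "continuous_on Z (\<lambda>z. f (Im (Ln (z * cnj d))))"
  if "continuous_on UNIV f" for f :: "real \<Rightarrow> real"
  by (rule continuous_on_compose2[OF that continuous_on_Re[OF cL]], simp, rule continuous_on_compose2[OF that continuous_on_Im[OF cL]], simp)
 have cD: "continuous_on Z (\<lambda>z. complex_of_real (R2 (Re (Ln (z * cnj d))) * H (Im (Ln (z * cnj d))) * Re (k / z)
   + R1 (Re (Ln (z * cnj d))) * H1 (Im (Ln (z * cnj d))) * Im (k / z)))" for k
  using z0 by (intro continuous_intros cc cont R(3) H(2)) auto
 have "C1on Z Y" by (rule C1onI[OF op Y_has_derivative cD cD]) (simp add: Z_def)
 then have "Ck 1 Y" by (intro C1_extend[OF op _ K KZ off])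
 then show ?thesis using K off unfolding C1c_def by blast
qed

abbreviation I :: "(real \<Rightarrow> real) \<Rightarrow> real" where "I f \<equiv> LINT s|lborel. f s"

lemma inverse_point:
 assumes "norm d' = 1"
 shows "exp (2 * s) * ((Re (1 / (exp (Complex s t) * d')))^2 + (Im (1 / (exp (Complex s t) * d')))^2) = 1"
 unfolding cmod_power2[symmetric] using assms
 by (simp add: norm_divide norm_mult power_divide flip: exp_double)

lemma Re_Im_i_div: "Re (\<i> / z) = - Im (1 / z)" "Im (\<i> / z) = Re (1 / z)"
 by (simp_all add: Re_divide Im_divide)

lemma X_gradient:
 assumes "norm d' = 1"
 defines "z s t \<equiv> exp (Complex s t) * d'"
 shows "X (z s t) = of_real (R s)"
  "der X (z s t) 1 = of_real (R1 s * Re (1 / z s t))"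
  "der X (z s t) \<i> = of_real (- R1 s * Im (1 / z s t))"
proof -
 have n: "norm (z s t) = exp s" "z s t \<noteq> 0" using assms by (auto simp: norm_mult)
 show "X (z s t) = of_real (R s)" by (simp add: X_def n)
 show "der X (z s t) 1 = of_real (R1 s * Re (1 / z s t))"
  "der X (z s t) \<i> = of_real (- R1 s * Im (1 / z s t))"
  unfolding fun_cong[OF frechet_derivative_at[OF X_has_derivative[OF n(2)]], symmetric] n(1) by (simp_all only: ln_exp Re_Im_i_div mult_minus_left mult_minus_right)
qed

lemma Y_gradient:
 assumes "\<bar>t\<bar> < h" and z: "z = exp (Complex s t) * d"
 shows "Y z = of_real (R1 s * t)"
  "der Y z 1 = of_real (R2 s * t * Re (1 / z) + R1 s * Im (1 / z))"
  "der Y z \<i> = of_real (R2 s * t * - Im (1 / z) + R1 s * Re (1 / z))"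
proof -
 have t: "\<bar>Im (Complex s t)\<bar> < pi" using assms h by simp
 have L: "Ln (z * cnj d) = Complex s t" unfolding z by (rule Ln_point[OF t])
 have z0: "z \<noteq> 0" using d by (auto simp: z)
 have "d * cnj d = 1" using d complex_norm_square[of d] by simp
 then have n: "z * cnj d \<notin> \<real>\<^sub>\<le>\<^sub>0" using exp_not_nonpos[OF t] by (simp add: z mult.assoc)
 show "Y z = of_real (R1 s * t)" using z0 by (simp add: Y_def L H(3)[OF assms(1)])
 show "der Y z 1 = of_real (R2 s * t * Re (1 / z) + R1 s * Im (1 / z))"
  "der Y z \<i> = of_real (R2 s * t * - Im (1 / z) + R1 s * Re (1 / z))"
  unfolding fun_cong[OF frechet_derivative_at[OF Y_has_derivative[OF n]], symmetric] L complex.sel H(3)[OF assms(1)] H(4)[OF assms(1)] mult_1_right Re_Im_i_div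
  by (rule refl)+
qed

lemma gradient_integrals:
 "integrable lborel (\<lambda>s. (R1 s)^2)" "integrable lborel (\<lambda>s. (R2 s)^2)"
 "integrable lborel (\<lambda>s. (R s)^2 * exp (2 * s))" "integrable lborel (\<lambda>s. (R1 s)^2 * exp (2 * s))"
 by (rule real_integrable_support[where l=l and r=r], intro continuous_intros cont R(3), simp add: R1_support R2_support R(4))+

lemma C1c_Ck: "C1c Z \<phi> \<Longrightarrow> Ck 1 \<phi>" by (simp only: C1c_def)

lemma sector_energy:
 assumes V: "C1c UNIV V" and e: "norm e = 1" "0 < h'" "h' < pi" and m: "integrable lborel m" "\<And>s. 0 \<le> m s"
  and le: "\<And>s t. \<bar>t\<bar> < h' \<Longrightarrow> exp (2 * s) * ((norm (der V (exp (Complex s t) * e) 1))^2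
   + (norm (der V (exp (Complex s t) * e) \<i>))^2) \<le> m s"
  and m': "integrable lborel m'" "\<And>s. 0 \<le> m' s" and le': "\<And>s t. \<bar>t\<bar> < h' \<Longrightarrow> exp (2 * s) * (norm (V (exp (Complex s t) * e)))^2 \<le> m' s"
 shows "(gnorm (Sec e (cot h')) V)^2 \<le> 2 * h' * I m" "V \<in> W12 (Sec e (cot h'))"
  "(W12_norm (Sec e (cot h')) V)^2 \<le> 2 * h' * (I m + I m')"
proof -
 note C = C1c_Ck[OF V]
 note cc = Ck_continuous[OF C] continuous_directional[OF C]
 have np: "(norm (a, b))^2 = (norm a)^2 + (norm b)^2" for a b :: complex by (simp add: norm_prod_def)
 have I0: "0 \<le> I m" "0 \<le> I m'" using m(2) m'(2) by (auto intro!: Bochner_Integration.integral_nonneg)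
 show "(gnorm (Sec e (cot h')) V)^2 \<le> 2 * h' * I m"
 proof (rule nn_l2(2)[OF open_Sec])
  show "(NN z. ennreal ((norm (der V z 1, der V z \<i>))^2) * indicator (Sec e (cot h')) z) \<le> ennreal (2 * h' * I m)"
   by (rule log_polar_le[OF e _ m]) (auto simp: np intro!: continuous_intros cc le)
  show "0 \<le> 2 * h' * I m" using I0 e by simp
 qed (intro continuous_intros continuous_on_subset[OF cc(2)] subset_UNIV)
 have b: "(NN z. ennreal ((norm (der V z 1, der V z \<i>, V z))^2) * indicator (Sec e (cot h')) z)
   \<le> ennreal (2 * h' * (LINT s|lborel. m s + m' s))"
 proof (rule log_polar_le[OF e])
  fix s t assume t: "\<bar>t\<bar> < h'"
  show "exp (2 * s) * (norm (der V (exp (Complex s t) * e) 1, der V (exp (Complex s t) * e) \<i>, V (exp (Complex s t) * e)))^2 \<le> m s + m' s"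
   using add_mono[OF le[OF t] le'[OF t], of s s] unfolding norm_triple_power2 by (simp add: distrib_left)
 qed (use m m' in \<open>auto intro!: continuous_intros cc Bochner_Integration.integrable_add\<close>)
 have "(LINT s|lborel. m s + m' s) = I m + I m'" by (rule Bochner_Integration.integral_add[OF m(1) m'(1)])
 note b = b[unfolded this]
 have p: "0 \<le> 2 * h' * (I m + I m')" using I0 e by simp
 show "V \<in> W12 (Sec e (cot h'))" by (rule jet_W12[OF jet_C1on(1)[OF open_Sec Ck_C1on[OF C] b p]])
 show "(W12_norm (Sec e (cot h')) V)^2 \<le> 2 * h' * (I m + I m')" by (rule jet_C1on(2)[OF open_Sec Ck_C1on[OF C] b p])
qed

lemma X_energy:
 assumes "norm e = 1" "0 < h'" "h' < pi"
 shows "(gnorm (Sec e (cot h')) X)^2 \<le> 2 * h' * I (\<lambda>s. (R1 s)^2)" "X \<in> W12 (Sec e (cot h'))"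
  "(W12_norm (Sec e (cot h')) X)^2 \<le> 2 * h' * (I (\<lambda>s. (R1 s)^2) + I (\<lambda>s. (R s)^2 * exp (2 * s)))"
proof -
 have g: "exp (2 * s) * ((norm (der X (exp (Complex s t) * e) 1))^2
   + (norm (der X (exp (Complex s t) * e) \<i>))^2) \<le> (R1 s)^2" for s t
 proof -
  have id: "exp (2 * s) * ((R1 s * a)^2 + (- R1 s * b)^2) = (R1 s)^2 * (exp (2 * s) * (a^2 + b^2))" for a b by (simp add: power_mult_distrib algebra_simps)
  show ?thesis unfolding X_gradient[OF assms(1)] norm_of_real power2_abs id inverse_point[OF assms(1)] by simp
 qed
 have v: "exp (2 * s) * (norm (X (exp (Complex s t) * e)))^2 \<le> (R s)^2 * exp (2 * s)" for s t
  unfolding X_gradient(1)[OF assms(1)] by simp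
 from sector_energy[OF X_C1c assms gradient_integrals(1) _ g gradient_integrals(3) _ v]
 show "(gnorm (Sec e (cot h')) X)^2 \<le> 2 * h' * I (\<lambda>s. (R1 s)^2)" "X \<in> W12 (Sec e (cot h'))"
  "(W12_norm (Sec e (cot h')) X)^2 \<le> 2 * h' * (I (\<lambda>s. (R1 s)^2) + I (\<lambda>s. (R s)^2 * exp (2 * s)))" by auto
qed

lemma Y_energy:
 shows "(gnorm (Sec d (cot h)) Y)^2 \<le> 2 * h * (I (\<lambda>s. (R1 s)^2) + h^2 * I (\<lambda>s. (R2 s)^2))" "Y \<in> W12 (Sec d (cot h))"
  "(W12_norm (Sec d (cot h)) Y)^2 \<le> 2 * h * (I (\<lambda>s. (R1 s)^2) + h^2 * I (\<lambda>s. (R2 s)^2) + h^2 * I (\<lambda>s. (R1 s)^2 * exp (2 * s)))"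
proof -
 have t2: "t^2 \<le> h^2" if "\<bar>t\<bar> < h" for t using that h by (simp add: abs_le_square_iff[symmetric])
 have g: "exp (2 * s) * ((norm (der Y (exp (Complex s t) * d) 1))^2
   + (norm (der Y (exp (Complex s t) * d) \<i>))^2) \<le> (R1 s)^2 + h^2 * (R2 s)^2" if t: "\<bar>t\<bar> < h" for s t
 proof -
  have id: "exp (2 * s) * ((R2 s * t * a + R1 s * b)^2 + (R2 s * t * - b + R1 s * a)^2) = ((R1 s)^2 + t^2 * (R2 s)^2) * (exp (2 * s) * (a^2 + b^2))" for a b
   by (simp add: power2_eq_square algebra_simps)
  show ?thesis unfolding Y_gradient[OF t refl] norm_of_real power2_abs id inverse_point[OF d] using t2[OF t]
   by (simp add: mult_right_mono)
 qed
 have v: "exp (2 * s) * (norm (Y (exp (Complex s t) * d)))^2 \<le> h^2 * ((R1 s)^2 * exp (2 * s))" if t: "\<bar>t\<bar> < h" for s t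
  unfolding Y_gradient(1)[OF t refl] using mult_right_mono[OF t2[OF t], of "(R1 s)^2 * exp (2 * s)"] by (simp add: norm_mult power_mult_distrib mult_ac)
 have hp: "h < pi" using h by linarith
 have i1: "integrable lborel (\<lambda>s. (R1 s)^2 + h^2 * (R2 s)^2)" and i2: "integrable lborel (\<lambda>s. h^2 * ((R1 s)^2 * exp (2 * s)))"
  using gradient_integrals by auto
 have e: "I (\<lambda>s. (R1 s)^2 + h^2 * (R2 s)^2) = I (\<lambda>s. (R1 s)^2) + h^2 * I (\<lambda>s. (R2 s)^2)"
  "I (\<lambda>s. h^2 * ((R1 s)^2 * exp (2 * s))) = h^2 * I (\<lambda>s. (R1 s)^2 * exp (2 * s))"
  using gradient_integrals by auto
 from sector_energy[OF Y_C1c d h(1) hp i1 _ g i2 _ v]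
 show "(gnorm (Sec d (cot h)) Y)^2 \<le> 2 * h * (I (\<lambda>s. (R1 s)^2) + h^2 * I (\<lambda>s. (R2 s)^2))" "Y \<in> W12 (Sec d (cot h))"
  "(W12_norm (Sec d (cot h)) Y)^2 \<le> 2 * h * (I (\<lambda>s. (R1 s)^2) + h^2 * I (\<lambda>s. (R2 s)^2) + h^2 * I (\<lambda>s. (R1 s)^2 * exp (2 * s)))"
  unfolding e by auto
qed

lemma curl_XY: "Re (LINT z|mu (Sec d (cot h)). curl X Y z) = 2 * h * I (\<lambda>s. (R1 s)^2)"
proof -
 note j = jet_C1c[OF X_C1c open_Sec, of d "cot h"] and j' = jet_C1c[OF Y_C1c open_Sec, of d "cot h"]
 have i: "integrable (mu (Sec d (cot h))) (curl X Y)"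
  using j j' by (intro l2_pair_pairing(2)) (auto simp: jet_def)
 have "(LINT z|mu (Sec d (cot h)). Re (curl X Y z)) = 2 * h * I (\<lambda>s. (R1 s)^2)"
 proof (rule log_polar_eq[OF d h(1)])
  show "h < pi" using h by linarith
  show "continuous_on UNIV (\<lambda>z. Re (curl X Y z))"
   by (intro continuous_intros continuous_directional C1c_Ck[OF X_C1c] C1c_Ck[OF Y_C1c])
  show "integrable (mu (Sec d (cot h))) (\<lambda>z. Re (curl X Y z))" by (rule integrable_Re[OF i])
  fix s t assume t: "\<bar>t\<bar> < h"
  have id: "exp (2 * s) * (R1 s * a * (R2 s * t * - b + R1 s * a) - - R1 s * b * (R2 s * t * a + R1 s * b)) = (R1 s)^2 * (exp (2 * s) * (a^2 + b^2))" for a b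
   by (simp add: power2_eq_square algebra_simps)
  show "exp (2 * s) * Re (curl X Y (exp (Complex s t) * d)) = (R1 s)^2"
   unfolding X_gradient[OF d] Y_gradient[OF t refl] of_real_mult[symmetric] of_real_diff[symmetric] Re_complex_of_real id inverse_point[OF d]
   by simp
 qed (use gradient_integrals in auto)
 then show ?thesis using integral_Re[OF i] by simp
qed

end

lemma lint_rescale:
 fixes g :: "real \<Rightarrow> real"
 assumes "L > 0" shows "(LINT s|lborel. g ((s + 2 * L) / L)) = L * (LINT x|lborel. g x)"
proof -
 have "(LINT x|lborel. g x) = \<bar>1 / L\<bar> *\<^sub>R (LINT s|lborel. g (2 + (1 / L) * s))"
  by (rule lborel_integral_real_affine) (use assms in simp)
 moreover have "2 + (1 / L) * s = (s + 2 * L) / L" for s using assms by (simp add: field_simps)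
 ultimately show ?thesis using assms by simp
qed

lemma positive_square_integral:
 fixes f :: "real \<Rightarrow> real"
 assumes c: "continuous_on UNIV f" and i: "integrable lborel (\<lambda>x. (f x)^2)" and x: "f x \<noteq> 0"
 shows "0 < (LINT x|lborel. (f x)^2)"
proof -
 have "(LINT x|lborel. (f x)^2) \<noteq> 0"
 proof
  assume "(LINT x|lborel. (f x)^2) = 0"
  then have "AE x in lborel. (f x)^2 = 0" using integral_nonneg_eq_0_iff_AE[OF i] by simp
  then have ae: "AE x in lborel. x \<notin> {x. f x \<noteq> 0}" by eventually_elim simp
  have "{x. f x \<noteq> 0} = f -` (- {0})" by auto
  then have op: "open {x. f x \<noteq> 0}" using open_vimage[OF open_Compl[OF closed_singleton[of 0]] c] by simp
  obtain e where e: "e > 0" "ball x e \<subseteq> {x. f x \<noteq> 0}" using openE[OF op] x by blast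
  have "AE y in lborel. y \<notin> ball x e" using ae by eventually_elim (use e(2) in blast)
  then have "emeasure lborel (ball x e) = 0" using AE_iff_null_sets[of "ball x e" lborel] by auto
  moreover have "ball x e = {x - e <..< x + e}" by (auto simp: dist_real_def)
  ultimately show False using e(1) by simp
 qed
 then show ?thesis using Bochner_Integration.integral_nonneg[of lborel "\<lambda>x. (f x)^2"] by (simp add: less_le)
qed

context sector_angle begin

definition low_bound :: "real \<Rightarrow> bool" where
 "low_bound k \<longleftrightarrow> (\<exists>u\<in>W12 A. \<exists>b>0. (W12_norm A u)^2 \<le> b \<and>
   (\<forall>w p q. jet UNIV w p q \<longrightarrow> eq_ae A w u \<longrightarrow> k * b \<le> (jn B w p q)^2))"

lemma low_bound_op_norm:
 assumes k: "low_bound k" "k > 0" and E: "extension_operator \<alpha> E"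
 shows "ennreal (sqrt (1 + k)) \<le> op_norm \<alpha> E"
proof -
 obtain u b where u: "u \<in> W12 A" "b > 0" "(W12_norm A u)^2 \<le> b"
  and low: "\<And>w p q. jet UNIV w p q \<Longrightarrow> eq_ae A w u \<Longrightarrow> k * b \<le> (jn B w p q)^2"
  using k(1) unfolding low_bound_def by blast
 have est: "(1 + k) * (W12_norm A u)^2 \<le> (W12_norm UNIV w)^2 \<and> 0 < (W12_norm UNIV w)^2"
  if w: "w \<in> W12 UNIV" "eq_ae A w u" for w
 proof -
  obtain p q where j: "jet UNIV w p q" using w(1) by (auto simp: W12_iff)
  have jA: "jet A w p q" by (rule jet_mono[OF open_UNIV open_AB(1) subset_UNIV j])
  have "jn A w p q = W12_norm A u"
   unfolding W12_norm_jet[OF open_AB(1) jA, symmetric]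
   by (rule W12_norm_cong[OF open_AB(1) jet_W12[OF jA] u(1) w(2)[unfolded eq_ae_def]])
  then have e: "(W12_norm UNIV w)^2 = (W12_norm A u)^2 + (jn B w p q)^2" using norm_split[OF j] by simp
  have l: "k * b \<le> (jn B w p q)^2" by (rule low[OF j w(2)])
  have "k * (W12_norm A u)^2 \<le> k * b" using u(3) k(2) by simp
  then have "(1 + k) * (W12_norm A u)^2 \<le> (W12_norm UNIV w)^2" using e l by (simp add: distrib_right)
  moreover have "0 < k * b" using k(2) u(2) by simp
  then have "0 < (W12_norm UNIV w)^2" unfolding e using l by (intro add_nonneg_pos) auto
  ultimately show ?thesis ..
 qed
 have "W12_norm A u \<noteq> 0"
 proof
  assume "W12_norm A u = 0"
  then have "AE x in mu A. u x = 0" by (rule W12_norm_eq_0[OF open_AB(1) u(1)])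
  then have "eq_ae A (\<lambda>_. 0) u" unfolding eq_ae_def by eventually_elim simp
  moreover have z: "(\<lambda>_. 0) \<in> W12 UNIV" "W12_norm UNIV (\<lambda>_. 0) = 0"
  proof -
   obtain v :: "cfun" where v: "v \<in> W12 UNIV" using E u(1) unfolding extension_operator_def by blast
   show "(\<lambda>_. 0) \<in> W12 UNIV" using W12_cmult[OF v, of 0] by simp
   show "W12_norm UNIV (\<lambda>_. 0) = 0" using W12_norm_cmult[OF open_UNIV v, of 0] by simp
  qed
  ultimately show False using est[OF z(1)] by simp
 qed
 then have n: "W12_norm A u > 0" using W12_norm_nonneg[of A u] by simp
 define c where "c = complex_of_real (1 / W12_norm A u)"
 define v where "v = (\<lambda>x. c * u x)"
 have cn: "norm c = 1 / W12_norm A u" using n by (simp add: c_def norm_divide)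
 have v: "v \<in> W12 A" unfolding v_def by (rule W12_cmult[OF u(1)])
 have vn: "W12_norm A v = 1" unfolding v_def W12_norm_cmult[OF open_AB(1) u(1)] cn using n by simp
 have Ev: "E v \<in> W12 UNIV" "eq_ae A (E v) v" using E v unfolding extension_operator_def by blast+
 define w where "w = (\<lambda>x. complex_of_real (W12_norm A u) * E v x)"
 have w: "w \<in> W12 UNIV" unfolding w_def by (rule W12_cmult[OF Ev(1)])
 have "eq_ae A w u" using Ev(2) unfolding eq_ae_def
  by eventually_elim (use n in \<open>simp add: w_def v_def c_def\<close>)
 from est[OF w this] have "(1 + k) * (W12_norm A u)^2 \<le> (W12_norm A u)^2 * (W12_norm UNIV (E v))^2"
  unfolding w_def W12_norm_cmult[OF open_UNIV Ev(1)] by (simp add: power_mult_distrib)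
 then have "1 + k \<le> (W12_norm UNIV (E v))^2" using n by (simp add: mult.commute[of "1 + k"])
 then have "sqrt (1 + k) \<le> W12_norm UNIV (E v)" using W12_norm_nonneg by (metis real_le_lsqrt real_sqrt_le_iff real_sqrt_unique)
 then have "ennreal (sqrt (1 + k)) \<le> ennreal (W12_norm UNIV (E v))" by (rule ennreal_leI)
 also have "... \<le> op_norm \<alpha> E" unfolding op_norm_def by (rule SUP_upper) (simp add: v vn)
 finally show ?thesis .
qed

text \<open>Test pairs supported in the annuli \<open>-3 L \<le> ln |z| \<le> -L\<close>: as \<open>L\<close> grows, the second
 derivatives and the zeroth order terms become negligible against \<open>I (R1^2)\<close>. For \<open>\<alpha> \<le> \<pi>\<close>
 the radial function is extended and tested against the angular one, otherwise conversely.\<close>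

lemma low_bounds: "\<exists>D. (D \<longlonglongrightarrow> 1) \<and> (\<forall>n. D n > 0 \<and> low_bound (Mk / D n))"
proof -
 obtain P P1 P2 where P: "\<And>x. (P has_real_derivative P1 x) (at x)" "\<And>x. (P1 has_real_derivative P2 x) (at x)"
  "continuous_on UNIV P2" "\<And>x. 1 < \<bar>x\<bar> \<Longrightarrow> P x = 0" "\<exists>x. P1 x \<noteq> 0"
  using profile_exists by blast
 have Pc: "continuous_on UNIV P" "continuous_on UNIV P1"
  using P(1,2) by (auto intro!: continuous_at_imp_continuous_on DERIV_isCont)
 have s: "P x = 0" if "x \<notin> {-1..1}" for x using that P(4)[of x] by auto
 have s1: "P1 x = 0" if "x \<notin> {-1..1}" for x by (rule derivative_support[OF P(1) s that])
 define e f g where "e = (LINT x|lborel. (P1 x)^2)" and "f = (LINT x|lborel. (P2 x)^2)" and "g = (LINT x|lborel. (P x)^2)"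
 have iP1: "integrable lborel (\<lambda>x. (P1 x)^2)"
  by (rule real_integrable_support[where l="-1" and r=1]) (auto intro!: continuous_intros Pc simp: s1)
 have e: "e > 0" unfolding e_def using P(5) positive_square_integral[OF Pc(2) iP1] by blast
 have fg: "f \<ge> 0" "g \<ge> 0" unfolding f_def g_def by auto
 define S where "S = (if \<alpha> \<le> pi then B else A)"
 define d where "d = (if \<alpha> \<le> pi then - dir else dir)"
 define h where "h = (if \<alpha> \<le> pi then pi - \<alpha> / 2 else \<alpha> / 2)"
 have dd: "norm d = 1" "norm (- d) = 1" using norm_dir by (auto simp: d_def)
 have hh: "0 < h" "h < pi" using \<alpha> by (auto simp: h_def)
 obtain H H1 where H: "\<And>t. (H has_real_derivative H1 t) (at t)" "continuous_on UNIV H1"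
  "\<And>t. \<bar>t\<bar> < h \<Longrightarrow> H t = t" "\<And>t. \<bar>t\<bar> < h \<Longrightarrow> H1 t = 1" "\<And>t. h + (pi - h) / 2 < \<bar>t\<bar> \<Longrightarrow> H t = 0"
  using cutoff_exists[of h "(pi - h) / 2"] hh by auto
 have Mk: "Mk = h / (pi - h)"
 proof -
  have m: "min \<alpha> (2 * pi - \<alpha>) = 2 * (pi - h)" by (auto simp: h_def min_def)
  have "Mk = Nval^2 - 1" using Nval(2) by simp
  also have "... = 2 * pi / (2 * (pi - h)) - 1" unfolding Nval(3) m ..
  also have "... = h / (pi - h)" using hh by (simp add: field_simps)
  finally show ?thesis .
 qed
 define D where "D n = (1 + h^2 * (f / e) / (real (Suc n))^2 + h^2 * exp (- (2 * real (Suc n))))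
  * (1 + (g / e) * (real (Suc n))^2 * exp (- (2 * real (Suc n))))" for n :: nat
 have lb: "low_bound (Mk / D n)" for n
 proof -
  define L where "L = real (Suc n)"
  have L: "L > 0" by (simp add: L_def)
  define x where "x s = (s + 2 * L) / L" for s
  have xd: "(x has_real_derivative 1 / L) (at s)" for s unfolding x_def using L by (auto intro!: derivative_eq_intros)
  have xi: "x s \<notin> {-1..1}" if "s \<notin> {- 3 * L..- L}" for s
   using that L by (auto simp: x_def field_simps)
  define R where "R s = P (x s)" for s
  define R1 where "R1 s = P1 (x s) / L" for s
  define R2 where "R2 s = P2 (x s) / L^2" for s
  interpret polar_pair d h "(pi - h) / 2" "- 3 * L" "- L" R R1 R2 H H1
  proof
   show "(R has_real_derivative R1 s) (at s)" for s
    unfolding R_def R1_def using DERIV_chain2[OF P(1) xd] by simp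
   show "(R1 has_real_derivative R2 s) (at s)" for s
    unfolding R1_def R2_def using DERIV_cdivide[OF DERIV_chain2[OF P(2) xd], of L] by (simp add: power2_eq_square)
   show "continuous_on UNIV R2" unfolding R2_def x_def
    by (intro continuous_intros continuous_on_compose2[OF P(3)]) (use L in auto)
   show "h + (pi - h) / 2 < pi" using hh by (simp add: field_simps)
  qed (use dd hh L H s xi in \<open>auto simp: R_def\<close>)
  let ?E = "I (\<lambda>s. (R1 s)^2)" and ?F = "I (\<lambda>s. (R2 s)^2)" and ?G = "I (\<lambda>s. (R s)^2 * exp (2 * s))" and ?G1 = "I (\<lambda>s. (R1 s)^2 * exp (2 * s))"
  have E: "?E = e / L" using lint_rescale[OF L, of "\<lambda>x. (P1 x)^2"] L
   unfolding R1_def x_def power_divide by (simp add: e_def power2_eq_square)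
  have F: "?F = f / L ^ 3" using lint_rescale[OF L, of "\<lambda>x. (P2 x)^2"] L
   unfolding R2_def x_def power_divide by (simp add: f_def power2_eq_square power3_eq_cube)
  have ex: "exp (2 * s) \<le> exp (- (2 * L))" if "s \<in> {- 3 * L..- L}" for s using that by simp
  have iR: "integrable lborel (\<lambda>s. (R s)^2)" by (rule real_integrable_support[OF _, where l="- 3 * L" and r="- L"]) (auto intro!: continuous_intros cont simp: R)
  have G: "?G \<le> exp (- (2 * L)) * (L * g)"
  proof -
   have "?G \<le> I (\<lambda>s. exp (- (2 * L)) * (R s)^2)"
   proof (rule integral_mono[OF gradient_integrals(3)])
    show "(R s)^2 * exp (2 * s) \<le> exp (- (2 * L)) * (R s)^2" for s
     using ex[of s] R(4)[of s] mult_right_mono[of "exp (2 * s)" "exp (- (2 * L))" "(R s)^2"] by (cases "s \<in> {- 3 * L..- L}") (auto simp: mult.commute)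
   qed (use iR in simp)
   then show ?thesis using lint_rescale[OF L, of "\<lambda>x. (P x)^2"] by (simp add: R_def x_def g_def)
  qed
  have G1: "?G1 \<le> exp (- (2 * L)) * ?E"
  proof -
   have "?G1 \<le> I (\<lambda>s. exp (- (2 * L)) * (R1 s)^2)"
   proof (rule integral_mono[OF gradient_integrals(4)])
    show "(R1 s)^2 * exp (2 * s) \<le> exp (- (2 * L)) * (R1 s)^2" for s
     using ex[of s] R1_support[of s] mult_right_mono[of "exp (2 * s)" "exp (- (2 * L))" "(R1 s)^2"] by (cases "s \<in> {- 3 * L..- L}") (auto simp: mult.commute)
   qed (use gradient_integrals in simp)
   then show ?thesis by simp
  qed
  have E0: "?E > 0" using E e L by simp
  have G0: "?G \<ge> 0" "?G1 \<ge> 0" by auto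
  define a1 where "a1 = 1 + h^2 * (f / e) / L^2 + h^2 * exp (- (2 * L))"
  define a2 where "a2 = 1 + (g / e) * L^2 * exp (- (2 * L))"
  have a: "a1 \<ge> 1" "a2 \<ge> 1" using fg e by (auto simp: a1_def a2_def)
  have Dn: "D n = a1 * a2" by (simp add: D_def a1_def a2_def L_def)
  have b1: "?E + h^2 * ?F + h^2 * ?G1 \<le> a1 * ?E"
  proof -
   have "h^2 * ?F = h^2 * (f / e) / L^2 * ?E" unfolding E F using e L by (simp add: field_simps power2_eq_square power3_eq_cube)
   moreover have "h^2 * ?G1 \<le> h^2 * (exp (- (2 * L)) * ?E)" by (intro mult_left_mono G1) simp
   ultimately show ?thesis unfolding a1_def by (simp add: distrib_right mult.assoc)
  qed
  have b2: "?E + ?G \<le> a2 * ?E"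
  proof -
   have "exp (- (2 * L)) * (L * g) = (g / e) * L^2 * exp (- (2 * L)) * ?E" unfolding E using e L by (simp add: field_simps power2_eq_square)
   then show ?thesis using G unfolding a2_def by (simp add: distrib_right)
  qed
  show "low_bound (Mk / D n)"
  proof (cases "\<alpha> \<le> pi")
   case True
   have Sd: "Sec d (cot h) = B" and S': "Sec (- d) (cot (pi - h)) = A"
    using A_cot B_cot True by (simp_all add: d_def h_def)
   have p: "0 < pi - h" "pi - h < pi" using hh by auto
   note X = X_energy[OF dd(2) p, unfolded S'] and Y = Y_energy[unfolded Sd]
   have main: "Mk / D n * (2 * (pi - h) * (a2 * ?E)) \<le> (jn B w p q)^2" if w: "jet UNIV w p q" "eq_ae A w X" for w p q
   proof -
    have "2 * h * ?E \<le> jn B w p q * gnorm B Y"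
     using curl_lower_bound[OF w(1) X_C1c Y_C1c w(2)] curl_XY unfolding Sd by simp
    moreover have "0 \<le> 2 * h * ?E" using hh E0 by simp
    ultimately have "(2 * h * ?E)^2 \<le> (jn B w p q)^2 * (gnorm B Y)^2" unfolding power_mult_distrib[symmetric] by (rule power_mono)
    also have "... \<le> (jn B w p q)^2 * (2 * h * (a1 * ?E))"
    proof (rule mult_left_mono)
     have "?E + h^2 * ?F \<le> a1 * ?E" using b1 mult_nonneg_nonneg[OF zero_le_power2[of h] G0(2)] by linarith
     then show "(gnorm B Y)^2 \<le> 2 * h * (a1 * ?E)"
      by (rule order_trans[OF Y(1) mult_left_mono]) (use hh in simp)
    qed simp
    finally have "(2 * h * ?E / a1) * (2 * h * a1 * ?E) \<le> (jn B w p q)^2 * (2 * h * a1 * ?E)"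
     using a by (simp add: power2_eq_square mult_ac)
    moreover have "0 < 2 * h * a1 * ?E" using a hh E0 by simp
    ultimately have "2 * h * ?E / a1 \<le> (jn B w p q)^2" by (rule mult_right_le_imp_le)
    moreover have "Mk / D n * (2 * (pi - h) * (a2 * ?E)) = 2 * h * ?E / a1" unfolding Mk Dn using a p by (simp add: field_simps)
    ultimately show ?thesis by simp
   qed
   have "(W12_norm A X)^2 \<le> 2 * (pi - h) * (a2 * ?E)"
    by (rule order_trans[OF X(3) mult_left_mono[OF b2]]) (use p in simp)
   moreover have "0 < 2 * (pi - h) * (a2 * ?E)" using p a E0 by simp
   ultimately show ?thesis unfolding low_bound_def using X(2) main by blast
  next
   case False
   have Sd: "Sec d (cot h) = A" and S': "Sec (- d) (cot (pi - h)) = B"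
    using A_cot B_cot False by (simp_all add: d_def h_def)
   have p: "0 < pi - h" "pi - h < pi" using hh by auto
   note X = X_energy[OF dd(2) p, unfolded S'] and Y = Y_energy[unfolded Sd]
   have main: "Mk / D n * (2 * h * (a1 * ?E)) \<le> (jn B w p q)^2" if w: "jet UNIV w p q" "eq_ae A w Y" for w p q
   proof -
    have "(LINT x|mu B. curl Y X x) = - (LINT x|mu B. curl X Y x)"
     by (simp add: mult.commute flip: Bochner_Integration.integral_minus)
    also have "... = (LINT x|mu A. curl X Y x)" unfolding curl_AB[OF X_C1c Y_C1c] by simp
    finally have "2 * h * ?E \<le> jn B w p q * gnorm B X"
     using curl_lower_bound[OF w(1) Y_C1c X_C1c w(2)] curl_XY unfolding Sd by simp
    moreover have "0 \<le> 2 * h * ?E" using hh E0 by simp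
    ultimately have "(2 * h * ?E)^2 \<le> (jn B w p q)^2 * (gnorm B X)^2" unfolding power_mult_distrib[symmetric] by (rule power_mono)
    also have "... \<le> (jn B w p q)^2 * (2 * (pi - h) * ?E)" by (intro mult_left_mono X(1)) simp
    also have "(2 * h * ?E)^2 = (2 * h^2 / (pi - h) * ?E) * (2 * (pi - h) * ?E)"
     using p by (simp add: field_simps power2_eq_square)
    finally have "(2 * h^2 / (pi - h) * ?E) * (2 * (pi - h) * ?E) \<le> (jn B w p q)^2 * (2 * (pi - h) * ?E)"
     .
    moreover have "0 < 2 * (pi - h) * ?E" using p E0 by simp
    ultimately have 1: "2 * h^2 / (pi - h) * ?E \<le> (jn B w p q)^2" by (rule mult_right_le_imp_le)
    have "Mk / D n * (2 * h * (a1 * ?E)) = (2 * h^2 / (pi - h) * ?E) / a2" unfolding Mk Dn using a p by (simp add: field_simps power2_eq_square)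
    also have "... \<le> 2 * h^2 / (pi - h) * ?E" using divide_left_mono[of 1 a2 "2 * h^2 / (pi - h) * ?E"] a p E0 by simp
    finally show ?thesis using 1 by linarith
   qed
   have "(W12_norm A Y)^2 \<le> 2 * h * (a1 * ?E)"
    by (rule order_trans[OF Y(3) mult_left_mono[OF b1]]) (use hh in simp)
   moreover have "0 < 2 * h * (a1 * ?E)" using hh a E0 by simp
   ultimately show ?thesis unfolding low_bound_def using Y(2) main by blast
  qed
 qed
 have "D \<longlonglongrightarrow> 1" unfolding D_def by real_asymp
 moreover have "D n > 0" for n unfolding D_def using fg e by (intro mult_pos_pos add_pos_nonneg) auto
 ultimately show ?thesis using lb by blast
qed

theorem op_norm_ge:
 assumes "extension_operator \<alpha> E" shows "ennreal Nval \<le> op_norm \<alpha> E"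
proof -
 obtain D where D: "D \<longlonglongrightarrow> 1" "\<And>n. D n > 0" "\<And>n. low_bound (Mk / D n)" using low_bounds by blast
 have Mk: "Mk > 0" using kap_pos by (simp add: Mk_def)
 have "(\<lambda>n. sqrt (1 + Mk / D n)) \<longlonglongrightarrow> sqrt (1 + Mk / 1)" by (intro tendsto_intros D(1)) simp
 also have "sqrt (1 + Mk / 1) = Nval" using Nval(1) unfolding div_by_1 Nval(2)[symmetric] by simp
 finally have "(\<lambda>n. ennreal (sqrt (1 + Mk / D n))) \<longlonglongrightarrow> ennreal Nval" by (rule tendsto_ennrealI)
 moreover have "ennreal (sqrt (1 + Mk / D n)) \<le> op_norm \<alpha> E" for n
  using D(2,3) Mk by (intro low_bound_op_norm assms) auto
 ultimately show ?thesis by (intro LIMSEQ_le_const2) auto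
qed

end

theorem theorem1:
  fixes \<alpha> :: real
  assumes "0 < \<alpha>" and "\<alpha> < 2 * pi"
  shows "min_ext_norm \<alpha> = ennreal (1 / min (sqrt (\<alpha> / (2 * pi))) (sqrt (1 - \<alpha> / (2 * pi)))) \<and>
    (\<forall>u \<in> W12 (sector \<alpha>). (\<exists>v. is_T0 \<alpha> u v) \<and>
       (\<forall>v v'. is_T0 \<alpha> u v \<and> is_T0 \<alpha> u v' \<longrightarrow> eq_ae (cosector \<alpha>) v v')) \<and>
    extension_operator \<alpha> (E0 \<alpha>) \<and>
    op_norm \<alpha> (E0 \<alpha>) = min_ext_norm \<alpha>"
proof -
  interpret sector_angle \<alpha> by unfold_locales (use assms in auto)
  have "min_ext_norm \<alpha> \<le> op_norm \<alpha> (E0 \<alpha>)"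
    unfolding min_ext_norm_def by (rule INF_lower) (simp add: extension_operator_E0)
  moreover have "ennreal Nval \<le> min_ext_norm \<alpha>"
    unfolding min_ext_norm_def by (rule INF_greatest) (simp add: op_norm_ge)
  ultimately have "min_ext_norm \<alpha> = ennreal Nval" "op_norm \<alpha> (E0 \<alpha>) = min_ext_norm \<alpha>"
    using op_norm_E0 by (auto intro: antisym order_trans)
  then show ?thesis using is_T0_exists is_T0_unique extension_operator_E0 unfolding Nval_def by blast
qed

end
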